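(* Let $(\Omega,\mu)$ be a measure space, let $\rho\colon\Omega\to(0,\infty)$ be measurable, and let $T$ be a positive self-adjoint $C_0$-semigroup on the complex space $L_2(\mu)$ satisfying $$\|\rho^{-\alpha}T(t)\rho^\alpha\|_{1\to\infty}\leqslant ct^{-\nu}e^{\alpha^2t},\qquad\|\rho^{-\alpha}T(t)\rho^\alpha\|_{2\to2}\leqslant e^{\alpha^2t}\qquad(t>0,\ \alpha\in\mathbb{R})$$ for some $c,\nu>0$. Let $V\colon\Omega\to\mathbb{R}$ be measurable, and assume that there exist $p>1$, $M\geqslant1$ and $r\geqslant1$ such that $pV$ is $T$-admissible, $\|T_{pV}(t)\|_{2\to2}\leqslant1$ and $$\|\rho^{-\alpha}T_V(t)\rho^\alpha\|_{1\to1}\leqslant Me^{\alpha^2t},\qquad\|\rho^{-\alpha}T_V(t)\rho^\alpha\|_{\infty\to\infty}\leqslant Me^{r\alpha^2t}\qquad(t>0,\ \alpha>0).$$ Then there exists $\tilde c>0$ such that $$\|\rho^{-\alpha}T_V(t)\rho^\alpha\|_{1\to\infty}\leqslant\tilde ct^{-\nu}\bigl(1+(r-1)\alpha^2t\bigr)^{\nu/2p}e^{\alpha^2t}\qquad(t>0,\ \alpha\in\mathbb{R}).$$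
   Context: The scalar field is $\mathbb{C}$. $a\wedge b$, $a\vee b$ denote (pointwise) minimum and maximum; $V^+=V\vee0$, $V^-=(-V)\vee0$. A semigroup is positive if each $T(t)$ maps nonnegative functions to nonnegative functions. The exponent $\nu/2p$ means $\nu/(2p)$. Admissibility. Let $T$ be a positive $C_0$-semigroup on $L_2(\mu)$ with generator $A$. For real-valued $V\in L_\infty(\mu)$, $T_V$ is the $C_0$-semigroup generated by $A-V$ ($V$ acting as multiplication operator). For measurable $V\geqslant0$, put $T_V(t):=\operatorname{s-lim}_{n\to\infty}T_{V\wedge n}(t)$ (always exists); $V$ is $T$-admissible if $T_V$ is a $C_0$-semigroup. A measurable (finite-valued) $V\leqslant0$ is $T$-admissible if $T_V(t):=\operatorname{s-lim}_{n\to\infty}T_{V\vee(-n)}(t)$ exists for all $t\geqslant0$ and $T_V$ is a $C_0$-semigroup. A measurable real-valued $V$ is $T$-admissible if $V^+$ and $-V^-$ are; then $T_V(t):=\operatorname{s-lim}_{n\to\infty}T_{(V\wedge n)\vee(-n)}(t)$ exists and defines a $C_0$-semigroup $T_V$. It is known that if $pV$ is $T$-admissible for some $p>1$, then $V$ is $T$-admissible, so $T_V$ is defined. Norms: for measurable $\rho_1\colon\Omega\to(0,\infty)$, a linear operator $B$ on $L_2(\mu)$ and $q,r\in[1,\infty]$, $\|\rho_1^{-1}B\rho_1\|_{q\to r}:=\sup\{\|\rho_1^{-1}B\rho_1f\|_{L_r(\mu)}: f\in L_q(\mu),\ \|f\|_{L_q(\mu)}\leqslant1,\ \rho_1f\in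 L_2(\mu)\}\in[0,\infty]$ (used with $\rho_1=\rho^\alpha$, and with $\rho_1=1$ for $\|B\|_{q\to r}$). *)

theory Defs
  imports "HOL-Analysis.Analysis" "HOL-Probability.Essential_Supremum"
begin

text \<open>
  Elements of \<open>L\<^sub>q(\<mu>)\<close> are represented by measurable functions, not by equivalence classes.
  Accordingly every equation between elements is stated almost everywhere, an operator on
  \<open>L\<^sub>2(\<mu>)\<close> is a map on representatives of which only the values on \<open>Lp_space \<mu> 2\<close> matter, and
  the objects selected by \<open>SOME\<close> below are determined up to null sets.
\<close>

type_synonym 'a op = "('a \<Rightarrow> complex) \<Rightarrow> ('a \<Rightarrow> complex)"

definition ennreal_powr :: "ennreal \<Rightarrow> real \<Rightarrow> ennreal" where
  "ennreal_powr a s = (if a = \<infinity> then \<infinity> else ennreal (enn2real a powr s))"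

text \<open>The \<open>L\<^sub>q\<close>-norm with values in \<open>[0,\<infinity>]\<close>, intended for \<open>1 \<le> q \<le> \<infinity>\<close>.\<close>

definition Lp_norm :: "'a measure \<Rightarrow> ennreal \<Rightarrow> ('a \<Rightarrow> complex) \<Rightarrow> ennreal" where
  "Lp_norm \<mu> q f =
     (if q = \<infinity> then esssup \<mu> (\<lambda>x. ennreal (cmod (f x)))
      else ennreal_powr (\<integral>\<^sup>+x. ennreal (cmod (f x) powr enn2real q) \<partial>\<mu>) (1 / enn2real q))"

definition Lp_space :: "'a measure \<Rightarrow> ennreal \<Rightarrow> ('a \<Rightarrow> complex) set" where
  "Lp_space \<mu> q = {f \<in> borel_measurable \<mu>. Lp_norm \<mu> q f < \<infinity>}"

abbreviation L2 :: "'a measure \<Rightarrow> ('a \<Rightarrow> complex) set" where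
  "L2 \<mu> \<equiv> Lp_space \<mu> 2"

text \<open>Compatibility with equality almost everywhere is a consequence of the two inner conditions.\<close>

definition bounded_op :: "'a measure \<Rightarrow> 'a op \<Rightarrow> bool" where
  "bounded_op \<mu> B \<longleftrightarrow>
     (\<forall>f\<in>L2 \<mu>. B f \<in> L2 \<mu>) \<and>
     (\<forall>f\<in>L2 \<mu>. \<forall>g\<in>L2 \<mu>. \<forall>a b.
        AE x in \<mu>. B (\<lambda>y. a * f y + b * g y) x = a * B f x + b * B g x) \<and>
     (\<exists>C::real. \<forall>f\<in>L2 \<mu>. Lp_norm \<mu> 2 (B f) \<le> ennreal C * Lp_norm \<mu> 2 f)"

definition strong_limit :: "'a measure \<Rightarrow> (nat \<Rightarrow> 'a op) \<Rightarrow> 'a op \<Rightarrow> bool" where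
  "strong_limit \<mu> Bn B \<longleftrightarrow> bounded_op \<mu> B \<and>
     (\<forall>f\<in>L2 \<mu>. (\<lambda>n. Lp_norm \<mu> 2 (\<lambda>x. Bn n f x - B f x)) \<longlonglongrightarrow> 0)"

definition C0_semigroup :: "'a measure \<Rightarrow> (real \<Rightarrow> 'a op) \<Rightarrow> bool" where
  "C0_semigroup \<mu> T \<longleftrightarrow>
     (\<forall>t\<ge>0. bounded_op \<mu> (T t)) \<and>
     (\<forall>f\<in>L2 \<mu>. AE x in \<mu>. T 0 f x = f x) \<and>
     (\<forall>s\<ge>0. \<forall>t\<ge>0. \<forall>f\<in>L2 \<mu>. AE x in \<mu>. T (s + t) f x = T s (T t f) x) \<and>
     (\<forall>f\<in>L2 \<mu>. ((\<lambda>t. Lp_norm \<mu> 2 (\<lambda>x. T t f x - f x)) \<longlongrightarrow> 0) (at_right 0))"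

definition positive_semigroup :: "'a measure \<Rightarrow> (real \<Rightarrow> 'a op) \<Rightarrow> bool" where
  "positive_semigroup \<mu> T \<longleftrightarrow>
     (\<forall>t\<ge>0. \<forall>f\<in>L2 \<mu>. (AE x in \<mu>. f x \<in> \<real>\<^sub>\<ge>\<^sub>0) \<longrightarrow> (AE x in \<mu>. T t f x \<in> \<real>\<^sub>\<ge>\<^sub>0))"

definition self_adjoint_semigroup :: "'a measure \<Rightarrow> (real \<Rightarrow> 'a op) \<Rightarrow> bool" where
  "self_adjoint_semigroup \<mu> T \<longleftrightarrow>
     (\<forall>t\<ge>0. \<forall>f\<in>L2 \<mu>. \<forall>g\<in>L2 \<mu>.
        (\<integral>x. T t f x * cnj (g x) \<partial>\<mu>) = (\<integral>x. f x * cnj (T t g x) \<partial>\<mu>))"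

text \<open>
  The generator, as the graph \<open>{(f, g). f \<in> D(A), g = A f}\<close>. Being closed under changes of \<open>f\<close>
  and \<open>g\<close> on null sets, graphs of equal operators are equal as sets.
\<close>

definition generator ::
  "'a measure \<Rightarrow> (real \<Rightarrow> 'a op) \<Rightarrow> (('a \<Rightarrow> complex) \<times> ('a \<Rightarrow> complex)) set" where
  "generator \<mu> T = {(f, g). f \<in> L2 \<mu> \<and> g \<in> L2 \<mu> \<and>
     ((\<lambda>t. Lp_norm \<mu> 2 (\<lambda>x. (T t f x - f x) / complex_of_real t - g x)) \<longlongrightarrow> 0) (at_right 0)}"

text \<open>
  The semigroup generated by \<open>A - V\<close>, where \<open>A\<close> is the generator of \<open>T\<close> and \<open>V\<close> is a bounded real
  potential; thus \<open>A - V\<close> has the same domain as \<open>A\<close>.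
\<close>

definition bounded_perturbation ::
  "'a measure \<Rightarrow> (real \<Rightarrow> 'a op) \<Rightarrow> ('a \<Rightarrow> real) \<Rightarrow> real \<Rightarrow> 'a op" where
  "bounded_perturbation \<mu> T V = (SOME S. C0_semigroup \<mu> S \<and>
     generator \<mu> S = {(f, \<lambda>x. g x - complex_of_real (V x) * f x) | f g. (f, g) \<in> generator \<mu> T})"

definition truncate :: "nat \<Rightarrow> ('a \<Rightarrow> real) \<Rightarrow> 'a \<Rightarrow> real" where
  "truncate n V x = max (min (V x) (real n)) (- real n)"

text \<open>
  \<open>T\<^sub>V(t)\<close> is the strong limit of \<open>T\<^bsub>(V \<and> n) \<or> (-n)\<^esub>(t)\<close>. The following two facts show that
  this one formula also covers the definitions by \<open>V \<and> n\<close> for \<open>V \<ge> 0\<close> and by \<open>V \<or> (-n)\<close> for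
  \<open>V \<le> 0\<close>.
\<close>

lemma truncate_nonneg: "(\<And>x. V x \<ge> 0) \<Longrightarrow> truncate n V = (\<lambda>x. min (V x) (real n))"
  by (rule ext) (simp add: truncate_def max_def min_def, smt (verit) of_nat_0_le_iff)

lemma truncate_nonpos: "(\<And>x. V x \<le> 0) \<Longrightarrow> truncate n V = (\<lambda>x. max (V x) (- real n))"
  by (rule ext) (smt (verit) truncate_def of_nat_0_le_iff)

definition perturbed ::
  "'a measure \<Rightarrow> (real \<Rightarrow> 'a op) \<Rightarrow> ('a \<Rightarrow> real) \<Rightarrow> real \<Rightarrow> 'a op" where
  "perturbed \<mu> T V t =
     (SOME B. strong_limit \<mu> (\<lambda>n. bounded_perturbation \<mu> T (truncate n V) t) B)"

text \<open>
  Admissibility of a potential of constant sign. For \<open>V \<ge> 0\<close> the strong limits always exist, so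
  that the first condition is relevant for \<open>V \<le> 0\<close> only.
\<close>

definition admissible_signed ::
  "'a measure \<Rightarrow> (real \<Rightarrow> 'a op) \<Rightarrow> ('a \<Rightarrow> real) \<Rightarrow> bool" where
  "admissible_signed \<mu> T V \<longleftrightarrow>
     (\<forall>t\<ge>0. \<exists>B. strong_limit \<mu> (\<lambda>n. bounded_perturbation \<mu> T (truncate n V) t) B) \<and>
     C0_semigroup \<mu> (perturbed \<mu> T V)"

definition admissible ::
  "'a measure \<Rightarrow> (real \<Rightarrow> 'a op) \<Rightarrow> ('a \<Rightarrow> real) \<Rightarrow> bool" where
  "admissible \<mu> T V \<longleftrightarrow> V \<in> borel_measurable \<mu> \<and>
     admissible_signed \<mu> T (\<lambda>x. max (V x) 0) \<and>
     admissible_signed \<mu> T (\<lambda>x. - max (- V x) 0)"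

text \<open>The norm of \<open>\<rho>\<^sup>-\<^sup>1 B \<rho>\<close> from \<open>L\<^sub>q\<close> to \<open>L\<^sub>r\<close>, for a weight \<open>\<rho> > 0\<close>.\<close>

definition weighted_norm ::
  "'a measure \<Rightarrow> ('a \<Rightarrow> real) \<Rightarrow> ennreal \<Rightarrow> ennreal \<Rightarrow> 'a op \<Rightarrow> ennreal" where
  "weighted_norm \<mu> \<rho> q r B =
     (SUP f \<in> {f \<in> Lp_space \<mu> q. Lp_norm \<mu> q f \<le> 1 \<and> (\<lambda>x. complex_of_real (\<rho> x) * f x) \<in> L2 \<mu>}.
        Lp_norm \<mu> r (\<lambda>x. complex_of_real (inverse (\<rho> x)) * B (\<lambda>y. complex_of_real (\<rho> y) * f y) x))"

abbreviation op_norm :: "'a measure \<Rightarrow> ennreal \<Rightarrow> ennreal \<Rightarrow> 'a op \<Rightarrow> ennreal" where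
  "op_norm \<mu> q r B \<equiv> weighted_norm \<mu> (\<lambda>_. 1) q r B"

end

theory Submission
  imports Defs "HOL-Analysis.Analysis" "HOL-Probability.Discrete_Topology"
begin

text \<open>The operators \<open>T\<^bsub>\<theta> p V\<^esub>(t)\<close> are log-convex in \<open>\<theta>\<close> on nonnegative functions, by the Trotter
  product formula. For \<open>\<theta> < 1\<close>, interpolating between the weighted \<open>L\<^sub>2\<close>-bound of \<open>T\<close> and the
  contractivity of \<open>T\<^bsub>pV\<^esub>\<close> gives a weighted \<open>L\<^sub>2\<close>-bound for \<open>T\<^bsub>\<theta>pV\<^esub>\<close>; dividing the time into
  \<open>2\<^sup>k\<close> steps turns the error terms into the sharp growth \<open>exp (\<alpha>\<^sup>2 t)\<close>. A second interpolation, with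
  the \<open>1 \<rightarrow> \<infinity>\<close> bound of \<open>T\<close>, bounds \<open>T\<^sub>V(t)\<close> from \<open>L\<^sub>q\<close> to the dual exponent for some \<open>q\<close> between \<open>1\<close>
  and \<open>2\<close>. Extrapolation to \<open>L\<^sub>1\<close> uses the \<open>1 \<rightarrow> 1\<close> bound on one side and the \<open>\<infinity> \<rightarrow> \<infinity>\<close> bound on the
  other; since the latter grows like \<open>exp (r \<alpha>\<^sup>2 t)\<close>, only the fraction \<open>1 / (1 + (r - 1) \<alpha>\<^sup>2 t)\<close> of the time
  is spent there, which produces the polynomial factor. Finally \<open>\<theta> \<rightarrow> 1\<close>.\<close>

text \<open>Direct interpolation of weighted norms loses the sharp rate: to carry the exponent
  \<alpha> on \<open>S theta\<close>, \<open>theta = 1 - 1/m\<close>, all of the weight must come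
  from \<open>Q\<close> with exponent m \<alpha>, and the power 1/m of exp(m^2 \<alpha>^2 t) is
  exp(m \<alpha>^2 t). For small times the loss is avoidable. Symmetry of the operators replaces the
  factors exp(k i - k j) of the weighted form by cosh(k i - k j), which has no first-order term, and
  \<open>cosh_power_le\<close> bounds powers of cosh with the exact second-order coefficient. So the
  quadratic form at time s is bounded by 1 + \<alpha>^2 s + O(s^2), and a power inequality for the
  numerical radius (\<open>quad_form_square\<close>) turns this into exp(\<alpha>^2 t). The constant
  4 that results does not depend on m; hence m can tend to infinity at the end, which gives the
  exponent \<nu>/(2p) itself. Geometric means are handled as infima of linear combinations, because
  linear inequalities pass through positive operators, integrals and limits. As operators are given
  on representatives, semigroup theory is applied after an embedding of \<open>L2\<close> into a
  Banach space type.\<close>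

abbreviation cor :: "real => complex" where "cor == complex_of_real"

section \<open>Strongly continuous semigroups on a closed subspace of a Banach space\<close>

definition lin_on :: "'x::real_normed_vector set => ('x => 'x) => bool" where
  "lin_on H L \<longleftrightarrow> (\<forall>x\<in>H. L x \<in> H) \<and> (\<forall>x\<in>H. \<forall>y\<in>H. L (x + y) = L x + L y) \<and>
     (\<forall>x\<in>H. \<forall>c. L (c *\<^sub>R x) = c *\<^sub>R L x) \<and> (\<exists>C. \<forall>x\<in>H. norm (L x) <= C * norm x)"

definition csg :: "'x::real_normed_vector set => (real => 'x => 'x) => bool" where
  "csg H S \<longleftrightarrow> (\<forall>t\<ge>0. lin_on H (S t)) \<and> (\<forall>x\<in>H. S 0 x = x) \<and>
     (\<forall>s\<ge>0. \<forall>t\<ge>0. \<forall>x\<in>H. S (s + t) x = S s (S t x)) \<and>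
     (\<forall>x\<in>H. ((%t. S t x) \<longlongrightarrow> x) (at_right 0))"

definition gen :: "'x::real_normed_vector set => (real => 'x => 'x) => ('x \<times> 'x) set" where
  "gen H S = {(x, y). x \<in> H \<and> y \<in> H \<and> ((%t. (S t x - x) /\<^sub>R t) \<longlongrightarrow> y) (at_right 0)}"

text \<open>Riemann sums of f lie in the subspace, and the integral is a limit of them.\<close>

lemma integral_in_closed_subspace:
  fixes f :: "real => 'y::banach"
  assumes G: "subspace G" "closed G" and f: "f integrable_on {a..b}" "!!r. r \<in> {a..b} ==> f r \<in> G"
  shows "integral {a..b} f \<in> G"
proof -
  have "\<exists>y\<in>G. dist y (integral {a..b} f) < e" if e: "e > 0" for e
  proof -
    obtain gamma where gamma: "gauge gamma" "!!D. D tagged_division_of (cbox a b) ==> gamma fine D ==>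
        norm ((\<Sum>(x,k) \<in> D. measure lborel k *\<^sub>R f x) - integral (cbox a b) f) < e"
      using integrable_integral[of f "cbox a b"] f(1) e unfolding has_integral by (auto simp: cbox_interval)
    obtain D where D: "D tagged_division_of (cbox a b)" "gamma fine D"
      using fine_division_exists[OF gamma(1)] by metis
    have "(\<Sum>(x,k) \<in> D. measure lborel k *\<^sub>R f x) \<in> G"
    proof (rule subspace_sum[OF G(1)], clarify)
      fix x k assume "(x, k) \<in> D"
      then have "x \<in> {a..b}" using tag_in_interval[OF D(1)] by (simp add: cbox_interval)
      then show "measure lborel k *\<^sub>R f x \<in> G" using f(2) G(1) by (simp add: subspace_scale)
    qed
    moreover have "dist (\<Sum>(x,k) \<in> D. measure lborel k *\<^sub>R f x) (integral {a..b} f) < e"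
      using gamma(2)[OF D] by (simp add: dist_norm cbox_interval)
    ultimately show ?thesis by blast
  qed
  then show ?thesis using G(2) closed_approachable by blast
qed

text \<open>For each \<epsilon> the set of s with |\<phi> s - \<phi> 0| <= \<epsilon> s is compact;
  if its largest element were below t, the vanishing right derivative would push it further.
  Derivatives are one-sided because generators are limits from the right.\<close>

lemma zero_right_derivative_imp_constant:
  fixes \<phi> :: "real => 'x::real_normed_vector"
  assumes t: "0 <= t" and cont: "continuous_on {0..t} \<phi>"
    and der: "!!r. 0 <= r ==> r < t ==> ((%h. norm (\<phi> (r + h) - \<phi> r) / h) \<longlongrightarrow> 0) (at_right 0)"
  shows "\<phi> t = \<phi> 0"
proof -
  have "norm (\<phi> t - \<phi> 0) <= \<epsilon> * t" if e: "\<epsilon> > 0" for \<epsilon>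
  proof -
    define A where "A = {s \<in> {0..t}. norm (\<phi> s - \<phi> 0) <= \<epsilon> * s}"
    have "closed A" unfolding A_def
      by (intro continuous_on_closed_Collect_le continuous_intros cont closed_atLeastAtMost)
    moreover have "bounded A" by (rule bounded_subset[of "{0..t}"]) (auto simp: A_def)
    ultimately have "compact A" by (simp add: compact_eq_bounded_closed)
    moreover have "A ~= {}" using t by (auto simp: A_def intro!: exI[of _ 0])
    ultimately obtain s where s: "s \<in> A" "!!r. r \<in> A ==> r <= s"
      using compact_attains_sup[of A] by blast
    have "s = t"
    proof (rule ccontr)
      assume "s ~= t"
      then have st: "0 <= s" "s < t" using s(1) by (auto simp: A_def)
      have "\<forall>\<^sub>F h in at_right 0. norm (\<phi> (s + h) - \<phi> s) / h < \<epsilon>"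
        using order_tendstoD(2)[OF der[OF st] e] .
      moreover have "\<forall>\<^sub>F h in at_right (0::real). h < t - s \<and> 0 < h"
        using st by (intro eventually_conj eventually_at_right_less order_tendstoD(2)[OF tendsto_ident_at]) auto
      ultimately have "\<forall>\<^sub>F h in at_right (0::real). norm (\<phi> (s + h) - \<phi> s) / h < \<epsilon> \<and> h < t - s \<and> 0 < h"
        by eventually_elim auto
      then obtain h where h: "norm (\<phi> (s + h) - \<phi> s) / h < \<epsilon>" "h < t - s" "0 < h"
        using eventually_happens trivial_limit_at_right_real by blast
      have "norm (\<phi> (s + h) - \<phi> s) <= \<epsilon> * h" using h by (simp add: field_simps)
      moreover have "norm (\<phi> s - \<phi> 0) <= \<epsilon> * s" using s by (simp add: A_def)
      moreover have "norm (\<phi> (s + h) - \<phi> 0) <= norm (\<phi> (s + h) - \<phi> s) + norm (\<phi> s - \<phi> 0)"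
        by (metis add_diff_cancel_right' diff_add_cancel norm_triangle_ineq add_diff_eq)
      ultimately have "s + h \<in> A" using h st by (simp add: A_def algebra_simps)
      then show False using s(2) h by fastforce
    qed
    then show ?thesis using s by (simp add: A_def)
  qed
  note le = this
  have "norm (\<phi> t - \<phi> 0) <= 0 + e" if "e > 0" for e
  proof -
    have "e / (t + 1) * t <= e" using that t by (simp add: field_simps)
    then show ?thesis using le[of "e / (t + 1)"] that t by simp
  qed
  then have "norm (\<phi> t - \<phi> 0) <= 0" by (rule field_le_epsilon)
  then show ?thesis by simp
qed

text \<open>\<open>L2\<close> will appear as a closed subspace \<open>H\<close> of a Banach space
  type, and operators are controlled on \<open>H\<close> only; hence all statements are relativised
  to \<open>H\<close>.\<close>

locale closed_subspace =
  fixes H :: "'x::banach set"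
  assumes sub: "subspace H" and cl: "closed H"
begin

lemma lin_onD:
  assumes "lin_on H L"
  shows "!!x. x \<in> H ==> L x \<in> H" "!!x y. x \<in> H ==> y \<in> H ==> L (x + y) = L x + L y"
    "!!x c. x \<in> H ==> L (c *\<^sub>R x) = c *\<^sub>R L x"
    "!!x y. x \<in> H ==> y \<in> H ==> L (x - y) = L x - L y"
    "L 0 = 0"
proof -
  show 1: "!!x. x \<in> H ==> L x \<in> H" "!!x y. x \<in> H ==> y \<in> H ==> L (x + y) = L x + L y"
    "!!x c. x \<in> H ==> L (c *\<^sub>R x) = c *\<^sub>R L x" using assms by (auto simp: lin_on_def)
  show "L 0 = 0" using 1(3)[of 0 0] sub by (simp add: subspace_0)
  fix x y assume "x \<in> H" "y \<in> H"
  then show "L (x - y) = L x - L y"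
    using 1(2)[of x "(-1) *\<^sub>R y"] 1(3)[of y "-1"] sub by (simp add: subspace_neg)
qed

lemma lin_on_bound:
  assumes "lin_on H L" obtains C where "C > 0" "!!x. x \<in> H ==> norm (L x) <= C * norm x"
proof -
  obtain C where C: "!!x. x \<in> H ==> norm (L x) <= C * norm x" using assms unfolding lin_on_def by blast
  show ?thesis
  proof (rule that[of "max C 1"])
    fix x assume "x \<in> H"
    then have "norm (L x) <= C * norm x" by (rule C)
    also have "... <= max C 1 * norm x" by (intro mult_right_mono) auto
    finally show "norm (L x) <= max C 1 * norm x" .
  qed simp
qed

lemma lin_on_tendsto:
  assumes L: "lin_on H L" and f: "(f \<longlongrightarrow> l) F" "!!r. f r \<in> H" "l \<in> H"
  shows "((%r. L (f r)) \<longlongrightarrow> L l) F"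
proof -
  obtain C where C: "C > 0" "!!x. x \<in> H ==> norm (L x) <= C * norm x" using lin_on_bound[OF L] by metis
  have "((%r. f r - l) \<longlongrightarrow> 0) F" using f(1) by (simp add: LIM_zero)
  then have z: "((%r. C * norm (f r - l)) \<longlongrightarrow> 0) F"
    using tendsto_mult_right_zero tendsto_norm_zero by blast
  have "((%r. L (f r) - L l) \<longlongrightarrow> 0) F"
  proof (rule Lim_null_comparison[OF _ z], rule always_eventually, rule allI)
    fix r
    have "L (f r) - L l = L (f r - l)" using lin_onD(4)[OF L f(2) f(3)] by simp
    then show "norm (L (f r) - L l) <= C * norm (f r - l)"
      using C(2)[of "f r - l"] f(2,3) subspace_diff[OF sub] by simp
  qed
  then show ?thesis by (rule LIM_zero_cancel)
qed

lemma integral_mem: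
  fixes f :: "real => 'x"
  assumes "continuous_on {a..b} f" "!!r. r \<in> {a..b} ==> f r \<in> H"
  shows "integral {a..b} f \<in> H"
  by (rule integral_in_closed_subspace[OF sub cl integrable_continuous_real]) (use assms in auto)

lemma integral_lin:
  fixes f :: "real => 'x"
  assumes L: "lin_on H L" and f: "continuous_on {a..b} f" "!!r. r \<in> {a..b} ==> f r \<in> H"
  shows "continuous_on {a..b} (%r. L (f r))" "L (integral {a..b} f) = integral {a..b} (%r. L (f r))"
proof -
  obtain C where C: "C > 0" "!!x. x \<in> H ==> norm (L x) <= C * norm x" using lin_on_bound[OF L] by metis
  have lip: "norm (L x - L y) <= C * norm (x - y)" if "x \<in> H" "y \<in> H" for x y
    using lin_onD(4)[OF L that] C(2)[of "x - y"] subspace_diff[OF sub that] by simp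
  have cL: "continuous_on H L"
    by (rule lipschitz_on_continuous_on[where L = C]) (use lip C(1) in \<open>auto simp: lipschitz_on_def dist_norm\<close>)
  show c: "continuous_on {a..b} (%r. L (f r))"
    by (rule continuous_on_compose2[OF cL f(1)]) (use f(2) in auto)
  define G where "G = {(x, y). x \<in> H \<and> y = L x}"
  have sG: "subspace G" using sub lin_onD(2,3,5)[OF L]
    by (auto simp: G_def subspace_def zero_prod_def)
  have "closed G"
    unfolding closed_sequential_limits
  proof (intro allI impI, elim conjE)
    fix z l assume z: "\<forall>n. z n \<in> G" "z \<longlonglongrightarrow> l"
    have 1: "(%n. fst (z n)) \<longlonglongrightarrow> fst l" "(%n. snd (z n)) \<longlonglongrightarrow> snd l"
      using z(2) by (auto intro: tendsto_fst tendsto_snd)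
    have m: "fst (z n) \<in> H" "snd (z n) = L (fst (z n))" for n using spec[OF z(1), of n] by (auto simp: G_def split: prod.splits)
    have lH: "fst l \<in> H" by (rule closed_sequentially[OF cl _ 1(1)]) (rule m(1))
    have "(%n. L (fst (z n))) \<longlonglongrightarrow> L (fst l)" using lin_on_tendsto[OF L 1(1) m(1) lH] .
    then have "snd l = L (fst l)" using 1(2) by (simp add: m(2) LIMSEQ_unique)
    then show "l \<in> G" using lH by (auto simp: G_def split: prod.splits)
  qed
  moreover have ci: "continuous_on {a..b} (%r. (f r, L (f r)))" by (intro continuous_intros f(1) c)
  ultimately have "integral {a..b} (%r. (f r, L (f r))) \<in> G"
    using integral_in_closed_subspace[OF sG _ integrable_continuous_real[OF ci]] f(2) by (auto simp: G_def)
  moreover have "integral {a..b} (%r. (f r, L (f r))) = (integral {a..b} f, integral {a..b} (%r. L (f r)))"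
  proof (rule prod_eqI)
    have i: "(%r. (f r, L (f r))) integrable_on {a..b}" using ci by (rule integrable_continuous_real)
    show "fst (integral {a..b} (%r. (f r, L (f r)))) = fst (integral {a..b} f, integral {a..b} (%r. L (f r)))"
      using integral_linear[OF i bounded_linear_fst] by (simp add: o_def)
    show "snd (integral {a..b} (%r. (f r, L (f r)))) = snd (integral {a..b} f, integral {a..b} (%r. L (f r)))"
      using integral_linear[OF i bounded_linear_snd] by (simp add: o_def)
  qed
  ultimately show "L (integral {a..b} f) = integral {a..b} (%r. L (f r))" by (simp add: G_def)
qed

text \<open>Uniform boundedness by a gliding hump: \<open>x n\<close> moves by at most \<open>3\<^sup>-\<^sup>n\<close>, but enough that
  \<open>L (k n)\<close> is large there.\<close>

lemma uniform_boundedness: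
  assumes L: "!!n::nat. lin_on H (L n)" and bd: "!!x. x \<in> H ==> \<exists>K. \<forall>n. norm (L n x) <= K"
  shows "\<exists>C. \<forall>n. \<forall>x\<in>H. norm (L n x) <= C * norm x"
proof (rule ccontr)
  assume neg: "\<nexists>C. \<forall>n. \<forall>x\<in>H. norm (L n x) <= C * norm x"
  define bnd where "bnd k C \<longleftrightarrow> (\<forall>x\<in>H. norm (L k x) <= C * norm x)" for k C
  have ex: "\<exists>k z C. z \<in> H \<and> norm z <= (1/3)^n \<and> bnd k C \<and> C >= 4^n \<and> norm (L k z) >= 3/4 * C * (1/3)^n" for n :: nat
  proof -
    obtain k where k: "\<not> bnd k (4^n)" using neg unfolding bnd_def by blast
    obtain C0 where C0: "C0 > 0" "bnd k C0" using lin_on_bound[OF L[of k]] unfolding bnd_def by metis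
    have "(%m. C0 * (3/4)^m) \<longlonglongrightarrow> 0" by (intro tendsto_mult_right_zero LIMSEQ_realpow_zero) auto
    then have "\<forall>\<^sub>F m in sequentially. C0 * (3/4)^m < 4^n" by (rule order_tendstoD) auto
    then obtain m where m: "C0 * (3/4)^m < 4^n" using eventually_happens trivial_limit_sequentially by blast
    have "\<not> bnd k (C0 * (3/4)^m)"
    proof
      assume "bnd k (C0 * (3/4)^m)"
      then have "bnd k (4^n)" unfolding bnd_def
        by (meson m less_imp_le mult_right_mono norm_ge_zero order_trans)
      then show False using k by simp
    qed
    moreover have "bnd k (C0 * (3/4)^0)" using C0 by simp
    \<comment> \<open>C is a bound for L k whose multiple 3/4 C fails to be one: the operator norm
      up to the factor 3/4.\<close>
    ultimately obtain j where j: "bnd k (C0 * (3/4)^j)" "\<not> bnd k (C0 * (3/4)^Suc j)"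
      using nat_induct[of "%j. bnd k (C0 * (3/4)^j)" m] by blast
    define C where "C = C0 * (3/4)^j"
    have C: "bnd k C" "\<not> bnd k (3/4 * C)" using j by (auto simp: C_def ac_simps)
    have C4: "C >= 4^n"
    proof (rule ccontr)
      assume "\<not> C >= 4^n"
      then have "bnd k (4^n)" using C(1) unfolding bnd_def
        by (meson less_imp_le mult_right_mono norm_ge_zero order_trans not_le)
      then show False using k by simp
    qed
    obtain y where y: "y \<in> H" "norm (L k y) > 3/4 * C * norm y" using C(2) unfolding bnd_def by (meson not_le)
    have y0: "y ~= 0" using y lin_onD(5)[OF L] by auto
    define z where "z = ((1/3)^n / norm y) *\<^sub>R y"
    have "norm (L k z) = (1/3)^n / norm y * norm (L k y)"
      using lin_onD(3)[OF L y(1)] by (simp add: z_def)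
    also have "... >= (1/3)^n / norm y * (3/4 * C * norm y)" using y(2) by (intro mult_left_mono) auto
    finally have "norm (L k z) >= 3/4 * C * (1/3)^n" using y0 by (simp add: ac_simps)
    moreover have "z \<in> H" using y sub by (simp add: z_def subspace_scale)
    moreover have "norm z <= (1/3)^n" using y0 by (simp add: z_def)
    ultimately show ?thesis using C C4 by blast
  qed
  define hump where "hump n k z C \<longleftrightarrow> z \<in> H \<and> norm z <= (1/3)^n \<and> bnd k C \<and> C >= 4^n \<and> norm (L k z) >= 3/4 * C * (1/3)^n"
    for n :: nat and k z C
  have "\<exists>k z C. hump n k z C" for n using ex[of n] unfolding hump_def .
  then obtain k z C where hump: "!!n. hump n (k n) (z n) (C n)" by metis
  have kz: "!!n. z n \<in> H" "!!n. norm (z n) <= (1/3)^n" "!!n. bnd (k n) (C n)"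
      "!!n. C n >= 4^n" "!!n::nat. norm (L (k n) (z n)) >= 3/4 * C n * (1/3)^n"
    using hump unfolding hump_def by auto
  define ok where "ok n x x' \<longleftrightarrow> x' \<in> H \<and> norm (x' - x) <= (1/3)^n \<and> norm (L (k n) x') >= 3/4 * C n * (1/3)^n" for n x x'
  have step: "\<exists>x'. ok n x x'" if "x \<in> H" for x n
  proof -
    \<comment> \<open>The difference of L(x + z) and L(x - z) is 2 L z, so one of the two is at
      least as large as L z; the hump can be added or subtracted whatever x is.\<close>
    have e: "L (k n) (x + z n) - L (k n) (x - z n) = 2 *\<^sub>R L (k n) (z n)"
      using lin_onD(2,4)[OF L that kz(1)] by (simp add: scaleR_2)
    have "2 * norm (L (k n) (z n)) <= norm (L (k n) (x + z n)) + norm (L (k n) (x - z n))"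
      using norm_triangle_ineq4[of "L (k n) (x + z n)" "L (k n) (x - z n)"] unfolding e by simp
    then have "norm (L (k n) (x + z n)) >= 3/4 * C n * (1/3)^n \<or> norm (L (k n) (x - z n)) >= 3/4 * C n * (1/3)^n"
      using kz(5)[of n] by linarith
    then show ?thesis
    proof
      assume "norm (L (k n) (x + z n)) >= 3/4 * C n * (1/3)^n"
      then show ?thesis using kz(1,2)[of n] that subspace_add[OF sub]
        by (intro exI[of _ "x + z n"]) (auto simp: ok_def)
    next
      assume "norm (L (k n) (x - z n)) >= 3/4 * C n * (1/3)^n"
      then show ?thesis using kz(1,2)[of n] that subspace_diff[OF sub]
        by (intro exI[of _ "x - z n"]) (auto simp: ok_def)
    qed
  qed
  define nx where "nx n x = (SOME x'. ok n x x')" for n x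
  have nx: "nx n x \<in> H" "norm (nx n x - x) <= (1/3)^n" "norm (L (k n) (nx n x)) >= 3/4 * C n * (1/3)^n" if "x \<in> H" for n x
    using someI_ex[OF step[OF that, of n]] unfolding nx_def ok_def by auto
  define X where "X = rec_nat 0 (%n x. nx n x)"
  have X0: "X 0 = 0" and XS: "X (Suc n) = nx n (X n)" for n by (auto simp: X_def)
  have XH: "X n \<in> H" for n by (induction n) (auto simp: X0 XS nx subspace_0[OF sub])
  have XD: "norm (X (Suc n) - X n) <= (1/3)^n" for n using nx(2)[OF XH] by (simp add: XS)
  have sm: "summable (%n. X (Suc n) - X n)"
    by (rule summable_comparison_test'[where g = "%n. (1/3)^n"]) (use XD in \<open>auto intro: summable_geometric\<close>)
  have "(\<Sum>i<n. X (Suc i) - X i) = X n" for n using sum_lessThan_telescope[of X n] X0 by simp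
  then have Xlim: "X \<longlonglongrightarrow> (\<Sum>i. X (Suc i) - X i)" (is "_ \<longlonglongrightarrow> ?x") using summable_LIMSEQ[OF sm] by simp
  have xH: "?x \<in> H" by (rule closed_sequentially[OF cl _ Xlim]) (rule XH)
  have tail: "norm (?x - X (Suc n)) <= (1/3)^n / 2" for n
  proof -
    have d: "norm (X (Suc n + m) - X (Suc n)) <= (1/3)^n / 2 - (1/3)^(n+m) / 2" for m
    proof (induction m)
      case (Suc m)
      have "norm (X (Suc n + Suc m) - X (Suc n)) <= norm (X (Suc (Suc n + m)) - X (Suc n + m)) + norm (X (Suc n + m) - X (Suc n))"
        using norm_triangle_ineq[of "X (Suc (Suc n + m)) - X (Suc n + m)" "X (Suc n + m) - X (Suc n)"] by simp
      also have "... <= (1/3)^(Suc n + m) + ((1/3)^n / 2 - (1/3)^(n+m) / 2)" using XD Suc by (intro add_mono)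
      finally show ?case by simp
    qed simp
    have "(%m. X (Suc n + m)) \<longlonglongrightarrow> ?x" using LIMSEQ_ignore_initial_segment[OF Xlim, of "Suc n"] by (simp add: add.commute)
    then have "(%m. norm (X (Suc n + m) - X (Suc n))) \<longlonglongrightarrow> norm (?x - X (Suc n))" by (intro tendsto_intros)
    moreover have "norm (X (Suc n + m) - X (Suc n)) <= (1/3)^n / 2" for m
      using order_trans[OF d[of m], of "(1/3)^n / 2"] by simp
    ultimately show ?thesis using LIMSEQ_le_const2 by blast
  qed
  obtain K where K: "!!n. norm (L n ?x) <= K" using bd[OF xH] by blast
  \<comment> \<open>The hump contributes 3/4 C n 3^-n and the later steps at most 1/2 C n 3^-n. The
    quarter that remains grows like (4/3)^n, as C n >= 4^n.\<close>
  have "(4/3)^n <= 4 * K" for n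
  proof -
    have "norm (L (k n) (?x - X (Suc n))) <= C n * norm (?x - X (Suc n))"
      using kz(3)[of n] subspace_diff[OF sub xH XH] unfolding bnd_def by blast
    also have "... <= C n * ((1/3)^n / 2)"
      using tail[of n] order_trans[OF zero_le_power kz(4)[of n]] by (intro mult_left_mono) auto
    finally have 1: "norm (L (k n) (?x - X (Suc n))) <= C n * ((1/3)^n / 2)" .
    have "L (k n) (?x - X (Suc n)) = L (k n) ?x - L (k n) (X (Suc n))" by (rule lin_onD(4)[OF L xH XH])
    then have "norm (L (k n) (X (Suc n))) <= norm (L (k n) ?x) + norm (L (k n) (?x - X (Suc n)))"
      using norm_triangle_ineq4[of "L (k n) ?x" "L (k n) ?x - L (k n) (X (Suc n))"] by simp
    then have "3/4 * C n * (1/3)^n <= K + C n * ((1/3)^n / 2)"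
      using K[of "k n"] 1 nx(3)[OF XH, of n n] by (simp add: XS)
    then have "C n * (1/3)^n <= 4 * K" by (simp add: algebra_simps)
    moreover have "4^n * (1/3)^n <= C n * (1/3)^n" using kz(4)[of n] by (intro mult_right_mono) auto
    ultimately show ?thesis by (simp add: power_divide)
  qed
  moreover obtain n where "(4/3)^n > 4 * K" using real_arch_pow[of "4/3" "4 * K"] by auto
  ultimately show False by (meson not_le)
qed

lemma csgD:
  assumes "csg H S"
  shows "!!t. t >= 0 ==> lin_on H (S t)" "!!x. x \<in> H ==> S 0 x = x"
    "!!s t x. s >= 0 ==> t >= 0 ==> x \<in> H ==> S (s + t) x = S s (S t x)"
    "!!x. x \<in> H ==> ((%t. S t x) \<longlongrightarrow> x) (at_right 0)"
    "!!t x. t >= 0 ==> x \<in> H ==> S t x \<in> H"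
    "!!t x y. t >= 0 ==> x \<in> H ==> y \<in> H ==> S t (x - y) = S t x - S t y"
    "!!t x y. t >= 0 ==> x \<in> H ==> y \<in> H ==> S t (x + y) = S t x + S t y"
    "!!t x c. t >= 0 ==> x \<in> H ==> S t (c *\<^sub>R x) = c *\<^sub>R S t x"
proof -
  show l: "!!t. t >= 0 ==> lin_on H (S t)" and "!!x. x \<in> H ==> S 0 x = x"
    "!!s t x. s >= 0 ==> t >= 0 ==> x \<in> H ==> S (s + t) x = S s (S t x)"
    "!!x. x \<in> H ==> ((%t. S t x) \<longlongrightarrow> x) (at_right 0)"
    using assms unfolding csg_def by blast+
  show "!!t x. t >= 0 ==> x \<in> H ==> S t x \<in> H"
    "!!t x y. t >= 0 ==> x \<in> H ==> y \<in> H ==> S t (x - y) = S t x - S t y"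
    "!!t x y. t >= 0 ==> x \<in> H ==> y \<in> H ==> S t (x + y) = S t x + S t y"
    "!!t x c. t >= 0 ==> x \<in> H ==> S t (c *\<^sub>R x) = c *\<^sub>R S t x"
    using lin_onD[OF l] by blast+
qed

text \<open>Without a bound near 0 there are times t n -> 0 with norms above n + 1, while strong
  continuity bounds every orbit along t n; this contradicts \<open>uniform_boundedness\<close>. A
  bound on [0,\<delta>] spreads to [0,b] by the semigroup law.\<close>

lemma csg_locally_bounded:
  assumes S: "csg H S"
  shows "\<exists>C>0. \<forall>t\<in>{0..b}. \<forall>x\<in>H. norm (S t x) <= C * norm x"
proof -
  have "\<exists>\<delta>>0. \<exists>C. \<forall>t\<in>{0..\<delta>}. \<forall>x\<in>H. norm (S t x) <= C * norm x"
  proof (rule ccontr)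
    assume neg: "\<not> (\<exists>\<delta>>0. \<exists>C. \<forall>t\<in>{0..\<delta>}. \<forall>x\<in>H. norm (S t x) <= C * norm x)"
    have "\<exists>t x. 0 < t \<and> t <= 1 / Suc n \<and> x \<in> H \<and> norm (S t x) > (real n + 1) * norm x" for n
    proof -
      obtain t x where t: "t \<in> {0..1 / Suc n}" "x \<in> H" "norm (S t x) > (real n + 1) * norm x"
        using neg by (metis not_le of_nat_0_less_iff zero_less_Suc zero_less_divide_1_iff)
      have "norm x <= (real n + 1) * norm x" by (simp add: mult_left_le_one_le algebra_simps)
      then have "t ~= 0" using t csgD(2)[OF S] by (intro notI) simp
      then show ?thesis using t by (intro exI[of _ t] exI[of _ x]) auto
    qed
    then obtain t x where tx: "!!n::nat. 0 < t n" "!!n. t n <= 1 / Suc n" "!!n. x n \<in> H"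
        "!!n. norm (S (t n) (x n)) > (real n + 1) * norm (x n)" by metis
    have "t \<longlonglongrightarrow> 0"
      by (rule tendsto_sandwich[OF _ _ tendsto_const lim_1_over_n[THEN LIMSEQ_Suc]])
        (use tx(1,2) in \<open>auto intro!: always_eventually less_imp_le\<close>)
    then have "filterlim t (at_right 0) sequentially"
      using less_imp_neq[OF tx(1)] by (simp add: filterlim_at tx(1))
    then have lim: "(%n. S (t n) y) \<longlonglongrightarrow> y" if "y \<in> H" for y
      using filterlim_compose[OF csgD(4)[OF S that]] by blast
    have "\<exists>C. \<forall>n. \<forall>y\<in>H. norm (S (t n) y) <= C * norm y"
    proof (rule uniform_boundedness)
      show "lin_on H (S (t n))" for n using csgD(1)[OF S] tx(1)[of n] by (simp add: less_imp_le)
      show "\<exists>K. \<forall>n. norm (S (t n) y) <= K" if "y \<in> H" for y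
        using convergent_imp_Bseq[OF convergentI[OF lim[OF that]]] unfolding Bseq_def by blast
    qed
    then obtain C where C: "!!n y. y \<in> H ==> norm (S (t n) y) <= C * norm y" by blast
    obtain n where n: "real n >= C" using real_arch_simple by blast
    have "C * norm (x n) <= (real n + 1) * norm (x n)" using n by (intro mult_right_mono) auto
    then show False using C[OF tx(3)[of n], of n] tx(4)[of n] by linarith
  qed
  then obtain \<delta> C0 where d: "\<delta> > 0" and C0: "!!t x. 0 <= t ==> t <= \<delta> ==> x \<in> H ==> norm (S t x) <= C0 * norm x"
    by (metis atLeastAtMost_iff)
  define C where "C = max C0 1"
  have C: "norm (S t x) <= C * norm x" if "0 <= t" "t <= \<delta>" "x \<in> H" for t x
    by (rule order_trans[OF C0[OF that] mult_right_mono]) (auto simp: C_def)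
  have C1: "C >= 1" by (simp add: C_def)
  have pow: "norm (S t x) <= C ^ (n + 1) * norm x" if "0 <= t" "t <= real n * \<delta> + \<delta>" "x \<in> H" for n t x
    using that
  proof (induction n arbitrary: t)
    case (Suc n)
    show ?case
    proof (cases "t <= \<delta>")
      case True
      have "norm (S t x) <= C * norm x" by (rule C[OF Suc(2) True Suc(4)])
      also have "... <= C ^ (Suc n + 1) * norm x" using C1 by (intro mult_right_mono self_le_power) auto
      finally show ?thesis .
    next
      case False
      then have "norm (S t x) = norm (S \<delta> (S (t - \<delta>) x))"
        using csgD(3)[OF S, of \<delta> "t - \<delta>" x] Suc d by simp
      also have "... <= C * norm (S (t - \<delta>) x)" using C d False Suc csgD(5)[OF S] by simp
      also have "... <= C * (C ^ (n + 1) * norm x)"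
        using Suc False C1 by (intro mult_left_mono Suc.IH) (auto simp: algebra_simps)
      finally show ?thesis by simp
    qed
  qed (use C in simp)
  obtain n where n: "real n >= b / \<delta>" using real_arch_simple by blast
  then have "b <= real n * \<delta> + \<delta>" using d by (simp add: field_simps)
  then have "\<forall>t\<in>{0..b}. \<forall>x\<in>H. norm (S t x) <= C ^ (n + 1) * norm x" using pow by auto
  moreover have "C ^ (n + 1) > 0" using C1 by simp
  ultimately show ?thesis by blast
qed

text \<open>Both one-sided limits reduce to the increment S s (S h x - x), which the local bound
  controls uniformly in s. For the limit from the left the base point is the smaller time.\<close>

lemma csg_continuous:
  assumes S: "csg H S" and x: "x \<in> H"
  shows "continuous_on {0..} (%t. S t x)"
proof -
  have main: "\<exists>d>0. \<forall>t'\<ge>0. dist t' t < d \<longrightarrow> dist (S t' x) (S t x) < e" if t: "t >= 0" and e: "e > 0" for t e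
  proof -
    obtain C where C: "C > 0" "!!t' y. 0 <= t' ==> t' <= t + 1 ==> y \<in> H ==> norm (S t' y) <= C * norm y"
      using csg_locally_bounded[OF S, of "t + 1"] by auto
    have "\<forall>\<^sub>F h in at_right 0. dist (S h x) x < e / C"
      using csgD(4)[OF S x] C e by (simp add: tendsto_iff)
    then obtain d where d: "d > 0" "!!h. 0 < h ==> h < d ==> dist (S h x) x < e / C"
      using eventually_at_right[of 0 "1::real"] by fastforce
    have d': "norm (S h x - x) < e / C" if "0 <= h" "h < d" for h
      using d(2)[of h] that csgD(2)[OF S x] C e by (cases "h = 0") (auto simp: dist_norm)
    have inc: "norm (S (s + h) x - S s x) < e" if "0 <= s" "s <= t + 1" "0 <= h" "h < d" for s h
    proof -
      have "S (s + h) x - S s x = S s (S h x - x)"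
        using csgD(3,6)[OF S] that x csgD(5)[OF S] by simp
      then have "norm (S (s + h) x - S s x) <= C * norm (S h x - x)"
        using C(2)[of s "S h x - x"] that x csgD(5)[OF S] subspace_diff[OF sub] by simp
      also have "... < C * (e / C)" using d' that C by (intro mult_strict_left_mono) auto
      finally show ?thesis using C by simp
    qed
    show ?thesis
    proof (intro exI[of _ "min d 1"] conjI allI impI)
      fix t' assume t': "t' >= 0" "dist t' t < min d 1"
      show "dist (S t' x) (S t x) < e"
      proof (cases "t' >= t")
        case True
        then show ?thesis using inc[of t "t' - t"] t t' by (simp add: dist_norm)
      next
        case False
        then show ?thesis using inc[of t' "t - t'"] t t' by (simp add: dist_norm norm_minus_commute)
      qed
    qed (use d in simp)
  qed
  then show ?thesis unfolding continuous_on_iff by (metis atLeast_iff)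
qed

lemma csg_continuous_comp:
  assumes S: "csg H S" and g: "continuous_on A g" "!!a. a \<in> A ==> 0 <= g a \<and> g a <= b"
    and f: "continuous_on A f" "!!a. a \<in> A ==> f a \<in> H"
  shows "continuous_on A (%a. S (g a) (f a))"
proof -
  obtain C where C: "C > 0" "!!t' y. 0 <= t' ==> t' <= b ==> y \<in> H ==> norm (S t' y) <= C * norm y"
    using csg_locally_bounded[OF S, of b] by auto
  show ?thesis unfolding continuous_on_def
  proof
    fix a assume a: "a \<in> A"
    have "((%z. f z) \<longlongrightarrow> f a) (at a within A)" using f(1) a by (simp add: continuous_on_def)
    then have 1: "((%z. C * norm (f z - f a)) \<longlongrightarrow> 0) (at a within A)"
      by (intro tendsto_mult_right_zero tendsto_norm_zero LIM_zero)
    have "continuous_on A (%z. S (g z) (f a))"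
      by (rule continuous_on_compose2[OF csg_continuous[OF S f(2)[OF a]] g(1)]) (use g(2) in auto)
    then have "((%z. S (g z) (f a)) \<longlongrightarrow> S (g a) (f a)) (at a within A)" using a by (simp add: continuous_on_def)
    moreover have "((%z. S (g z) (f z) - S (g z) (f a)) \<longlongrightarrow> 0) (at a within A)"
    proof (rule Lim_null_comparison[OF _ 1])
      show "\<forall>\<^sub>F z in at a within A. norm (S (g z) (f z) - S (g z) (f a)) <= C * norm (f z - f a)"
        unfolding eventually_at_filter
      proof (rule always_eventually, intro allI impI)
        fix z assume z: "z \<in> A"
        have "S (g z) (f z) - S (g z) (f a) = S (g z) (f z - f a)" using csgD(6)[OF S] g(2) f(2) z a by simp
        then show "norm (S (g z) (f z) - S (g z) (f a)) <= C * norm (f z - f a)"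
          using C(2) g(2) f(2) z a subspace_diff[OF sub] by simp
      qed
    qed
    ultimately show "((%z. S (g z) (f z)) \<longlongrightarrow> S (g a) (f a)) (at a within A)"
      using tendsto_add by fastforce
  qed
qed

lemma integral_near_constant:
  fixes f :: "real => 'x"
  assumes f: "continuous_on {a..b} f" "a <= b" and "!!r. r \<in> {a..b} ==> norm (f r - y) <= e"
  shows "norm (integral {a..b} f - (b - a) *\<^sub>R y) <= e * (b - a)"
proof -
  have "norm (integral {a..b} (%r. f r - y)) <= e * (b - a)"
    by (rule integral_bound) (use assms in \<open>auto intro!: continuous_intros\<close>)
  then show ?thesis using f by (simp add: integral_diff integrable_continuous_real)
qed

lemma tendsto_average:
  fixes f :: "real => 'x"
  assumes f: "continuous_on {a..b} f" "a < b"
  shows "((%s. integral {a..a+s} f /\<^sub>R s) \<longlongrightarrow> f a) (at_right 0)"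
  unfolding tendsto_iff
proof (intro allI impI)
  fix e :: real assume e: "e > 0"
  obtain d where d: "d > 0" "!!r. r \<in> {a..b} ==> dist r a < d ==> dist (f r) (f a) < e / 2"
    using f e unfolding continuous_on_iff by (metis atLeastAtMost_iff half_gt_zero less_imp_le order_refl)
  have "\<forall>\<^sub>F s in at_right 0. s < min d (b - a) \<and> 0 < s"
    using d f by (intro eventually_conj eventually_at_right_less order_tendstoD(2)[OF tendsto_ident_at]) auto
  then show "\<forall>\<^sub>F s in at_right 0. dist (integral {a..a+s} f /\<^sub>R s) (f a) < e"
  proof eventually_elim
    case (elim s)
    have "norm (integral {a..a+s} f - (a + s - a) *\<^sub>R f a) <= e / 2 * (a + s - a)"
    proof (rule integral_near_constant)
      show "continuous_on {a..a+s} f" by (rule continuous_on_subset[OF f(1)]) (use elim in auto)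
      show "norm (f r - f a) <= e / 2" if "r \<in> {a..a+s}" for r
        using d(2)[of r] that elim by (auto simp: dist_norm)
    qed (use elim in auto)
    moreover have "integral {a..a+s} f /\<^sub>R s - f a = (integral {a..a+s} f - s *\<^sub>R f a) /\<^sub>R s"
      using elim by (simp add: algebra_simps)
    ultimately have "norm (integral {a..a+s} f /\<^sub>R s - f a) <= e / 2"
      using elim by (simp only: norm_scaleR) (simp add: divide_simps)
    then show ?case using e by (simp add: dist_norm)
  qed
qed

text \<open>The averages (1/s) times the integral of S r x over [0,s] tend to x. They lie in the
  domain because S h only shifts the interval of integration, so that the difference quotient is a
  difference of averages at the two end points.\<close>

lemma csg_gen_dense:
  assumes S: "csg H S" and x: "x \<in> H" and e: "e > 0"
  shows "\<exists>y z. (y, z) \<in> gen H S \<and> norm (y - x) < e"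
proof -
  have cont: "continuous_on {a..b} (%r. S r x)" if "a >= 0" for a b
    by (rule continuous_on_subset[OF csg_continuous[OF S x]]) (use that in auto)
  have SH: "S r x \<in> H" if "r >= 0" for r using csgD(5)[OF S that x] .
  define I where "I a b = integral {a..b} (%r. S r x)" for a b
  have IH: "I a b \<in> H" if "a >= 0" for a b unfolding I_def
    by (rule integral_mem[OF cont]) (use that SH in auto)
  have SI: "S s (I 0 h) = I s (s + h)" if "s >= 0" "h >= 0" for s h
  proof -
    have "S s (I 0 h) = integral {0..h} (%r. S s (S r x))" unfolding I_def
      by (rule integral_lin(2)[OF csgD(1)[OF S]]) (use that SH cont in auto)
    also have "... = integral {0..h} (%r. S (r + s) x)"
      using csgD(3)[OF S \<open>s >= 0\<close> _ x] by (intro integral_cong) (simp add: add.commute[of _ s])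
    also have "... = I s (s + h)"
      unfolding I_def using integral_unique[OF iffD2[OF has_integral_shift_Icc_real, OF integrable_integral,
        OF integrable_continuous_real, OF cont[of "0 + s" "h + s"]]] that by (simp add: o_def add.commute)
    finally show ?thesis .
  qed
  have avg: "((%s. I a (a + s) /\<^sub>R s) \<longlongrightarrow> S a x) (at_right 0)" if "a >= 0" for a
    unfolding I_def using tendsto_average[of a "a+1" "%r. S r x"] cont that by simp
  have D: "(I 0 h, S h x - x) \<in> gen H S" if h: "h > 0" for h
  proof -
    have "((%s. I h (h + s) /\<^sub>R s - I 0 (0 + s) /\<^sub>R s) \<longlongrightarrow> S h x - S 0 x) (at_right 0)"
      using h by (intro tendsto_diff avg) auto
    moreover have "\<forall>\<^sub>F s in at_right 0. I h (h + s) /\<^sub>R s - I 0 (0 + s) /\<^sub>R s = (S s (I 0 h) - I 0 h) /\<^sub>R s"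
    proof (rule eventually_mono[OF eventually_at_right_less[of 0]])
      fix s :: real assume s: "s > 0"
      have "I 0 s + I s (s + h) = I 0 (s + h)" unfolding I_def
        by (rule Henstock_Kurzweil_Integration.integral_combine) (use s h in \<open>auto intro!: integrable_continuous_real cont\<close>)
      moreover have "I 0 h + I h (h + s) = I 0 (h + s)" unfolding I_def
        by (rule Henstock_Kurzweil_Integration.integral_combine) (use s h in \<open>auto intro!: integrable_continuous_real cont\<close>)
      moreover have "I h (h + s) - I 0 s = S s (I 0 h) - I 0 h" if "I 0 s + I s (s + h) = I 0 (s + h)" "I 0 h + I h (h + s) = I 0 (h + s)"
        using SI[of s h] s h that by (simp add: algebra_simps)
      ultimately have "(I h (h + s) - I 0 s) /\<^sub>R s = (S s (I 0 h) - I 0 h) /\<^sub>R s" by simp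
      then show "I h (h + s) /\<^sub>R s - I 0 (0 + s) /\<^sub>R s = (S s (I 0 h) - I 0 h) /\<^sub>R s"
        by (simp add: scaleR_diff_right)
    qed
    ultimately have "((%s. (S s (I 0 h) - I 0 h) /\<^sub>R s) \<longlongrightarrow> S h x - x) (at_right 0)"
      using csgD(2)[OF S x] by (simp add: filterlim_cong[OF refl refl])
    then show ?thesis using IH[of 0 h] SH[of h] h x subspace_diff[OF sub] by (simp add: gen_def)
  qed
  have "\<forall>\<^sub>F s in at_right 0. dist (I 0 (0 + s) /\<^sub>R s) (S 0 x) < e"
    using avg[of 0] e by (simp add: tendsto_iff)
  then have "\<forall>\<^sub>F s in at_right 0. dist (I 0 (0 + s) /\<^sub>R s) (S 0 x) < e \<and> 0 < s"
    by (intro eventually_conj eventually_at_right_less)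
  from eventually_happens'[OF _ this]
  obtain s where s: "s > 0" "dist (I 0 s /\<^sub>R s) x < e"
    using csgD(2)[OF S x] by auto
  have "(I 0 s /\<^sub>R s, (S s x - x) /\<^sub>R s) \<in> gen H S"
  proof -
    have "((%t. (1/s) *\<^sub>R ((S t (I 0 s) - I 0 s) /\<^sub>R t)) \<longlongrightarrow> (1/s) *\<^sub>R (S s x - x)) (at_right 0)"
      using D[OF s(1)] by (intro tendsto_intros) (simp add: gen_def)
    moreover have "\<forall>\<^sub>F t in at_right 0. (1/s) *\<^sub>R ((S t (I 0 s) - I 0 s) /\<^sub>R t) = (S t (I 0 s /\<^sub>R s) - I 0 s /\<^sub>R s) /\<^sub>R t"
    proof (rule eventually_mono[OF eventually_at_right_less[of 0]])
      fix t :: real assume t: "t > 0"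
      have "S t (I 0 s /\<^sub>R s) = S t (I 0 s) /\<^sub>R s" using csgD(8)[OF S _ IH] t by simp
      then show "(1/s) *\<^sub>R ((S t (I 0 s) - I 0 s) /\<^sub>R t) = (S t (I 0 s /\<^sub>R s) - I 0 s /\<^sub>R s) /\<^sub>R t"
        by (simp add: algebra_simps divide_inverse)
    qed
    ultimately have "((%t. (S t (I 0 s /\<^sub>R s) - I 0 s /\<^sub>R s) /\<^sub>R t) \<longlongrightarrow> (1/s) *\<^sub>R (S s x - x)) (at_right 0)"
      by (simp add: filterlim_cong[OF refl refl])
    then show ?thesis using IH[of 0 s] SH[of s] s x sub by (simp add: gen_def divide_inverse subspace_diff subspace_scale)
  qed
  then show ?thesis using s(2) unfolding dist_norm by blast
qed

text \<open>For y in the domain, r -> U (t - r) (S r y) has vanishing right derivative: S r y stays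
  in the domain, where both difference quotients have the same limit. The function is constant; its
  values at 0 and t give equality on a dense set.\<close>

lemma csg_generator_unique:
  assumes S: "csg H S" and U: "csg H U" and g: "gen H S \<subseteq> gen H U" and t: "t >= 0" and x: "x \<in> H"
  shows "S t x = U t x"
proof -
  obtain C where C: "C > 0" "!!r y. 0 <= r ==> r <= t ==> y \<in> H ==> norm (U r y) <= C * norm y"
    using csg_locally_bounded[OF U, of t] by auto
  obtain C' where C': "C' > 0" "!!r y. 0 <= r ==> r <= t ==> y \<in> H ==> norm (S r y) <= C' * norm y"
    using csg_locally_bounded[OF S, of t] by auto
  have D: "S t y = U t y" if yz: "(y, z) \<in> gen H S" for y z
  proof -
    have yH: "y \<in> H" "z \<in> H" and lim: "((%h. (S h y - y) /\<^sub>R h) \<longlongrightarrow> z) (at_right 0)" using yz by (auto simp: gen_def)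
    define \<phi> where "\<phi> r = U (t - r) (S r y)" for r
    have "\<phi> t = \<phi> 0"
    proof (rule zero_right_derivative_imp_constant[OF t])
      show "continuous_on {0..t} \<phi>" unfolding \<phi>_def
        by (rule csg_continuous_comp[OF U, where b = t])
           (auto intro!: continuous_intros continuous_on_subset[OF csg_continuous[OF S yH(1)]] csgD(5)[OF S _ yH(1)])
      fix r assume r: "0 <= r" "r < t"
      define w where "w = S r y"
      have wH: "w \<in> H" using csgD(5)[OF S] r yH by (simp add: w_def)
      \<comment> \<open>The absolute value keeps the argument in \<open>H\<close> for every h, as
        \<open>lin_on_tendsto\<close> demands; for h > 0 it changes nothing.\<close>
      have "((%h. S r ((S \<bar>h\<bar> y - y) /\<^sub>R h)) \<longlongrightarrow> S r z) (at_right 0)"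
      proof (rule lin_on_tendsto[OF csgD(1)[OF S r(1)] _ _ yH(2)])
        show "((%h. (S \<bar>h\<bar> y - y) /\<^sub>R h) \<longlongrightarrow> z) (at_right 0)"
          by (rule Lim_transform_eventually[OF lim])
             (rule eventually_mono[OF eventually_at_right_less[of 0]], simp)
        show "(S \<bar>h\<bar> y - y) /\<^sub>R h \<in> H" for h
          using csgD(5)[OF S] yH sub by (simp add: subspace_diff subspace_scale)
      qed
      moreover have "\<forall>\<^sub>F h in at_right 0. S r ((S \<bar>h\<bar> y - y) /\<^sub>R h) = (S h w - w) /\<^sub>R h"
      proof (rule eventually_mono[OF eventually_at_right_less[of 0]])
        fix h :: real assume h: "h > 0"
        have "S r (S h y) = S h w" using csgD(3)[OF S, of r h y] csgD(3)[OF S, of h r y] r h yH by (simp add: w_def add.commute)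
        then show "S r ((S \<bar>h\<bar> y - y) /\<^sub>R h) = (S h w - w) /\<^sub>R h"
          using csgD(8)[OF S] csgD(6)[OF S] csgD(5)[OF S] r h yH subspace_diff[OF sub] by (simp add: w_def)
      qed
      ultimately have "((%h. (S h w - w) /\<^sub>R h) \<longlongrightarrow> S r z) (at_right 0)" by (simp add: filterlim_cong[OF refl refl])
      then have wg: "(w, S r z) \<in> gen H S" using wH csgD(5)[OF S] r yH by (simp add: gen_def)
      then have "(w, S r z) \<in> gen H U" using g by blast
      then have "((%h. (S h w - w) /\<^sub>R h - (U h w - w) /\<^sub>R h) \<longlongrightarrow> S r z - S r z) (at_right 0)"
        using wg by (intro tendsto_diff) (auto simp: gen_def)
      then have "((%h. C * norm ((S h w - w) /\<^sub>R h - (U h w - w) /\<^sub>R h)) \<longlongrightarrow> 0) (at_right 0)"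
        by (intro tendsto_mult_right_zero tendsto_norm_zero) simp
      then show "((%h. norm (\<phi> (r + h) - \<phi> r) / h) \<longlongrightarrow> 0) (at_right 0)"
      proof (rule Lim_null_comparison[rotated])
        have "\<forall>\<^sub>F h in at_right 0. h < t - r \<and> 0 < h"
          using r by (intro eventually_conj eventually_at_right_less order_tendstoD(2)[OF tendsto_ident_at]) auto
        then show "\<forall>\<^sub>F h in at_right 0. norm (norm (\<phi> (r + h) - \<phi> r) / h) <= C * norm ((S h w - w) /\<^sub>R h - (U h w - w) /\<^sub>R h)"
        proof eventually_elim
          case (elim h)
          have 1: "\<phi> (r + h) = U (t - r - h) (S h w)"
            using csgD(3)[OF S, of h r y] elim r yH by (simp add: \<phi>_def w_def add.commute algebra_simps)
          have 2: "\<phi> r = U (t - r - h) (U h w)"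
            using csgD(3)[OF U, of "t - r - h" h w] elim wH by (simp add: \<phi>_def w_def)
          have 3: "S h w \<in> H" "U h w \<in> H" using elim wH csgD(5)[OF S] csgD(5)[OF U] by auto
          have "\<phi> (r + h) - \<phi> r = U (t - r - h) (S h w - U h w)"
            unfolding 1 2 using csgD(6)[OF U _ 3] elim by simp
          then have "norm (\<phi> (r + h) - \<phi> r) <= C * norm (S h w - U h w)"
            using C(2)[of "t - r - h" "S h w - U h w"] elim r 3 subspace_diff[OF sub] by simp
          moreover have "(S h w - w) /\<^sub>R h - (U h w - w) /\<^sub>R h = (S h w - U h w) /\<^sub>R h"
            by (simp add: algebra_simps)
          ultimately show ?case using elim by (simp only: norm_scaleR) (simp add: divide_simps mult.commute)
        qed
      qed
    qed
    then show ?thesis using csgD(2)[OF U] csgD(2)[OF S] csgD(5)[OF S t] yH by (simp add: \<phi>_def)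
  qed
  have "norm (S t x - U t x) <= 0 + e" if e: "e > 0" for e
  proof -
    obtain y z where yz: "(y, z) \<in> gen H S" "norm (y - x) < e / (C + C')"
      using csg_gen_dense[OF S x, of "e / (C + C')"] e C C' by auto
    have yH: "y \<in> H" using yz by (simp add: gen_def)
    have xy: "x - y \<in> H" using subspace_diff[OF sub x yH] .
    have "S t x - U t x = S t (x - y) - U t (x - y)"
      using D[OF yz(1)] csgD(6)[OF S t x yH] csgD(6)[OF U t x yH] by simp
    also have "norm ... <= C' * norm (x - y) + C * norm (x - y)"
      by (rule order_trans[OF norm_triangle_ineq4 add_mono[OF C'(2)[OF t order_refl xy] C(2)[OF t order_refl xy]]])
    also have "... = (C + C') * norm (y - x)" by (simp add: algebra_simps norm_minus_commute)
    also have "... <= (C + C') * (e / (C + C'))" using yz C C' by (intro mult_left_mono) auto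
    finally show ?thesis using C C' by simp
  qed
  then have "norm (S t x - U t x) <= 0" by (rule field_le_epsilon)
  then show ?thesis by simp
qed

end

section \<open>Bounded perturbations by variation of constants, and the Trotter product
  formula\<close>

lemma integral_rescale:
  fixes h :: "real => 'x::banach"
  assumes h: "continuous_on {0..t} h" and t: "0 <= t"
  shows "integral {0..t} h = t *\<^sub>R integral {0..1} (%theta. h (t * theta))"
proof (cases "t = 0")
  case False
  then have t0: "t > 0" using t by simp
  have "(h has_integral integral {0..t} h) (cbox 0 t)"
    using integrable_integral[OF integrable_continuous_real[OF h]] by (simp add: cbox_interval)
  from has_integral_affinity'[OF this t0, of 0]
  have "((%theta. h (t * theta)) has_integral integral {0..t} h /\<^sub>R t) {0..1}"
    using t0 by (simp add: cbox_interval)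
  then have "integral {0..1} (%theta. h (t * theta)) = integral {0..t} h /\<^sub>R t" by (rule integral_unique)
  then show ?thesis using t0 by simp
qed simp

lemma continuous_on_obtain:
  assumes "continuous_on A f" "a \<in> A" "e > 0"
  obtains d where "d > 0" "!!x. x \<in> A ==> dist x a < d ==> dist (f x) (f a) < e"
  using assms(3) bspec[OF iffD1[OF continuous_on_iff assms(1)] assms(2)] by auto

lemma continuous_on_atLeast_0:
  fixes f :: "real => 'x::metric_space"
  assumes "!!b. b >= 0 ==> continuous_on {0..b} f"
  shows "continuous_on {0..} f"
  unfolding continuous_on_iff
proof (intro ballI allI impI)
  fix t :: real and e :: real assume t: "t \<in> {0..}" and e: "e > 0"
  have "continuous_on {0..t+1} f" using assms t by simp
  then obtain d where d: "d > 0" "!!s. s \<in> {0..t+1} ==> dist s t < d ==> dist (f s) (f t) < e"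
    by (rule continuous_on_obtain[where a = t and e = e]) (use t e in auto)
  show "\<exists>d>0. \<forall>s\<in>{0..}. dist s t < d \<longrightarrow> dist (f s) (f t) < e"
    using d by (intro exI[of _ "min d 1"]) (auto simp: dist_real_def)
qed

lemma integral_exp_bound:
  fixes K :: real
  assumes "K > 0" "t >= 0"
  shows "((%r. K * exp (2 * K * r)) has_integral (exp (2 * K * t) - 1) / 2) {0..t}"
proof -
  have "((%r. K * exp (2 * K * r)) has_integral exp (2 * K * t) / 2 - exp (2 * K * 0) / 2) {0..t}"
    by (rule fundamental_theorem_of_calculus[OF assms(2)])
      (auto simp flip: has_real_derivative_iff_has_vector_derivative intro!: derivative_eq_intros)
  then show ?thesis by (simp add: diff_divide_distrib)
qed

locale bounded_perturbation_setup = closed_subspace H for H :: "'x::banach set" +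
  fixes T :: "real => 'x => 'x" and B :: "'x => 'x" and K :: real
  assumes T: "csg H T" and contr: "!!t x. t >= 0 ==> x \<in> H ==> norm (T t x) <= norm x"
    and B: "lin_on H B" and K: "K > 0" "!!x. x \<in> H ==> norm (B x) <= K * norm x"
begin

lemmas TH = csgD(5)[OF T]
lemmas BH = lin_onD(1)[OF B]

text \<open>The Duhamel integral: if A generates T, then u = T x + conv u is the integrated form of
  u' = (A + B) u with u 0 = x.\<close>

definition conv :: "(real => 'x) => real => 'x" where
  "conv u t = integral {0..t} (%r. T (t - r) (B (u r)))"

definition mild :: "'x => (real => 'x) => bool" where
  "mild x u \<longleftrightarrow> continuous_on {0..} u \<and> (\<forall>t\<ge>0. u t \<in> H) \<and> (\<forall>t\<ge>0. u t = T t x + conv u t)"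

lemma continuous_B:
  assumes "continuous_on A u" "!!a. a \<in> A ==> u a \<in> H"
  shows "continuous_on A (%a. B (u a))"
proof -
  have "continuous_on H B"
    by (rule lipschitz_on_continuous_on[where L = K])
      (use K lin_onD(4)[OF B] subspace_diff[OF sub] in \<open>auto simp: lipschitz_on_def dist_norm simp flip: lin_onD(4)[OF B]\<close>)
  then show ?thesis by (rule continuous_on_compose2) (use assms in auto)
qed

lemma integrand_continuous:
  assumes u: "continuous_on {0..} u" "!!t. t >= 0 ==> u t \<in> H" and ab: "0 <= a" "b <= t"
  shows "continuous_on {a..b} (%r. T (t - r) (B (u r)))"
  by (rule csg_continuous_comp[OF T, where b = t])
    (use ab u in \<open>auto intro!: continuous_intros continuous_B BH continuous_on_subset[OF u(1)]\<close>)

text \<open>Rescaling turns the Duhamel integral into t times an integral over the fixed interval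
  [0,1] with jointly continuous integrand, so continuity in t is that of a parameter
  integral.\<close>

lemma conv_continuous:
  assumes u: "continuous_on {0..} u" "!!t. t >= 0 ==> u t \<in> H"
  shows "continuous_on {0..} (conv u)"
proof (rule continuous_on_atLeast_0)
  fix b :: real assume b: "b >= 0"
  have "continuous_on ({0..b} \<times> cbox 0 1) (%(t, theta). T (t - t * theta) (B (u (t * theta))))"
    unfolding case_prod_beta
  proof (rule csg_continuous_comp[OF T, where b = b])
    show "0 <= fst a - fst a * snd a \<and> fst a - fst a * snd a <= b" if "a \<in> {0..b} \<times> cbox 0 1" for a
      using that by (auto simp: mult_left_le mem_Times_iff) (smt (verit) mult_nonneg_nonneg)
    show "continuous_on ({0..b} \<times> cbox 0 1) (%a. B (u (fst a * snd a)))"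
      by (intro continuous_B continuous_on_compose2[OF u(1)] continuous_intros u(2)) (auto simp: mem_Times_iff)
  qed (auto intro!: continuous_intros BH u(2) simp: mem_Times_iff)
  then have "continuous_on {0..b} (%t. integral (cbox 0 1) (%theta. T (t - t * theta) (B (u (t * theta)))))"
    by (rule integral_continuous_on_param)
  then have "continuous_on {0..b} (%t. t *\<^sub>R integral (cbox 0 1) (%theta. T (t - t * theta) (B (u (t * theta)))))"
    by (intro continuous_intros)
  then show "continuous_on {0..b} (conv u)"
    by (rule continuous_on_eq) (use integral_rescale[OF integrand_continuous[OF u]] in \<open>auto simp: conv_def cbox_interval\<close>)
qed

lemma conv_mem:
  assumes u: "continuous_on {0..} u" "!!t. t >= 0 ==> u t \<in> H" and t: "t >= 0"
  shows "conv u t \<in> H"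
  unfolding conv_def by (rule integral_mem[OF integrand_continuous[OF u]]) (use t u in \<open>auto intro!: TH BH\<close>)

lemma conv_lincomb:
  assumes u: "continuous_on {0..} u" "!!t. t >= 0 ==> u t \<in> H"
    and v: "continuous_on {0..} v" "!!t. t >= 0 ==> v t \<in> H" and t: "t >= 0"
  shows "conv (%r. a *\<^sub>R u r + b *\<^sub>R v r) t = a *\<^sub>R conv u t + b *\<^sub>R conv v t"
proof -
  have "conv (%r. a *\<^sub>R u r + b *\<^sub>R v r) t = integral {0..t} (%r. a *\<^sub>R T (t - r) (B (u r)) + b *\<^sub>R T (t - r) (B (v r)))"
    unfolding conv_def
  proof (rule integral_cong)
    fix r assume "r \<in> {0..t}"
    then show "T (t - r) (B (a *\<^sub>R u r + b *\<^sub>R v r)) = a *\<^sub>R T (t - r) (B (u r)) + b *\<^sub>R T (t - r) (B (v r))"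
      using u(2) v(2) sub lin_onD(2,3)[OF B] csgD(7,8)[OF T] BH by (simp add: subspace_scale)
  qed
  also have "... = a *\<^sub>R conv u t + b *\<^sub>R conv v t"
    unfolding conv_def using integrand_continuous[OF u] integrand_continuous[OF v]
    by (subst integral_add) (auto intro!: integrable_continuous_real continuous_intros)
  finally show ?thesis .
qed

text \<open>In the weight exp(2 K t) the map \<open>conv\<close> has norm at most 1/2, since K exp(2
  K r) integrates over [0,t] to less than exp(2 K t) / 2. Both the a priori bound and the
  contraction property rest on this.\<close>

lemma norm_conv_le:
  assumes u: "continuous_on {0..} u" "!!t. t >= 0 ==> u t \<in> H" and t: "t >= 0"
    and m: "m >= 0" "!!r. 0 <= r ==> r <= t ==> norm (u r) <= m * exp (2 * K * r)"
  shows "norm (conv u t) <= m / 2 * exp (2 * K * t)"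
proof -
  have i: "((%r. m * (K * exp (2 * K * r))) has_integral m * ((exp (2 * K * t) - 1) / 2)) {0..t}"
    by (rule has_integral_mult_right[OF integral_exp_bound[OF K(1) t]])
  have "norm (conv u t) <= integral {0..t} (%r. m * (K * exp (2 * K * r)))"
    unfolding conv_def
  proof (rule integral_norm_bound_integral)
    show "(%r. T (t - r) (B (u r))) integrable_on {0..t}"
      by (intro integrable_continuous_real integrand_continuous[OF u]) auto
    fix r assume r: "r \<in> {0..t}"
    have "norm (T (t - r) (B (u r))) <= K * norm (u r)"
      using r u(2)[of r] by (intro order_trans[OF contr K(2)] BH) auto
    also have "... <= K * (m * exp (2 * K * r))" using K r by (intro mult_left_mono m(2)) auto
    finally show "norm (T (t - r) (B (u r))) <= m * (K * exp (2 * K * r))" by (simp add: ac_simps)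
  qed (use i in auto)
  also have "... = m * ((exp (2 * K * t) - 1) / 2)" using i by (rule integral_unique)
  also have "... <= m * (exp (2 * K * t) / 2)" using m by (intro mult_left_mono divide_right_mono) auto
  finally show ?thesis by simp
qed

text \<open>If m is the maximum of |u r| exp(-2 K r) on [0,t], the equation at a maximum point gives
  m <= |x| + m/2. The case x = 0 is uniqueness.\<close>

lemma mild_bound:
  assumes u: "mild x u" and x: "x \<in> H" and t: "t >= 0"
  shows "norm (u t) <= 2 * exp (2 * K * t) * norm x"
proof -
  have uc: "continuous_on {0..} u" and uH: "!!t. t >= 0 ==> u t \<in> H" and eq: "!!t. t >= 0 ==> u t = T t x + conv u t"
    using u by (auto simp: mild_def)
  have "continuous_on {0..t} (%r. norm (u r) / exp (2 * K * r))"
    by (intro continuous_intros continuous_on_subset[OF uc]) auto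
  then obtain s where s: "s \<in> {0..t}" "!!r. r \<in> {0..t} ==> norm (u r) / exp (2 * K * r) <= norm (u s) / exp (2 * K * s)"
    using continuous_attains_sup[of "{0..t}"] t by fastforce
  define m where "m = norm (u s) / exp (2 * K * s)"
  have m: "norm (u r) <= m * exp (2 * K * r)" if "0 <= r" "r <= t" for r
    using s(2)[of r] that by (simp add: m_def divide_simps)
  have "norm (conv u s) <= m / 2 * exp (2 * K * s)"
    by (rule norm_conv_le[OF uc uH]) (use s m in \<open>auto simp: m_def\<close>)
  moreover have "norm (u s) <= norm x + norm (conv u s)"
    using eq[of s] s contr[of s x] x norm_triangle_ineq[of "T s x" "conv u s"] by auto
  moreover have "norm x <= norm x * exp (2 * K * s)" using s K by (simp add: mult_le_cancel_left1)
  ultimately have "norm (u s) <= (norm x + m / 2) * exp (2 * K * s)" by (simp add: algebra_simps)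
  then have "m <= norm x + m / 2" by (simp add: m_def divide_simps)
  then have "m <= 2 * norm x" by simp
  then have "m * exp (2 * K * t) <= 2 * norm x * exp (2 * K * t)" by (intro mult_right_mono) auto
  then have "norm (u t) <= 2 * norm x * exp (2 * K * t)" using m[of t] t by linarith
  then show ?thesis by (simp add: ac_simps)
qed

lemma mild_lincomb:
  assumes u: "mild x u" "x \<in> H" and v: "mild y v" "y \<in> H"
  shows "mild (a *\<^sub>R x + b *\<^sub>R y) (%t. a *\<^sub>R u t + b *\<^sub>R v t)"
proof -
  have uc: "continuous_on {0..} u" and uH: "!!t. t >= 0 ==> u t \<in> H" and eq: "!!t. t >= 0 ==> u t = T t x + conv u t"
    using u by (auto simp: mild_def)
  have vc: "continuous_on {0..} v" and vH: "!!t. t >= 0 ==> v t \<in> H" and veq: "!!t. t >= 0 ==> v t = T t y + conv v t"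
    using v by (auto simp: mild_def)
  show ?thesis unfolding mild_def
  proof (intro conjI allI impI)
    show "continuous_on {0..} (%t. a *\<^sub>R u t + b *\<^sub>R v t)" by (intro continuous_intros uc vc)
    fix t :: real assume t: "t >= 0"
    show "a *\<^sub>R u t + b *\<^sub>R v t \<in> H" using uH vH t sub by (simp add: subspace_add subspace_scale)
    show "a *\<^sub>R u t + b *\<^sub>R v t = T t (a *\<^sub>R x + b *\<^sub>R y) + conv (%t. a *\<^sub>R u t + b *\<^sub>R v t) t"
      using conv_lincomb[OF uc uH vc vH t, of a b] eq[OF t] veq[OF t] csgD(7,8)[OF T t] u v sub by (simp add: subspace_scale algebra_simps)
  qed
qed

lemma mild_unique:
  assumes u: "mild x u" and v: "mild x v" and x: "x \<in> H" and t: "t >= 0"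
  shows "u t = v t"
proof -
  have "mild (1 *\<^sub>R x + (-1) *\<^sub>R x) (%t. 1 *\<^sub>R u t + (-1) *\<^sub>R v t)" by (rule mild_lincomb[OF u x v x])
  from mild_bound[OF this _ t] show ?thesis using subspace_0[OF sub] by simp
qed

text \<open>Banach's fixed point theorem for u exp(-2 K t) in the bounded continuous functions with
  values in \<open>H\<close>; the contraction factor is the 1/2 of
  \<open>norm_conv_le\<close>.\<close>

lemma mild_exists:
  assumes x: "x \<in> H"
  shows "\<exists>u. mild x u"
proof -
  define wt where "wt t = exp (2 * K * t)" for t :: real
  have wt: "wt t > 0" "wt 0 = 1" for t by (auto simp: wt_def)
  have wtc: "continuous_on A wt" for A unfolding wt_def by (intro continuous_intros)
  define unw :: "(real \<Rightarrow>\<^sub>C 'x) => real => 'x" where "unw v r = wt r *\<^sub>R apply_bcontfun v r" for v r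
  \<comment> \<open>Bounded continuous functions live on the whole line here; \<open>max t 0\<close>
    continues the function as a constant to negative times.\<close>
  define \<Phi> where "\<Phi> v t = (T (max t 0) x + conv (unw v) (max t 0)) /\<^sub>R wt (max t 0)" for v t
  define S where "S = {v :: real \<Rightarrow>\<^sub>C 'x. \<forall>t. apply_bcontfun v t \<in> H}"
  have unwc: "continuous_on {0..} (unw v)" for v unfolding unw_def by (intro continuous_intros wtc) auto
  have unwH: "unw v t \<in> H" if "v \<in> S" for v t using that sub by (auto simp: S_def unw_def subspace_scale)
  have small: "norm (conv u t /\<^sub>R wt t) <= m / 2"
    if "continuous_on {0..} u" "!!t. t >= 0 ==> u t \<in> H" "t >= 0" "m >= 0" "!!r. 0 <= r ==> norm (u r) <= m * wt r" for u t m
    using norm_conv_le[OF that(1-3), of m] that(4,5) by (simp add: wt_def divide_simps)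
  have T1: "norm (T t x /\<^sub>R wt t) <= norm x" if "t >= 0" for t
  proof -
    have "norm (T t x) <= norm x * wt t"
      using contr[OF that x] that K mult_left_mono[of 1 "wt t" "norm x"] by (simp add: wt_def)
    then show ?thesis using wt(1)[of t] by (simp add: divide_simps)
  qed
  have nunw: "norm (unw v r) <= norm v * wt r" for v r
    using norm_bounded[of v r] wt(1)[of r] by (simp add: unw_def mult.commute mult_left_mono)
  have \<Phi>b: "\<Phi> v \<in> bcontfun" if v: "v \<in> S" for v
    unfolding bcontfun_def
  proof (intro CollectI conjI)
    have "continuous_on {0..} (%t. (T t x + conv (unw v) t) /\<^sub>R wt t)"
      using wt by (intro continuous_intros csg_continuous[OF T x] conv_continuous unwc unwH v wtc) (auto simp: less_imp_neq[THEN not_sym])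
    then show "continuous_on UNIV (\<Phi> v)" unfolding \<Phi>_def
      by (rule continuous_on_compose2) (auto intro!: continuous_intros)
    have "norm (\<Phi> v t) <= norm x + norm v / 2" for t
    proof -
      have "norm (\<Phi> v t) <= norm (T (max t 0) x /\<^sub>R wt (max t 0)) + norm (conv (unw v) (max t 0) /\<^sub>R wt (max t 0))"
        unfolding \<Phi>_def scaleR_add_right by (rule norm_triangle_ineq)
      also have "... <= norm x + norm v / 2"
        by (intro add_mono T1 small unwc unwH v nunw) auto
      finally show ?thesis .
    qed
    then show "bounded (range (\<Phi> v))" by (auto simp: bounded_iff)
  qed
  define F where "F v = Bcontfun (\<Phi> v)" for v
  have appF: "apply_bcontfun (F v) = \<Phi> v" if "v \<in> S" for v using \<Phi>b[OF that] by (simp add: F_def Bcontfun_inverse)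
  have "\<exists>!v\<in>S. F v = v"
  proof (rule Banach_fix[where c = "1/2"])
    have "closed S" unfolding S_def
    proof (rule closed_Collect_all)
      fix t
      have "continuous_on UNIV (%v::real \<Rightarrow>\<^sub>C 'x. apply_bcontfun v t)"
        by (rule lipschitz_on_continuous_on[where L = 1]) (auto simp: lipschitz_on_def dist_bounded)
      then show "closed {v :: real \<Rightarrow>\<^sub>C 'x. apply_bcontfun v t \<in> H}"
        using continuous_closed_vimage[OF cl, of "%v. apply_bcontfun v t"] by (simp add: vimage_def continuous_on_eq_continuous_at)
    qed
    then show "complete S" by (simp add: complete_eq_closed)
    show "S ~= {}" using subspace_0[OF sub] by (auto simp: S_def intro!: exI[of _ 0])
    show "F ` S \<subseteq> S"
    proof clarify
      fix v assume v: "v \<in> S"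
      have "\<Phi> v t \<in> H" for t
      proof -
        have t: "max t 0 >= 0" by simp
        show ?thesis unfolding \<Phi>_def
          by (intro subspace_scale[OF sub] subspace_add[OF sub] TH[OF t x] conv_mem[OF unwc unwH[OF v] t])
      qed
      then show "F v \<in> S" by (simp add: S_def appF[OF v])
    qed
    fix v w assume v: "v \<in> S" and w: "w \<in> S"
    show "dist (F v) (F w) <= 1 / 2 * dist v w"
    proof (rule dist_bound)
      fix t :: real
      define s where "s = max t 0"
      have s: "s >= 0" by (simp add: s_def)
      have "\<Phi> v t - \<Phi> w t = (conv (unw v) s - conv (unw w) s) /\<^sub>R wt s"
        by (simp add: \<Phi>_def s_def scaleR_diff_right scaleR_add_right)
      also have "conv (unw v) s - conv (unw w) s = conv (%r. 1 *\<^sub>R unw v r + (-1) *\<^sub>R unw w r) s"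
        by (subst conv_lincomb[OF unwc unwH[OF v] unwc unwH[OF w] s]) simp
      also have "norm (... /\<^sub>R wt s) <= dist v w / 2"
      proof (rule small[OF _ _ s])
        show "continuous_on {0..} (%r. 1 *\<^sub>R unw v r + (-1) *\<^sub>R unw w r)" by (intro continuous_intros unwc)
        show "1 *\<^sub>R unw v r + (-1) *\<^sub>R unw w r \<in> H" for r
          using unwH v w sub by (simp add: subspace_diff)
        fix r :: real assume "0 <= r"
        have "norm (unw v r - unw w r) = wt r * dist (apply_bcontfun v r) (apply_bcontfun w r)"
          using wt(1)[of r] by (simp add: unw_def dist_norm flip: scaleR_diff_right)
        also have "... <= wt r * dist v w" using wt(1)[of r] by (intro mult_left_mono dist_bounded) auto
        finally show "norm (1 *\<^sub>R unw v r + (-1) *\<^sub>R unw w r) <= dist v w * wt r" by (simp add: mult.commute)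
      qed simp
      finally show "dist (apply_bcontfun (F v) t) (apply_bcontfun (F w) t) <= 1 / 2 * dist v w"
        by (simp add: appF v w dist_norm)
    qed
  qed auto
  then obtain v where v: "v \<in> S" "F v = v" by blast
  have "mild x (unw v)" unfolding mild_def
  proof (intro conjI allI impI)
    fix t :: real assume t: "t >= 0"
    have "apply_bcontfun v t = \<Phi> v t" using appF[OF v(1)] v(2) by simp
    then show "unw v t = T t x + conv (unw v) t" using t wt(1)[of t] by (simp add: unw_def \<Phi>_def)
  qed (use unwc unwH v in auto)
  then show ?thesis by blast
qed

definition U :: "real => 'x => 'x" where "U t x = (SOME u. mild x u) t"

lemma U_mild: "x \<in> H ==> mild x (%t. U t x)"
  unfolding U_def using someI_ex[OF mild_exists] by simp

lemma U_eqI: "mild x u ==> x \<in> H ==> t >= 0 ==> U t x = u t"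
  using mild_unique[OF U_mild] by blast

lemma U_props:
  assumes "x \<in> H"
  shows "continuous_on {0..} (%t. U t x)" "!!t. t >= 0 ==> U t x \<in> H" "!!t. t >= 0 ==> U t x = T t x + conv (%t. U t x) t"
    "!!t. t >= 0 ==> norm (U t x) <= 2 * exp (2 * K * t) * norm x"
  using U_mild[OF assms] mild_bound[OF U_mild[OF assms] assms] by (auto simp: mild_def)

text \<open>R applied to the mild solution from x is a mild solution from R x, so uniqueness
  applies. The Banach space is a real one; with R the multiplication by a complex scalar this
  restores complex linearity of the perturbed semigroup.\<close>

lemma U_commute:
  assumes R: "lin_on H R" and RT: "!!t x. t >= 0 ==> x \<in> H ==> T t (R x) = R (T t x)"
    and RB: "!!x. x \<in> H ==> B (R x) = R (B x)" and x: "x \<in> H" and t: "t >= 0"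
  shows "U t (R x) = R (U t x)"
proof (rule U_eqI[OF _ lin_onD(1)[OF R x] t, where u = "%t. R (U t x)"])
  note u = U_props[OF x]
  show "mild (R x) (%t. R (U t x))" unfolding mild_def
  proof (intro conjI allI impI)
    show "continuous_on {0..} (%t. R (U t x))"
      by (rule continuous_on_atLeast_0, rule integral_lin(1)[OF R])
        (auto intro: u continuous_on_subset[OF u(1)])
    fix t :: real assume t: "t >= 0"
    show "R (U t x) \<in> H" using lin_onD(1)[OF R u(2)[OF t]] .
    have "R (conv (%t. U t x) t) = conv (%t. R (U t x)) t"
      unfolding conv_def
      by (subst integral_lin(2)[OF R integrand_continuous[OF u(1,2)]])
        (auto intro!: integral_cong TH BH u(2) simp: RB RT[symmetric] BH u(2))
    then show "R (U t x) = T t (R x) + conv (%t. R (U t x)) t"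
      using u(3)[OF t] lin_onD(2)[OF R TH[OF t x] conv_mem[OF u(1,2) t]] t x RT by simp
  qed
qed

text \<open>For fixed t the function s -> U (s + t) x solves the mild equation with initial value U
  t x: the Duhamel integral over [0, s + t] is split at t, and its first part is T s applied to the
  Duhamel integral up to t.\<close>

lemma U_csg: "csg H U"
  unfolding csg_def
proof (intro conjI allI impI ballI)
  fix t :: real assume t: "t >= 0"
  have lc: "U t (a *\<^sub>R x + b *\<^sub>R y) = a *\<^sub>R U t x + b *\<^sub>R U t y" if "x \<in> H" "y \<in> H" for a b x y
    by (rule U_eqI[OF mild_lincomb[OF U_mild _ U_mild] _ t]) (use that sub in \<open>auto simp: subspace_add subspace_scale\<close>)
  show "lin_on H (U t)" unfolding lin_on_def
  proof (intro conjI ballI allI)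
    show "U t (x + y) = U t x + U t y" if "x \<in> H" "y \<in> H" for x y using lc[of x y 1 1] that by simp
    show "U t (c *\<^sub>R x) = c *\<^sub>R U t x" if "x \<in> H" for x c using lc[of x x c 0] that by simp
    show "\<exists>C. \<forall>x\<in>H. norm (U t x) <= C * norm x" using U_props(4) t by blast
  qed (use U_props t in auto)
next
  fix x assume x: "x \<in> H"
  show U0: "U 0 x = x" using U_props(3)[OF x, of 0] csgD(2)[OF T x] by (simp add: conv_def)
  have "((%t. U t x) \<longlongrightarrow> U 0 x) (at 0 within {0..})"
    using U_props(1)[OF x] by (simp add: continuous_on_def)
  then show "((%t. U t x) \<longlongrightarrow> x) (at_right 0)" unfolding U0 by (rule tendsto_within_subset) auto
next
  fix s t :: real and x assume s: "s >= 0" and t: "t >= 0" and x: "x \<in> H"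
  note u = U_props[OF x]
  show "U (s + t) x = U s (U t x)"
  proof (rule U_eqI[symmetric, OF _ u(2)[OF t] s, where u = "%s. U (s + t) x"])
    show "mild (U t x) (%s. U (s + t) x)" unfolding mild_def
    proof (intro conjI allI impI)
      show "continuous_on {0..} (%s. U (s + t) x)"
        by (rule continuous_on_compose2[OF u(1)]) (use t in \<open>auto intro!: continuous_intros\<close>)
      fix s :: real assume s: "s >= 0"
      show "U (s + t) x \<in> H" using u(2) s t by simp
      define g where "g r = T (s + t - r) (B (U r x))" for r
      have gc: "continuous_on {0..s+t} g" unfolding g_def by (rule integrand_continuous[OF u(1,2)]) auto
      have "conv (%t. U t x) (s + t) = integral {0..t} g + integral {t..s+t} g"
        unfolding conv_def g_def[symmetric]
        by (rule Henstock_Kurzweil_Integration.integral_combine[symmetric])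
          (use s t gc in \<open>auto intro: integrable_continuous_real\<close>)
      also have "integral {0..t} g = integral {0..t} (%r. T s (T (t - r) (B (U r x))))"
      proof (rule integral_cong)
        fix r assume "r \<in> {0..t}"
        then show "g r = T s (T (t - r) (B (U r x)))"
          using csgD(3)[OF T s, of "t - r" "B (U r x)"] BH u(2) by (simp add: g_def add_diff_eq)
      qed
      also have "... = T s (conv (%t. U t x) t)" unfolding conv_def
        by (rule integral_lin(2)[symmetric, OF csgD(1)[OF T s] integrand_continuous[OF u(1,2)]]) (auto intro!: TH BH u)
      also have "integral {t..s+t} g = conv (%s. U (s + t) x) s"
      proof -
        have "continuous_on {0 + t..s + t} g" by (rule continuous_on_subset[OF gc]) (use t in auto)
        from integrable_integral[OF integrable_continuous_real[OF this]]
        have "((g \<circ> (+) t) has_integral integral {t..s+t} g) {0..s}"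
          unfolding has_integral_shift_Icc_real by simp
        then show ?thesis by (simp add: conv_def g_def o_def integral_unique add.commute)
      qed
      finally have "conv (%t. U t x) (s + t) = T s (conv (%t. U t x) t) + conv (%s. U (s + t) x) s" .
      then show "U (s + t) x = T s (U t x) + conv (%s. U (s + t) x) s"
        using u(3)[of "s + t"] u(3)[OF t] s t csgD(3)[OF T s t x] csgD(7)[OF T s TH[OF t x] conv_mem[OF u(1,2) t]]
        by simp
    qed
  qed
qed

lemma conv_average:
  assumes u: "continuous_on {0..} u" "!!t. t >= 0 ==> u t \<in> H"
  shows "((%s. conv u s /\<^sub>R s) \<longlongrightarrow> B (u 0)) (at_right 0)"
  unfolding tendsto_iff
proof (intro allI impI)
  fix e :: real assume e: "e > 0"
  have "continuous_on {0..1::real} (%r. B (u r))"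
    by (intro continuous_B continuous_on_subset[OF u(1)] u) auto
  then obtain d1 where d1: "d1 > 0" "!!r. r \<in> {0..1} ==> dist r 0 < d1 ==> dist (B (u r)) (B (u 0)) < e / 4"
    by (rule continuous_on_obtain[where a = 0 and e = "e / 4"]) (use e in auto)
  have "continuous_on {0..} (%t. T t (B (u 0)))" using csg_continuous[OF T BH] u by simp
  then obtain d2 where d2: "d2 > 0" "!!r. r \<in> {0..} ==> dist r 0 < d2 ==> dist (T r (B (u 0))) (T 0 (B (u 0))) < e / 4"
    by (rule continuous_on_obtain[where a = 0 and e = "e / 4"]) (use e in auto)
  have "\<forall>\<^sub>F s in at_right (0::real). s < min (min d1 d2) 1 \<and> 0 < s"
    using d1 d2 by (intro eventually_conj eventually_at_right_less order_tendstoD(2)[OF tendsto_ident_at]) auto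
  then show "\<forall>\<^sub>F s in at_right 0. dist (conv u s /\<^sub>R s) (B (u 0)) < e"
  proof eventually_elim
    case (elim s)
    have "norm (conv u s - (s - 0) *\<^sub>R B (u 0)) <= e / 2 * (s - 0)" unfolding conv_def
    proof (rule integral_near_constant)
      show "continuous_on {0..s} (%r. T (s - r) (B (u r)))" by (rule integrand_continuous[OF u]) auto
      fix r assume r: "r \<in> {0..s}"
      have m: "B (u r) \<in> H" "B (u 0) \<in> H" using u(2) BH r by auto
      have "norm (T (s - r) (B (u r)) - T (s - r) (B (u 0))) <= norm (B (u r) - B (u 0))"
        using csgD(6)[OF T _ m, of "s - r"] contr[of "s - r" "B (u r) - B (u 0)"] subspace_diff[OF sub m] r by simp
      also have "... <= e / 4" using d1(2)[of r] r elim by (auto simp: dist_norm)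
      finally have 1: "norm (T (s - r) (B (u r)) - T (s - r) (B (u 0))) <= e / 4" .
      have 2: "norm (T (s - r) (B (u 0)) - B (u 0)) <= e / 4"
        using d2(2)[of "s - r"] r elim csgD(2)[OF T m(2)] by (auto simp: dist_norm)
      have "T (s - r) (B (u r)) - B (u 0) = (T (s - r) (B (u r)) - T (s - r) (B (u 0))) + (T (s - r) (B (u 0)) - B (u 0))" by simp
      then have "norm (T (s - r) (B (u r)) - B (u 0)) <= e / 4 + e / 4"
        using norm_triangle_mono[OF 1 2] by simp
      then show "norm (T (s - r) (B (u r)) - B (u 0)) <= e / 2" by simp
    qed (use elim in auto)
    moreover have "conv u s /\<^sub>R s - B (u 0) = (conv u s - s *\<^sub>R B (u 0)) /\<^sub>R s"
      using elim by (simp add: algebra_simps)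
    ultimately have "norm (conv u s /\<^sub>R s - B (u 0)) <= e / 2"
      using elim by (simp only: norm_scaleR) (simp add: divide_simps)
    then show ?case using e by (simp add: dist_norm)
  qed
qed

text \<open>The difference quotients of U and T at x differ by \<open>conv\<close> / s, which tends
  to B x for every x in \<open>H\<close> by \<open>conv_average\<close>; so the two limits exist for
  the same x.\<close>

lemma U_gen: "gen H U = {(x, y + B x) | x y. (x, y) \<in> gen H T}"
proof -
  have key: "((%s. (U s x - x) /\<^sub>R s - (T s x - x) /\<^sub>R s) \<longlongrightarrow> B x) (at_right 0)" if x: "x \<in> H" for x
  proof (rule Lim_transform_eventually)
    show "((%s. conv (%t. U t x) s /\<^sub>R s) \<longlongrightarrow> B x) (at_right 0)"
      using conv_average[OF U_props(1,2)[OF x]] csgD(2)[OF U_csg x] by simp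
    show "\<forall>\<^sub>F s in at_right 0. conv (%t. U t x) s /\<^sub>R s = (U s x - x) /\<^sub>R s - (T s x - x) /\<^sub>R s"
      by (rule eventually_mono[OF eventually_at_right_less[of 0]])
        (simp add: U_props(3)[OF x] scaleR_add_right scaleR_diff_right)
  qed
  have 1: "(x, z) \<in> gen H U \<longleftrightarrow> (x, z - B x) \<in> gen H T" for x z
  proof (cases "x \<in> H")
    case x: True
    have "z \<in> H \<longleftrightarrow> z - B x \<in> H" using BH[OF x] sub by (metis diff_add_cancel subspace_add subspace_diff)
    moreover have "((%s. (U s x - x) /\<^sub>R s) \<longlongrightarrow> z) (at_right 0) \<longleftrightarrow> ((%s. (T s x - x) /\<^sub>R s) \<longlongrightarrow> z - B x) (at_right 0)"
    proof
      assume "((%s. (U s x - x) /\<^sub>R s) \<longlongrightarrow> z) (at_right 0)"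
      from tendsto_diff[OF this key[OF x]] show "((%s. (T s x - x) /\<^sub>R s) \<longlongrightarrow> z - B x) (at_right 0)" by simp
    next
      assume "((%s. (T s x - x) /\<^sub>R s) \<longlongrightarrow> z - B x) (at_right 0)"
      from tendsto_add[OF this key[OF x]] show "((%s. (U s x - x) /\<^sub>R s) \<longlongrightarrow> z) (at_right 0)" by simp
    qed
    ultimately show ?thesis using x by (simp add: gen_def)
  qed (simp add: gen_def)
  show ?thesis
  proof (rule set_eqI, clarify)
    fix x z
    have "(x, z) \<in> {(x, y + B x) | x y. (x, y) \<in> gen H T} \<longleftrightarrow> (x, z - B x) \<in> gen H T"
      by (auto simp: algebra_simps intro: exI[of _ "z - B x"])
    then show "(x, z) \<in> gen H U \<longleftrightarrow> (x, z) \<in> {(x, y + B x) | x y. (x, y) \<in> gen H T}" using 1 by simp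
  qed
qed

text \<open>Uniform continuity on a compact rectangle; it makes the consistency error below uniform
  along an orbit.\<close>

lemma csg_uniform_small:
  fixes f :: "real => 'x" and e b :: real
  assumes f: "continuous_on {0..b} f" "!!r. r \<in> {0..b} ==> f r \<in> H" and e: "e > 0" and S: "csg H S"
  shows "\<exists>d>0. \<forall>s r. 0 <= s \<and> s < d \<and> 0 <= r \<and> r <= b \<longrightarrow> norm (S s (f r) - f r) < e"
proof -
  have "continuous_on ({0..1} \<times> {0..b}) (%z. S (fst z) (f (snd z)))"
    by (rule csg_continuous_comp[OF S, where b = 1])
      (auto intro!: continuous_intros continuous_on_compose2[OF f(1)] f(2) simp: mem_Times_iff)
  then have "uniformly_continuous_on ({0..1} \<times> {0..b}) (%z. S (fst z) (f (snd z)))"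
    by (rule compact_uniformly_continuous) (auto intro: compact_Times)
  then obtain d where d: "d > 0" "!!z z'. z \<in> {0..1} \<times> {0..b} ==> z' \<in> {0..1} \<times> {0..b} ==> dist z' z < d ==>
      dist (S (fst z') (f (snd z'))) (S (fst z) (f (snd z))) < e"
    using e unfolding uniformly_continuous_on_def by blast
  show ?thesis
  proof (intro exI[of _ "min d 1"] conjI allI impI)
    fix s r assume sr: "0 <= s \<and> s < min d 1 \<and> 0 <= r \<and> r <= b"
    then show "norm (S s (f r) - f r) < e"
      using d(2)[of "(0, r)" "(s, r)"] csgD(2)[OF S f(2), of r] by (simp add: dist_norm norm_Pair)
  qed (use d in simp)
qed

text \<open>Stability and consistency. By \<open>FT\<close>, F s agrees with T s + (s/2) (B T s + T
  s B) up to c s^2, hence with U s up to o(s), uniformly along the orbit of x up to time t. Each of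
  the n steps of length t/n adds one such error, amplified by at most exp(c t).\<close>

theorem Trotter:
  fixes F :: "real => 'x => 'x"
  assumes FL: "!!s. s >= 0 ==> lin_on H (F s)"
    and Fb: "!!s x. s >= 0 ==> x \<in> H ==> norm (F s x) <= exp (c * s) * norm x"
    and FT: "!!s x. 0 <= s ==> s <= 1 ==> x \<in> H ==>
      norm (F s x - T s x - (s / 2) *\<^sub>R (B (T s x) + T s (B x))) <= c * s^2 * norm x"
    and c: "c >= 0" and x: "x \<in> H" and t: "t >= 0"
  shows "(%n. (F (t / real n) ^^ n) x) \<longlonglongrightarrow> U t x"
proof -
  note u = U_props[OF x]
  define M where "M = 2 * exp (2 * K * t) * norm x"
  have M: "norm (U r x) <= M" if "0 <= r" "r <= t" for r
  proof -
    have "norm (U r x) <= 2 * exp (2 * K * r) * norm x" using u(4) that by simp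
    also have "... <= M" unfolding M_def using that K by (intro mult_right_mono mult_left_mono) auto
    finally show ?thesis .
  qed
  have M0: "M >= 0" by (simp add: M_def)
  have local: "\<exists>d>0. \<forall>s r. 0 <= s \<and> s < d \<and> 0 <= r \<and> r <= t \<longrightarrow> norm (U s (U r x) - F s (U r x)) <= s * e" if e: "e > 0" for e
  proof -
    define e' where "e' = e / (4 * (K + 1))"
    have e': "e' > 0" using e K by (simp add: e'_def)
    have cU: "continuous_on {0..t} (%r. U r x)" by (rule continuous_on_subset[OF u(1)]) auto
    have cB: "continuous_on {0..t} (%r. B (U r x))" by (rule continuous_B[OF cU]) (use u(2) in auto)
    obtain d1 where d1: "d1 > 0" "!!s r. 0 <= s ==> s < d1 ==> 0 <= r ==> r <= t ==> norm (U s (U r x) - U r x) < e'"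
      using csg_uniform_small[OF cU _ e' U_csg] u(2) by fastforce
    obtain d2 where d2: "d2 > 0" "!!s r. 0 <= s ==> s < d2 ==> 0 <= r ==> r <= t ==> norm (T s (U r x) - U r x) < e'"
      using csg_uniform_small[OF cU _ e' T] u(2) by fastforce
    obtain d3 where d3: "d3 > 0" "!!s r. 0 <= s ==> s < d3 ==> 0 <= r ==> r <= t ==> norm (T s (B (U r x)) - B (U r x)) < e'"
      using csg_uniform_small[OF cB _ e' T] u(2) BH by fastforce
    define d4 where "d4 = e / (4 * (c * M + 1))"
    have d4: "d4 > 0" using e c M0 by (simp add: d4_def add_nonneg_pos)
    show ?thesis
    proof (intro exI[of _ "min (min (min d1 d2) (min d3 d4)) 1"] conjI allI impI)
      fix s r assume "0 <= s \<and> s < min (min (min d1 d2) (min d3 d4)) 1 \<and> 0 <= r \<and> r <= t"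
      then have s: "0 <= s" "s < d1" "s < d2" "s < d3" "s < d4" "s <= 1" and r: "0 <= r" "r <= t" by auto
      define y where "y = U r x"
      have yH: "y \<in> H" using u(2) r by (simp add: y_def)
      note v = U_props[OF yH]
      have i1: "norm (conv (%t. U t y) s - (s - 0) *\<^sub>R B y) <= ((K + 1) * e') * (s - 0)" unfolding conv_def
      proof (rule integral_near_constant)
        show "continuous_on {0..s} (%r. T (s - r) (B (U r y)))" by (rule integrand_continuous[OF v(1,2)]) auto
        fix q assume q: "q \<in> {0..s}"
        have m: "B (U q y) \<in> H" "B y \<in> H" "U q y \<in> H" using v(2) BH q yH by auto
        have "norm (T (s - q) (B (U q y)) - T (s - q) (B y)) <= norm (B (U q y) - B y)"
          using csgD(6)[OF T _ m(1,2), of "s - q"] contr[of "s - q" "B (U q y) - B y"] subspace_diff[OF sub m(1,2)] q by simp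
        also have "... <= K * norm (U q y - y)"
          using lin_onD(4)[OF B m(3) yH] K(2)[OF subspace_diff[OF sub m(3) yH]] by simp
        also have "... <= K * e'" using d1(2)[of q r] q r s K by (intro mult_left_mono) (auto simp: y_def)
        finally have 1: "norm (T (s - q) (B (U q y)) - T (s - q) (B y)) <= K * e'" .
        have 2: "norm (T (s - q) (B y) - B y) <= e'" using d3(2)[of "s - q" r] q r s by (auto simp: y_def)
        show "norm (T (s - q) (B (U q y)) - B y) <= (K + 1) * e'"
          using norm_triangle_mono[OF 1 2] by (simp add: algebra_simps)
      qed (use s in auto)
      have TsH: "T s y \<in> H" using TH s yH by simp
      have "norm (B (T s y) - B y) <= K * norm (T s y - y)"
        using lin_onD(4)[OF B TsH yH] K(2)[OF subspace_diff[OF sub TsH yH]] by simp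
      also have "... <= K * e'" using d2(2)[of s r] r s K by (intro mult_left_mono) (auto simp: y_def)
      finally have 3: "norm (B (T s y) - B y) <= K * e'" .
      have 4: "norm (T s (B y) - B y) <= e'" using d3(2)[of s r] r s by (auto simp: y_def)
      have "s *\<^sub>R B y = (s / 2) *\<^sub>R (B y + B y)" by (simp flip: scaleR_add_left add: scaleR_add_right)
      then have e2: "(s / 2) *\<^sub>R (B (T s y) + T s (B y)) - s *\<^sub>R B y = (s / 2) *\<^sub>R ((B (T s y) - B y) + (T s (B y) - B y))"
        by (simp add: scaleR_add_right scaleR_diff_right)
      have "norm ((B (T s y) - B y) + (T s (B y) - B y)) <= (K + 1) * e'"
        using norm_triangle_mono[OF 3 4] by (simp add: algebra_simps)
      then have "(s / 2) * norm ((B (T s y) - B y) + (T s (B y) - B y)) <= (s / 2) * ((K + 1) * e')"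
        using s by (intro mult_left_mono) auto
      then have i2: "norm ((s / 2) *\<^sub>R (B (T s y) + T s (B y)) - s *\<^sub>R B y) <= (s / 2) * ((K + 1) * e')"
        unfolding e2 norm_scaleR using s by simp
      have i3: "norm (F s y - T s y - (s / 2) *\<^sub>R (B (T s y) + T s (B y))) <= s * (e / 4)"
      proof -
        have "norm (F s y - T s y - (s / 2) *\<^sub>R (B (T s y) + T s (B y))) <= c * s^2 * norm y"
          using FT[of s y] s yH by simp
        also have "... <= c * s^2 * M" using M[OF r] c by (intro mult_left_mono) (auto simp: y_def)
        also have "... = s * (s * (c * M))" by (simp add: power2_eq_square)
        also have "... <= s * (e / 4)"
        proof (intro mult_left_mono)
          have "s * (c * M) <= s * (c * M + 1)" using s by (intro mult_left_mono) auto
          also have "... <= d4 * (c * M + 1)" using s c M0 by (intro mult_right_mono) auto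
          also have "... = e / 4"
          proof -
            have "c * M + 1 > 0" using c M0 by (simp add: add_nonneg_pos)
            then show ?thesis by (simp add: d4_def divide_simps)
          qed
          finally show "s * (c * M) <= e / 4" .
        qed (use s in auto)
        finally show ?thesis .
      qed
      have eq: "U s y - F s y = (conv (%t. U t y) s - (s - 0) *\<^sub>R B y) - ((s / 2) *\<^sub>R (B (T s y) + T s (B y)) - s *\<^sub>R B y)
          - (F s y - T s y - (s / 2) *\<^sub>R (B (T s y) + T s (B y)))"
        using v(3)[OF s(1)] by simp
      have "norm (U s y - F s y) <= ((K + 1) * e') * (s - 0) + (s / 2) * ((K + 1) * e') + s * (e / 4)"
        unfolding eq
        by (rule order_trans[OF norm_triangle_ineq4 add_mono[OF order_trans[OF norm_triangle_ineq4 add_mono[OF i1 i2]] i3]])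
      also have "(K + 1) * e' = e / 4" using K(1) by (simp add: e'_def divide_simps)
      also have "e / 4 * (s - 0) + s / 2 * (e / 4) + s * (e / 4) <= s * e" using s e by (simp add: algebra_simps)
      finally show "norm (U s (U r x) - F s (U r x)) <= s * e" unfolding y_def .
    qed (use d1 d2 d3 d4 in auto)
  qed
  have Fpow: "norm ((F s ^^ k) y) <= exp (c * s) ^ k * norm y \<and> (F s ^^ k) y \<in> H" if "s >= 0" "y \<in> H" for s k y
  proof (induction k)
    case (Suc k)
    have "norm (F s ((F s ^^ k) y)) <= exp (c * s) * norm ((F s ^^ k) y)" using Fb Suc that by blast
    also have "... <= exp (c * s) * (exp (c * s) ^ k * norm y)" using Suc by (intro mult_left_mono) auto
    finally show ?case using Suc lin_onD(1)[OF FL] that by (simp add: ac_simps)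
  qed (use that in simp)
  have Fpowd: "(F s ^^ k) (y - z) = (F s ^^ k) y - (F s ^^ k) z" if "s >= 0" "y \<in> H" "z \<in> H" for s k y z
    by (induction k) (use that lin_onD(4)[OF FL] Fpow in auto)
  show ?thesis unfolding LIMSEQ_iff
  proof (intro allI impI)
    fix e :: real assume e: "e > 0"
    define e' where "e' = e / (2 * (exp (c * t) * (t + 1)))"
    have e': "e' > 0" using e t by (simp add: e'_def)
    obtain d where d: "d > 0" "!!s r. 0 <= s ==> s < d ==> 0 <= r ==> r <= t ==> norm (U s (U r x) - F s (U r x)) <= s * e'"
      using local[OF e'] by blast
    obtain N :: nat where N: "real N > t / d" "N > 0"
      using reals_Archimedean2[of "max (t / d) 0"] by auto
    show "\<exists>no. \<forall>n\<ge>no. norm ((F (t / real n) ^^ n) x - U t x) < e"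
    proof (intro exI[of _ N] allI impI)
      fix n assume n: "n >= N"
      define s where "s = t / real n"
      have n0: "n > 0" using n N by simp
      have s0: "s >= 0" using t by (simp add: s_def)
      have "t / d < real n" using n N by (meson less_le_trans of_nat_le_iff)
      then have sd: "s < d" using d n0 by (simp add: s_def field_simps)
      have ns: "real n * s = t" using n0 by (simp add: s_def)
      have step: "norm ((F s ^^ k) x - U (real k * s) x) <= real k * (exp (c * s) ^ k * (s * e'))" if "k <= n" for k
        using that
      proof (induction k)
        case 0
        then show ?case using csgD(2)[OF U_csg x] by simp
      next
        case (Suc k)
        have "real (Suc k) * s <= real n * s" using Suc s0 by (intro mult_right_mono) auto
        then have ks: "real k * s <= t" "0 <= real k * s"
          using s0 ns by (auto simp: algebra_simps)
        define y where "y = U (real k * s) x"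
        have yH: "y \<in> H" unfolding y_def using u(2) ks by simp
        define z where "z = (F s ^^ k) x"
        have zH: "z \<in> H" using Fpow[OF s0 x] by (simp add: z_def)
        have Uy: "U (real (Suc k) * s) x = U s y" unfolding y_def
          using csgD(3)[OF U_csg s0 ks(2) x] by (simp add: algebra_simps)
        have "(F s ^^ Suc k) x - U (real (Suc k) * s) x = F s (z - y) - (U s y - F s y)"
          unfolding Uy using lin_onD(4)[OF FL[OF s0] zH yH] by (simp add: z_def)
        also have "norm ... <= exp (c * s) * norm (z - y) + s * e'"
          by (rule order_trans[OF norm_triangle_ineq4 add_mono[OF Fb[OF s0 subspace_diff[OF sub zH yH]]]])
            (use d(2)[OF s0 sd ks(2,1)] in \<open>simp add: y_def\<close>)
        also have "... <= exp (c * s) * (real k * (exp (c * s) ^ k * (s * e'))) + exp (c * s) ^ Suc k * (s * e')"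
        proof (intro add_mono mult_left_mono)
          show "norm (z - y) <= real k * (exp (c * s) ^ k * (s * e'))" using Suc by (simp add: z_def y_def)
          have "1 <= exp (c * s) ^ Suc k" using c s0 by (intro one_le_power) simp
          then have "1 * (s * e') <= exp (c * s) ^ Suc k * (s * e')" using s0 e' by (intro mult_right_mono) auto
          then show "s * e' <= exp (c * s) ^ Suc k * (s * e')" by simp
        qed auto
        finally show ?case by (simp add: algebra_simps)
      qed
      have "exp (c * s) ^ n = exp (c * t)" using ns by (simp add: exp_of_nat_mult[symmetric] mult.left_commute)
      then have "norm ((F s ^^ n) x - U t x) <= real n * (exp (c * t) * (s * e'))" using step[of n] ns by simp
      also have "... = t * exp (c * t) * e'" using ns by (simp add: ac_simps)
      also have "... = (t / (t + 1)) * (e / 2)" using t by (simp add: e'_def divide_simps)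
      also have "... <= 1 * (e / 2)" using e t by (intro mult_right_mono) auto
      also have "... < e" using e by simp
      finally show "norm ((F (t / real n) ^^ n) x - U t x) < e" by (simp add: s_def)
    qed
  qed
qed

end

section \<open>Geometric means as infima of linear combinations\<close>

lemma le_weighted_am_gm:
  fixes b c z l :: real
  assumes "0 < l" "l < 1" "0 <= b" "0 <= c" "0 < z"
  shows "b powr (1 - l) * c powr l <= (1 - l) * z powr l * b + l * z powr (l - 1) * c"
proof (cases "b = 0 \<or> c = 0")
  case False
  then have bc: "b > 0" "c > 0" using assms by auto
  \<comment> \<open>Young's inequality for z^l b and z^(l-1) c: the powers of z cancel on the
    left.\<close>
  have "(z powr l * b) powr (1 - l) * (z powr (l - 1) * c) powr l <= (1 - l) * (z powr l * b) + l * (z powr (l - 1) * c)"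
    using assms bc by (intro Youngs_inequality_0) auto
  moreover have "(z powr l * b) powr (1 - l) * (z powr (l - 1) * c) powr l
      = z powr (l * (1 - l)) * z powr ((l - 1) * l) * (b powr (1 - l) * c powr l)"
    using bc assms by (simp add: powr_mult powr_powr ac_simps)
  moreover have "z powr (l * (1 - l)) * z powr ((l - 1) * l) = 1"
    using assms by (simp flip: powr_add add: algebra_simps)
  ultimately show ?thesis by (simp add: ac_simps)
qed (use assms in auto)

text \<open>Only rational \<open>z\<close> are needed, so that the hypothesis may hold almost everywhere for each \<open>z\<close>.\<close>

lemma weighted_am_gm_optimal:
  fixes a b c l :: real
  assumes l: "0 < l" "l < 1" and bc: "0 <= b" "0 <= c"
    and le: "!!z. z \<in> \<rat> ==> 0 < z ==> a <= (1 - l) * z powr l * b + l * z powr (l - 1) * c"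
  shows "a <= b powr (1 - l) * c powr l"
proof -
  have le': "a <= (1 - l) * z powr l * b + l * z powr (l - 1) * c" if z: "z > 0" for z
  proof (rule ccontr)
    assume n: "\<not> a <= (1 - l) * z powr l * b + l * z powr (l - 1) * c"
    have "((%y. (1 - l) * y powr l * b + l * y powr (l - 1) * c) \<longlongrightarrow> (1 - l) * z powr l * b + l * z powr (l - 1) * c) (at z)"
      using z by (intro tendsto_intros) auto
    then have "\<forall>\<^sub>F y in at z. (1 - l) * y powr l * b + l * y powr (l - 1) * c < a"
      using n by (intro order_tendstoD(2)) auto
    moreover have "\<forall>\<^sub>F y in at z. y > 0" using z by (intro order_tendstoD(1)[OF tendsto_ident_at]) auto
    ultimately have "\<forall>\<^sub>F y in at z. (1 - l) * y powr l * b + l * y powr (l - 1) * c < a \<and> y > 0"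
      by (rule eventually_conj)
    then obtain d where d: "d > 0" "!!y. y ~= z ==> dist y z < d ==> (1 - l) * y powr l * b + l * y powr (l - 1) * c < a \<and> y > 0"
      unfolding eventually_at by auto
    obtain q where q: "q \<in> \<rat>" "z < q" "q < z + d" using Rats_dense_in_real[of z "z + d"] d by auto
    then show False using d(2)[of q] le[of q] by (auto simp: dist_real_def)
  qed
  \<comment> \<open>After a shift by e > 0 the minimiser z = (c + e) / (b + e) exists even when b or
    c vanishes.\<close>
  have e: "a <= (b + e) powr (1 - l) * (c + e) powr l" if e: "e > 0" for e
  proof -
    define B C where "B = b + e" and "C = c + e"
    have BC: "B > 0" "C > 0" using e bc by (auto simp: B_def C_def)
    have "a <= (1 - l) * (C / B) powr l * b + l * (C / B) powr (l - 1) * c" using BC by (intro le') auto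
    also have "... <= (1 - l) * (C / B) powr l * B + l * (C / B) powr (l - 1) * C"
      using l e by (intro add_mono mult_left_mono) (auto simp: B_def C_def)
    also have "... = (1 - l) * ((C / B) powr l * B) + l * ((C / B) powr (l - 1) * C)" by simp
    also have "(C / B) powr l * B = B powr (1 - l) * C powr l"
      using BC by (simp add: powr_divide powr_diff)
    also have "(C / B) powr (l - 1) * C = B powr (1 - l) * C powr l"
      using BC by (simp add: powr_divide powr_diff)
    finally show ?thesis by (simp add: B_def C_def algebra_simps)
  qed
  have "((%e. (b + e) powr (1 - l) * (c + e) powr l) \<longlongrightarrow> (b + 0) powr (1 - l) * (c + 0) powr l) (at_right 0)"
    using l bc by (intro tendsto_mult tendsto_powr2 tendsto_intros)
      (auto intro!: eventually_mono[OF eventually_at_right_less[of "0::real"]])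
  then show ?thesis
    by (intro tendsto_lowerbound[where a = a and F = "at_right (0::real)", simplified])
      (auto intro!: eventually_mono[OF eventually_at_right_less[of "0::real"]] e)
qed

section \<open>The complex space \<open>L2\<close>\<close>

definition nrm :: "'a measure => ('a => complex) => real" where
  "nrm mu f = sqrt (\<integral>x. (cmod (f x))^2 \<partial>mu)"

lemma nrm_nonneg[simp]: "nrm mu f >= 0" by (simp add: nrm_def)

lemma L2_iff: "f \<in> L2 mu \<longleftrightarrow> f \<in> borel_measurable mu \<and> integrable mu (%x. (cmod (f x))^2)"
proof -
  have "Lp_norm mu 2 f < \<infinity> \<longleftrightarrow> (\<integral>\<^sup>+x. ennreal ((cmod (f x))^2) \<partial>mu) < \<infinity>"
    by (auto simp: Lp_norm_def ennreal_powr_def less_top powr_numeral)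
  then show ?thesis unfolding Lp_space_def by (auto simp: integrable_iff_bounded)
qed

lemma L2_borel: "f \<in> L2 mu ==> f \<in> borel_measurable mu" by (simp add: L2_iff)

lemma Lp_norm_2: "f \<in> L2 mu ==> Lp_norm mu 2 f = ennreal (nrm mu f)"
proof -
  assume "f \<in> L2 mu"
  then have "(\<integral>\<^sup>+x. ennreal ((cmod (f x))^2) \<partial>mu) = ennreal (\<integral>x. (cmod (f x))^2 \<partial>mu)"
    by (intro nn_integral_eq_integral) (auto simp: L2_iff)
  then show ?thesis by (simp add: Lp_norm_def ennreal_powr_def nrm_def powr_half_sqrt)
qed

lemma L2_lincomb: assumes f: "f \<in> L2 mu" and g: "g \<in> L2 mu" shows "(%x. a * f x + b * g x) \<in> L2 mu"
proof -
  have "integrable mu (%x. (cmod (a * f x + b * g x))^2)"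
  proof (rule Bochner_Integration.integrable_bound)
    show "integrable mu (%x. 2 * (cmod a)^2 * (cmod (f x))^2 + 2 * (cmod b)^2 * (cmod (g x))^2)"
      using f g by (auto simp: L2_iff)
    have "(cmod (a * f x + b * g x))^2 <= 2 * (cmod a)^2 * (cmod (f x))^2 + 2 * (cmod b)^2 * (cmod (g x))^2" for x
    proof -
      have "(cmod (a * f x + b * g x))^2 <= (cmod (a * f x) + cmod (b * g x))^2"
        by (intro power_mono norm_triangle_ineq) auto
      also have "... <= 2 * (cmod (a * f x))^2 + 2 * (cmod (b * g x))^2"
        using sum_squares_bound[of "cmod (a * f x)" "cmod (b * g x)"] by (simp add: power2_sum)
      finally show ?thesis by (simp add: norm_mult power_mult_distrib)
    qed
    then show "AE x in mu. norm ((cmod (a * f x + b * g x))^2) <= norm (2 * (cmod a)^2 * (cmod (f x))^2 + 2 * (cmod b)^2 * (cmod (g x))^2)"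
      by simp
    show "(%x. (cmod (a * f x + b * g x))^2) \<in> borel_measurable mu" using f g by (auto simp: L2_iff)
  qed
  then show ?thesis using f g by (auto simp: L2_iff)
qed

lemma L2_add: "f \<in> L2 mu ==> g \<in> L2 mu ==> (%x. f x + g x) \<in> L2 mu"
  and L2_diff: "f \<in> L2 mu ==> g \<in> L2 mu ==> (%x. f x - g x) \<in> L2 mu"
  and L2_scale: "f \<in> L2 mu ==> (%x. a * f x) \<in> L2 mu"
  and L2_0: "(%x. 0) \<in> L2 mu"
  using L2_lincomb[of f mu g 1 1] L2_lincomb[of f mu g 1 "-1"] L2_lincomb[of f mu f a 0] by (auto simp: L2_iff)

lemma L2_bounded_mult:
  assumes f: "f \<in> L2 mu" and m: "m \<in> borel_measurable mu" "!!x. \<bar>m x\<bar> <= C"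
  shows "(%x. cor (m x) * f x) \<in> L2 mu" "nrm mu (%x. cor (m x) * f x) <= C * nrm mu f"
proof -
  have C: "C >= 0" using m(2) abs_ge_zero order_trans by blast
  have le: "(cmod (cor (m x) * f x))^2 <= C^2 * (cmod (f x))^2" for x
    using power_mono[OF m(2), of x 2] by (simp add: norm_mult power_mult_distrib mult_right_mono)
  have i: "integrable mu (%x. C^2 * (cmod (f x))^2)" using f by (auto simp: L2_iff)
  have mm: "(%x. cor (m x) * f x) \<in> borel_measurable mu" using f m by (auto simp: L2_iff)
  have i': "integrable mu (%x. (cmod (cor (m x) * f x))^2)"
    by (rule Bochner_Integration.integrable_bound[OF i]) (use mm le in \<open>auto intro!: AE_I2\<close>)
  then show "(%x. cor (m x) * f x) \<in> L2 mu" using mm by (simp add: L2_iff)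
  have "(\<integral>x. (cmod (cor (m x) * f x))^2 \<partial>mu) <= (\<integral>x. C^2 * (cmod (f x))^2 \<partial>mu)"
    by (rule integral_mono[OF i' i le])
  then show "nrm mu (%x. cor (m x) * f x) <= C * nrm mu f"
    using C real_sqrt_le_mono by (fastforce simp: nrm_def real_sqrt_mult)
qed

definition cip :: "'a measure => ('a => complex) => ('a => complex) => complex" where
  "cip mu f g = (\<integral>x. f x * cnj (g x) \<partial>mu)"

lemma L2_mult_integrable:
  assumes f: "f \<in> L2 mu" and g: "g \<in> L2 mu"
  shows "integrable mu (%x. cmod (f x) * cmod (g x))" "integrable mu (%x. f x * cnj (g x))"
proof -
  have le: "cmod (f x) * cmod (g x) <= (cmod (f x))^2 + (cmod (g x))^2" for x
    using sum_squares_bound[of "cmod (f x)" "cmod (g x)"] mult_nonneg_nonneg[OF norm_ge_zero norm_ge_zero, of "f x" "g x"] by linarith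
  have i: "integrable mu (%x. (cmod (f x))^2 + (cmod (g x))^2)" using f g by (auto simp: L2_iff)
  show "integrable mu (%x. cmod (f x) * cmod (g x))"
    by (rule Bochner_Integration.integrable_bound[OF i]) (use f g le in \<open>auto simp: L2_iff intro!: AE_I2\<close>)
  have "(cnj :: complex => complex) \<in> borel_measurable borel"
    by (intro borel_measurable_continuous_onI continuous_intros)
  then have [measurable]: "(%x. cnj (g x)) \<in> borel_measurable mu"
    using g by (intro measurable_compose[of g mu borel cnj borel]) (auto simp: L2_iff)
  show "integrable mu (%x. f x * cnj (g x))"
    by (rule Bochner_Integration.integrable_bound[OF i]) (use f g le in \<open>auto simp: L2_iff norm_mult intro!: AE_I2\<close>)
qed

text \<open>The case l = 1/2 of \<open>weighted_am_gm_optimal\<close>, after integration of the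
  pointwise linear inequalities.\<close>

lemma Cauchy_Schwarz_L2:
  assumes f: "f \<in> L2 mu" and g: "g \<in> L2 mu"
  shows "(\<integral>x. cmod (f x) * cmod (g x) \<partial>mu) <= nrm mu f * nrm mu g"
proof -
  have "(\<integral>x. cmod (f x) * cmod (g x) \<partial>mu) <= (\<integral>x. (cmod (f x))^2 \<partial>mu) powr (1 - 1/2) * (\<integral>x. (cmod (g x))^2 \<partial>mu) powr (1/2)"
  proof (rule weighted_am_gm_optimal)
    fix z :: real assume z: "z > 0"
    have "(\<integral>x. cmod (f x) * cmod (g x) \<partial>mu) <= (\<integral>x. (1 - 1/2) * z powr (1/2) * (cmod (f x))^2 + 1/2 * z powr (1/2 - 1) * (cmod (g x))^2 \<partial>mu)"
    proof (rule integral_mono[OF L2_mult_integrable(1)[OF f g]])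
      show "integrable mu (%x. (1 - 1/2) * z powr (1/2) * (cmod (f x))^2 + 1/2 * z powr (1/2 - 1) * (cmod (g x))^2)"
        using f g by (auto simp: L2_iff)
      fix x
      have "cmod (f x) * cmod (g x) = (cmod (f x))\<^sup>2 powr (1 - 1/2) * (cmod (g x))\<^sup>2 powr (1/2)"
        by (simp add: powr_half_sqrt)
      also have "... <= (1 - 1/2) * z powr (1/2) * (cmod (f x))^2 + 1/2 * z powr (1/2 - 1) * (cmod (g x))^2"
        using z by (intro le_weighted_am_gm) auto
      finally show "cmod (f x) * cmod (g x) <= (1 - 1/2) * z powr (1/2) * (cmod (f x))^2 + 1/2 * z powr (1/2 - 1) * (cmod (g x))^2" .
    qed
    also have "... = (1 - 1/2) * z powr (1/2) * (\<integral>x. (cmod (f x))^2 \<partial>mu) + 1/2 * z powr (1/2 - 1) * (\<integral>x. (cmod (g x))^2 \<partial>mu)"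
      using f g by (simp add: L2_iff)
    finally show "(\<integral>x. cmod (f x) * cmod (g x) \<partial>mu) <= (1 - 1/2) * z powr (1/2) * (\<integral>x. (cmod (f x))^2 \<partial>mu) + 1/2 * z powr (1/2 - 1) * (\<integral>x. (cmod (g x))^2 \<partial>mu)" .
  qed auto
  then show ?thesis by (simp add: powr_half_sqrt nrm_def)
qed

lemma cip_bound: assumes f: "f \<in> L2 mu" and g: "g \<in> L2 mu" shows "cmod (cip mu f g) <= nrm mu f * nrm mu g"
proof -
  have "cmod (cip mu f g) <= (\<integral>x. cmod (f x * cnj (g x)) \<partial>mu)" unfolding cip_def by (rule integral_norm_bound)
  also have "... = (\<integral>x. cmod (f x) * cmod (g x) \<partial>mu)" by (simp add: norm_mult)
  finally show ?thesis using Cauchy_Schwarz_L2[OF f g] by simp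
qed

lemma cip_self: "f \<in> L2 mu ==> cip mu f f = cor ((nrm mu f)^2)"
  by (simp add: cip_def nrm_def complex_norm_square[symmetric] integral_nonneg_AE del: of_real_power) 

lemma cip_lincomb: "f \<in> L2 mu ==> g \<in> L2 mu ==> h \<in> L2 mu ==> cip mu (%x. a * f x + b * g x) h = a * cip mu f h + b * cip mu g h"
proof -
  assume h: "f \<in> L2 mu" "g \<in> L2 mu" "h \<in> L2 mu"
  have "cip mu (%x. a * f x + b * g x) h = (\<integral>x. a * (f x * cnj (h x)) + b * (g x * cnj (h x)) \<partial>mu)"
    by (simp add: cip_def algebra_simps)
  then show ?thesis using L2_mult_integrable(2)[OF h(1,3)] L2_mult_integrable(2)[OF h(2,3)] by (simp add: cip_def)
qed

lemma nrm_0_iff: "f \<in> L2 mu ==> nrm mu f = 0 \<longleftrightarrow> (AE x in mu. f x = 0)"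
proof -
  assume "f \<in> L2 mu"
  then have "(\<integral>x. (cmod (f x))^2 \<partial>mu) = 0 \<longleftrightarrow> (AE x in mu. (cmod (f x))^2 = 0)"
    by (intro integral_nonneg_eq_0_iff_AE) (auto simp: L2_iff)
  then show ?thesis by (simp add: nrm_def)
qed

lemma nrm_cong: "f \<in> borel_measurable mu ==> g \<in> borel_measurable mu ==> (AE x in mu. f x = g x) ==> nrm mu f = nrm mu g"
  unfolding nrm_def by (intro arg_cong[where f = sqrt] integral_cong_AE) auto

lemma nrm_mono:
  assumes "f \<in> borel_measurable mu" "g \<in> L2 mu" "AE x in mu. cmod (f x) <= cmod (g x)"
  shows "f \<in> L2 mu" "nrm mu f <= nrm mu g"
proof -
  have a: "AE x in mu. (cmod (f x))^2 <= (cmod (g x))^2" using assms(3) by eventually_elim (auto intro: power_mono)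
  have "integrable mu (%x. (cmod (f x))^2)"
    by (rule Bochner_Integration.integrable_bound[of mu "%x. (cmod (g x))^2"]) (use assms a in \<open>auto simp: L2_iff\<close>)
  then show "f \<in> L2 mu" using assms by (simp add: L2_iff)
  then show "nrm mu f <= nrm mu g" unfolding nrm_def
    using assms a by (intro real_sqrt_le_mono integral_mono_AE) (auto simp: L2_iff)
qed

text \<open>A rapidly converging subsequence converges almost everywhere, and Fatou's lemma shows
  that its pointwise limit is the limit in norm of the whole sequence.\<close>

lemma L2_complete:
  fixes f :: "nat => 'a => complex"
  assumes f: "!!n. f n \<in> L2 mu" and C: "!!e. e > 0 ==> \<exists>N. \<forall>m\<ge>N. \<forall>n\<ge>N. nrm mu (%x. f m x - f n x) <= e"
  shows "\<exists>g\<in>L2 mu. (%n. nrm mu (%x. f n x - g x)) \<longlonglongrightarrow> 0"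
proof -
  have fm[measurable]: "f n \<in> borel_measurable mu" for n using f by (simp add: L2_iff)
  obtain N where N: "!!k m n. m >= N k ==> n >= N k ==> nrm mu (%x. f m x - f n x) <= (1/2)^k"
    using C[of "(1/2)^_"] by (metis zero_less_divide_1_iff zero_less_numeral zero_less_power)
  define M where "M = rec_nat (N 0) (%k m. max (Suc m) (N (Suc k)))"
  have M: "M 0 = N 0" "M (Suc k) = max (Suc (M k)) (N (Suc k))" for k by (auto simp: M_def)
  have MN: "M k >= N k" for k by (cases k) (auto simp: M)
  have MS: "M k <= M (Suc k)" for k by (simp add: M)
  define h where "h k x = f (M k) x" for k x
  have hm[measurable]: "h k \<in> borel_measurable mu" for k by (simp add: h_def[abs_def])
  have hL: "h k \<in> L2 mu" for k using f by (simp add: h_def[abs_def])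
  have d: "nrm mu (%x. h (Suc k) x - h k x) <= (1/2)^k" for k
    unfolding h_def by (rule N) (use MN MS le_trans in blast)+
  \<comment> \<open>The square integrals are at most 4^-k, so the weight 2^k leaves a convergent
    series; where its sum is finite, the increments decay like 2^(-k/2).\<close>
  have d2: "(\<integral>\<^sup>+x. ennreal (2^k * (cmod (h (Suc k) x - h k x))^2) \<partial>mu) <= ennreal ((1/2)^k)" for k
  proof -
    have i: "integrable mu (%x. (cmod (h (Suc k) x - h k x))^2)" using L2_diff[OF hL[of "Suc k"] hL[of k]] by (simp add: L2_iff)
    have "(\<integral>x. (cmod (h (Suc k) x - h k x))^2 \<partial>mu) = (nrm mu (%x. h (Suc k) x - h k x))^2"
      by (simp add: nrm_def integral_nonneg_AE)
    also have "... <= ((1/2)^k)^2" using d by (intro power_mono) auto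
    finally have "2^k * (\<integral>x. (cmod (h (Suc k) x - h k x))^2 \<partial>mu) <= 2^k * ((1/2)^k)^2" by (intro mult_left_mono) auto
    also have "... = (1/2)^k" by (simp add: power2_eq_square power_divide)
    finally show ?thesis using i by (subst nn_integral_eq_integral) (auto simp: ennreal_leI)
  qed
  have "(\<integral>\<^sup>+x. (\<Sum>k. ennreal (2^k * (cmod (h (Suc k) x - h k x))^2)) \<partial>mu)
      = (\<Sum>k. (\<integral>\<^sup>+x. ennreal (2^k * (cmod (h (Suc k) x - h k x))^2) \<partial>mu))"
    by (rule nn_integral_suminf) measurable
  also have "... <= (\<Sum>k. ennreal ((1/2)^k))" by (intro suminf_le d2) auto
  also have "... = ennreal (\<Sum>k. (1/2)^k)" by (rule suminf_ennreal2) (auto intro: summable_geometric)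
  also have "... < \<infinity>" by simp
  finally have "AE x in mu. (\<Sum>k. ennreal (2^k * (cmod (h (Suc k) x - h k x))^2)) ~= \<infinity>"
    by (intro nn_integral_PInf_AE) auto
  then have conv: "AE x in mu. convergent (%k. h k x)"
  proof eventually_elim
    case (elim x)
    have s: "summable (%k. 2^k * (cmod (h (Suc k) x - h k x))^2)"
      by (rule summable_suminf_not_top) (use elim in auto)
    then have "(%k. 2^k * (cmod (h (Suc k) x - h k x))^2) \<longlonglongrightarrow> 0" by (rule summable_LIMSEQ_zero)
    then obtain B where B: "B > 0" "!!k. norm (2^k * (cmod (h (Suc k) x - h k x))^2) <= B"
      by (rule BseqE[OF convergent_imp_Bseq[OF convergentI]]) auto
    have le: "cmod (h (Suc k) x - h k x) <= sqrt B * (sqrt (1/2))^k" for k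
    proof -
      have "(cmod (h (Suc k) x - h k x))^2 <= B * (1/2)^k" using B(2)[of k] by (simp add: power_divide field_simps)
      then have "sqrt ((cmod (h (Suc k) x - h k x))^2) <= sqrt (B * (1/2)^k)" by (rule real_sqrt_le_mono)
      then show ?thesis by (simp add: real_sqrt_mult real_sqrt_power)
    qed
    have "summable (%k. h (Suc k) x - h k x)"
      by (rule summable_comparison_test'[where g = "%k. sqrt B * (sqrt (1/2))^k"])
        (use le in \<open>auto intro!: summable_mult summable_geometric\<close>)
    then have "convergent (%n. \<Sum>k<n. h (Suc k) x - h k x)" by (simp add: summable_iff_convergent)
    then have "convergent (%n. (\<Sum>k<n. h (Suc k) x - h k x) + h 0 x)"
      by (intro convergent_add convergent_const)
    moreover have "(%n. (\<Sum>k<n. h (Suc k) x - h k x) + h 0 x) = (%n. h n x - h 0 x + h 0 x)"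
      by (intro ext arg_cong2[where f = plus] sum_lessThan_telescope refl)
    ultimately have "convergent (%n. h n x - h 0 x + h 0 x)" by metis
    then show ?case by simp
  qed
  define g where "g x = lim (%k. h k x)" for x
  have gm[measurable]: "g \<in> borel_measurable mu" unfolding g_def[abs_def] by measurable
  have lim: "AE x in mu. (%k. h k x) \<longlonglongrightarrow> g x" using conv by eventually_elim (simp add: g_def convergent_LIMSEQ_iff)
  have key: "(%x. f n x - g x) \<in> L2 mu \<and> nrm mu (%x. f n x - g x) <= e"
    if e: "e >= 0" and n: "!!m. m >= n ==> nrm mu (%x. f n x - f m x) <= e" for n e
  proof -
    have "(\<integral>\<^sup>+x. ennreal ((cmod (f n x - g x))^2) \<partial>mu) = (\<integral>\<^sup>+x. liminf (%k. ennreal ((cmod (f n x - h k x))^2)) \<partial>mu)"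
    proof (rule nn_integral_cong_AE, use lim in eventually_elim)
      case (elim x)
      then have "(%k. ennreal ((cmod (f n x - h k x))^2)) \<longlonglongrightarrow> ennreal ((cmod (f n x - g x))^2)"
        by (intro tendsto_ennrealI tendsto_intros)
      then show ?case by (rule lim_imp_Liminf[OF trivial_limit_sequentially, symmetric])
    qed
    also have "... <= liminf (%k. \<integral>\<^sup>+x. ennreal ((cmod (f n x - h k x))^2) \<partial>mu)" by (rule nn_integral_liminf) measurable
    also have "... <= ennreal (e^2)"
    proof (rule Liminf_le[OF trivial_limit_sequentially eventually_sequentiallyI])
      fix k assume k: "k >= n"
      have Mk: "M k >= k" for k by (induction k) (auto simp: M le_max_iff_disj)
      have i: "(%x. f n x - h k x) \<in> L2 mu" using L2_diff[OF f[of n] hL[of k]] .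
      have "(\<integral>\<^sup>+x. ennreal ((cmod (f n x - h k x))^2) \<partial>mu) = ennreal (\<integral>x. (cmod (f n x - h k x))^2 \<partial>mu)"
        using i by (intro nn_integral_eq_integral) (auto simp: L2_iff)
      also have "(\<integral>x. (cmod (f n x - h k x))^2 \<partial>mu) = (nrm mu (%x. f n x - h k x))^2"
        by (simp add: nrm_def integral_nonneg_AE)
      also have "... <= e^2" using n[of "M k"] Mk[of k] k by (intro power_mono) (auto simp: h_def)
      finally show "(\<integral>\<^sup>+x. ennreal ((cmod (f n x - h k x))^2) \<partial>mu) <= ennreal (e^2)" by (simp add: ennreal_leI)
    qed
    finally have le: "(\<integral>\<^sup>+x. ennreal ((cmod (f n x - g x))^2) \<partial>mu) <= ennreal (e^2)" .
    then have i: "integrable mu (%x. (cmod (f n x - g x))^2)"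
      by (intro integrableI_bounded) (auto intro: le_less_trans)
    have "ennreal (\<integral>x. (cmod (f n x - g x))^2 \<partial>mu) <= ennreal (e^2)"
      using le i by (subst (asm) nn_integral_eq_integral) auto
    then have "(\<integral>x. (cmod (f n x - g x))^2 \<partial>mu) <= e^2" by (simp add: ennreal_le_iff)
    then have "nrm mu (%x. f n x - g x) <= sqrt (e^2)" unfolding nrm_def by (rule real_sqrt_le_mono)
    then show ?thesis using i e by (simp add: L2_iff)
  qed
  obtain N1 where N1: "\<forall>m\<ge>N1. \<forall>n\<ge>N1. nrm mu (%x. f m x - f n x) <= 1" using C[of 1] by auto
  have "(%x. f N1 x - g x) \<in> L2 mu" using key[of 1 N1] N1 by simp
  then have "(%x. f N1 x - (f N1 x - g x)) \<in> L2 mu" using L2_diff[OF f] by blast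
  then have gL: "g \<in> L2 mu" by simp
  have "(%n. nrm mu (%x. f n x - g x)) \<longlonglongrightarrow> 0"
  proof (rule LIMSEQ_I)
    fix r :: real assume r: "r > 0"
    obtain N where N: "\<forall>m\<ge>N. \<forall>n\<ge>N. nrm mu (%x. f m x - f n x) <= r / 2" using C[of "r/2"] r by auto
    show "\<exists>no. \<forall>n\<ge>no. norm (nrm mu (%x. f n x - g x) - 0) < r"
    proof (intro exI[of _ N] allI impI)
      fix n assume "n >= N"
      then have "nrm mu (%x. f n x - g x) <= r / 2" using key[of "r/2" n] N r by simp
      then show "norm (nrm mu (%x. f n x - g x) - 0) < r" using r by simp
    qed
  qed
  then show ?thesis using gL by blast
qed

lemma nrm_triangle:
  assumes f: "f \<in> L2 mu" and g: "g \<in> L2 mu"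
  shows "nrm mu (%x. f x + g x) <= nrm mu f + nrm mu g"
proof -
  have i: "integrable mu (%x. (cmod (f x))^2)" "integrable mu (%x. (cmod (g x))^2)" using f g by (auto simp: L2_iff)
  have "(nrm mu (%x. f x + g x))^2 = (\<integral>x. (cmod (f x + g x))^2 \<partial>mu)" by (simp add: nrm_def integral_nonneg_AE)
  also have "... <= (\<integral>x. (cmod (f x))^2 + (cmod (g x))^2 + 2 * (cmod (f x) * cmod (g x)) \<partial>mu)"
  proof (rule integral_mono)
    show "integrable mu (%x. (cmod (f x + g x))^2)" using L2_add[OF f g] by (simp add: L2_iff)
    show "integrable mu (%x. (cmod (f x))^2 + (cmod (g x))^2 + 2 * (cmod (f x) * cmod (g x)))"
      using i L2_mult_integrable(1)[OF f g] by simp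
    fix x
    have "(cmod (f x + g x))^2 <= (cmod (f x) + cmod (g x))^2" by (intro power_mono norm_triangle_ineq) auto
    then show "(cmod (f x + g x))^2 <= (cmod (f x))^2 + (cmod (g x))^2 + 2 * (cmod (f x) * cmod (g x))"
      by (simp add: power2_sum)
  qed
  also have "... = (nrm mu f)^2 + (nrm mu g)^2 + 2 * (\<integral>x. cmod (f x) * cmod (g x) \<partial>mu)"
    using i L2_mult_integrable(1)[OF f g] by (simp add: nrm_def integral_nonneg_AE)
  also have "... <= (nrm mu f)^2 + (nrm mu g)^2 + 2 * (nrm mu f * nrm mu g)" using Cauchy_Schwarz_L2[OF f g] by simp
  also have "... = (nrm mu f + nrm mu g)^2" by (simp add: power2_sum)
  finally show ?thesis by (rule power2_le_imp_le) simp
qed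

lemma nrm_scale: "nrm mu (%x. a * f x) = cmod a * nrm mu f"
  by (simp add: nrm_def norm_mult power_mult_distrib real_sqrt_mult)

lemma nrm_minus_commute: "nrm mu (%x. f x - g x) = nrm mu (%x. g x - f x)"
  by (simp add: nrm_def norm_minus_commute)

lemma nrm_triangle_diff:
  assumes "f \<in> L2 mu" "g \<in> L2 mu" "h \<in> L2 mu"
  shows "nrm mu (%x. f x - h x) <= nrm mu (%x. f x - g x) + nrm mu (%x. g x - h x)"
  using nrm_triangle[OF L2_diff[OF assms(1,2)] L2_diff[OF assms(2,3)]] by simp

lemma bounded_opD:
  assumes "bounded_op mu P"
  shows "!!f. f \<in> L2 mu ==> P f \<in> L2 mu"
    "!!f g a b. f \<in> L2 mu ==> g \<in> L2 mu ==> AE x in mu. P (%y. a * f y + b * g y) x = a * P f x + b * P g x"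
  using assms by (auto simp: bounded_op_def)

lemma bounded_op_bound:
  assumes P: "bounded_op mu P"
  obtains C where "C > 0" "!!f. f \<in> L2 mu ==> nrm mu (P f) <= C * nrm mu f"
proof -
  obtain C where C: "!!f. f \<in> L2 mu ==> Lp_norm mu 2 (P f) <= ennreal C * Lp_norm mu 2 f"
    using P unfolding bounded_op_def by blast
  show thesis
  proof (rule that[of "max C 1"])
    fix f assume f: "f \<in> L2 mu"
    have "ennreal (nrm mu (P f)) <= ennreal C * ennreal (nrm mu f)"
      using C[OF f] f bounded_opD(1)[OF P f] by (simp add: Lp_norm_2)
    also have "... <= ennreal (max C 1) * ennreal (nrm mu f)" by (intro mult_right_mono ennreal_leI) auto
    also have "... = ennreal (max C 1 * nrm mu f)" by (simp add: ennreal_mult'' )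
    finally show "nrm mu (P f) <= max C 1 * nrm mu f" by (subst (asm) ennreal_le_iff) auto
  qed simp
qed

lemma bounded_opI:
  assumes "!!f. f \<in> L2 mu ==> P f \<in> L2 mu"
    "!!f g a b. f \<in> L2 mu ==> g \<in> L2 mu ==> AE x in mu. P (%y. a * f y + b * g y) x = a * P f x + b * P g x"
    "!!f. f \<in> L2 mu ==> nrm mu (P f) <= C * nrm mu f"
  shows "bounded_op mu P"
  unfolding bounded_op_def
proof (intro conjI ballI allI)
  show "\<exists>C. \<forall>f\<in>L2 mu. Lp_norm mu 2 (P f) <= ennreal C * Lp_norm mu 2 f"
  proof (intro exI[of _ C] ballI)
    fix f assume f: "f \<in> L2 mu"
    show "Lp_norm mu 2 (P f) <= ennreal C * Lp_norm mu 2 f"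
      using assms(3)[OF f] by (simp add: Lp_norm_2 f assms(1) ennreal_mult''[symmetric] ennreal_leI)
  qed
qed (use assms in auto)

lemma bounded_op_diff:
  assumes P: "bounded_op mu P" and f: "f \<in> L2 mu" and g: "g \<in> L2 mu"
  shows "AE x in mu. P (%y. f y - g y) x = P f x - P g x"
  using bounded_opD(2)[OF P f g, of 1 "-1"] by simp

lemma bounded_op_nrm_diff:
  assumes P: "bounded_op mu P" and f: "f \<in> L2 mu" and g: "g \<in> L2 mu"
  shows "nrm mu (%x. P f x - P g x) = nrm mu (P (%y. f y - g y))"
proof (rule nrm_cong)
  note m = bounded_opD(1)[OF P]
  show "(%x. P f x - P g x) \<in> borel_measurable mu" by (rule L2_borel[OF L2_diff[OF m[OF f] m[OF g]]])
  show "P (%y. f y - g y) \<in> borel_measurable mu" by (rule L2_borel[OF m[OF L2_diff[OF f g]]])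
  show "AE x in mu. P f x - P g x = P (%y. f y - g y) x" using bounded_op_diff[OF assms] by eventually_elim simp
qed

text \<open>Linearity and the norm bound suffice: the image of a function of norm 0 has norm
  0.\<close>

lemma bounded_op_cong:
  assumes P: "bounded_op mu P" and f: "f \<in> L2 mu" and g: "g \<in> L2 mu" and e: "AE x in mu. f x = g x"
  shows "AE x in mu. P f x = P g x"
proof -
  obtain C where C: "C > 0" "!!f. f \<in> L2 mu ==> nrm mu (P f) <= C * nrm mu f" using bounded_op_bound[OF P] by blast
  have "nrm mu (%y. f y - g y) = 0" using e by (subst nrm_0_iff[OF L2_diff[OF f g]]) auto
  then have "nrm mu (%x. P f x - P g x) = 0"
    using C(2)[OF L2_diff[OF f g]] bounded_op_nrm_diff[OF P f g] nrm_nonneg[of mu "P (%y. f y - g y)"] by (simp add: order_antisym)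
  then show ?thesis using nrm_0_iff[OF L2_diff[OF bounded_opD(1)[OF P f] bounded_opD(1)[OF P g]]] by simp
qed

section \<open>Transport of operators and semigroups to a Banach space type\<close>

text \<open>\<open>L\<^sub>2(mu)\<close> is embedded isometrically into a Banach space type by letting \<open>f\<close> act on the unit ball.\<close>

instance bcontfun :: (metric_space, banach) banach ..

type_synonym 'a l2_hull = "('a => complex) discrete \<Rightarrow>\<^sub>C complex"

text \<open>On a discrete space every function is continuous, so the hull consists of all bounded
  functions on it. The value 0 is a default for arguments outside the unit ball of
  \<open>L2\<close>.\<close>

definition emb :: "'a measure => ('a => complex) => 'a l2_hull" where
  "emb mu f = Bcontfun (%d. if of_discrete d \<in> L2 mu \<and> nrm mu (of_discrete d) <= 1 then cip mu f (of_discrete d) else 0)"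

definition unemb :: "'a measure => 'a l2_hull => 'a => complex" where
  "unemb mu y = (SOME f. f \<in> L2 mu \<and> emb mu f = y)"

definition lift_op :: "'a measure => 'a op => 'a l2_hull => 'a l2_hull" where
  "lift_op mu P y = emb mu (P (unemb mu y))"

abbreviation EH :: "'a measure => 'a l2_hull set" where "EH mu == emb mu ` L2 mu"

context fixes mu :: "'a measure" begin

lemma emb_apply:
  assumes f: "f \<in> L2 mu"
  shows "apply_bcontfun (emb mu f) d = (if of_discrete d \<in> L2 mu \<and> nrm mu (of_discrete d) <= 1 then cip mu f (of_discrete d) else 0)"
  unfolding emb_def
proof (subst Bcontfun_inverse)
  show "(%d. if of_discrete d \<in> L2 mu \<and> nrm mu (of_discrete d) <= 1 then cip mu f (of_discrete d) else 0) \<in> bcontfun"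
  proof (rule bcontfun_normI[where b = "nrm mu f"])
    show "continuous_on UNIV (%d. if of_discrete d \<in> L2 mu \<and> nrm mu (of_discrete d) <= 1 then cip mu f (of_discrete d) else 0)"
      by (auto simp: continuous_on_open_vimage open_discrete)
    fix d :: "('a => complex) discrete"
    have "cmod (cip mu f (of_discrete d)) <= nrm mu f" if "of_discrete d \<in> L2 mu" "nrm mu (of_discrete d) <= 1"
      using cip_bound[OF f that(1)] mult_left_le[OF that(2) nrm_nonneg[of mu f]] by linarith
    then show "norm (if of_discrete d \<in> L2 mu \<and> nrm mu (of_discrete d) <= 1 then cip mu f (of_discrete d) else 0) <= nrm mu f"
      by auto
  qed
qed simp

text \<open>Cauchy-Schwarz bounds the supremum from above, and f divided by its norm attains
  it.\<close>

lemma norm_emb: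
  assumes f: "f \<in> L2 mu"
  shows "norm (emb mu f) = nrm mu f"
proof (rule antisym)
  show "norm (emb mu f) <= nrm mu f"
  proof (rule norm_bound)
    fix d :: "('a => complex) discrete"
    have "cmod (cip mu f (of_discrete d)) <= nrm mu f" if "of_discrete d \<in> L2 mu" "nrm mu (of_discrete d) <= 1"
      using cip_bound[OF f that(1)] mult_left_le[OF that(2) nrm_nonneg[of mu f]] by linarith
    then show "norm (apply_bcontfun (emb mu f) d) <= nrm mu f" by (auto simp: emb_apply[OF f])
  qed
  show "nrm mu f <= norm (emb mu f)"
  proof (cases "nrm mu f = 0")
    case False
    define c where "c = cor (1 / nrm mu f)"
    define g where "g = (%x. c * f x)"
    have g: "g \<in> L2 mu" "nrm mu g <= 1" using L2_scale[OF f, of c] False nrm_scale[of mu c f] by (auto simp: g_def c_def norm_divide)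
    have "cip mu f g = (\<integral>x. c * (f x * cnj (f x)) \<partial>mu)" by (simp add: cip_def g_def c_def ac_simps)
    also have "... = c * cip mu f f" by (simp add: cip_def)
    also have "... = cor (nrm mu f)" using False by (simp add: cip_self[OF f] c_def power2_eq_square)
    finally have "cmod (cip mu f g) = nrm mu f" by simp
    moreover have "apply_bcontfun (emb mu f) (discrete g) = cip mu f g"
      using g by (simp add: emb_apply[OF f] discrete_inverse)
    ultimately show ?thesis using norm_bounded[of "emb mu f" "discrete g"] by simp
  qed simp
qed

lemma emb_lincomb:
  assumes f: "f \<in> L2 mu" and g: "g \<in> L2 mu"
  shows "emb mu (%x. cor a * f x + cor b * g x) = a *\<^sub>R emb mu f + b *\<^sub>R emb mu g"
  by (rule bcontfun_eqI)
    (auto simp: emb_apply f g L2_lincomb cip_lincomb scaleR_conv_of_real)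

lemma emb_add: "f \<in> L2 mu ==> g \<in> L2 mu ==> emb mu (%x. f x + g x) = emb mu f + emb mu g"
  and emb_diff: "f \<in> L2 mu ==> g \<in> L2 mu ==> emb mu (%x. f x - g x) = emb mu f - emb mu g"
  and emb_scale: "f \<in> L2 mu ==> emb mu (%x. cor a * f x) = a *\<^sub>R emb mu f"
  using emb_lincomb[of f g 1 1] emb_lincomb[of f g 1 "-1"] emb_lincomb[of f f a 0] by auto

lemma emb_eq_iff:
  assumes f: "f \<in> L2 mu" and g: "g \<in> L2 mu"
  shows "emb mu f = emb mu g \<longleftrightarrow> (AE x in mu. f x = g x)"
proof -
  have "emb mu f = emb mu g \<longleftrightarrow> norm (emb mu f - emb mu g) = 0" by simp
  also have "... \<longleftrightarrow> nrm mu (%x. f x - g x) = 0" using norm_emb[OF L2_diff[OF f g]] by (simp add: emb_diff[OF f g])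
  also have "... \<longleftrightarrow> (AE x in mu. f x = g x)" using nrm_0_iff[OF L2_diff[OF f g]] by simp
  finally show ?thesis .
qed

lemma unemb:
  assumes "y \<in> EH mu"
  shows "unemb mu y \<in> L2 mu" "emb mu (unemb mu y) = y"
  using someI_ex[of "%f. f \<in> L2 mu \<and> emb mu f = y"] assms by (auto simp: unemb_def)

lemma unemb_emb: "f \<in> L2 mu ==> AE x in mu. unemb mu (emb mu f) x = f x"
  using unemb[of "emb mu f"] emb_eq_iff[of "unemb mu (emb mu f)" f] by auto

text \<open>The embedding is isometric, so closedness is completeness of \<open>L2\<close>.\<close>

lemma EH_closed_subspace: "closed_subspace (EH mu)"
proof
  show "subspace (EH mu)" unfolding subspace_def
  proof (intro conjI ballI allI)
    have "emb mu (%x. 0) = 0" using emb_diff[OF L2_0 L2_0] by simp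
    then show "0 \<in> EH mu" using L2_0 by (metis imageI)
    show "x + y \<in> EH mu" if "x \<in> EH mu" "y \<in> EH mu" for x y
      using that by (auto simp flip: emb_add intro: L2_add)
    show "c *\<^sub>R x \<in> EH mu" if "x \<in> EH mu" for c x
      using that by (auto simp flip: emb_scale intro: L2_scale)
  qed
  show "closed (EH mu)" unfolding closed_sequential_limits
  proof (intro allI impI, elim conjE)
    fix z l assume z: "\<forall>n. z n \<in> EH mu" "z \<longlonglongrightarrow> l"
    define f where "f n = unemb mu (z n)" for n
    have f: "f n \<in> L2 mu" "emb mu (f n) = z n" for n using unemb[of "z n"] z(1) by (auto simp: f_def)
    have nf: "nrm mu (%x. f m x - f n x) = dist (z m) (z n)" for m n
      using norm_emb[OF L2_diff[OF f(1)[of m] f(1)[of n]]] emb_diff[OF f(1)[of m] f(1)[of n]] f(2) by (simp add: dist_norm)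
    have "\<exists>N. \<forall>m\<ge>N. \<forall>n\<ge>N. nrm mu (%x. f m x - f n x) <= e" if e: "e > 0" for e
    proof -
      obtain N where "\<forall>m\<ge>N. \<forall>n\<ge>N. dist (z m) (z n) < e" using metric_CauchyD[OF LIMSEQ_imp_Cauchy[OF z(2)] e] by auto
      then show ?thesis unfolding nf by (intro exI[of _ N]) (auto intro: less_imp_le)
    qed
    from L2_complete[OF f(1) this]
    obtain g where g: "g \<in> L2 mu" "(%n. nrm mu (%x. f n x - g x)) \<longlonglongrightarrow> 0" by auto
    have "norm (z n - emb mu g) = nrm mu (%x. f n x - g x)" for n
      using norm_emb[OF L2_diff[OF f(1)[of n] g(1)]] emb_diff[OF f(1)[of n] g(1)] f(2) by simp
    then have "(%n. norm (z n - emb mu g)) \<longlonglongrightarrow> 0" using g(2) by simp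
    then have "z \<longlonglongrightarrow> emb mu g" by (simp add: tendsto_norm_zero_iff LIM_zero_iff)
    from LIMSEQ_unique[OF z(2) this] have "l = emb mu g" .
    then show "l \<in> EH mu" using g by simp
  qed
qed

lemma lift_op_emb:
  assumes P: "bounded_op mu P" and f: "f \<in> L2 mu"
  shows "lift_op mu P (emb mu f) = emb mu (P f)"
proof -
  have u: "unemb mu (emb mu f) \<in> L2 mu" using unemb(1) f by blast
  have "AE x in mu. P (unemb mu (emb mu f)) x = P f x"
    by (rule bounded_op_cong[OF P u f unemb_emb[OF f]])
  then show ?thesis unfolding lift_op_def using emb_eq_iff[OF bounded_opD(1)[OF P u] bounded_opD(1)[OF P f]] by simp
qed

lemma emb_cong: "f \<in> L2 mu ==> g \<in> L2 mu ==> (AE x in mu. f x = g x) ==> emb mu f = emb mu g"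
  using emb_eq_iff by simp

lemma lift_op_lin_on:
  assumes P: "bounded_op mu P"
  shows "lin_on (EH mu) (lift_op mu P)"
  unfolding lin_on_def
proof (intro conjI ballI allI)
  note m = bounded_opD(1)[OF P]
  show "lift_op mu P x \<in> EH mu" if "x \<in> EH mu" for x
    using that m by (auto simp: lift_op_emb[OF P])
  have lc: "lift_op mu P (emb mu (%x. cor a * f x + cor b * g x)) = a *\<^sub>R emb mu (P f) + b *\<^sub>R emb mu (P g)"
    if f: "f \<in> L2 mu" and g: "g \<in> L2 mu" for a b f g
  proof -
    have "lift_op mu P (emb mu (%x. cor a * f x + cor b * g x)) = emb mu (P (%x. cor a * f x + cor b * g x))"
      by (rule lift_op_emb[OF P L2_lincomb[OF f g]])
    also have "... = emb mu (%x. cor a * P f x + cor b * P g x)"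
      by (rule emb_cong[OF m[OF L2_lincomb[OF f g]] L2_lincomb[OF m[OF f] m[OF g]] bounded_opD(2)[OF P f g]])
    finally show ?thesis by (simp add: emb_lincomb[OF m[OF f] m[OF g]])
  qed
  show "lift_op mu P (x + y) = lift_op mu P x + lift_op mu P y" if xy: "x \<in> EH mu" "y \<in> EH mu" for x y
  proof -
    obtain f g where fg: "f \<in> L2 mu" "g \<in> L2 mu" "x = emb mu f" "y = emb mu g" using xy by (elim imageE) auto
    then show ?thesis using lc[OF fg(1,2), of 1 1] by (simp add: emb_add lift_op_emb[OF P])
  qed
  show "lift_op mu P (c *\<^sub>R x) = c *\<^sub>R lift_op mu P x" if x: "x \<in> EH mu" for c x
  proof -
    obtain f where f: "f \<in> L2 mu" "x = emb mu f" using x by (elim imageE) auto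
    then show ?thesis using lc[OF f(1) f(1), of c 0] by (simp add: emb_scale lift_op_emb[OF P])
  qed
  obtain C where C: "C > 0" "!!f. f \<in> L2 mu ==> nrm mu (P f) <= C * nrm mu f" using bounded_op_bound[OF P] by blast
  show "\<exists>C. \<forall>x\<in>EH mu. norm (lift_op mu P x) <= C * norm x"
    using C by (intro exI[of _ C]) (auto simp: lift_op_emb[OF P] norm_emb m)
qed

lemma tendsto_L2_emb:
  assumes g: "\<forall>\<^sub>F t in F. g t \<in> L2 mu" and f: "f \<in> L2 mu"
  shows "((%t. emb mu (g t)) \<longlongrightarrow> emb mu f) F \<longleftrightarrow> ((%t. nrm mu (%x. g t x - f x)) \<longlongrightarrow> 0) F"
proof -
  have "\<forall>\<^sub>F t in F. norm (emb mu (g t) - emb mu f) = nrm mu (%x. g t x - f x)"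
    by (rule eventually_mono[OF g]) (simp add: norm_emb[OF L2_diff[OF _ f]] flip: emb_diff[OF _ f])
  then have "((%t. nrm mu (%x. g t x - f x)) \<longlongrightarrow> 0) F \<longleftrightarrow> ((%t. norm (emb mu (g t) - emb mu f)) \<longlongrightarrow> 0) F"
    by (simp add: filterlim_cong[OF refl refl])
  also have "... \<longleftrightarrow> ((%t. emb mu (g t)) \<longlongrightarrow> emb mu f) F" by (simp only: tendsto_norm_zero_iff LIM_zero_iff)
  finally show ?thesis ..
qed

lemma tendsto_Lp_norm_2:
  assumes "\<forall>\<^sub>F t in F. g t \<in> L2 mu"
  shows "((%t. Lp_norm mu 2 (g t)) \<longlongrightarrow> 0) F \<longleftrightarrow> ((%t. nrm mu (g t)) \<longlongrightarrow> 0) F"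
proof -
  have "\<forall>\<^sub>F t in F. Lp_norm mu 2 (g t) = ennreal (nrm mu (g t))" using assms by eventually_elim (rule Lp_norm_2)
  then have "((%t. Lp_norm mu 2 (g t)) \<longlongrightarrow> 0) F \<longleftrightarrow> ((%t. ennreal (nrm mu (g t))) \<longlongrightarrow> ennreal 0) F"
    by (simp add: filterlim_cong[OF refl refl])
  also have "... \<longleftrightarrow> ((%t. nrm mu (g t)) \<longlongrightarrow> 0) F"
    by (rule tendsto_ennreal_iff) auto
  finally show ?thesis .
qed

lemma C0_semigroupD:
  assumes "C0_semigroup mu S"
  shows "!!t. t >= 0 ==> bounded_op mu (S t)" "!!f. f \<in> L2 mu ==> AE x in mu. S 0 f x = f x"
    "!!s t f. s >= 0 ==> t >= 0 ==> f \<in> L2 mu ==> AE x in mu. S (s + t) f x = S s (S t f) x"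
    "!!f. f \<in> L2 mu ==> ((%t. Lp_norm mu 2 (%x. S t f x - f x)) \<longlongrightarrow> 0) (at_right 0)"
    "!!t f. t >= 0 ==> f \<in> L2 mu ==> S t f \<in> L2 mu"
  using assms by (auto simp: C0_semigroup_def bounded_op_def)

lemma eventually_at_right_nonneg: "\<forall>\<^sub>F t in at_right (0::real). t >= 0"
  by (rule eventually_mono[OF eventually_at_right_less[of 0]]) simp

lemma C0_semigroup_csg:
  assumes S: "C0_semigroup mu S"
  shows "csg (EH mu) (%t. lift_op mu (S t))"
  unfolding csg_def
proof (intro conjI allI impI ballI)
  note b = C0_semigroupD(1)[OF S] and m = C0_semigroupD(5)[OF S]
  show "lin_on (EH mu) (lift_op mu (S t))" if "t >= 0" for t by (rule lift_op_lin_on[OF b[OF that]])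
  show "lift_op mu (S 0) x = x" if x: "x \<in> EH mu" for x
  proof -
    obtain f where f: "f \<in> L2 mu" "x = emb mu f" using x by (elim imageE) auto
    then show ?thesis using emb_cong[OF m f(1) C0_semigroupD(2)[OF S]] by (simp add: lift_op_emb[OF b])
  qed
  show "lift_op mu (S (s + t)) x = lift_op mu (S s) (lift_op mu (S t) x)" if st: "s >= 0" "t >= 0" and x: "x \<in> EH mu" for s t x
  proof -
    obtain f where f: "f \<in> L2 mu" "x = emb mu f" using x by (elim imageE) auto
    then show ?thesis using emb_cong[OF m m C0_semigroupD(3)[OF S st f(1)]] st by (simp add: lift_op_emb[OF b] m)
  qed
  show "((%t. lift_op mu (S t) x) \<longlongrightarrow> x) (at_right 0)" if x: "x \<in> EH mu" for x
  proof -
    obtain f where f: "f \<in> L2 mu" "x = emb mu f" using x by (elim imageE) auto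
    have e: "\<forall>\<^sub>F t in at_right 0. S t f \<in> L2 mu" "\<forall>\<^sub>F t in at_right 0. (%x. S t f x - f x) \<in> L2 mu"
      using eventually_at_right_nonneg by (eventually_elim, auto intro!: m L2_diff f)+
    have "((%t. emb mu (S t f)) \<longlongrightarrow> emb mu f) (at_right 0)"
      using C0_semigroupD(4)[OF S f(1)] tendsto_L2_emb[OF e(1) f(1)] tendsto_Lp_norm_2[OF e(2)] by simp
    then show ?thesis unfolding f(2)
      by (rule Lim_transform_eventually)
        (use eventually_at_right_nonneg in \<open>eventually_elim, simp add: lift_op_emb[OF b f(1)]\<close>)
  qed
qed

lemma gen_lift_iff:
  assumes S: "C0_semigroup mu S" and f: "f \<in> L2 mu" and g: "g \<in> L2 mu"
  shows "(emb mu f, emb mu g) \<in> gen (EH mu) (%t. lift_op mu (S t)) \<longleftrightarrow> (f, g) \<in> generator mu S"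
proof -
  note b = C0_semigroupD(1)[OF S] and m = C0_semigroupD(5)[OF S]
  define q where "q t = (%x. cor (1 / t) * (S t f x - f x))" for t
  have q0: "q t \<in> L2 mu" if "t >= 0" for t unfolding q_def by (rule L2_scale[OF L2_diff[OF m[OF that f] f]])
  have q: "\<forall>\<^sub>F t in at_right 0. q t \<in> L2 mu" "\<forall>\<^sub>F t in at_right 0. (%x. q t x - g x) \<in> L2 mu"
    using eventually_mono[OF eventually_at_right_nonneg q0] eventually_mono[OF eventually_at_right_nonneg L2_diff[OF q0 g]]
    by simp_all
  have "\<forall>\<^sub>F t in at_right 0. (lift_op mu (S t) (emb mu f) - emb mu f) /\<^sub>R t = emb mu (q t)"
    using eventually_at_right_nonneg
  proof eventually_elim
    case (elim t)
    then show ?case unfolding q_def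
      by (subst emb_scale[OF L2_diff[OF m f]]) (auto simp: emb_diff[OF m f] lift_op_emb[OF b f] f divide_inverse)
  qed
  then have "((%t. (lift_op mu (S t) (emb mu f) - emb mu f) /\<^sub>R t) \<longlongrightarrow> emb mu g) (at_right 0) \<longleftrightarrow>
      ((%t. emb mu (q t)) \<longlongrightarrow> emb mu g) (at_right 0)"
    by (rule filterlim_cong[OF refl refl])
  also have "... \<longleftrightarrow> ((%t. Lp_norm mu 2 (%x. q t x - g x)) \<longlongrightarrow> 0) (at_right 0)"
    using tendsto_L2_emb[OF q(1) g] tendsto_Lp_norm_2[OF q(2)] by simp
  finally show ?thesis using f g by (simp add: gen_def generator_def q_def)
qed

lemma bounded_op_mult:
  assumes "m \<in> borel_measurable mu" "!!x. \<bar>m x\<bar> <= C"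
  shows "bounded_op mu (%f x. cor (m x) * f x)"
  by (rule bounded_opI[where C = C]) (use L2_bounded_mult[OF _ assms] in \<open>auto simp: algebra_simps\<close>)

lemma bounded_op_const: "bounded_op mu (%f x. c * f x)"
  by (rule bounded_opI[where C = "cmod c"]) (auto simp: nrm_scale L2_scale algebra_simps)

lemma bounded_op_comp:
  assumes P: "bounded_op mu P" and Q: "bounded_op mu Q"
  shows "bounded_op mu (%f. P (Q f))"
proof -
  obtain C where C: "C > 0" "!!f. f \<in> L2 mu ==> nrm mu (P f) <= C * nrm mu f" using bounded_op_bound[OF P] by blast
  obtain D where D: "D > 0" "!!f. f \<in> L2 mu ==> nrm mu (Q f) <= D * nrm mu f" using bounded_op_bound[OF Q] by blast
  note p = bounded_opD[OF P] and q = bounded_opD[OF Q]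
  show ?thesis
  proof (rule bounded_opI[where C = "C * D"])
    fix f g a b assume f: "f \<in> L2 mu" and g: "g \<in> L2 mu"
    have "AE x in mu. P (Q (%y. a * f y + b * g y)) x = P (%y. a * Q f y + b * Q g y) x"
      by (rule bounded_op_cong[OF P q(1)[OF L2_lincomb[OF f g]] L2_lincomb[OF q(1)[OF f] q(1)[OF g]] q(2)[OF f g]])
    then show "AE x in mu. P (Q (%y. a * f y + b * g y)) x = a * P (Q f) x + b * P (Q g) x"
      using p(2)[OF q(1)[OF f] q(1)[OF g], of a b] by eventually_elim simp
  next
    fix f assume f: "f \<in> L2 mu"
    show "P (Q f) \<in> L2 mu" using p q f by blast
    have "nrm mu (P (Q f)) <= C * nrm mu (Q f)" using C(2) q(1) f by blast
    also have "... <= C * (D * nrm mu f)" using C D f by (intro mult_left_mono) auto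
    finally show "nrm mu (P (Q f)) <= C * D * nrm mu f" by simp
  qed
qed

text \<open>The symmetric splitting of a time step: the half factors on both sides keep the step
  self-adjoint when T s is, and nonnegativity of the multiplier keeps it positive.\<close>

definition strang :: "(real => 'a op) => ('a => real) => real => 'a op" where
  "strang T V s f = (%x. cor (exp (- (s * V x / 2))) * T s (%y. cor (exp (- (s * V y / 2))) * f y) x)"

end

section \<open>Bounded potentials on \<open>L2\<close>\<close>

lemma abs_exp_minus_one_le: "\<bar>exp y - 1\<bar> <= \<bar>y\<bar> * exp \<bar>y\<bar>" for y :: real
proof (cases "y >= 0")
  case True
  have "1 - y <= exp (- y)" using exp_ge_add_one_self[of "-y"] by simp
  then have "(1 - y) * exp y <= exp (- y) * exp y" by (intro mult_right_mono) auto
  then show ?thesis using True by (simp add: algebra_simps flip: exp_add)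
next
  case False
  then have "\<bar>y\<bar> * 1 <= \<bar>y\<bar> * exp \<bar>y\<bar>" by (intro mult_left_mono) auto
  moreover have "\<bar>exp y - 1\<bar> <= \<bar>y\<bar>"
  proof -
    have "exp y <= 1" using False by simp
    then show ?thesis using False exp_ge_add_one_self[of y] by linarith
  qed
  ultimately show ?thesis by linarith
qed

lemma abs_exp_minus_linear_le: "\<bar>exp y - 1 - y\<bar> <= y^2 * exp \<bar>y\<bar>" for y :: real
proof -
  have "1 - y <= exp (- y)" using exp_ge_add_one_self[of "-y"] by simp
  then have "(1 - y) * exp y <= exp (- y) * exp y" by (intro mult_right_mono) auto
  then have "exp y - 1 - y <= y * (exp y - 1)" by (simp add: algebra_simps flip: exp_add)
  also have "... <= \<bar>y\<bar> * \<bar>exp y - 1\<bar>" by (simp add: abs_mult[symmetric])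
  also have "... <= \<bar>y\<bar> * (\<bar>y\<bar> * exp \<bar>y\<bar>)" by (intro mult_left_mono abs_exp_minus_one_le) auto
  also have "... = y^2 * exp \<bar>y\<bar>" by (simp add: power2_eq_square)
  finally have "exp y - 1 - y <= y^2 * exp \<bar>y\<bar>" .
  moreover have "0 <= exp y - 1 - y" using exp_ge_add_one_self[of y] by linarith
  ultimately show ?thesis by simp
qed

text \<open>\<open>bounded_perturbation\<close> is a choice. It is meaningful because the semigroup
  of mild solutions, transported back from the hull, has the required generator; by uniqueness it is
  that semigroup. The splitting step then satisfies the hypotheses of \<open>Trotter\<close> with B
  = -V.\<close>

lemma bounded_perturbation_aux:
  assumes T: "C0_semigroup mu T" and contr: "!!t f. t >= 0 ==> f \<in> L2 mu ==> nrm mu (T t f) <= nrm mu f"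
    and V: "V \<in> borel_measurable mu" "!!x. \<bar>V x\<bar> <= K" "K > 0"
  shows "C0_semigroup mu (bounded_perturbation mu T V)"
    and "!!t f. t >= 0 ==> f \<in> L2 mu ==>
      (%n. nrm mu (%x. (strang T V (t / real n) ^^ n) f x - bounded_perturbation mu T V t f x)) \<longlonglongrightarrow> 0"
    and "!!s f. s >= 0 ==> f \<in> L2 mu ==> strang T V s f \<in> L2 mu"
proof -
  define Bo :: "'a op" where "Bo f x = cor (- V x) * f x" for f x
  have Bo: "bounded_op mu Bo" "!!f. f \<in> L2 mu ==> Bo f \<in> L2 mu" "!!f. f \<in> L2 mu ==> nrm mu (Bo f) <= K * nrm mu f"
    using bounded_op_mult[of "%x. - V x" mu K] L2_bounded_mult[of _ mu "%x. - V x" K] V by (auto simp: Bo_def[abs_def])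
  note Tb = C0_semigroupD(1)[OF T] and Tm = C0_semigroupD(5)[OF T]
  interpret closed_subspace "EH mu" by (rule EH_closed_subspace)
  interpret P: bounded_perturbation_setup "EH mu" "%t. lift_op mu (T t)" "lift_op mu Bo" K
  proof
    show "csg (EH mu) (%t. lift_op mu (T t))" by (rule C0_semigroup_csg[OF T])
    show "lin_on (EH mu) (lift_op mu Bo)" by (rule lift_op_lin_on[OF Bo(1)])
    show "norm (lift_op mu (T t) x) <= norm x" if "t >= 0" "x \<in> EH mu" for t x
      using that contr by (auto simp: lift_op_emb[OF Tb] norm_emb Tm)
    show "norm (lift_op mu Bo x) <= K * norm x" if "x \<in> EH mu" for x
      using that Bo by (auto simp: lift_op_emb[OF Bo(1)] norm_emb)
  qed (fact V)
  note U = P.U_csg and UH = csgD(5)[OF P.U_csg]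
  define S :: "real => 'a op" where "S t f = unemb mu (P.U t (emb mu f))" for t f
  have S: "S t f \<in> L2 mu" "emb mu (S t f) = P.U t (emb mu f)" if "t >= 0" "f \<in> L2 mu" for t f
    using unemb[OF UH[of t "emb mu f"]] that by (auto simp: S_def)
  have comm: "P.U t (lift_op mu (%f x. a * f x) y) = lift_op mu (%f x. a * f x) (P.U t y)" if t: "t >= 0" and y: "y \<in> EH mu" for t a y
  proof (rule P.U_commute[OF lift_op_lin_on[OF bounded_op_const] _ _ y t])
    fix t x assume t: "t >= (0::real)" and x: "x \<in> EH mu"
    obtain f where f: "f \<in> L2 mu" "x = emb mu f" using x by (elim imageE) auto
    have "AE x in mu. T t (%x. a * f x) x = a * T t f x"
      using bounded_opD(2)[OF Tb[OF t] f(1) f(1), of a 0] by simp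
    then have "emb mu (T t (%x. a * f x)) = emb mu (%x. a * T t f x)"
      by (intro emb_cong Tm t L2_scale f)
    then show "lift_op mu (T t) (lift_op mu (%f x. a * f x) x) = lift_op mu (%f x. a * f x) (lift_op mu (T t) x)"
      using f t by (simp add: lift_op_emb[OF Tb[OF t]] lift_op_emb[OF bounded_op_const] L2_scale Tm)
  next
    fix x assume x: "x \<in> EH mu"
    obtain f where f: "f \<in> L2 mu" "x = emb mu f" using x by (elim imageE) auto
    then show "lift_op mu Bo (lift_op mu (%f x. a * f x) x) = lift_op mu (%f x. a * f x) (lift_op mu Bo x)"
      using f by (simp add: lift_op_emb[OF Bo(1)] lift_op_emb[OF bounded_op_const] L2_scale Bo)
        (simp add: Bo_def[abs_def] ac_simps)
  qed
  have Sb: "bounded_op mu (S t)" if t: "t >= 0" for t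
  proof -
    obtain C where C: "C > 0" "!!x. x \<in> EH mu ==> norm (P.U t x) <= C * norm x"
      using lin_on_bound[OF csgD(1)[OF U t]] by blast
    show ?thesis
    proof (rule bounded_opI[where C = C])
      fix f g a b assume f: "f \<in> L2 mu" and g: "g \<in> L2 mu"
      note af = L2_scale[OF f, of a] and bg = L2_scale[OF g, of b]
      have "emb mu (S t (%y. a * f y + b * g y)) = P.U t (emb mu (%y. a * f y) + emb mu (%y. b * g y))"
        by (simp add: S(2)[OF t L2_lincomb[OF f g]] emb_add[OF af bg])
      also have "... = P.U t (emb mu (%y. a * f y)) + P.U t (emb mu (%y. b * g y))"
        using csgD(7)[OF U t] af bg by simp
      also have "P.U t (emb mu (%y. a * f y)) = emb mu (%y. a * S t f y)"
        using comm[OF t imageI[OF f], of a] lift_op_emb[OF bounded_op_const f, of a] lift_op_emb[OF bounded_op_const S(1)[OF t f], of a]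
        by (simp only: S(2)[OF t f])
      also have "P.U t (emb mu (%y. b * g y)) = emb mu (%y. b * S t g y)"
        using comm[OF t imageI[OF g], of b] lift_op_emb[OF bounded_op_const g, of b] lift_op_emb[OF bounded_op_const S(1)[OF t g], of b]
        by (simp only: S(2)[OF t g])
      also have "emb mu (%y. a * S t f y) + emb mu (%y. b * S t g y) = emb mu (%y. a * S t f y + b * S t g y)"
        by (intro emb_add[symmetric] L2_scale S t f g)
      finally show "AE x in mu. S t (%y. a * f y + b * g y) x = a * S t f x + b * S t g x"
        using emb_eq_iff[OF S(1)[OF t L2_lincomb[OF f g]] L2_lincomb[OF S(1)[OF t f] S(1)[OF t g]]] by blast
    next
      fix f assume f: "f \<in> L2 mu"
      show "S t f \<in> L2 mu" using S f t by simp
      show "nrm mu (S t f) <= C * nrm mu f" using C(2)[OF imageI[OF f]] norm_emb[OF S(1)[OF t f]] by (simp only: S(2)[OF t f] norm_emb[OF f])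
    qed
  qed
  have SC: "C0_semigroup mu S" unfolding C0_semigroup_def
  proof (intro conjI allI impI ballI)
    show "bounded_op mu (S t)" if "t >= 0" for t by (rule Sb[OF that])
    show "AE x in mu. S 0 f x = f x" if "f \<in> L2 mu" for f
      using emb_eq_iff[OF S(1)[of 0 f] that] S(2)[of 0 f] csgD(2)[OF U, of "emb mu f"] that by simp
    show "AE x in mu. S (s + t) f x = S s (S t f) x" if "s >= 0" "t >= 0" "f \<in> L2 mu" for s t f
      using emb_eq_iff[OF S(1)[of "s+t" f] S(1)[of s "S t f"]] S that csgD(3)[OF U that(1,2), of "emb mu f"] by simp
    show "((%t. Lp_norm mu 2 (%x. S t f x - f x)) \<longlongrightarrow> 0) (at_right 0)" if f: "f \<in> L2 mu" for f
    proof -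
      have e: "\<forall>\<^sub>F t in at_right 0. S t f \<in> L2 mu" "\<forall>\<^sub>F t in at_right 0. (%x. S t f x - f x) \<in> L2 mu"
        using eventually_at_right_nonneg by (eventually_elim, auto intro!: S L2_diff f)+
      have "((%t. emb mu (S t f)) \<longlongrightarrow> emb mu f) (at_right 0)"
        by (rule Lim_transform_eventually[OF csgD(4)[OF U imageI[OF f]]])
          (use eventually_at_right_nonneg in \<open>eventually_elim, simp add: S f\<close>)
      then show ?thesis using tendsto_L2_emb[OF e(1) f] tendsto_Lp_norm_2[OF e(2)] by simp
    qed
  qed
  let ?G = "{(f, %x. g x - cor (V x) * f x) | f g. (f, g) \<in> generator mu T}"
  have Gset: "(f, h) \<in> ?G \<longleftrightarrow> (f, %x. h x + cor (V x) * f x) \<in> generator mu T" for f h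
  proof
    assume "(f, h) \<in> ?G"
    then obtain g where "(f, g) \<in> generator mu T" "h = (%x. g x - cor (V x) * f x)" by auto
    then show "(f, %x. h x + cor (V x) * f x) \<in> generator mu T" by simp
  next
    assume g: "(f, %x. h x + cor (V x) * f x) \<in> generator mu T"
    show "(f, h) \<in> ?G"
      by (rule CollectI, rule exI[of _ f], rule exI[of _ "%x. h x + cor (V x) * f x"]) (use g in simp)
  qed
  have VL: "(%x. cor (V x) * f x) \<in> L2 mu" if "f \<in> L2 mu" for f
    by (rule L2_bounded_mult(1)[OF that V(1,2)])
  have key: "(f, h) \<in> ?G \<longleftrightarrow> (emb mu f, emb mu h) \<in> gen (EH mu) P.U" if f: "f \<in> L2 mu" and h: "h \<in> L2 mu" for f h
  proof -
    have e: "emb mu (%x. h x + cor (V x) * f x) = emb mu h - lift_op mu Bo (emb mu f)"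
      by (simp add: lift_op_emb[OF Bo(1) f] flip: emb_diff[OF h Bo(2)[OF f]]) (simp add: Bo_def)
    have "(f, h) \<in> ?G \<longleftrightarrow> (emb mu f, emb mu h - lift_op mu Bo (emb mu f)) \<in> gen (EH mu) (%t. lift_op mu (T t))"
      using gen_lift_iff[OF T f L2_add[OF h VL[OF f]]] unfolding Gset e by simp
    also have "... \<longleftrightarrow> (emb mu f, emb mu h) \<in> gen (EH mu) P.U"
      unfolding P.U_gen by (auto intro: exI[of _ "emb mu h - lift_op mu Bo (emb mu f)"])
    finally show ?thesis .
  qed
  have GL: "f \<in> L2 mu \<and> h \<in> L2 mu" if "(f, h) \<in> ?G" for f h
    using that by (auto simp: generator_def intro!: L2_diff VL)
  have lift_eq: "gen (EH mu) (%t. lift_op mu (R t)) \<subseteq> gen (EH mu) P.U"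
    if R: "C0_semigroup mu R" and g: "generator mu R = ?G" for R
  proof clarify
    fix x y assume xy: "(x, y) \<in> gen (EH mu) (%t. lift_op mu (R t))"
    then have "x \<in> EH mu" "y \<in> EH mu" by (auto simp: gen_def)
    then obtain f h where fh: "f \<in> L2 mu" "h \<in> L2 mu" "x = emb mu f" "y = emb mu h" by (elim imageE) auto
    have "(f, h) \<in> generator mu R" using xy gen_lift_iff[OF R fh(1,2)] fh by simp
    then show "(x, y) \<in> gen (EH mu) P.U" using key[OF fh(1,2)] fh unfolding g by simp
  qed
  have lS: "lift_op mu (S t) x = P.U t x" if t: "t >= 0" and x: "x \<in> EH mu" for t x
  proof -
    obtain f where f: "f \<in> L2 mu" "x = emb mu f" using x by (elim imageE) auto
    then show ?thesis using S(2)[OF t f(1)] lift_op_emb[OF Sb[OF t] f(1)] by simp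
  qed
  have gS: "gen (EH mu) (%t. lift_op mu (S t)) = gen (EH mu) P.U"
  proof -
    have "((%t. (lift_op mu (S t) x - x) /\<^sub>R t) \<longlongrightarrow> y) (at_right 0) \<longleftrightarrow> ((%t. (P.U t x - x) /\<^sub>R t) \<longlongrightarrow> y) (at_right 0)"
      if "x \<in> EH mu" for x y
      by (rule filterlim_cong[OF refl refl], rule eventually_mono[OF eventually_at_right_nonneg]) (simp add: lS that)
    then show ?thesis by (auto simp: gen_def)
  qed
  have SG: "generator mu S = ?G"
  proof (rule set_eqI, clarify)
    fix f h
    show "(f, h) \<in> generator mu S \<longleftrightarrow> (f, h) \<in> ?G"
    proof (cases "f \<in> L2 mu \<and> h \<in> L2 mu")
      case True
      then show ?thesis using gen_lift_iff[OF SC, of f h] key[of f h] gS by simp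
    next
      case False
      then show ?thesis using GL[of f h] by (auto simp: generator_def)
    qed
  qed
  define R where "R = bounded_perturbation mu T V"
  have R: "C0_semigroup mu R" "generator mu R = ?G"
    using someI[of "%S. C0_semigroup mu S \<and> generator mu S = ?G", OF conjI[OF SC SG]]
    unfolding R_def bounded_perturbation_def by simp_all
  show "C0_semigroup mu (bounded_perturbation mu T V)" using R(1) by (simp add: R_def)
  have RL: "R t f \<in> L2 mu" if "t >= 0" "f \<in> L2 mu" for t f using C0_semigroupD(5)[OF R(1) that] .
  have RU: "emb mu (R t f) = P.U t (emb mu f)" if t: "t >= 0" and f: "f \<in> L2 mu" for t f
    using csg_generator_unique[OF C0_semigroup_csg[OF R(1)] U lift_eq[OF R] t imageI[OF f]]
    by (simp add: lift_op_emb[OF C0_semigroupD(1)[OF R(1) t] f])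
  define E where "E s x = exp (- (s * V x / 2))" for s x
  have Em: "E s \<in> borel_measurable mu" for s unfolding E_def[abs_def] using V(1) by measurable
  have sV: "\<bar>s * V x / 2\<bar> <= s * K / 2" if "s >= 0" for s x
    using mult_left_mono[OF V(2)[of x] that] that by (simp add: abs_mult)
  have Eb: "\<bar>E s x\<bar> <= exp (s * K / 2)" if "s >= 0" for s x
    using sV[OF that, of x] by (simp add: E_def)
  have Fdef: "strang T V s = (%f x. cor (E s x) * T s (%y. cor (E s y) * f y) x)" for s
    by (simp add: strang_def[abs_def] E_def)
  have Fb: "bounded_op mu (strang T V s)" if s: "s >= 0" for s
    unfolding Fdef
    using bounded_op_comp[OF bounded_op_mult[OF Em Eb[OF s]] bounded_op_comp[OF Tb[OF s] bounded_op_mult[OF Em Eb[OF s]]]] .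
  show sL: "strang T V s f \<in> L2 mu" if s: "s >= 0" and f: "f \<in> L2 mu" for s f
    by (rule bounded_opD(1)[OF Fb[OF s] f])
  \<comment> \<open>K bounds the growth rate of a splitting step, K^2 exp K its consistency error
    for s <= 1.\<close>
  define c where "c = K + K^2 * exp K"
  have c: "c >= K" "c >= K^2 * exp K" "c >= 0" using V(3) by (auto simp: c_def)
  have Fn: "nrm mu (strang T V s f) <= exp (c * s) * nrm mu f" if s: "s >= 0" and f: "f \<in> L2 mu" for s f
  proof -
    note e1 = L2_bounded_mult[OF f Em Eb[OF s]]
    note e2 = L2_bounded_mult[OF Tm[OF s e1(1)] Em Eb[OF s]]
    have "nrm mu (strang T V s f) <= exp (s * K / 2) * nrm mu (T s (%y. cor (E s y) * f y))"
      unfolding Fdef by (rule e2(2))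
    also have "... <= exp (s * K / 2) * (exp (s * K / 2) * nrm mu f)"
      by (intro mult_left_mono order_trans[OF contr[OF s e1(1)] e1(2)]) auto
    also have "... = exp (s * K) * nrm mu f" by (simp add: mult.assoc[symmetric] flip: exp_add)
    also have "... <= exp (c * s) * nrm mu f" using c s by (intro mult_right_mono) (auto simp: mult.commute mult_right_mono)
    finally show ?thesis .
  qed
  have FT: "norm (lift_op mu (strang T V s) x - lift_op mu (T s) x - (s / 2) *\<^sub>R (lift_op mu Bo (lift_op mu (T s) x) + lift_op mu (T s) (lift_op mu Bo x))) <= c * s^2 * norm x"
    if s: "0 <= s" "s <= 1" and x: "x \<in> EH mu" for s x
  proof -
    obtain f where f: "f \<in> L2 mu" "x = emb mu f" using x by (elim imageE) auto
    \<comment> \<open>D = O(s) and d = O(s^2) are the Taylor remainders of exp(- s V / 2) of first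
      and second order. Expanding (1 + D) T s (1 + D) and writing D = - s V / 2 + d in the linear
      terms leaves a remainder of order s^2.\<close>
    define D where "D x = E s x - 1" for x
    define d where "d x = E s x - 1 - (- (s * V x / 2))" for x
    have m: "D \<in> borel_measurable mu" "d \<in> borel_measurable mu"
      unfolding D_def[abs_def] d_def[abs_def] using Em[of s] V(1) by measurable
    have ab: "\<bar>- (s * V x / 2)\<bar> <= s * K / 2" "s * K / 2 <= K / 2" for x
      using sV[OF s(1), of x] s V(3) by (auto simp: mult_le_cancel_right1)
    have ee: "exp \<bar>- (s * V x / 2)\<bar> <= exp (K / 2)" for x using ab(1)[of x] ab(2) by simp
    have Db: "\<bar>D x\<bar> <= s * K / 2 * exp (K / 2)" for x
      unfolding D_def E_def using V(3) s by (intro order_trans[OF abs_exp_minus_one_le] mult_mono ab ee) auto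
    have db: "\<bar>d x\<bar> <= (s * K / 2)^2 * exp (K / 2)" for x
    proof -
      have "(- (s * V x / 2))^2 <= (s * K / 2)^2" using ab(1)[of x] by (simp add: abs_le_square_iff[symmetric] power2_le_iff_abs_le)
      then show ?thesis unfolding d_def E_def
        by (intro order_trans[OF abs_exp_minus_linear_le] mult_mono ee) auto
    qed
    define Df where "Df = (%y. cor (D y) * f y)"
    define df where "df = (%y. cor (d y) * f y)"
    note L = L2_bounded_mult[OF f(1) m(1) Db, folded Df_def] L2_bounded_mult[OF f(1) m(2) db, folded df_def]
    have TL: "T s f \<in> L2 mu" "T s Df \<in> L2 mu" "T s df \<in> L2 mu" "T s (Bo f) \<in> L2 mu" using Tm s L f Bo by auto
    note L' = L2_bounded_mult[OF TL(1) m(2) db] L2_bounded_mult[OF TL(2) m(1) Db]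
    have a1: "AE x in mu. T s (%y. cor (E s y) * f y) x = T s f x + T s Df x"
      using bounded_opD(2)[OF Tb[OF s(1)] f(1) L(1), of 1 1] by (simp add: Df_def D_def algebra_simps)
    have "(%y. cor (s / 2) * Bo f y + 1 * df y) = Df"
      by (simp add: Bo_def df_def Df_def d_def D_def fun_eq_iff algebra_simps)
    then have a2: "AE x in mu. T s Df x = cor (s / 2) * T s (Bo f) x + T s df x"
      using bounded_opD(2)[OF Tb[OF s(1)] Bo(2)[OF f(1)] L(3), of "cor (s / 2)" 1] by simp
    define rem where "rem = (%x. (T s df x + cor (d x) * T s f x) + cor (D x) * T s Df x)"
    have remL: "rem \<in> L2 mu" unfolding rem_def by (intro L2_add TL L')
    define lhs where "lhs = (%x. (strang T V s f x - T s f x) - cor (s / 2) * (Bo (T s f) x + T s (Bo f) x))"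
    have lhsL: "lhs \<in> L2 mu" unfolding lhs_def by (intro L2_diff L2_scale L2_add sL s f TL Bo)
    have "AE x in mu. lhs x = rem x" using a1 a2
    proof eventually_elim
      case (elim x)
      have E: "cor (E s x) = 1 + cor (D x)" by (simp add: D_def)
      have D: "cor (d x) = cor (D x) + cor (s / 2) * cor (V x)"
        by (simp add: D_def d_def)
      have "strang T V s f x = (1 + cor (D x)) * (T s f x + T s Df x)"
        unfolding Fdef using elim(1) E by simp
      then have "lhs x = T s Df x + cor (D x) * T s f x + cor (D x) * T s Df x
          - cor (s / 2) * (- cor (V x) * T s f x + T s (Bo f) x)"
        unfolding lhs_def Bo_def by (simp add: algebra_simps)
      also have "T s Df x + cor (D x) * T s f x + cor (D x) * T s Df x
          - cor (s / 2) * (- cor (V x) * T s f x + T s (Bo f) x) = rem x"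
        unfolding rem_def using elim(2) D by (simp add: algebra_simps)
      finally show ?case .
    qed
    then have nr: "nrm mu lhs = nrm mu rem" by (intro nrm_cong L2_borel lhsL remL)
    have "nrm mu rem <= (nrm mu (T s df) + nrm mu (%x. cor (d x) * T s f x)) + nrm mu (%x. cor (D x) * T s Df x)"
      unfolding rem_def by (rule order_trans[OF nrm_triangle add_right_mono[OF nrm_triangle]]) (intro L2_add TL L')+
    also have "... <= ((s * K / 2)^2 * exp (K / 2) * nrm mu f + (s * K / 2)^2 * exp (K / 2) * nrm mu f)
        + s * K / 2 * exp (K / 2) * (s * K / 2 * exp (K / 2) * nrm mu f)"
    proof (intro add_mono)
      show "nrm mu (T s df) <= (s * K / 2)^2 * exp (K / 2) * nrm mu f"
        using order_trans[OF contr[OF s(1) L(3)] L(4)] .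
      show "nrm mu (%x. cor (d x) * T s f x) <= (s * K / 2)^2 * exp (K / 2) * nrm mu f"
        by (rule order_trans[OF L'(2) mult_left_mono[OF contr[OF s(1) f(1)]]]) auto
      show "nrm mu (%x. cor (D x) * T s Df x) <= s * K / 2 * exp (K / 2) * (s * K / 2 * exp (K / 2) * nrm mu f)"
        by (rule order_trans[OF L'(4) mult_left_mono[OF order_trans[OF contr[OF s(1) L(1)] L(2)]]]) (use s V in auto)
    qed
    also have "... = (s^2 * nrm mu f) * (K^2 * ((2 * exp (K / 2) + exp (K / 2) * exp (K / 2)) / 4))"
      by (simp add: power2_eq_square algebra_simps)
    also have "... <= (s^2 * nrm mu f) * (K^2 * exp K)"
    proof (intro mult_left_mono)
      have 1: "exp (K / 2) <= exp K" using V(3) by simp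
      have 2: "exp (K / 2) * exp (K / 2) = exp K" by (simp flip: exp_add)
      have 3: "exp K > 0" by simp
      show "(2 * exp (K / 2) + exp (K / 2) * exp (K / 2)) / 4 <= exp K"
        unfolding 2 using 1 3 by argo
    qed auto
    also have "... <= (s^2 * nrm mu f) * c" using c by (intro mult_left_mono) auto
    finally have "nrm mu lhs <= c * s^2 * nrm mu f" unfolding nr by (simp add: ac_simps)
    moreover have "emb mu lhs = lift_op mu (strang T V s) x - lift_op mu (T s) x - (s / 2) *\<^sub>R (lift_op mu Bo (lift_op mu (T s) x) + lift_op mu (T s) (lift_op mu Bo x))"
    proof -
      have "emb mu lhs = emb mu (%x. strang T V s f x - T s f x) - emb mu (%x. cor (s / 2) * (Bo (T s f) x + T s (Bo f) x))"
        unfolding lhs_def by (intro emb_diff L2_diff L2_scale L2_add sL s f TL Bo)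
      also have "emb mu (%x. cor (s / 2) * (Bo (T s f) x + T s (Bo f) x)) = (s / 2) *\<^sub>R emb mu (%x. Bo (T s f) x + T s (Bo f) x)"
        by (intro emb_scale L2_add TL Bo)
      finally show ?thesis
        using f s TL by (simp add: emb_diff[OF sL[OF s(1) f(1)]] emb_add[OF Bo(2)] lift_op_emb[OF Fb[OF s(1)]] lift_op_emb[OF Tb[OF s(1)]] lift_op_emb[OF Bo(1)] Bo(2))
    qed
    ultimately show ?thesis using norm_emb[OF lhsL] norm_emb[OF f(1)] f(2) by simp
  qed
  have pow: "(lift_op mu (strang T V s) ^^ n) (emb mu f) = emb mu ((strang T V s ^^ n) f) \<and> (strang T V s ^^ n) f \<in> L2 mu"
    if s: "s >= 0" and f: "f \<in> L2 mu" for s f n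
    by (induction n) (use f s in \<open>auto simp: lift_op_emb[OF Fb] sL\<close>)
  show "(%n. nrm mu (%x. (strang T V (t / real n) ^^ n) f x - bounded_perturbation mu T V t f x)) \<longlonglongrightarrow> 0"
    if t: "t >= 0" and f: "f \<in> L2 mu" for t f
  proof -
    have "(%n. (lift_op mu (strang T V (t / real n)) ^^ n) (emb mu f)) \<longlonglongrightarrow> P.U t (emb mu f)"
    proof (rule P.Trotter[where c = c])
      show "norm (lift_op mu (strang T V s) x) <= exp (c * s) * norm x" if "s >= 0" "x \<in> EH mu" for s x
        using that Fn by (auto simp: lift_op_emb[OF Fb] norm_emb sL)
    qed (use lift_op_lin_on[OF Fb] FT c f t in auto)
    then have "(%n. emb mu ((strang T V (t / real n) ^^ n) f)) \<longlonglongrightarrow> emb mu (R t f)"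
      using pow[OF _ f] t RU[OF t f] by simp
    then show ?thesis
      using tendsto_L2_emb[where g = "%n. (strang T V (t / real n) ^^ n) f" and F = sequentially, OF _ RL[OF t f]] pow[OF _ f] t RL[OF t f]
      by (simp add: R_def)
  qed
qed

section \<open>Real square integrable functions: order, pairing, convergence\<close>

definition R2 :: "'a measure => ('a => real) set" where
  "R2 mu = {f \<in> borel_measurable mu. integrable mu (%x. (f x)^2)}"

definition rn :: "'a measure => ('a => real) => real" where
  "rn mu f = sqrt (\<integral>x. (f x)^2 \<partial>mu)"

definition ip :: "'a measure => ('a => real) => ('a => real) => real" where
  "ip mu f g = (\<integral>x. f x * g x \<partial>mu)"

lemma R2_L2_iff: "f \<in> R2 mu \<longleftrightarrow> (%x. cor (f x)) \<in> L2 mu"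
proof -
  have "f \<in> borel_measurable mu" if m: "(%x. cor (f x)) \<in> borel_measurable mu"
  proof -
    have "(%x. Re (cor (f x))) \<in> borel_measurable mu" using m by measurable
    then show ?thesis by simp
  qed
  moreover have "(%x. cor (f x)) \<in> borel_measurable mu" if [measurable]: "f \<in> borel_measurable mu" by measurable
  ultimately have "f \<in> borel_measurable mu \<longleftrightarrow> (%x. cor (f x)) \<in> borel_measurable mu" by (rule iffI[rotated])
  then show ?thesis by (simp add: R2_def L2_iff)
qed

lemma rn_nrm: "rn mu f = nrm mu (%x. cor (f x))"
  by (simp add: rn_def nrm_def)

lemma rn_nonneg[simp]: "rn mu f >= 0" by (simp add: rn_nrm)
lemma rn_zero[simp]: "rn mu (%x. 0) = 0" by (simp add: rn_def)

lemma R2_borel: "f \<in> R2 mu ==> f \<in> borel_measurable mu" by (simp add: R2_def)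

lemma R2_lincomb: "f \<in> R2 mu ==> g \<in> R2 mu ==> (%x. a * f x + b * g x) \<in> R2 mu"
  using L2_lincomb[of "%x. cor (f x)" mu "%x. cor (g x)" "cor a" "cor b"]
  by (simp add: R2_L2_iff)

lemma R2_add: "f \<in> R2 mu ==> g \<in> R2 mu ==> (%x. f x + g x) \<in> R2 mu"
  and R2_diff: "f \<in> R2 mu ==> g \<in> R2 mu ==> (%x. f x - g x) \<in> R2 mu"
  and R2_scale: "f \<in> R2 mu ==> (%x. a * f x) \<in> R2 mu"
  and R2_0: "(%x. 0) \<in> R2 mu"
  using R2_lincomb[of f mu g 1 1] R2_lincomb[of f mu g 1 "-1"] R2_lincomb[of f mu f a 0] by (auto simp: R2_def)

lemma R2_mono:
  assumes "f \<in> borel_measurable mu" "g \<in> R2 mu" "AE x in mu. \<bar>f x\<bar> <= \<bar>g x\<bar>"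
  shows "f \<in> R2 mu" "rn mu f <= rn mu g"
  using nrm_mono[of "%x. cor (f x)" mu "%x. cor (g x)"] assms
  by (auto simp: R2_L2_iff rn_nrm)

lemma rn_cong: "f \<in> borel_measurable mu ==> g \<in> borel_measurable mu ==> (AE x in mu. f x = g x) ==> rn mu f = rn mu g"
  unfolding rn_def by (intro arg_cong[where f = sqrt] integral_cong_AE) auto

lemma R2_bounded_mult:
  assumes "f \<in> R2 mu" "m \<in> borel_measurable mu" "!!x. \<bar>m x\<bar> <= C"
  shows "(%x. m x * f x) \<in> R2 mu" "rn mu (%x. m x * f x) <= C * rn mu f"
  using L2_bounded_mult[of "%x. cor (f x)" mu m C] assms by (simp_all add: R2_L2_iff rn_nrm)

lemma rn_triangle: "f \<in> R2 mu ==> g \<in> R2 mu ==> rn mu (%x. f x + g x) <= rn mu f + rn mu g"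
  using nrm_triangle[of "%x. cor (f x)" mu "%x. cor (g x)"] by (simp add: R2_L2_iff rn_nrm)

lemma rn_scale: "rn mu (%x. a * f x) = \<bar>a\<bar> * rn mu f"
  by (simp add: rn_def power_mult_distrib real_sqrt_mult)

lemma rn_minus_commute: "rn mu (%x. f x - g x) = rn mu (%x. g x - f x)"
  by (simp add: rn_def power2_commute)

lemma rn_triangle_diff:
  assumes "f \<in> R2 mu" "g \<in> R2 mu" "h \<in> R2 mu"
  shows "rn mu (%x. f x - h x) <= rn mu (%x. f x - g x) + rn mu (%x. g x - h x)"
  using rn_triangle[OF R2_diff[OF assms(1,2)] R2_diff[OF assms(2,3)]] by simp

lemma rn_0_iff: "f \<in> R2 mu ==> rn mu f = 0 \<longleftrightarrow> (AE x in mu. f x = 0)"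
  using nrm_0_iff[of "%x. cor (f x)" mu] by (simp add: R2_L2_iff rn_nrm)

lemma rn_sq: "(rn mu f)^2 = (\<integral>x. (f x)^2 \<partial>mu)" by (simp add: rn_def integral_nonneg_AE)

lemma ip_self: "ip mu f f = (rn mu f)^2" by (simp add: ip_def rn_sq) (simp add: power2_eq_square)

lemma ip_integrable: "f \<in> R2 mu ==> g \<in> R2 mu ==> integrable mu (%x. f x * g x)"
proof -
  assume f: "f \<in> R2 mu" and g: "g \<in> R2 mu"
  have "integrable mu (%x. norm (f x * g x))"
    using L2_mult_integrable(1)[of "%x. cor (f x)" mu "%x. cor (g x)"] f g
    by (simp add: R2_L2_iff abs_mult)
  then show ?thesis using R2_borel[OF f] R2_borel[OF g] by (subst (asm) integrable_norm_iff) auto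
qed

lemma ip_bound: assumes f: "f \<in> R2 mu" and g: "g \<in> R2 mu" shows "\<bar>ip mu f g\<bar> <= rn mu f * rn mu g"
proof -
  have "\<bar>ip mu f g\<bar> <= (\<integral>x. \<bar>f x * g x\<bar> \<partial>mu)" unfolding ip_def using integral_norm_bound[of mu "%x. f x * g x"] by simp
  also have "... = (\<integral>x. cmod (cor (f x)) * cmod (cor (g x)) \<partial>mu)" by (simp add: abs_mult)
  also have "... <= rn mu f * rn mu g" unfolding rn_nrm using f g by (intro Cauchy_Schwarz_L2) (auto simp: R2_L2_iff)
  finally show ?thesis .
qed

lemma ip_commute: "ip mu f g = ip mu g f" by (simp add: ip_def mult.commute)

lemma ip_lincomb: "f \<in> R2 mu ==> g \<in> R2 mu ==> h \<in> R2 mu ==> ip mu (%x. a * f x + b * g x) h = a * ip mu f h + b * ip mu g h"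
proof -
  assume h: "f \<in> R2 mu" "g \<in> R2 mu" "h \<in> R2 mu"
  have "ip mu (%x. a * f x + b * g x) h = (\<integral>x. a * (f x * h x) + b * (g x * h x) \<partial>mu)"
    by (simp add: ip_def algebra_simps)
  then show ?thesis using ip_integrable[OF h(1,3)] ip_integrable[OF h(2,3)] by (simp add: ip_def)
qed

lemma ip_diff: "f \<in> R2 mu ==> g \<in> R2 mu ==> h \<in> R2 mu ==> ip mu (%x. f x - g x) h = ip mu f h - ip mu g h"
  using ip_lincomb[of f mu g h 1 "-1"] by simp

lemma ip_cong: "f \<in> R2 mu ==> f' \<in> R2 mu ==> g \<in> R2 mu ==> (AE x in mu. f x = f' x) ==> ip mu f g = ip mu f' g"
  unfolding ip_def by (intro integral_cong_AE borel_measurable_times R2_borel) auto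

lemma ip_mono: "f \<in> R2 mu ==> f' \<in> R2 mu ==> g \<in> R2 mu ==> (AE x in mu. f x <= f' x) ==> (AE x in mu. 0 <= g x) ==> ip mu f g <= ip mu f' g"
  unfolding ip_def by (intro integral_mono_AE ip_integrable) (auto intro: mult_right_mono elim: eventually_elim2)

lemma ip_nonneg: "(AE x in mu. 0 <= f x) ==> (AE x in mu. 0 <= g x) ==> 0 <= ip mu f g"
  unfolding ip_def by (intro integral_nonneg_AE) (auto elim: eventually_elim2)

definition Rlim :: "'a measure => (nat => 'a => real) => ('a => real) => bool" where
  "Rlim mu a b \<longleftrightarrow> (\<forall>n. a n \<in> R2 mu) \<and> b \<in> R2 mu \<and> (%n. rn mu (%x. a n x - b x)) \<longlonglongrightarrow> 0"

lemma RlimD: "Rlim mu a b ==> a n \<in> R2 mu" "Rlim mu a b ==> b \<in> R2 mu" "Rlim mu a b ==> (%n. rn mu (%x. a n x - b x)) \<longlonglongrightarrow> 0"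
  by (auto simp: Rlim_def)

lemma Rlim_const: "a \<in> R2 mu ==> Rlim mu (%_. a) a" by (simp add: Rlim_def)

lemma Rlim_lincomb:
  assumes a: "Rlim mu a a'" and b: "Rlim mu b b'"
  shows "Rlim mu (%n x. c * a n x + d * b n x) (%x. c * a' x + d * b' x)"
  unfolding Rlim_def
proof (intro conjI allI)
  note A = RlimD[OF a] and B = RlimD[OF b]
  show "(%x. c * a n x + d * b n x) \<in> R2 mu" for n by (intro R2_lincomb A B)
  show "(%x. c * a' x + d * b' x) \<in> R2 mu" by (intro R2_lincomb A B)
  have z: "(%n. \<bar>c\<bar> * rn mu (%x. a n x - a' x) + \<bar>d\<bar> * rn mu (%x. b n x - b' x)) \<longlonglongrightarrow> 0"
    using tendsto_add[OF tendsto_mult_right_zero[OF A(3), of "\<bar>c\<bar>"] tendsto_mult_right_zero[OF B(3), of "\<bar>d\<bar>"]] by simp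
  show "(%n. rn mu (%x. (c * a n x + d * b n x) - (c * a' x + d * b' x))) \<longlonglongrightarrow> 0"
  proof (rule Lim_null_comparison[OF always_eventually z], rule allI)
    fix n
    have "(%x. (c * a n x + d * b n x) - (c * a' x + d * b' x)) = (%x. c * (a n x - a' x) + d * (b n x - b' x))"
      by (simp add: algebra_simps)
    then show "norm (rn mu (%x. (c * a n x + d * b n x) - (c * a' x + d * b' x))) <= \<bar>c\<bar> * rn mu (%x. a n x - a' x) + \<bar>d\<bar> * rn mu (%x. b n x - b' x)"
      using rn_triangle[OF R2_scale[OF R2_diff[OF A(1)[of n] A(2)], of c] R2_scale[OF R2_diff[OF B(1)[of n] B(2)], of d]]
      by (simp add: rn_scale)
  qed
qed

lemma Rlim_diff: "Rlim mu a a' ==> Rlim mu b b' ==> Rlim mu (%n x. a n x - b n x) (%x. a' x - b' x)"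
  using Rlim_lincomb[of mu a a' b b' 1 "-1"] by simp

text \<open>Where a n <= b n, the positive part of a' - b' is at most the modulus of (a n - b n) -
  (a' - b'), whose norm tends to 0.\<close>

lemma Rlim_le:
  assumes a: "Rlim mu a a'" and b: "Rlim mu b b'" and le: "\<forall>\<^sub>F n in sequentially. AE x in mu. a n x <= b n x"
  shows "AE x in mu. a' x <= b' x"
proof -
  note A = RlimD[OF a] and B = RlimD[OF b]
  define p where "p = (%x. max (a' x - b' x) 0)"
  have pm: "p \<in> borel_measurable mu" unfolding p_def using R2_borel[OF A(2)] R2_borel[OF B(2)] by measurable
  have pL: "p \<in> R2 mu"
    by (rule R2_mono(1)[OF pm R2_diff[OF A(2) B(2)]]) (auto simp: p_def)
  have D: "Rlim mu (%n x. a n x - b n x) (%x. a' x - b' x)" by (rule Rlim_diff[OF a b])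
  have "\<forall>\<^sub>F n in sequentially. rn mu p <= rn mu (%x. (a n x - b n x) - (a' x - b' x))"
    using le
  proof eventually_elim
    case (elim n)
    show ?case
    proof (rule R2_mono(2)[OF pm])
      show "(%x. (a n x - b n x) - (a' x - b' x)) \<in> R2 mu" by (intro R2_diff A B)
      show "AE x in mu. \<bar>p x\<bar> <= \<bar>(a n x - b n x) - (a' x - b' x)\<bar>" using elim by eventually_elim (auto simp: p_def)
    qed
  qed
  then have "rn mu p <= 0" by (rule tendsto_lowerbound[OF RlimD(3)[OF D]]) simp
  then have "rn mu p = 0" by (simp add: order_antisym)
  then have "AE x in mu. p x = 0" using rn_0_iff[OF pL] by simp
  then show ?thesis by eventually_elim (auto simp: p_def max_def split: if_splits)
qed

lemma Rlim_ip:
  assumes a: "Rlim mu a a'" and g: "g \<in> R2 mu"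
  shows "(%n. ip mu (a n) g) \<longlonglongrightarrow> ip mu a' g"
proof -
  note A = RlimD[OF a]
  have "(%n. rn mu (%x. a n x - a' x) * rn mu g) \<longlonglongrightarrow> 0" by (rule tendsto_mult_left_zero[OF A(3)])
  then have "(%n. ip mu (a n) g - ip mu a' g) \<longlonglongrightarrow> 0"
    by (rule Lim_null_comparison[rotated]) (use ip_bound[OF R2_diff[OF A(1) A(2)] g] in \<open>auto simp: ip_diff[OF A(1) A(2) g]\<close>)
  then show ?thesis by (rule LIM_zero_cancel)
qed

lemma Rlim_rn:
  assumes a: "Rlim mu a a'" shows "(%n. rn mu (a n)) \<longlonglongrightarrow> rn mu a'"
proof -
  note A = RlimD[OF a]
  have "\<bar>rn mu (a n) - rn mu a'\<bar> <= rn mu (%x. a n x - a' x)" for n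
    using rn_triangle[OF R2_diff[OF A(1)[of n] A(2)] A(2)] rn_triangle[OF R2_diff[OF A(2) A(1)[of n]] A(1)[of n]]
      rn_minus_commute[of mu "a n" a'] by simp
  then have "(%n. rn mu (a n) - rn mu a') \<longlonglongrightarrow> 0" by (intro Lim_null_comparison[OF always_eventually A(3)]) auto
  then show ?thesis by (rule LIM_zero_cancel)
qed

lemma R2_complete:
  fixes f :: "nat => 'a => real"
  assumes f: "!!n. f n \<in> R2 mu" and C: "!!e. e > 0 ==> \<exists>N. \<forall>m\<ge>N. \<forall>n\<ge>N. rn mu (%x. f m x - f n x) <= e"
  shows "\<exists>g. Rlim mu f g"
proof -
  have "\<exists>g\<in>L2 mu. (%n. nrm mu (%x. cor (f n x) - g x)) \<longlonglongrightarrow> 0"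
    by (rule L2_complete) (use f C in \<open>auto simp: R2_L2_iff rn_nrm\<close>)
  then obtain g where g: "g \<in> L2 mu" "(%n. nrm mu (%x. cor (f n x) - g x)) \<longlonglongrightarrow> 0" by auto
  have Rm: "(%x. Re (g x)) \<in> borel_measurable mu" using L2_borel[OF g(1)] by measurable
  have gR: "(%x. Re (g x)) \<in> R2 mu" unfolding R2_L2_iff
    by (rule nrm_mono(1)[OF _ g(1)]) (use Rm abs_Re_le_cmod in auto)
  have "rn mu (%x. f n x - Re (g x)) <= nrm mu (%x. cor (f n x) - g x)" for n
    unfolding rn_nrm
  proof (rule nrm_mono(2))
    show "(%x. cor (f n x - Re (g x))) \<in> borel_measurable mu" using Rm R2_borel[OF f[of n]] by measurable
    show "(%x. cor (f n x) - g x) \<in> L2 mu" using L2_diff[OF _ g(1)] f by (auto simp: R2_L2_iff)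
    have "cmod (cor (f n x - Re (g x))) <= cmod (cor (f n x) - g x)" for x
      using abs_Re_le_cmod[of "cor (f n x) - g x"] by (simp del: of_real_diff)
    then show "AE x in mu. cmod (cor (f n x - Re (g x))) <= cmod (cor (f n x) - g x)" by simp
  qed
  then have "(%n. rn mu (%x. f n x - Re (g x))) \<longlonglongrightarrow> 0"
    by (intro Lim_null_comparison[OF always_eventually g(2)]) auto
  then show ?thesis using f gR by (auto simp: Rlim_def)
qed

section \<open>Positive operators and geometric means\<close>

definition posop :: "'a measure => (('a => real) => 'a => real) => bool" where
  "posop mu Q \<longleftrightarrow> (\<forall>f\<in>R2 mu. Q f \<in> R2 mu) \<and>
    (\<forall>f\<in>R2 mu. \<forall>g\<in>R2 mu. \<forall>a b. AE x in mu. Q (%y. a * f y + b * g y) x = a * Q f x + b * Q g x) \<and>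
    (\<forall>f\<in>R2 mu. (AE x in mu. 0 <= f x) \<longrightarrow> (AE x in mu. 0 <= Q f x)) \<and>
    (\<exists>C. \<forall>f\<in>R2 mu. rn mu (Q f) <= C * rn mu f)"

lemma posopD:
  assumes "posop mu Q"
  shows "!!f. f \<in> R2 mu ==> Q f \<in> R2 mu"
    "!!f g a b. f \<in> R2 mu ==> g \<in> R2 mu ==> AE x in mu. Q (%y. a * f y + b * g y) x = a * Q f x + b * Q g x"
    "!!f. f \<in> R2 mu ==> AE x in mu. 0 <= f x ==> AE x in mu. 0 <= Q f x"
    "!!f g. f \<in> R2 mu ==> g \<in> R2 mu ==> AE x in mu. Q (%y. f y - g y) x = Q f x - Q g x"
    "!!f g. f \<in> R2 mu ==> g \<in> R2 mu ==> AE x in mu. Q (%y. f y + g y) x = Q f x + Q g x"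
proof -
  show 1: "!!f. f \<in> R2 mu ==> Q f \<in> R2 mu" "!!f. f \<in> R2 mu ==> AE x in mu. 0 <= f x ==> AE x in mu. 0 <= Q f x"
    and 2: "!!f g a b. f \<in> R2 mu ==> g \<in> R2 mu ==> AE x in mu. Q (%y. a * f y + b * g y) x = a * Q f x + b * Q g x"
    using assms by (auto simp: posop_def)
  show "!!f g. f \<in> R2 mu ==> g \<in> R2 mu ==> AE x in mu. Q (%y. f y - g y) x = Q f x - Q g x"
    "!!f g. f \<in> R2 mu ==> g \<in> R2 mu ==> AE x in mu. Q (%y. f y + g y) x = Q f x + Q g x"
    using 2[of _ _ 1 "-1"] 2[of _ _ 1 1] by auto
qed

lemma posop_mono:
  assumes Q: "posop mu Q" and f: "f \<in> R2 mu" and g: "g \<in> R2 mu" and le: "AE x in mu. f x <= g x"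
  shows "AE x in mu. Q f x <= Q g x"
proof -
  have "AE x in mu. 0 <= Q (%y. g y - f y) x"
    by (rule posopD(3)[OF Q R2_diff[OF g f]]) (use le in auto)
  then show ?thesis using posopD(4)[OF Q g f] by eventually_elim simp
qed

lemma posop_cong:
  assumes Q: "posop mu Q" and f: "f \<in> R2 mu" and g: "g \<in> R2 mu" and e: "AE x in mu. f x = g x"
  shows "AE x in mu. Q f x = Q g x"
proof -
  have "AE x in mu. Q f x <= Q g x" by (rule posop_mono[OF Q f g]) (use e in auto)
  moreover have "AE x in mu. Q g x <= Q f x" by (rule posop_mono[OF Q g f]) (use e in auto)
  ultimately show ?thesis by eventually_elim simp
qed

lemma posop_bound:
  assumes Q: "posop mu Q" obtains C where "C > 0" "!!f. f \<in> R2 mu ==> rn mu (Q f) <= C * rn mu f"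
proof -
  obtain C where C: "\<forall>f\<in>R2 mu. rn mu (Q f) <= C * rn mu f" using Q unfolding posop_def by blast
  show thesis
  proof (rule that[of "max C 1"])
    show "rn mu (Q f) <= max C 1 * rn mu f" if "f \<in> R2 mu" for f
      using C that by (intro order_trans[OF bspec[OF C that] mult_right_mono]) auto
  qed simp
qed

lemma posop_Rlim:
  assumes Q: "posop mu Q" and a: "Rlim mu a a'"
  shows "Rlim mu (%n. Q (a n)) (Q a')"
  unfolding Rlim_def
proof (intro conjI allI)
  note A = RlimD[OF a]
  show "Q (a n) \<in> R2 mu" for n by (intro posopD(1)[OF Q] A)
  show "Q a' \<in> R2 mu" by (intro posopD(1)[OF Q] A)
  obtain C where C: "C > 0" "!!f. f \<in> R2 mu ==> rn mu (Q f) <= C * rn mu f" using posop_bound[OF Q] by blast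
  have z: "(%n. C * rn mu (%x. a n x - a' x)) \<longlonglongrightarrow> 0" by (rule tendsto_mult_right_zero[OF A(3)])
  show "(%n. rn mu (%x. Q (a n) x - Q a' x)) \<longlonglongrightarrow> 0"
  proof (rule Lim_null_comparison[OF always_eventually z], rule allI)
    fix n
    have "rn mu (%x. Q (a n) x - Q a' x) = rn mu (Q (%x. a n x - a' x))"
    proof (rule rn_cong)
      show "(%x. Q (a n) x - Q a' x) \<in> borel_measurable mu" by (intro R2_borel R2_diff posopD(1)[OF Q] A)
      show "Q (%x. a n x - a' x) \<in> borel_measurable mu" by (intro R2_borel R2_diff posopD(1)[OF Q] A)
      show "AE x in mu. Q (a n) x - Q a' x = Q (%x. a n x - a' x) x" using posopD(4)[OF Q A(1)[of n] A(2)] by eventually_elim simp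
    qed
    then show "norm (rn mu (%x. Q (a n) x - Q a' x)) <= C * rn mu (%x. a n x - a' x)"
      using C(2)[OF R2_diff[OF A(1)[of n] A(2)]] by simp
  qed
qed

text \<open>One inequality with a geometric mean is equivalent to a family of linear ones, and
  countably many z suffice to interchange the quantifiers. Positive operators and limits can then
  act on each linear inequality.\<close>

lemma AE_le_weighted_am_gm:
  fixes a b c :: "'a => real"
  assumes l: "0 < l" "l < 1" and bc: "AE x in mu. 0 <= b x" "AE x in mu. 0 <= c x"
  shows "(AE x in mu. a x <= b x powr (1 - l) * c x powr l) \<longleftrightarrow>
    (\<forall>z>0. AE x in mu. a x <= (1 - l) * z powr l * b x + l * z powr (l - 1) * c x)"
proof
  assume a: "AE x in mu. a x <= b x powr (1 - l) * c x powr l"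
  show "\<forall>z>0. AE x in mu. a x <= (1 - l) * z powr l * b x + l * z powr (l - 1) * c x"
  proof (intro allI impI)
    fix z :: real assume z: "z > 0"
    show "AE x in mu. a x <= (1 - l) * z powr l * b x + l * z powr (l - 1) * c x"
      using a bc by eventually_elim (use le_weighted_am_gm[OF l _ _ z] order_trans in blast)
  qed
next
  assume a: "\<forall>z>0. AE x in mu. a x <= (1 - l) * z powr l * b x + l * z powr (l - 1) * c x"
  have "AE x in mu. \<forall>z\<in>\<rat> \<inter> {0<..}. a x <= (1 - l) * z powr l * b x + l * z powr (l - 1) * c x"
    using a by (subst AE_ball_countable) (auto intro: countable_subset[OF _ countable_rat])
  then show "AE x in mu. a x <= b x powr (1 - l) * c x powr l"
    using bc by eventually_elim (rule weighted_am_gm_optimal[OF l], auto)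
qed

text \<open>Hoelder's inequality for an abstract positive operator; no kernel representation enters,
  only the linear inequalities for all z.\<close>

lemma posop_weighted_am_gm:
  assumes Q: "posop mu Q" and l: "0 < l" "l < 1" and R: "a \<in> R2 mu" "b \<in> R2 mu" "c \<in> R2 mu"
    and bc: "AE x in mu. 0 <= b x" "AE x in mu. 0 <= c x"
    and le: "AE x in mu. a x <= b x powr (1 - l) * c x powr l"
  shows "AE x in mu. Q a x <= Q b x powr (1 - l) * Q c x powr l"
proof -
  have "AE x in mu. Q a x <= (1 - l) * z powr l * Q b x + l * z powr (l - 1) * Q c x" if z: "z > 0" for z
  proof -
    have "AE x in mu. a x <= (1 - l) * z powr l * b x + l * z powr (l - 1) * c x"
      using le z AE_le_weighted_am_gm[OF l bc, of a] by blast
    from posop_mono[OF Q R(1) R2_lincomb[OF R(2,3)] this] posopD(2)[OF Q R(2,3), of "(1 - l) * z powr l" "l * z powr (l - 1)"]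
    show ?thesis by eventually_elim simp
  qed
  then show ?thesis
    using AE_le_weighted_am_gm[OF l posopD(3)[OF Q R(2) bc(1)] posopD(3)[OF Q R(3) bc(2)], of "Q a"] by blast
qed

lemma Rlim_weighted_am_gm:
  assumes l: "0 < l" "l < 1" and A: "Rlim mu a a'" and B: "Rlim mu b b'" and C: "Rlim mu c c'"
    and b: "!!n. AE x in mu. 0 <= b n x" and c: "!!n. AE x in mu. 0 <= c n x"
    and le: "!!n. AE x in mu. a n x <= b n x powr (1 - l) * c n x powr l"
  shows "AE x in mu. a' x <= b' x powr (1 - l) * c' x powr l"
proof -
  have z0: "Rlim mu (%n x. 0) (%x. 0)" by (rule Rlim_const[OF R2_0])
  have b': "AE x in mu. 0 <= b' x" by (rule Rlim_le[OF z0 B]) (use b in auto)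
  have c': "AE x in mu. 0 <= c' x" by (rule Rlim_le[OF z0 C]) (use c in auto)
  have "AE x in mu. a' x <= (1 - l) * z powr l * b' x + l * z powr (l - 1) * c' x" if z: "z > 0" for z
  proof (rule Rlim_le[OF A Rlim_lincomb[OF B C] always_eventually], rule allI)
    fix n
    show "AE x in mu. a n x <= (1 - l) * z powr l * b n x + l * z powr (l - 1) * c n x"
      using le[of n] z AE_le_weighted_am_gm[OF l b[of n] c[of n], of "a n"] by blast
  qed
  then show ?thesis using AE_le_weighted_am_gm[OF l b' c', of a'] by blast
qed

definition ople :: "'a measure => (('a => real) => 'a => real) => (('a => real) => 'a => real) => bool" where
  "ople mu P Q \<longleftrightarrow> (\<forall>f\<in>R2 mu. (AE x in mu. 0 <= f x) \<longrightarrow> (AE x in mu. P f x <= Q f x))"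

lemma opleD: "ople mu P Q ==> f \<in> R2 mu ==> AE x in mu. 0 <= f x ==> AE x in mu. P f x <= Q f x"
  by (simp add: ople_def)

lemma posop_comp:
  assumes P: "posop mu P" and Q: "posop mu Q"
  shows "posop mu (%f. P (Q f))"
proof -
  obtain C where C: "C > 0" "!!f. f \<in> R2 mu ==> rn mu (P f) <= C * rn mu f" using posop_bound[OF P] by blast
  obtain D where D: "D > 0" "!!f. f \<in> R2 mu ==> rn mu (Q f) <= D * rn mu f" using posop_bound[OF Q] by blast
  note p = posopD[OF P] and q = posopD[OF Q]
  show ?thesis unfolding posop_def
  proof (intro conjI ballI allI impI exI[of _ "C * D"])
    fix f g a b assume f: "f \<in> R2 mu" and g: "g \<in> R2 mu"
    have "AE x in mu. P (Q (%y. a * f y + b * g y)) x = P (%y. a * Q f y + b * Q g y) x"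
      by (rule posop_cong[OF P q(1)[OF R2_lincomb[OF f g]] R2_lincomb[OF q(1)[OF f] q(1)[OF g]] q(2)[OF f g]])
    then show "AE x in mu. P (Q (%y. a * f y + b * g y)) x = a * P (Q f) x + b * P (Q g) x"
      using p(2)[OF q(1)[OF f] q(1)[OF g], of a b] by eventually_elim simp
  next
    fix f assume f: "f \<in> R2 mu"
    show "P (Q f) \<in> R2 mu" by (rule p(1)[OF q(1)[OF f]])
    show "AE x in mu. 0 <= P (Q f) x" if "AE x in mu. 0 <= f x" by (rule p(3)[OF q(1)[OF f] q(3)[OF f that]])
    have "rn mu (P (Q f)) <= C * rn mu (Q f)" by (rule C(2)[OF q(1)[OF f]])
    also have "... <= C * (D * rn mu f)" using C D f by (intro mult_left_mono) auto
    finally show "rn mu (P (Q f)) <= C * D * rn mu f" by simp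
  qed
qed

lemma posop_id: "posop mu (%f. f)"
  unfolding posop_def by (auto intro: exI[of _ 1])

lemma posop_funpow: "posop mu P ==> posop mu (P ^^ n)"
  by (induction n) (use posop_id posop_comp in \<open>auto simp: id_def o_def\<close>)

lemma posop_mult:
  assumes "m \<in> borel_measurable mu" "!!x. \<bar>m x\<bar> <= C" "!!x. 0 <= m x"
  shows "posop mu (%f x. m x * f x)"
  unfolding posop_def
  using R2_bounded_mult[OF _ assms(1,2)] assms(3) by (auto intro!: exI[of _ C] simp: algebra_simps)

lemma ople_funpow:
  assumes P: "posop mu P" and Q: "posop mu Q" and le: "ople mu P Q"
  shows "ople mu (P ^^ n) (Q ^^ n)"
  unfolding ople_def
proof (intro ballI impI)
  fix f assume f: "f \<in> R2 mu" "AE x in mu. 0 <= f x"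
  show "AE x in mu. (P ^^ n) f x <= (Q ^^ n) f x"
  proof (induction n)
    case (Suc n)
    note Pn = posopD(1,3)[OF posop_funpow[OF P, of n]] and Qn = posopD(1,3)[OF posop_funpow[OF Q, of n]]
    have "AE x in mu. P ((P ^^ n) f) x <= P ((Q ^^ n) f) x" by (rule posop_mono[OF P Pn(1) Qn(1) Suc]) (use f in auto)
    moreover have "AE x in mu. P ((Q ^^ n) f) x <= Q ((Q ^^ n) f) x" by (rule opleD[OF le Qn(1) Qn(2)]) (use f in auto)
    ultimately show ?case by (auto elim: eventually_elim2)
  qed simp
qed

text \<open>With X, Y, Z, W the n-th iterates of A, A0, B, B0, one has A X - A0 Y = A (X - Y) + (A -
  A0) Y <= B (Z - W) + (B - B0) Y, and (B - B0) Y <= (B - B0) W since Y <= W. It carries a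
  comparison of increments through Trotter products.\<close>

lemma funpow_increment_le:
  assumes A: "posop mu A" and A0: "posop mu A0" and B: "posop mu B" and B0: "posop mu B0"
    and AB: "ople mu A B" and A0B0: "ople mu A0 B0" and A0A: "ople mu A0 A" and B0B: "ople mu B0 B"
    and inc: "!!h. h \<in> R2 mu ==> AE x in mu. 0 <= h x ==> AE x in mu. A h x - A0 h x <= B h x - B0 h x"
    and f: "f \<in> R2 mu" "AE x in mu. 0 <= f x"
  shows "AE x in mu. (A ^^ n) f x - (A0 ^^ n) f x <= (B ^^ n) f x - (B0 ^^ n) f x"
proof (induction n)
  case (Suc n)
  define X where "X = (A ^^ n) f" define Y where "Y = (A0 ^^ n) f"
  define Z where "Z = (B ^^ n) f" define W where "W = (B0 ^^ n) f"
  have R: "X \<in> R2 mu" "Y \<in> R2 mu" "Z \<in> R2 mu" "W \<in> R2 mu"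
    unfolding X_def Y_def Z_def W_def using posopD(1)[OF posop_funpow] A A0 B B0 f by auto
  have pos: "AE x in mu. 0 <= Y x" unfolding Y_def by (rule posopD(3)[OF posop_funpow[OF A0] f])
  have YX: "AE x in mu. Y x <= X x" unfolding X_def Y_def by (rule opleD[OF ople_funpow[OF A0 A A0A] f])
  have YW: "AE x in mu. Y x <= W x" unfolding W_def Y_def by (rule opleD[OF ople_funpow[OF A0 B0 A0B0] f])
  have XY: "(%x. X x - Y x) \<in> R2 mu" "AE x in mu. 0 <= X x - Y x" using R YX by (auto intro: R2_diff)
  have WY: "(%x. W x - Y x) \<in> R2 mu" "AE x in mu. 0 <= W x - Y x" using R YW by (auto intro: R2_diff)
  have ZW: "(%x. Z x - W x) \<in> R2 mu" using R by (auto intro: R2_diff)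
  have IH: "AE x in mu. X x - Y x <= Z x - W x" using Suc by (simp add: X_def Y_def Z_def W_def)
  have "AE x in mu. A X x - A0 Y x <= B Z x - B0 W x"
    using posopD(4)[OF A R(1,2)] opleD[OF AB XY] posop_mono[OF B XY(1) ZW IH] posopD(4)[OF B R(3,4)]
      inc[OF R(2) pos] opleD[OF B0B WY] posopD(4)[OF B R(4,2)] posopD(4)[OF B0 R(4,2)]
    by eventually_elim linarith
  then show ?case by (simp add: X_def Y_def Z_def W_def)
qed simp

section \<open>Bounded potentials on real functions: monotonicity, symmetry, log-convexity\<close>

definition rstrang :: "(real => ('a => real) => 'a => real) => ('a => real) => real => ('a => real) => 'a => real" where
  "rstrang Q V s f = (%x. exp (- (s * V x / 2)) * Q s (%y. exp (- (s * V y / 2)) * f y) x)"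

definition bdd :: "'a measure => ('a => real) => bool" where
  "bdd mu V \<longleftrightarrow> V \<in> borel_measurable mu \<and> (\<exists>K. \<forall>x. \<bar>V x\<bar> <= K)"

lemma bdd_scale:
  assumes "bdd mu U" shows "bdd mu (%x. c * U x)"
proof -
  obtain K where K: "!!x. \<bar>U x\<bar> <= K" using assms by (auto simp: bdd_def)
  have "\<bar>c * U x\<bar> <= \<bar>c\<bar> * K" for x unfolding abs_mult by (intro mult_left_mono K) auto
  then show ?thesis using assms by (auto simp: bdd_def)
qed

lemma bdd_exp:
  assumes V: "bdd mu V" and s: "s >= 0"
  obtains C where "(%x. exp (- (s * V x / 2))) \<in> borel_measurable mu" "!!x. \<bar>exp (- (s * V x / 2))\<bar> <= C"
proof -
  obtain K where K: "!!x. \<bar>V x\<bar> <= K" using V by (auto simp: bdd_def)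
  have "V \<in> borel_measurable mu" using V by (simp add: bdd_def)
  then have "(%x. exp (- (s * V x / 2))) \<in> borel_measurable mu" by measurable
  moreover have "\<bar>exp (- (s * V x / 2))\<bar> <= exp (s * K / 2)" for x
  proof -
    have "s * (- V x) <= s * K" using K[of x] s by (intro mult_left_mono) auto
    then show ?thesis by simp
  qed
  ultimately show thesis using that by blast
qed

text \<open>The data on which the order arguments rest: \<open>Q\<close> is the given semigroup and
  \<open>R V\<close> the one with bounded potential V, both on real functions. The Trotter formula
  is the link between the two.\<close>

locale perturbed_family =
  fixes mu :: "'a measure" and Q :: "real => ('a => real) => 'a => real"
    and R :: "('a => real) => real => ('a => real) => 'a => real"
  assumes Q: "!!t. t >= 0 ==> posop mu (Q t)"
    and Q_contraction: "!!t f. t >= 0 ==> f \<in> R2 mu ==> rn mu (Q t f) <= rn mu f"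
    and Q_add: "!!s t f. s >= 0 ==> t >= 0 ==> f \<in> R2 mu ==> AE x in mu. Q (s + t) f x = Q s (Q t f) x"
    and Q_0: "!!f. f \<in> R2 mu ==> AE x in mu. Q 0 f x = f x"
    and Q_sym: "!!t f g. t >= 0 ==> f \<in> R2 mu ==> g \<in> R2 mu ==> ip mu (Q t f) g = ip mu f (Q t g)"
    and R: "!!V t. bdd mu V ==> t >= 0 ==> posop mu (R V t)"
    and R_add: "!!V s t f. bdd mu V ==> s >= 0 ==> t >= 0 ==> f \<in> R2 mu ==> AE x in mu. R V (s + t) f x = R V s (R V t f) x"
    and R_Trotter: "!!V t f. bdd mu V ==> t >= 0 ==> f \<in> R2 mu ==> Rlim mu (%n. (rstrang Q V (t / real n) ^^ n) f) (R V t f)"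
begin

lemma rstrang_posop: "bdd mu V ==> s >= 0 ==> posop mu (rstrang Q V s)"
proof -
  assume V: "bdd mu V" and s: "s >= 0"
  obtain C where C: "(%x. exp (- (s * V x / 2))) \<in> borel_measurable mu" "!!x. \<bar>exp (- (s * V x / 2))\<bar> <= C"
    using bdd_exp[OF V s] by blast
  have "posop mu (%f x. exp (- (s * V x / 2)) * f x)" by (rule posop_mult[OF C]) auto
  from posop_comp[OF this posop_comp[OF Q[OF s] this]] show ?thesis by (simp add: rstrang_def[abs_def])
qed

lemma exp_mult_R2: "bdd mu V ==> s >= 0 ==> f \<in> R2 mu ==> (%x. exp (- (s * V x / 2)) * f x) \<in> R2 mu"
  by (rule bdd_exp) (assumption | rule R2_bounded_mult(1))+

lemma rstrang_mono:
  assumes V: "bdd mu V" "bdd mu V'" and le: "!!x. V x <= V' x" and s: "s >= 0"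
  shows "ople mu (rstrang Q V' s) (rstrang Q V s)"
  unfolding ople_def
proof (intro ballI impI)
  fix f assume f: "f \<in> R2 mu" "AE x in mu. 0 <= f x"
  note m = exp_mult_R2[OF V(1) s f(1)] exp_mult_R2[OF V(2) s f(1)]
  have e: "exp (- (s * V' x / 2)) <= exp (- (s * V x / 2))" for x
    using mult_left_mono[OF le s, of x] by simp
  have "AE x in mu. Q s (%y. exp (- (s * V' y / 2)) * f y) x <= Q s (%y. exp (- (s * V y / 2)) * f y) x"
    by (rule posop_mono[OF Q[OF s] m(2,1)]) (use f(2) e in \<open>auto intro!: mult_right_mono\<close>)
  moreover have "AE x in mu. 0 <= Q s (%y. exp (- (s * V' y / 2)) * f y) x"
    by (rule posopD(3)[OF Q[OF s] m(2)]) (use f(2) in auto)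
  ultimately show "AE x in mu. rstrang Q V' s f x <= rstrang Q V s f x"
    by eventually_elim (auto simp: rstrang_def intro!: mult_mono e)
qed

lemma R_mono:
  assumes V: "bdd mu V" "bdd mu V'" and le: "!!x. V x <= V' x" and t: "t >= 0"
  shows "ople mu (R V' t) (R V t)"
  unfolding ople_def
proof (intro ballI impI)
  fix f assume f: "f \<in> R2 mu" "AE x in mu. 0 <= f x"
  show "AE x in mu. R V' t f x <= R V t f x"
  proof (rule Rlim_le[OF R_Trotter[OF V(2) t f(1)] R_Trotter[OF V(1) t f(1)]], rule always_eventually, rule allI)
    fix n
    have "t / real n >= 0" using t by simp
    then show "AE x in mu. (rstrang Q V' (t / real n) ^^ n) f x <= (rstrang Q V (t / real n) ^^ n) f x"
      by (intro opleD[OF ople_funpow f] rstrang_posop V rstrang_mono le)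
  qed
qed

text \<open>A nonnegative potential P can only shrink the gain caused by deepening the negative part
  from N to N': in a splitting step it enters as a factor e = exp(- s P / 2) <= 1 on either side.
  The gain thus has a bound independent of P.\<close>

lemma R_increment_le:
  assumes V: "bdd mu P" "bdd mu N" "bdd mu N'" and P: "!!x. 0 <= P x" and N: "!!x. N x <= N' x" and t: "t >= 0"
    and f: "f \<in> R2 mu" "AE x in mu. 0 <= f x"
  shows "AE x in mu. R (%x. P x - N' x) t f x - R (%x. P x - N x) t f x <= R (%x. - N' x) t f x - R (%x. - N x) t f x"
proof -
  have b: "bdd mu (%x. P x - N' x)" "bdd mu (%x. P x - N x)" "bdd mu (%x. - N' x)" "bdd mu (%x. - N x)"
    using V unfolding bdd_def by (auto intro!: borel_measurable_diff) (meson abs_triangle_ineq4 add_mono order_trans)+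
  show ?thesis
  proof (rule Rlim_le[OF Rlim_diff[OF R_Trotter[OF b(1) t f(1)] R_Trotter[OF b(2) t f(1)]]
      Rlim_diff[OF R_Trotter[OF b(3) t f(1)] R_Trotter[OF b(4) t f(1)]]], rule always_eventually, rule allI)
    fix n
    define s where "s = t / real n"
    have s: "s >= 0" using t by (simp add: s_def)
    note p = rstrang_posop[OF b(1) s] rstrang_posop[OF b(2) s] rstrang_posop[OF b(3) s] rstrang_posop[OF b(4) s]
    define e where "e x = exp (- (s * P x / 2))" for x
    have e: "0 <= e x" "e x <= 1" for x using P[of x] s by (auto simp: e_def)
    have B0B: "ople mu (rstrang Q (%x. - N x) s) (rstrang Q (%x. - N' x) s)" using N by (intro rstrang_mono b s) auto
    have spl: "rstrang Q (%x. P x - M x) s h x = e x * rstrang Q (%x. - M x) s (%x. e x * h x) x" for M h x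
      by (simp add: rstrang_def e_def mult.assoc[symmetric] flip: exp_add) (simp add: algebra_simps diff_divide_distrib)
    have inc: "AE x in mu. rstrang Q (%x. P x - N' x) s h x - rstrang Q (%x. P x - N x) s h x
        <= rstrang Q (%x. - N' x) s h x - rstrang Q (%x. - N x) s h x"
      if h: "h \<in> R2 mu" "AE x in mu. 0 <= h x" for h
    proof -
      define k where "k = (%x. e x * h x)"
      have k: "k \<in> R2 mu" unfolding k_def e_def by (rule exp_mult_R2[OF V(1) s h(1)])
      have k0: "AE x in mu. 0 <= k x" using h(2) by eventually_elim (simp add: k_def e)
      have hk: "(%x. h x - k x) \<in> R2 mu" by (rule R2_diff[OF h(1) k])
      have hk0: "AE x in mu. 0 <= h x - k x"
        using h(2) by eventually_elim (use e in \<open>auto simp: k_def mult_left_le_one_le\<close>)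
      show ?thesis
        using opleD[OF B0B k k0] opleD[OF B0B hk hk0] posopD(4)[OF p(3) h(1) k] posopD(4)[OF p(4) h(1) k]
      proof eventually_elim
        case (elim x)
        define d where "d = rstrang Q (%x. - N' x) s k x - rstrang Q (%x. - N x) s k x"
        have "e x * d <= d" using elim(1) e by (simp add: d_def mult_left_le_one_le)
        moreover have "rstrang Q (%x. P x - N' x) s h x - rstrang Q (%x. P x - N x) s h x = e x * d"
          unfolding spl by (simp add: d_def k_def[symmetric] right_diff_distrib)
        ultimately show ?case using elim by (simp add: d_def)
      qed
    qed
    show "AE x in mu. (rstrang Q (%x. P x - N' x) (t / real n) ^^ n) f x - (rstrang Q (%x. P x - N x) (t / real n) ^^ n) f x
        <= (rstrang Q (%x. - N' x) (t / real n) ^^ n) f x - (rstrang Q (%x. - N x) (t / real n) ^^ n) f x"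
      unfolding s_def[symmetric]
      by (rule funpow_increment_le[OF p _ _ _ B0B inc f]) (use P N in \<open>auto intro!: rstrang_mono b s\<close>)
  qed
qed

lemma rstrang_sym:
  assumes V: "bdd mu V" and s: "s >= 0" and f: "f \<in> R2 mu" and g: "g \<in> R2 mu"
  shows "ip mu (rstrang Q V s f) g = ip mu f (rstrang Q V s g)"
proof -
  note m = exp_mult_R2[OF V s f] exp_mult_R2[OF V s g]
  have "ip mu (rstrang Q V s f) g = ip mu (Q s (%y. exp (- (s * V y / 2)) * f y)) (%y. exp (- (s * V y / 2)) * g y)"
    by (simp add: ip_def rstrang_def ac_simps)
  also have "... = ip mu (%y. exp (- (s * V y / 2)) * f y) (Q s (%y. exp (- (s * V y / 2)) * g y))"
    by (rule Q_sym[OF s m])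
  also have "... = ip mu f (rstrang Q V s g)"
    by (simp add: ip_def rstrang_def ac_simps)
  finally show ?thesis .
qed

text \<open>A splitting step is symmetric and so are its powers; the pairing passes to the Trotter
  limit.\<close>

lemma R_sym:
  assumes V: "bdd mu V" and t: "t >= 0" and f: "f \<in> R2 mu" and g: "g \<in> R2 mu"
  shows "ip mu (R V t f) g = ip mu f (R V t g)"
proof -
  have s: "t / real n >= 0" for n using t by simp
  have "ip mu ((rstrang Q V s ^^ n) f) g = ip mu f ((rstrang Q V s ^^ n) g)" if s: "s >= 0" for s n
    using f g
  proof (induction n arbitrary: f)
    case (Suc n)
    have "ip mu ((rstrang Q V s ^^ Suc n) f) g = ip mu ((rstrang Q V s ^^ n) (rstrang Q V s f)) g"
      by (simp add: funpow_swap1)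
    also have "... = ip mu (rstrang Q V s f) ((rstrang Q V s ^^ n) g)"
      by (rule Suc.IH[OF posopD(1)[OF rstrang_posop[OF V s] Suc.prems(1)] Suc.prems(2)])
    also have "... = ip mu f (rstrang Q V s ((rstrang Q V s ^^ n) g))"
      by (rule rstrang_sym[OF V s Suc.prems(1) posopD(1)[OF posop_funpow[OF rstrang_posop[OF V s]] Suc.prems(2)]])
    finally show ?case by simp
  qed simp
  then have eq: "ip mu ((rstrang Q V (t / real n) ^^ n) f) g = ip mu ((rstrang Q V (t / real n) ^^ n) g) f" for n
    using s ip_commute by metis
  have "(%n. ip mu ((rstrang Q V (t / real n) ^^ n) f) g) \<longlonglongrightarrow> ip mu (R V t f) g"
    by (rule Rlim_ip[OF R_Trotter[OF V t f] g])
  moreover have "(%n. ip mu ((rstrang Q V (t / real n) ^^ n) f) g) \<longlonglongrightarrow> ip mu (R V t g) f"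
    unfolding eq by (rule Rlim_ip[OF R_Trotter[OF V t g] f])
  ultimately have "ip mu (R V t f) g = ip mu (R V t g) f" by (rule LIMSEQ_unique)
  then show ?thesis by (simp only: ip_commute[of mu f])
qed

lemma Q_pow:
  assumes s: "s >= 0" and f: "f \<in> R2 mu"
  shows "AE x in mu. (Q s ^^ n) f x = Q (real n * s) f x"
proof (induction n)
  case 0
  then show ?case using Q_0[OF f] by auto
next
  case (Suc n)
  have ns: "real n * s >= 0" using s by simp
  note q = posopD(1)[OF posop_funpow[OF Q[OF s]] f] posopD(1)[OF Q[OF ns] f]
  have "AE x in mu. Q s ((Q s ^^ n) f) x = Q s (Q (real n * s) f) x" by (rule posop_cong[OF Q[OF s] q Suc])
  then show ?case using Q_add[OF s ns f] by eventually_elim (simp add: algebra_simps)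
qed

text \<open>The multiplier of a splitting step for l U is the l-th power of that for U, and
  \<open>Q s\<close> respects geometric means by \<open>posop_weighted_am_gm\<close>; so the
  inequality survives each step and the limit.\<close>

lemma R_log_convex:
  assumes U: "bdd mu U" and l: "0 < l" "l < 1" and t: "t > 0"
    and R: "a \<in> R2 mu" "b \<in> R2 mu" "c \<in> R2 mu"
    and bc: "AE x in mu. 0 <= b x" "AE x in mu. 0 <= c x"
    and le: "AE x in mu. a x <= b x powr (1 - l) * c x powr l"
  shows "AE x in mu. R (%x. l * U x) t a x <= Q t b x powr (1 - l) * R U t c x powr l"
proof -
  have lU: "bdd mu (%x. l * U x)"
    by (rule bdd_scale[OF U])
  have step: "AE x in mu. (rstrang Q (%x. l * U x) s ^^ n) a x <= (Q s ^^ n) b x powr (1 - l) * (rstrang Q U s ^^ n) c x powr l"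
    if s: "s >= 0" for s n
  proof (induction n)
    case (Suc n)
    define a' where "a' = (rstrang Q (%x. l * U x) s ^^ n) a"
    define b' where "b' = (Q s ^^ n) b"
    define c' where "c' = (rstrang Q U s ^^ n) c"
    have R': "a' \<in> R2 mu" "b' \<in> R2 mu" "c' \<in> R2 mu" unfolding a'_def b'_def c'_def
      by (intro posopD(1)[OF posop_funpow] rstrang_posop lU U s Q R)+
    have bc': "AE x in mu. 0 <= b' x" "AE x in mu. 0 <= c' x" unfolding b'_def c'_def
      by (intro posopD(3)[OF posop_funpow] rstrang_posop U s Q R bc)+
    have ab': "AE x in mu. a' x <= b' x powr (1 - l) * c' x powr l" using Suc by (simp add: a'_def b'_def c'_def)
    note m = exp_mult_R2[OF lU s R'(1)] exp_mult_R2[OF U s R'(3)]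
    have aux: "exp (- (s * (l * u) / 2)) * A <= B * (exp (- (s * u / 2)) * C) powr l" if "A <= B * C powr l" "0 <= C" for u A B C
    proof -
      have ex: "exp (- (s * (l * u) / 2)) = exp (- (s * u / 2)) powr l" by (simp add: powr_def)
      have "exp (- (s * (l * u) / 2)) * A <= exp (- (s * (l * u) / 2)) * (B * C powr l)" using that by (intro mult_left_mono) auto
      also have "... = B * (exp (- (s * u / 2)) powr l * C powr l)" unfolding ex by (simp only: ac_simps)
      also have "exp (- (s * u / 2)) powr l * C powr l = (exp (- (s * u / 2)) * C) powr l" using that by (simp add: powr_mult)
      finally show ?thesis .
    qed
    have "AE x in mu. Q s (%x. exp (- (s * (l * U x) / 2)) * a' x) x
        <= Q s b' x powr (1 - l) * Q s (%x. exp (- (s * U x / 2)) * c' x) x powr l"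
    proof (rule posop_weighted_am_gm[OF Q[OF s] l m(1) R'(2) m(2) bc'(1)])
      show "AE x in mu. 0 <= exp (- (s * U x / 2)) * c' x" using bc'(2) by eventually_elim simp
      show "AE x in mu. exp (- (s * (l * U x) / 2)) * a' x <= b' x powr (1 - l) * (exp (- (s * U x / 2)) * c' x) powr l"
        using ab' bc'(2) by eventually_elim (rule aux)
    qed
    moreover have "AE x in mu. 0 <= Q s (%x. exp (- (s * U x / 2)) * c' x) x"
      by (rule posopD(3)[OF Q[OF s] m(2)]) (use bc' in auto)
    ultimately have "AE x in mu. rstrang Q (%x. l * U x) s a' x <= Q s b' x powr (1 - l) * rstrang Q U s c' x powr l"
      unfolding rstrang_def by eventually_elim (rule aux)
    then show ?case by (simp add: a'_def b'_def c'_def)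
  qed (use le in simp)
  have s: "t / real n >= 0" for n using t by simp
  \<comment> \<open>\<open>Suc n\<close> excludes n = 0, where the product is the identity and not
    \<open>Q t\<close>.\<close>
  have Qlim: "Rlim mu (%n. (Q (t / real (Suc n)) ^^ (Suc n)) b) (Q t b)"
  proof -
    have m: "(Q (t / real (Suc n)) ^^ (Suc n)) b \<in> R2 mu" for n by (intro posopD(1)[OF posop_funpow] Q s R)
    have q: "Q t b \<in> R2 mu" by (intro posopD(1)[OF Q] R) (use t in simp)
    have "rn mu (%x. (Q (t / real (Suc n)) ^^ (Suc n)) b x - Q t b x) = rn mu (%x. 0)" for n
    proof (rule rn_cong)
      show "(%x. (Q (t / real (Suc n)) ^^ (Suc n)) b x - Q t b x) \<in> borel_measurable mu" by (intro R2_borel R2_diff m q)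
      show "AE x in mu. (Q (t / real (Suc n)) ^^ (Suc n)) b x - Q t b x = 0"
        using Q_pow[OF s R(2), of "Suc n" "Suc n"] by eventually_elim simp
    qed simp
    then show ?thesis using m q by (simp add: Rlim_def)
  qed
  have shift: "Rlim mu (%n. F (Suc n)) h" if "Rlim mu F h" for F h
    using that LIMSEQ_Suc[of "%n. rn mu (%x. F n x - h x)" 0] by (simp add: Rlim_def)
  have t': "t >= 0" using t by simp
  show ?thesis
  proof (rule Rlim_weighted_am_gm[OF l shift[OF R_Trotter[OF lU t' R(1)]] Qlim shift[OF R_Trotter[OF U t' R(3)]]])
    show "AE x in mu. 0 <= (Q (t / real (Suc n)) ^^ Suc n) b x" for n
      by (intro posopD(3)[OF posop_funpow] s Q R bc)
    show "AE x in mu. 0 <= (rstrang Q U (t / real (Suc n)) ^^ Suc n) c x" for n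
      by (intro posopD(3)[OF posop_funpow] rstrang_posop U s Q R bc)
  qed (rule step[OF s])
qed

end

section \<open>Unbounded potentials by truncation\<close>

definition trunc :: "real => ('a => real) => 'a => real" where
  "trunc L V x = max (min (V x) L) (- L)"

lemma mono_bounded_Cauchy:
  fixes \<phi> :: "real => real"
  assumes mono: "!!x y. 0 <= x ==> x <= y ==> \<phi> x <= \<phi> y" and bd: "!!x. 0 <= x ==> \<phi> x <= C" and e: "e > 0"
  shows "\<exists>L0\<ge>0. \<forall>x\<ge>L0. \<forall>y\<ge>L0. \<bar>\<phi> x - \<phi> y\<bar> <= e"
proof -
  define s where "s = Sup (\<phi> ` {0..})"
  have b: "bdd_above (\<phi> ` {0..})" using bd by (intro bdd_aboveI[of _ C]) auto
  have "\<exists>y\<in>\<phi> ` {0..}. s - e < y" unfolding s_def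
    by (subst less_cSup_iff[symmetric]) (use b e in auto)
  then obtain L0 where L0: "L0 >= 0" "s - e < \<phi> L0" by auto
  have "\<phi> L0 <= \<phi> x \<and> \<phi> x <= s" if "x >= L0" for x
    using mono[OF L0(1) that] that L0 cSup_upper[OF _ b, of "\<phi> x"] by (auto simp: s_def)
  note b' = this
  show ?thesis
  proof (intro exI[of _ L0] conjI allI impI)
    fix x y assume "x >= L0" "y >= L0"
    then show "\<bar>\<phi> x - \<phi> y\<bar> <= e" using b'[of x] b'[of y] L0 by linarith
  qed (rule L0)
qed

text \<open>Pointwise (v - u)^2 <= v^2 - u^2 if 0 <= u <= v. Hence a monotone family of nonnegative
  functions whose norms converge is Cauchy.\<close>

lemma rn_diff_sq_le:
  assumes u: "u \<in> R2 mu" and v: "v \<in> R2 mu" and le: "AE x in mu. 0 <= u x" "AE x in mu. u x <= v x"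
  shows "(rn mu (%x. v x - u x))^2 <= (rn mu v)^2 - (rn mu u)^2"
proof -
  have i: "integrable mu (%x. (v x)^2)" "integrable mu (%x. (u x)^2)" "integrable mu (%x. (v x - u x)^2)"
    using u v R2_diff[OF v u] by (auto simp: R2_def)
  have "(\<integral>x. (v x - u x)^2 \<partial>mu) <= (\<integral>x. (v x)^2 - (u x)^2 \<partial>mu)"
  proof (rule integral_mono_AE[OF i(3) Bochner_Integration.integrable_diff[OF i(1,2)]])
    show "AE x in mu. (v x - u x)^2 <= (v x)^2 - (u x)^2" using le
    proof eventually_elim
      case (elim x)
      have "(v x)^2 - (u x)^2 - (v x - u x)^2 = 2 * (u x * (v x - u x))" by (simp add: power2_eq_square algebra_simps)
      moreover have "0 <= u x * (v x - u x)" using elim by (intro mult_nonneg_nonneg) auto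
      ultimately show ?case by linarith
    qed
  qed
  also have "... = (\<integral>x. (v x)^2 \<partial>mu) - (\<integral>x. (u x)^2 \<partial>mu)" using i by simp
  finally show ?thesis by (simp add: rn_sq)
qed

lemma posop_abs:
  assumes Q: "posop mu Q" and f: "f \<in> R2 mu"
  shows "(%x. \<bar>f x\<bar>) \<in> R2 mu" "AE x in mu. \<bar>Q f x\<bar> <= Q (%x. \<bar>f x\<bar>) x"
proof -
  show a: "(%x. \<bar>f x\<bar>) \<in> R2 mu" using f R2_borel[OF f] by (simp add: R2_def borel_measurable_abs)
  have "AE x in mu. Q f x <= Q (%x. \<bar>f x\<bar>) x" by (rule posop_mono[OF Q f a]) auto
  moreover have "AE x in mu. Q (%x. (-1) * f x) x <= Q (%x. \<bar>f x\<bar>) x" by (rule posop_mono[OF Q R2_scale[OF f] a]) auto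
  moreover have "AE x in mu. Q (%x. (-1) * f x + 0 * f x) x = (-1) * Q f x + 0 * Q f x" by (rule posopD(2)[OF Q f f])
  ultimately show "AE x in mu. \<bar>Q f x\<bar> <= Q (%x. \<bar>f x\<bar>) x" by eventually_elim auto
qed

lemma bdd_add: "bdd mu U ==> bdd mu V ==> bdd mu (%x. U x + V x)"
proof -
  assume U: "bdd mu U" and V: "bdd mu V"
  obtain K where K: "!!x. \<bar>U x\<bar> <= K" using U by (auto simp: bdd_def)
  obtain K' where K': "!!x. \<bar>V x\<bar> <= K'" using V by (auto simp: bdd_def)
  have "\<bar>U x + V x\<bar> <= K + K'" for x using abs_triangle_ineq[of "U x" "V x"] K[of x] K'[of x] by linarith
  then show ?thesis using U V by (auto simp: bdd_def)
qed

text \<open>\<open>G\<close> will be the semigroup whose potential is the negative part of W, taken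
  with the minus sign; admissibility provides it. It dominates all truncations of theta W with 0 <=
  theta <= 1 and so yields all bounds that must be uniform.\<close>

locale dominated_family = perturbed_family mu Q R for mu :: "'a measure" and Q R +
  fixes W :: "'a => real" and G :: "real => ('a => real) => 'a => real"
  assumes W: "W \<in> borel_measurable mu" and G: "!!t. t >= 0 ==> posop mu (G t)"
    and dom: "!!t L f. t >= 0 ==> L >= 0 ==> f \<in> R2 mu ==> AE x in mu. 0 <= f x ==>
      AE x in mu. R (%x. - min (max (- W x) 0) L) t f x <= G t f x"
begin

definition np :: "real => real => 'a => real" where "np theta L x = min (max (- (theta * W x)) 0) L"
definition pp :: "real => real => 'a => real" where "pp theta L x = min (max (theta * W x) 0) L"

lemma trunc_eq: "L >= 0 ==> trunc L (%x. theta * W x) = (%x. pp theta L x - np theta L x)"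
  by (rule ext) (auto simp: trunc_def pp_def np_def)

lemma np_bdd: "L >= 0 ==> bdd mu (np theta L)" and pp_bdd: "L >= 0 ==> bdd mu (pp theta L)"
  using W unfolding bdd_def np_def[abs_def] pp_def[abs_def] by (auto intro!: exI[of _ L])

lemma np_neg_bdd: "L >= 0 ==> bdd mu (%x. - np theta L x)"
  using bdd_scale[OF np_bdd, of L "-1"] by simp

lemma mixed_bdd: "L >= 0 ==> K >= 0 ==> bdd mu (%x. pp theta L x - np theta K x)"
  using bdd_add[OF pp_bdd np_neg_bdd] by simp

lemma trunc_bdd: "L >= 0 ==> bdd mu (trunc L (%x. theta * W x))"
  by (simp add: trunc_eq mixed_bdd)

lemma np_dom:
  assumes theta: "0 <= theta" "theta <= 1" and t: "t >= 0" and L: "L >= 0" and f: "f \<in> R2 mu" "AE x in mu. 0 <= f x"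
  shows "AE x in mu. R (%x. - np theta L x) t f x <= G t f x"
proof -
  have le: "- np 1 L x <= - np theta L x" for x
  proof -
    have "- (theta * W x) <= max (- W x) 0"
    proof (cases "W x >= 0")
      case False
      then have "theta * (- W x) <= 1 * (- W x)" using theta by (intro mult_right_mono) auto
      then show ?thesis by simp
    qed (use theta in simp)
    then show ?thesis unfolding np_def by auto
  qed
  have "AE x in mu. R (%x. - np theta L x) t f x <= R (%x. - np 1 L x) t f x"
    by (rule opleD[OF R_mono[OF np_neg_bdd[OF L] np_neg_bdd[OF L] le t] f])
  moreover have "AE x in mu. R (%x. - np 1 L x) t f x <= G t f x" using dom[OF t L f] by (simp add: np_def)
  ultimately show ?thesis by (auto elim: eventually_elim2)
qed

lemma trunc_dom:
  assumes theta: "0 <= theta" "theta <= 1" and t: "t >= 0" and L: "L >= 0" and f: "f \<in> R2 mu" "AE x in mu. 0 <= f x"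
  shows "AE x in mu. R (trunc L (%x. theta * W x)) t f x <= G t f x"
proof -
  have "AE x in mu. R (trunc L (%x. theta * W x)) t f x <= R (%x. - np theta L x) t f x"
    by (rule opleD[OF R_mono[OF np_neg_bdd[OF L] trunc_bdd[OF L] _ t] f])
      (use L in \<open>auto simp: trunc_eq pp_def\<close>)
  then show ?thesis using np_dom[OF assms] by (auto elim: eventually_elim2)
qed

text \<open>|R f| <= R |f| <= G |f|, whatever theta and the level are.\<close>

lemma trunc_bound:
  assumes t: "t >= 0"
  obtains C where "C > 0" "!!theta L f. 0 <= theta ==> theta <= 1 ==> L >= 0 ==> f \<in> R2 mu ==> rn mu (R (trunc L (%x. theta * W x)) t f) <= C * rn mu f"
proof -
  obtain C where C: "C > 0" "!!f. f \<in> R2 mu ==> rn mu (G t f) <= C * rn mu f" using posop_bound[OF G[OF t]] by blast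
  show thesis
  proof (rule that[OF C(1)])
    fix theta L :: real and f assume theta: "0 <= theta" "theta <= 1" and L: "L >= (0::real)" and f: "f \<in> R2 mu"
    note P = R[OF trunc_bdd[OF L] t, of theta]
    note a = posop_abs[OF P f]
    have "rn mu (R (trunc L (%x. theta * W x)) t f) <= rn mu (G t (%x. \<bar>f x\<bar>))"
    proof (rule R2_mono(2)[OF R2_borel[OF posopD(1)[OF P f]] posopD(1)[OF G[OF t] a(1)]])
      have "AE x in mu. R (trunc L (%x. theta * W x)) t (%x. \<bar>f x\<bar>) x <= G t (%x. \<bar>f x\<bar>) x"
        by (rule trunc_dom[OF theta t L a(1)]) simp
      then show "AE x in mu. \<bar>R (trunc L (%x. theta * W x)) t f x\<bar> <= \<bar>G t (%x. \<bar>f x\<bar>) x\<bar>"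
        using a(2) by eventually_elim linarith
    qed
    also have "... <= C * rn mu (%x. \<bar>f x\<bar>)" by (rule C(2)[OF a(1)])
    finally show "rn mu (R (trunc L (%x. theta * W x)) t f) <= C * rn mu f" by (simp add: rn_def)
  qed
qed

text \<open>The symmetric truncations are not monotone in the level: the positive part lowers the
  semigroup, the negative part raises it. So the two levels are separated in \<open>a L K\<close>.
  Deepening the negative part beyond some K0 costs at most e, uniformly in L, by comparison with
  \<open>g\<close> and \<open>R_increment_le\<close>; with K0 fixed the family decreases in L. Three
  errors e arise.\<close>

lemma trunc_Cauchy:
  assumes theta: "0 <= theta" "theta <= 1" and t: "t >= 0" and f: "f \<in> R2 mu" "AE x in mu. 0 <= f x" and e: "e > 0"
  shows "\<exists>L0\<ge>0. \<forall>L\<ge>L0. \<forall>L'\<ge>L0. rn mu (%x. R (trunc L (%x. theta * W x)) t f x - R (trunc L' (%x. theta * W x)) t f x) <= 3 * e"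
proof -
  define g where "g K = R (%x. - np theta K x) t f" for K
  define a where "a L K = R (%x. pp theta L x - np theta K x) t f" for L K
  have gR: "g K \<in> R2 mu" "AE x in mu. 0 <= g K x" if "K >= 0" for K
    unfolding g_def using posopD(1,3)[OF R[OF np_neg_bdd[OF that] t]] f by auto
  have aR: "a L K \<in> R2 mu" "AE x in mu. 0 <= a L K x" if "L >= 0" "K >= 0" for L K
    unfolding a_def using posopD(1,3)[OF R[OF mixed_bdd[OF that] t]] f by auto
  have gmono: "AE x in mu. g K x <= g K' x" if "0 <= K" "K <= K'" for K K'
    unfolding g_def by (rule opleD[OF R_mono[OF np_neg_bdd np_neg_bdd _ t] f]) (use that in \<open>auto simp: np_def\<close>)
  have amonoL: "AE x in mu. a L' K x <= a L K x" if "0 <= L" "L <= L'" "K >= 0" for L L' K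
    unfolding a_def by (rule opleD[OF R_mono[OF mixed_bdd mixed_bdd _ t] f]) (use that in \<open>auto simp: pp_def\<close>)
  have amonoK: "AE x in mu. a L K x <= a L K' x" if "0 <= K" "K <= K'" "L >= 0" for L K K'
    unfolding a_def by (rule opleD[OF R_mono[OF mixed_bdd mixed_bdd _ t] f]) (use that in \<open>auto simp: np_def\<close>)
  have inc: "AE x in mu. a L K' x - a L K x <= g K' x - g K x" if "0 <= K" "K <= K'" "L >= 0" for L K K'
    unfolding a_def g_def by (rule R_increment_le[OF pp_bdd np_bdd np_bdd _ _ t f]) (use that in \<open>auto simp: pp_def np_def\<close>)
  have "\<exists>K0\<ge>0. \<forall>K\<ge>K0. \<forall>K'\<ge>K0. \<bar>(rn mu (g K))^2 - (rn mu (g K'))^2\<bar> <= e^2"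
  proof (rule mono_bounded_Cauchy)
    show "(rn mu (g K))^2 <= (rn mu (g K'))^2" if K: "0 <= K" "K <= K'" for K K'
      using rn_diff_sq_le[OF gR(1)[OF K(1)] gR(1) gR(2)[OF K(1)] gmono[OF K]] K zero_le_power2[of "rn mu (%x. g K' x - g K x)"] by linarith
    show "(rn mu (g K))^2 <= (rn mu (G t f))^2" if K: "0 <= K" for K
    proof (rule power_mono[OF R2_mono(2)[OF R2_borel[OF gR(1)[OF K]] posopD(1)[OF G[OF t] f(1)]]])
      show "AE x in mu. \<bar>g K x\<bar> <= \<bar>G t f x\<bar>"
        using np_dom[OF theta t K f] gR(2)[OF K] unfolding g_def[symmetric] by eventually_elim linarith
    qed simp
  qed (use e in simp)
  then obtain K0 where K0: "K0 >= 0" "!!K K'. K >= K0 ==> K' >= K0 ==> \<bar>(rn mu (g K))^2 - (rn mu (g K'))^2\<bar> <= e^2" by blast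
  have "\<exists>L0\<ge>0. \<forall>L\<ge>L0. \<forall>L'\<ge>L0. \<bar>- (rn mu (a L K0))\<^sup>2 - - (rn mu (a L' K0))\<^sup>2\<bar> <= e\<^sup>2"
  proof (rule mono_bounded_Cauchy[where C = 0])
    show "- (rn mu (a L K0))\<^sup>2 <= - (rn mu (a L' K0))\<^sup>2" if K: "0 <= L" "L <= L'" for L L'
      using rn_diff_sq_le[OF aR(1) aR(1)[OF K(1) K0(1)] aR(2) amonoL[OF K K0(1)]] K K0 zero_le_power2[of "rn mu (%x. a L K0 x - a L' K0 x)"] by linarith
  qed (use e in simp_all)
  then obtain L0 where L0: "L0 >= 0" "!!L L'. L >= L0 ==> L' >= L0 ==> \<bar>- (rn mu (a L K0))\<^sup>2 - - (rn mu (a L' K0))\<^sup>2\<bar> <= e\<^sup>2" by blast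
  have s1: "rn mu (%x. a L L x - a L K0 x) <= e" if "L >= K0" for L
  proof -
    have L: "L >= 0" using that K0 by simp
    have "rn mu (%x. a L L x - a L K0 x) <= rn mu (%x. g L x - g K0 x)"
    proof (rule R2_mono(2)[OF R2_borel[OF R2_diff[OF aR(1)[OF L L] aR(1)[OF L K0(1)]]] R2_diff[OF gR(1)[OF L] gR(1)[OF K0(1)]]])
      show "AE x in mu. \<bar>a L L x - a L K0 x\<bar> <= \<bar>g L x - g K0 x\<bar>"
        using inc[OF K0(1) that L] amonoK[OF K0(1) that L] by eventually_elim linarith
    qed
    moreover have "(rn mu (%x. g L x - g K0 x))^2 <= e^2"
      using rn_diff_sq_le[OF gR(1)[OF K0(1)] gR(1)[OF L] gR(2)[OF K0(1)] gmono[OF K0(1) that]] K0(2)[OF that order_refl] by linarith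
    ultimately show ?thesis using e power2_le_imp_le[of "rn mu (%x. g L x - g K0 x)" e] by simp
  qed
  have s2: "rn mu (%x. a L K0 x - a L' K0 x) <= e" if LL: "L >= L0" "L' >= L0" for L L'
  proof -
    have w: "rn mu (%x. a L K0 x - a L' K0 x) <= e" if "L0 <= L" "L <= L'" for L L'
    proof -
      have L: "L >= 0" "L' >= 0" using that L0 by auto
      have "(rn mu (%x. a L K0 x - a L' K0 x))^2 <= e^2"
        using rn_diff_sq_le[OF aR(1)[OF L(2) K0(1)] aR(1)[OF L(1) K0(1)] aR(2)[OF L(2) K0(1)] amonoL[OF L(1) that(2) K0(1)]]
          L0(2)[of L L'] that by linarith
      then show ?thesis by (rule power2_le_imp_le) (use e in simp)
    qed
    show ?thesis using w[of L L'] w[of L' L] LL rn_minus_commute[of mu "a L K0" "a L' K0"] by (cases "L <= L'") auto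
  qed
  show ?thesis
  proof (intro exI[of _ "max K0 L0"] conjI allI impI)
    fix L L' assume LL: "L >= max K0 L0" "L' >= max K0 L0"
    then have L: "L >= 0" "L' >= 0" using K0 by auto
    note A = aR(1)[OF L(1) L(1)] aR(1)[OF L(1) K0(1)] aR(1)[OF L(2) K0(1)] aR(1)[OF L(2) L(2)]
    have "rn mu (%x. a L L x - a L' L' x) <= rn mu (%x. a L L x - a L K0 x) + rn mu (%x. a L K0 x - a L' L' x)"
      by (rule rn_triangle_diff[OF A(1,2,4)])
    also have "rn mu (%x. a L K0 x - a L' L' x) <= rn mu (%x. a L K0 x - a L' K0 x) + rn mu (%x. a L' K0 x - a L' L' x)"
      by (rule rn_triangle_diff[OF A(2,3,4)])
    finally have "rn mu (%x. a L L x - a L' L' x) <= 3 * e"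
      using s1[of L] s1[of L'] s2[of L L'] LL rn_minus_commute[of mu "a L' K0" "a L' L'"] by simp
    then show "rn mu (%x. R (trunc L (%x. theta * W x)) t f x - R (trunc L' (%x. theta * W x)) t f x) <= 3 * e"
      by (simp add: a_def trunc_eq L)
  qed (use K0 in simp)
qed

lemma trunc_Rlim:
  assumes theta: "0 <= theta" "theta <= 1" and t: "t >= 0" and f: "f \<in> R2 mu"
  shows "\<exists>h. Rlim mu (%n. R (trunc (real n) (%x. theta * W x)) t f) h"
proof -
  have pos: "\<exists>h. Rlim mu (%n. R (trunc (real n) (%x. theta * W x)) t f) h" if f: "f \<in> R2 mu" "AE x in mu. 0 <= f x" for f
  proof (rule R2_complete)
    show "R (trunc (real n) (%x. theta * W x)) t f \<in> R2 mu" for n by (intro posopD(1)[OF R[OF trunc_bdd t]] f) simp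
    fix e :: real assume e: "e > 0"
    obtain L0 where L0: "!!L L'. L >= L0 ==> L' >= L0 ==> rn mu (%x. R (trunc L (%x. theta * W x)) t f x - R (trunc L' (%x. theta * W x)) t f x) <= 3 * (e / 3)"
      using trunc_Cauchy[OF theta t f, of "e / 3"] e by auto
    obtain N :: nat where N: "real N >= L0" using real_arch_simple by blast
    show "\<exists>N. \<forall>m\<ge>N. \<forall>n\<ge>N. rn mu (%x. R (trunc (real m) (%x. theta * W x)) t f x - R (trunc (real n) (%x. theta * W x)) t f x) <= e"
    proof (intro exI[of _ N] allI impI)
      fix m n assume "m >= N" "n >= N"
      then have "real m >= L0" "real n >= L0" using N by (auto intro: order_trans)
      from L0[OF this] show "rn mu (%x. R (trunc (real m) (%x. theta * W x)) t f x - R (trunc (real n) (%x. theta * W x)) t f x) <= e" by simp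
    qed
  qed
  define fp where "fp = (%x. max (f x) 0)" define fn where "fn = (%x. max (- f x) 0)"
  have fpn: "fp \<in> R2 mu" "fn \<in> R2 mu" unfolding fp_def fn_def
    by (rule R2_mono(1)[OF _ f]; use R2_borel[OF f] in auto)+
  obtain h1 where h1: "Rlim mu (%n. R (trunc (real n) (%x. theta * W x)) t fp) h1" using pos[OF fpn(1)] by (auto simp: fp_def)
  obtain h2 where h2: "Rlim mu (%n. R (trunc (real n) (%x. theta * W x)) t fn) h2" using pos[OF fpn(2)] by (auto simp: fn_def)
  have feq: "f = (%x. fp x - fn x)" by (auto simp: fp_def fn_def max_def)
  have m: "R (trunc (real n) (%x. theta * W x)) t f \<in> R2 mu" for n by (intro posopD(1)[OF R[OF trunc_bdd t]] f) simp
  note D = Rlim_diff[OF h1 h2]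
  have "rn mu (%x. R (trunc (real n) (%x. theta * W x)) t f x - (h1 x - h2 x)) =
     rn mu (%x. (R (trunc (real n) (%x. theta * W x)) t fp x - R (trunc (real n) (%x. theta * W x)) t fn x) - (h1 x - h2 x))" for n
  proof (rule rn_cong)
    show "AE x in mu. R (trunc (real n) (%x. theta * W x)) t f x - (h1 x - h2 x) = (R (trunc (real n) (%x. theta * W x)) t fp x - R (trunc (real n) (%x. theta * W x)) t fn x) - (h1 x - h2 x)"
      using posopD(4)[OF R[OF trunc_bdd t] fpn, of "real n" theta] unfolding feq[symmetric] by simp
  qed (intro R2_borel R2_diff m RlimD(2)[OF h1] RlimD(2)[OF h2] RlimD(1)[OF h1] RlimD(1)[OF h2])+
  then show ?thesis using RlimD(2,3)[OF D] m by (auto simp: Rlim_def)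
qed

end

locale limit_family = dominated_family mu Q R W G for mu :: "'a measure" and Q R W G +
  fixes S :: "real => real => ('a => real) => 'a => real"
  assumes S_Rlim: "!!theta t f. 0 <= theta ==> theta <= 1 ==> t >= 0 ==> f \<in> R2 mu ==>
      Rlim mu (%n. R (trunc (real n) (%x. theta * W x)) t f) (S theta t f)"
    and S: "!!theta t. 0 <= theta ==> theta <= 1 ==> t >= 0 ==> posop mu (S theta t)"
begin

text \<open>Real truncation levels are needed because scaling the potential by l turns the level n
  into n / l in \<open>S_log_convex\<close>.\<close>

lemma S_Rlim_real:
  assumes theta: "0 <= theta" "theta <= 1" and t: "t >= 0" and f: "f \<in> R2 mu" "AE x in mu. 0 <= f x"
    and L: "!!n. L n >= 0" "filterlim L at_top sequentially"
  shows "Rlim mu (%n. R (trunc (L n) (%x. theta * W x)) t f) (S theta t f)"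
  unfolding Rlim_def
proof (intro conjI allI)
  define A where "A l = R (trunc l (%x. theta * W x)) t f" for l
  have m: "A l \<in> R2 mu" if "l >= 0" for l unfolding A_def by (intro posopD(1)[OF R[OF trunc_bdd[OF that] t]] f)
  show "R (trunc (L n) (%x. theta * W x)) t f \<in> R2 mu" for n using m[OF L(1)] by (simp add: A_def)
  show Sm: "S theta t f \<in> R2 mu" by (rule posopD(1)[OF S[OF theta t] f(1)])
  show "(%n. rn mu (%x. R (trunc (L n) (%x. theta * W x)) t f x - S theta t f x)) \<longlonglongrightarrow> 0"
    unfolding A_def[symmetric]
  proof (rule LIMSEQ_I)
    fix e :: real assume e: "e > 0"
    obtain L0 where L0: "L0 >= 0" "!!l l'. l >= L0 ==> l' >= L0 ==> rn mu (%x. A l x - A l' x) <= 3 * (e / 6)"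
      using trunc_Cauchy[OF theta t f, of "e / 6"] e unfolding A_def by auto
    have le: "rn mu (%x. A l x - S theta t f x) <= e / 2" if l: "l >= L0" for l
    proof -
      have l0: "l >= 0" using l L0 by simp
      note lim = Rlim_diff[OF Rlim_const[OF m[OF l0]] S_Rlim[OF theta t f(1)], folded A_def]
      obtain N :: nat where N: "real N >= L0" using real_arch_simple by blast
      show ?thesis
      proof (rule LIMSEQ_le_const2[OF Rlim_rn[OF lim]], intro exI[of _ N] allI impI)
        fix n assume "n >= N"
        then have "real n >= L0" using N by (auto intro: order_trans)
        then show "rn mu (%x. A l x - A (real n) x) <= e / 2" using L0(2)[OF l, of "real n"] by simp
      qed
    qed
    have "\<forall>\<^sub>F n in sequentially. L n >= L0" using L(2) by (simp add: filterlim_at_top)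
    then obtain N where "!!n. n >= N ==> L n >= L0" by (auto simp: eventually_sequentially)
    then show "\<exists>no. \<forall>n\<ge>no. norm (rn mu (%x. A (L n) x - S theta t f x) - 0) < e"
      using le e by (intro exI[of _ N]) fastforce
  qed
qed

lemma S_sym:
  assumes theta: "0 <= theta" "theta <= 1" and t: "t >= 0" and f: "f \<in> R2 mu" and g: "g \<in> R2 mu"
  shows "ip mu (S theta t f) g = ip mu f (S theta t g)"
proof -
  have 1: "(%n. ip mu (R (trunc (real n) (%x. theta * W x)) t f) g) \<longlonglongrightarrow> ip mu (S theta t f) g"
    by (rule Rlim_ip[OF S_Rlim[OF theta t f] g])
  have 2: "(%n. ip mu (R (trunc (real n) (%x. theta * W x)) t g) f) \<longlonglongrightarrow> ip mu (S theta t g) f"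
    by (rule Rlim_ip[OF S_Rlim[OF theta t g] f])
  have "ip mu (R (trunc (real n) (%x. theta * W x)) t f) g = ip mu (R (trunc (real n) (%x. theta * W x)) t g) f" for n
    using R_sym[OF trunc_bdd t f g, of "real n" theta] by (simp add: ip_commute[of mu f])
  then have "ip mu (S theta t f) g = ip mu (S theta t g) f" using 1 2 LIMSEQ_unique by simp
  then show ?thesis by (simp only: ip_commute[of mu f])
qed

text \<open>A product of strong limits is the limit of the products, since
  \<open>trunc_bound\<close> bounds the factors uniformly in n.\<close>

lemma S_add:
  assumes theta: "0 <= theta" "theta <= 1" and s: "s >= 0" and t: "t >= 0" and f: "f \<in> R2 mu"
  shows "AE x in mu. S theta (s + t) f x = S theta s (S theta t f) x"
proof -
  define P where "P n = R (trunc (real n) (%x. theta * W x))" for n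
  have P: "posop mu (P n t)" if "t >= 0" for n t unfolding P_def by (rule R[OF trunc_bdd that]) simp
  have lim: "Rlim mu (%n. P n t f) (S theta t f)" if "t >= 0" "f \<in> R2 mu" for t f unfolding P_def by (rule S_Rlim[OF theta that])
  define h where "h = S theta t f"
  have h: "h \<in> R2 mu" unfolding h_def by (rule posopD(1)[OF S[OF theta t] f])
  obtain C where C: "C > 0" "!!n f. f \<in> R2 mu ==> rn mu (P n s f) <= C * rn mu f"
    using trunc_bound[OF s] theta unfolding P_def by (metis of_nat_0_le_iff)
  have m: "P n t f \<in> R2 mu" for n by (rule posopD(1)[OF P[OF t] f])
  have A1: "Rlim mu (%n. P n s (P n t f)) (S theta s h)"
    unfolding Rlim_def
  proof (intro conjI allI)
    show mm: "P n s (P n t f) \<in> R2 mu" for n by (rule posopD(1)[OF P[OF s] m])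
    show Sh: "S theta s h \<in> R2 mu" by (rule posopD(1)[OF S[OF theta s] h])
    have z: "(%n. C * rn mu (%x. P n t f x - h x) + rn mu (%x. P n s h x - S theta s h x)) \<longlonglongrightarrow> 0"
      using tendsto_add[OF tendsto_mult_right_zero[OF RlimD(3)[OF lim[OF t f]]] RlimD(3)[OF lim[OF s h]]] by (simp add: h_def)
    show "(%n. rn mu (%x. P n s (P n t f) x - S theta s h x)) \<longlonglongrightarrow> 0"
    proof (rule Lim_null_comparison[OF always_eventually z], rule allI)
      fix n
      have "rn mu (%x. P n s (P n t f) x - P n s h x) = rn mu (P n s (%x. P n t f x - h x))"
      proof (rule rn_cong)
        show "AE x in mu. P n s (P n t f) x - P n s h x = P n s (%x. P n t f x - h x) x"
          using posopD(4)[OF P[OF s] m h, of n n] by eventually_elim simp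
      qed (intro R2_borel R2_diff posopD(1)[OF P[OF s]] m h)+
      also have "... <= C * rn mu (%x. P n t f x - h x)" by (rule C(2)[OF R2_diff[OF m h]])
      finally show "norm (rn mu (%x. P n s (P n t f) x - S theta s h x)) <= C * rn mu (%x. P n t f x - h x) + rn mu (%x. P n s h x - S theta s h x)"
        using rn_triangle_diff[OF mm[of n] posopD(1)[OF P[OF s] h] Sh, of n] by simp
    qed
  qed
  have A2: "Rlim mu (%n. P n (s + t) f) (S theta (s + t) f)" by (rule lim[OF _ f]) (use s t in simp)
  have A3: "AE x in mu. P n (s + t) f x = P n s (P n t f) x" for n unfolding P_def by (rule R_add[OF trunc_bdd s t f]) simp
  have "AE x in mu. S theta (s + t) f x <= S theta s h x"
  proof (rule Rlim_le[OF A2 A1 always_eventually], rule allI)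
    show "AE x in mu. P n (s + t) f x <= P n s (P n t f) x" for n using A3[of n] by eventually_elim simp
  qed
  moreover have "AE x in mu. S theta s h x <= S theta (s + t) f x"
  proof (rule Rlim_le[OF A1 A2 always_eventually], rule allI)
    show "AE x in mu. P n s (P n t f) x <= P n (s + t) f x" for n using A3[of n] by eventually_elim simp
  qed
  ultimately show ?thesis unfolding h_def by eventually_elim simp
qed

text \<open>Truncating l theta W at n is l times truncating theta W at n / l, so
  \<open>R_log_convex\<close> applies to every truncation and passes to the limit.\<close>

lemma S_log_convex:
  assumes theta: "0 <= theta" "theta <= 1" and l: "0 < l" "l < 1" and t: "t > 0"
    and R2: "a \<in> R2 mu" "b \<in> R2 mu" "c \<in> R2 mu"
    and bc: "AE x in mu. 0 <= b x" "AE x in mu. 0 <= c x"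
    and le: "AE x in mu. a x <= b x powr (1 - l) * c x powr l"
  shows "AE x in mu. S (l * theta) t a x <= Q t b x powr (1 - l) * S theta t c x powr l"
proof -
  have t': "t >= 0" using t by simp
  have ltheta: "0 <= l * theta" "l * theta <= 1" using l theta mult_mono[of l 1 theta 1] by auto
  have L: "real n / l >= 0" for n using l by simp
  have Lt: "filterlim (%n. real n / l) at_top sequentially"
    using filterlim_tendsto_pos_mult_at_top[OF tendsto_const[of "1 / l"] _ filterlim_real_sequentially] l by simp
  have eq: "trunc (real n) (%x. l * theta * W x) = (%x. l * trunc (real n / l) (%x. theta * W x) x)" for n
  proof
    fix x
    have "l * max (min (theta * W x) (real n / l)) (- (real n / l)) = max (min (l * (theta * W x)) (l * (real n / l))) (l * (- (real n / l)))"
      using l by (simp add: max_mult_distrib_left min_mult_distrib_left)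
    then show "trunc (real n) (%x. l * theta * W x) x = l * trunc (real n / l) (%x. theta * W x) x"
      using l by (simp add: trunc_def mult.assoc)
  qed
  show ?thesis
  proof (rule Rlim_weighted_am_gm[OF l S_Rlim[OF ltheta t' R2(1)] Rlim_const S_Rlim_real[OF theta t' R2(3) bc(2) L Lt]])
    show "Q t b \<in> R2 mu" by (rule posopD(1)[OF Q[OF t'] R2(2)])
    show "AE x in mu. 0 <= Q t b x" by (rule posopD(3)[OF Q[OF t'] R2(2) bc(1)])
    show "AE x in mu. 0 <= R (trunc (real n / l) (%x. theta * W x)) t c x" for n
      by (rule posopD(3)[OF R[OF trunc_bdd[OF L] t'] R2(3) bc(2)])
    show "AE x in mu. R (trunc (real n) (%x. l * theta * W x)) t a x <= Q t b x powr (1 - l) * R (trunc (real n / l) (%x. theta * W x)) t c x powr l" for n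
      unfolding eq by (rule R_log_convex[OF trunc_bdd[OF L] l t R2 bc le])
  qed
qed

end

section \<open>From complex operators to positive operators on real functions\<close>

definition rop :: "'a op => ('a => real) => 'a => real" where
  "rop P f = (%x. Re (P (%y. cor (f y)) x))"

lemma Re_R2: assumes h: "h \<in> L2 mu"
  shows "(%x. Re (h x)) \<in> R2 mu" "rn mu (%x. Re (h x)) <= nrm mu h"
    and Im_R2: "(%x. Im (h x)) \<in> R2 mu" "rn mu (%x. Im (h x)) <= nrm mu h"
proof -
  have m: "(%x. cor (Re (h x))) \<in> borel_measurable mu" "(%x. cor (Im (h x))) \<in> borel_measurable mu"
    using L2_borel[OF h] by measurable
  have a: "AE x in mu. cmod (cor (Re (h x))) <= cmod (h x)" "AE x in mu. cmod (cor (Im (h x))) <= cmod (h x)"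
    using abs_Re_le_cmod abs_Im_le_cmod by auto
  show "(%x. Re (h x)) \<in> R2 mu" "rn mu (%x. Re (h x)) <= nrm mu h"
    "(%x. Im (h x)) \<in> R2 mu" "rn mu (%x. Im (h x)) <= nrm mu h"
    unfolding R2_L2_iff rn_nrm using nrm_mono[OF m(1) h a(1)] nrm_mono[OF m(2) h a(2)] by auto
qed

text \<open>The imaginary part of h has norm at most the distance of h from any real function, so it
  vanishes.\<close>

lemma nrm_limit_real:
  assumes f: "!!n. f n \<in> R2 mu" and h: "h \<in> L2 mu"
    and lim: "(%n. nrm mu (%x. cor (f n x) - h x)) \<longlonglongrightarrow> 0"
  shows "Rlim mu f (%x. Re (h x))" "AE x in mu. h x = cor (Re (h x))"
proof -
  have L: "(%x. cor (f n x) - h x) \<in> L2 mu" for n using f[of n] h by (intro L2_diff) (auto simp: R2_L2_iff)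
  have "(%n. rn mu (%x. f n x - Re (h x))) \<longlonglongrightarrow> 0"
    by (rule Lim_null_comparison[OF always_eventually lim]) (use Re_R2(2)[OF L] in simp)
  then show "Rlim mu f (%x. Re (h x))" using f Re_R2(1)[OF h] by (simp add: Rlim_def)
  have "rn mu (%x. Im (h x)) <= nrm mu (%x. cor (f n x) - h x)" for n
    using Im_R2(2)[OF L, of n] rn_scale[of mu "-1" "%x. Im (h x)"] by simp
  then have "rn mu (%x. Im (h x)) <= 0" by (intro LIMSEQ_le_const[OF lim]) auto
  then have "rn mu (%x. Im (h x)) = 0" by (simp add: order_antisym)
  then have "AE x in mu. Im (h x) = 0" using rn_0_iff[OF Im_R2(1)[OF h]] by simp
  then show "AE x in mu. h x = cor (Re (h x))" by eventually_elim (simp add: complex_eq_iff)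
qed

lemma rop_posop:
  assumes P: "bounded_op mu P" and pos: "!!f. f \<in> R2 mu ==> AE x in mu. 0 <= f x ==> AE x in mu. 0 <= rop P f x"
  shows "posop mu (rop P)"
proof -
  obtain C where C: "C > 0" "!!f. f \<in> L2 mu ==> nrm mu (P f) <= C * nrm mu f" using bounded_op_bound[OF P] by blast
  note m = bounded_opD(1)[OF P]
  show ?thesis unfolding posop_def
  proof (intro conjI ballI allI impI exI[of _ C])
    fix f g a b assume f: "f \<in> R2 mu" and g: "g \<in> R2 mu"
    have "AE x in mu. P (%y. cor a * cor (f y) + cor b * cor (g y)) x
       = cor a * P (%y. cor (f y)) x + cor b * P (%y. cor (g y)) x"
      by (rule bounded_opD(2)[OF P]) (use f g in \<open>auto simp: R2_L2_iff\<close>)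
    then show "AE x in mu. rop P (%y. a * f y + b * g y) x = a * rop P f x + b * rop P g x"
      by eventually_elim (simp add: rop_def)
  next
    fix f assume f: "f \<in> R2 mu"
    then have fL: "(%y. cor (f y)) \<in> L2 mu" by (simp add: R2_L2_iff)
    show "rop P f \<in> R2 mu" unfolding rop_def by (rule Re_R2(1)[OF m[OF fL]])
    show "rn mu (rop P f) <= C * rn mu f" unfolding rop_def rn_nrm[of mu f]
      by (rule order_trans[OF Re_R2(2)[OF m[OF fL]] C(2)[OF fL]])
  qed (rule pos)
qed

lemma bounded_op_real_imag:
  assumes P: "bounded_op mu P" and f: "f \<in> L2 mu"
  shows "AE x in mu. P f x = P (%y. cor (Re (f y))) x + \<i> * P (%y. cor (Im (f y))) x"
proof -
  have "f = (%y. 1 * cor (Re (f y)) + \<i> * cor (Im (f y)))" by (simp add: complex_eq[symmetric])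
  then show ?thesis
    using bounded_opD(2)[OF P Re_R2(1)[OF f, unfolded R2_L2_iff] Im_R2(1)[OF f, unfolded R2_L2_iff], of 1 \<i>] by simp
qed

lemma strong_limit_real:
  assumes SL: "strong_limit mu Pn B" and Pn: "!!n f. f \<in> R2 mu ==> AE x in mu. Pn n (%y. cor (f y)) x = cor (rop (Pn n) f x)"
    and pos: "!!n. posop mu (rop (Pn n))" and b: "!!n. bounded_op mu (Pn n)"
  shows "!!f. f \<in> R2 mu ==> Rlim mu (%n. rop (Pn n) f) (rop B f)"
    "!!f. f \<in> R2 mu ==> AE x in mu. B (%y. cor (f y)) x = cor (rop B f x)"
    "posop mu (rop B)"
proof -
  have B: "bounded_op mu B" using SL by (simp add: strong_limit_def)
  have main: "Rlim mu (%n. rop (Pn n) f) (rop B f) \<and> (AE x in mu. B (%y. cor (f y)) x = cor (rop B f x))"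
    if f: "f \<in> R2 mu" for f
  proof -
    define F where "F = (%y. cor (f y))"
    have F: "F \<in> L2 mu" using f by (simp add: F_def R2_L2_iff)
    note BF = bounded_opD(1)[OF B F] and PF = bounded_opD(1)[OF b F]
    have rL: "rop (Pn n) f \<in> R2 mu" for n by (rule posopD(1)[OF pos f])
    have "(%n. Lp_norm mu 2 (%x. Pn n F x - B F x)) \<longlonglongrightarrow> 0" using SL F by (auto simp: strong_limit_def)
    moreover have e: "\<forall>\<^sub>F n in sequentially. (%x. Pn n F x - B F x) \<in> L2 mu" by (intro always_eventually allI L2_diff PF BF)
    ultimately have "(%n. nrm mu (%x. Pn n F x - B F x)) \<longlonglongrightarrow> 0" using tendsto_Lp_norm_2[OF e] by simp
    moreover have "nrm mu (%x. Pn n F x - B F x) = nrm mu (%x. cor (rop (Pn n) f x) - B F x)" for n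
    proof (rule nrm_cong)
      show "AE x in mu. Pn n F x - B F x = cor (rop (Pn n) f x) - B F x"
        using Pn[OF f, of n] unfolding F_def by eventually_elim simp
    qed (intro L2_borel L2_diff BF PF rL[unfolded R2_L2_iff])+
    ultimately have "(%n. nrm mu (%x. cor (rop (Pn n) f x) - B F x)) \<longlonglongrightarrow> 0" by simp
    from nrm_limit_real[OF rL BF this] show ?thesis by (simp add: rop_def F_def)
  qed
  show 1: "!!f. f \<in> R2 mu ==> Rlim mu (%n. rop (Pn n) f) (rop B f)"
    and "!!f. f \<in> R2 mu ==> AE x in mu. B (%y. cor (f y)) x = cor (rop B f x)"
    using main by auto
  show "posop mu (rop B)"
  proof (rule rop_posop[OF B])
    fix f assume f: "f \<in> R2 mu" "AE x in mu. 0 <= f x"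
    show "AE x in mu. 0 <= rop B f x"
      by (rule Rlim_le[OF Rlim_const[OF R2_0] 1[OF f(1)] always_eventually]) (use posopD(3)[OF pos f] in simp)
  qed
qed

text \<open>Convergence is known on real functions. The limit is chosen there and extended by real
  and imaginary parts; complex linearity is inherited from the \<open>Pn\<close> in the
  limit.\<close>

lemma strong_limitI:
  assumes b: "!!n. bounded_op mu (Pn n)"
    and Pn: "!!n f. f \<in> R2 mu ==> AE x in mu. Pn n (%y. cor (f y)) x = cor (rop (Pn n) f x)"
    and ex: "!!f. f \<in> R2 mu ==> \<exists>h. Rlim mu (%n. rop (Pn n) f) h"
    and C: "!!n f. f \<in> R2 mu ==> rn mu (rop (Pn n) f) <= C * rn mu f" "C >= 0"
  shows "\<exists>B. strong_limit mu Pn B"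
proof -
  define s where "s f = (SOME h. Rlim mu (%n. rop (Pn n) f) h)" for f
  have s: "Rlim mu (%n. rop (Pn n) f) (s f)" if "f \<in> R2 mu" for f unfolding s_def using someI_ex[OF ex[OF that]] .
  define B where "B f = (%x. cor (s (%y. Re (f y)) x) + \<i> * cor (s (%y. Im (f y)) x))" for f :: "'a => complex"
  have sL: "(%x. cor (s g x)) \<in> L2 mu" if "g \<in> R2 mu" for g using RlimD(2)[OF s[OF that]] by (simp add: R2_L2_iff)
  have BL: "B f \<in> L2 mu" if f: "f \<in> L2 mu" for f
    unfolding B_def by (intro L2_add L2_scale sL Re_R2(1)[OF f] Im_R2(1)[OF f])
  have PL: "Pn n f \<in> L2 mu" if f: "f \<in> L2 mu" for n f by (rule bounded_opD(1)[OF b f])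
  have lim: "(%n. nrm mu (%x. Pn n f x - B f x)) \<longlonglongrightarrow> 0" if f: "f \<in> L2 mu" for f
  proof -
    note r = Re_R2(1)[OF f] and i = Im_R2(1)[OF f]
    note z = tendsto_add[OF RlimD(3)[OF s[OF r]] RlimD(3)[OF s[OF i]], simplified]
    show ?thesis
    proof (rule Lim_null_comparison[OF always_eventually z], rule allI)
      fix n
      define d1 where "d1 = (%x. cor (rop (Pn n) (%y. Re (f y)) x - s (%y. Re (f y)) x))"
      define d2 where "d2 = (%x. cor (rop (Pn n) (%y. Im (f y)) x - s (%y. Im (f y)) x))"
      have d: "d1 \<in> L2 mu" "d2 \<in> L2 mu" unfolding d1_def d2_def R2_L2_iff[symmetric]
        by (intro R2_diff RlimD(1)[OF s[OF r]] RlimD(2)[OF s[OF r]] RlimD(1)[OF s[OF i]] RlimD(2)[OF s[OF i]])+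
      have "nrm mu (%x. Pn n f x - B f x) = nrm mu (%x. d1 x + \<i> * d2 x)"
      proof (rule nrm_cong)
        show "AE x in mu. Pn n f x - B f x = d1 x + \<i> * d2 x"
          using bounded_op_real_imag[OF b[of n] f] Pn[OF r, of n] Pn[OF i, of n]
          by eventually_elim (simp add: d1_def d2_def B_def algebra_simps)
      qed (intro L2_borel L2_diff L2_add L2_scale PL BL f d)+
      also have "... <= nrm mu d1 + nrm mu d2"
        using nrm_triangle[OF d(1) L2_scale[OF d(2), of \<i>]] by (simp add: nrm_scale)
      finally show "norm (nrm mu (%x. Pn n f x - B f x)) <= rn mu (%x. rop (Pn n) (%y. Re (f y)) x - s (%y. Re (f y)) x)
          + rn mu (%x. rop (Pn n) (%y. Im (f y)) x - s (%y. Im (f y)) x)"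
        by (simp add: d1_def d2_def rn_nrm)
    qed
  qed
  have sb: "rn mu (s g) <= C * rn mu g" if g: "g \<in> R2 mu" for g
    by (rule LIMSEQ_le_const2[OF Rlim_rn[OF s[OF g]]]) (use C(1)[OF g] in auto)
  have "bounded_op mu B"
  proof (rule bounded_opI[where C = "2 * C"])
    fix f g a b' assume f: "f \<in> L2 mu" and g: "g \<in> L2 mu"
    define k where "k = (%y. a * f y + b' * g y)"
    have k: "k \<in> L2 mu" unfolding k_def by (rule L2_lincomb[OF f g])
    define r where "r = (%x. a * B f x + b' * B g x)"
    have r: "r \<in> L2 mu" unfolding r_def by (rule L2_lincomb[OF BL[OF f] BL[OF g]])
    have le: "nrm mu (%x. B k x - r x) <= nrm mu (%x. Pn n k x - B k x) + (cmod a * nrm mu (%x. Pn n f x - B f x) + cmod b' * nrm mu (%x. Pn n g x - B g x))" for n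
    proof -
      have "nrm mu (%x. B k x - r x) <= nrm mu (%x. B k x - Pn n k x) + nrm mu (%x. Pn n k x - r x)"
        by (rule nrm_triangle_diff[OF BL[OF k] PL[OF k] r])
      also have "nrm mu (%x. B k x - Pn n k x) = nrm mu (%x. Pn n k x - B k x)" by (rule nrm_minus_commute)
      also have "nrm mu (%x. Pn n k x - r x) = nrm mu (%x. a * (Pn n f x - B f x) + b' * (Pn n g x - B g x))"
      proof (rule nrm_cong)
        show "AE x in mu. Pn n k x - r x = a * (Pn n f x - B f x) + b' * (Pn n g x - B g x)"
          using bounded_opD(2)[OF b[of n] f g, of a b'] unfolding k_def r_def by eventually_elim (simp add: algebra_simps)
      qed (intro L2_borel L2_diff L2_add L2_scale PL BL f g k r)+
      also have "... <= cmod a * nrm mu (%x. Pn n f x - B f x) + cmod b' * nrm mu (%x. Pn n g x - B g x)"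
        using nrm_triangle[OF L2_scale[OF L2_diff[OF PL[OF f] BL[OF f]]] L2_scale[OF L2_diff[OF PL[OF g] BL[OF g]]], of a n b' n] by (simp add: nrm_scale)
      finally show ?thesis by simp
    qed
    have "(%n. nrm mu (%x. Pn n k x - B k x) + (cmod a * nrm mu (%x. Pn n f x - B f x) + cmod b' * nrm mu (%x. Pn n g x - B g x))) \<longlonglongrightarrow> 0 + (cmod a * 0 + cmod b' * 0)"
      by (intro tendsto_intros lim f g k)
    then have "nrm mu (%x. B k x - r x) <= 0 + (cmod a * 0 + cmod b' * 0)" by (rule LIMSEQ_le_const) (use le in auto)
    then have "nrm mu (%x. B k x - r x) = 0" by (simp add: order_antisym)
    then have "AE x in mu. B k x - r x = 0" using nrm_0_iff[OF L2_diff[OF BL[OF k] r]] by simp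
    then show "AE x in mu. B (%y. a * f y + b' * g y) x = a * B f x + b' * B g x"
      unfolding k_def r_def by eventually_elim simp
  next
    fix f assume f: "f \<in> L2 mu"
    show "B f \<in> L2 mu" by (rule BL[OF f])
    note r = Re_R2[OF f] and i = Im_R2[OF f]
    have "nrm mu (B f) <= rn mu (s (%y. Re (f y))) + rn mu (s (%y. Im (f y)))"
      unfolding B_def using nrm_triangle[OF sL[OF r(1)] L2_scale[OF sL[OF i(1)], of \<i>]] by (simp add: nrm_scale rn_nrm)
    also have "... <= C * rn mu (%y. Re (f y)) + C * rn mu (%y. Im (f y))" by (intro add_mono sb r i)
    also have "... <= C * nrm mu f + C * nrm mu f" by (intro add_mono mult_left_mono r i C)
    finally show "nrm mu (B f) <= 2 * C * nrm mu f" by simp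
  qed
  moreover have "(%n. Lp_norm mu 2 (%x. Pn n f x - B f x)) \<longlonglongrightarrow> 0" if f: "f \<in> L2 mu" for f
  proof -
    have e: "\<forall>\<^sub>F n in sequentially. (%x. Pn n f x - B f x) \<in> L2 mu" by (intro always_eventually allI L2_diff PL BL f)
    from tendsto_Lp_norm_2[OF e] lim[OF f] show ?thesis by simp
  qed
  ultimately show ?thesis by (auto simp: strong_limit_def)
qed

locale positive_contraction_semigroup =
  fixes mu :: "'a measure" and T :: "real => 'a op"
  assumes T: "C0_semigroup mu T" and pos: "positive_semigroup mu T" and sa: "self_adjoint_semigroup mu T"
    and contr: "!!t f. t >= 0 ==> f \<in> L2 mu ==> nrm mu (T t f) <= nrm mu f"
begin

text \<open>A real function is a difference of two nonnegative ones, whose images are nonnegative;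
  so its image is real.\<close>

lemma T_real:
  assumes t: "t >= 0" and f: "f \<in> R2 mu"
  shows "AE x in mu. T t (%y. cor (f y)) x = cor (rop (T t) f x)"
    "(AE x in mu. 0 <= f x) ==> AE x in mu. 0 <= rop (T t) f x"
proof -
  note b = C0_semigroupD(1)[OF T t]
  have nn: "AE x in mu. T t (%y. cor (f y)) x \<in> \<real>\<^sub>\<ge>\<^sub>0" if "f \<in> R2 mu" "AE x in mu. 0 <= f x" for f
  proof -
    have "AE x in mu. cor (f x) \<in> \<real>\<^sub>\<ge>\<^sub>0" using that(2) by eventually_elim simp
    then show ?thesis by (intro pos[unfolded positive_semigroup_def, rule_format] t that(1)[unfolded R2_L2_iff])
  qed
  show "AE x in mu. 0 <= rop (T t) f x" if "AE x in mu. 0 <= f x"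
    using nn[OF f that] by eventually_elim (simp add: rop_def complex_nonneg_Reals_iff)
  define fp where "fp = (%x. max (f x) 0)" define fn where "fn = (%x. max (- f x) 0)"
  have fpn: "fp \<in> R2 mu" "fn \<in> R2 mu" unfolding fp_def fn_def
    by (rule R2_mono(1)[OF _ f]; use R2_borel[OF f] in auto)+
  have feq: "(%x. cor (f x)) = (%x. cor (fp x) - cor (fn x))"
    by (auto simp: fp_def fn_def max_def)
  have "AE x in mu. T t (%x. cor (f x)) x = T t (%x. cor (fp x)) x - T t (%x. cor (fn x)) x"
    unfolding feq by (rule bounded_op_diff[OF b]) (use fpn in \<open>auto simp: R2_L2_iff\<close>)
  moreover have "AE x in mu. T t (%y. cor (fp y)) x \<in> \<real>\<^sub>\<ge>\<^sub>0" by (rule nn[OF fpn(1)]) (simp add: fp_def)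
  moreover have "AE x in mu. T t (%y. cor (fn y)) x \<in> \<real>\<^sub>\<ge>\<^sub>0" by (rule nn[OF fpn(2)]) (simp add: fn_def)
  ultimately show "AE x in mu. T t (%y. cor (f y)) x = cor (rop (T t) f x)"
    by eventually_elim (simp add: rop_def complex_nonneg_Reals_iff complex_eq_iff)
qed

lemma rop_comp_cong:
  assumes P: "bounded_op mu P" and f: "f \<in> R2 mu" and g: "g \<in> L2 mu" and e: "AE x in mu. g x = cor (f x)"
  shows "AE x in mu. Re (P g x) = rop P f x"
proof -
  have "AE x in mu. P g x = P (%x. cor (f x)) x"
    by (rule bounded_op_cong[OF P g _ e]) (use f in \<open>simp add: R2_L2_iff\<close>)
  then show ?thesis by eventually_elim (simp add: rop_def)
qed

abbreviation "BP V t == bounded_perturbation mu T V t"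

lemma BP:
  assumes V: "bdd mu V"
  shows "C0_semigroup mu (bounded_perturbation mu T V)"
    "!!t f. t >= 0 ==> f \<in> L2 mu ==> (%n. nrm mu (%x. (strang T V (t / real n) ^^ n) f x - BP V t f x)) \<longlonglongrightarrow> 0"
    "!!s f. s >= 0 ==> f \<in> L2 mu ==> strang T V s f \<in> L2 mu"
proof -
  obtain K where K: "!!x. \<bar>V x\<bar> <= K" using V by (auto simp: bdd_def)
  have "\<bar>V x\<bar> <= max K 1" "max K 1 > 0" for x using K[of x] by auto
  from bounded_perturbation_aux[OF T contr _ this] V
  show "C0_semigroup mu (bounded_perturbation mu T V)"
    "!!t f. t >= 0 ==> f \<in> L2 mu ==> (%n. nrm mu (%x. (strang T V (t / real n) ^^ n) f x - BP V t f x)) \<longlonglongrightarrow> 0"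
    "!!s f. s >= 0 ==> f \<in> L2 mu ==> strang T V s f \<in> L2 mu"
    by (auto simp: bdd_def)
qed

lemma rT_posop: "t >= 0 ==> posop mu (rop (T t))"
  by (rule rop_posop[OF C0_semigroupD(1)[OF T]]) (assumption | rule T_real(2))+

lemma rstrang_rT_posop:
  assumes V: "bdd mu V" and s: "s >= 0" shows "posop mu (rstrang (%t. rop (T t)) V s)"
proof -
  obtain C where C: "(%x. exp (- (s * V x / 2))) \<in> borel_measurable mu" "!!x. \<bar>exp (- (s * V x / 2))\<bar> <= C"
    using bdd_exp[OF V s] by blast
  have "posop mu (%f x. exp (- (s * V x / 2)) * f x)" by (rule posop_mult[OF C]) auto
  from posop_comp[OF this posop_comp[OF rT_posop[OF s] this]] show ?thesis by (simp add: rstrang_def[abs_def])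
qed

lemma strang_real:
  assumes V: "bdd mu V" and s: "s >= 0" and f: "f \<in> R2 mu"
  shows "AE x in mu. (strang T V s ^^ n) (%y. cor (f y)) x = cor ((rstrang (%t. rop (T t)) V s ^^ n) f x)
      \<and> True" "(strang T V s ^^ n) (%y. cor (f y)) \<in> L2 mu"
proof -
  obtain C where C: "(%x. exp (- (s * V x / 2))) \<in> borel_measurable mu" "!!x. \<bar>exp (- (s * V x / 2))\<bar> <= C"
    using bdd_exp[OF V s] by blast
  have L: "(strang T V s ^^ n) (%y. cor (f y)) \<in> L2 mu" for n
    by (induction n) (use f BP(3)[OF V s] in \<open>auto simp: R2_L2_iff\<close>)
  then show "(strang T V s ^^ n) (%y. cor (f y)) \<in> L2 mu" .
  have "AE x in mu. (strang T V s ^^ n) (%y. cor (f y)) x = cor ((rstrang (%t. rop (T t)) V s ^^ n) f x)"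
  proof (induction n)
    case (Suc n)
    define F where "F = (strang T V s ^^ n) (%y. cor (f y))"
    define g where "g = (rstrang (%t. rop (T t)) V s ^^ n) f"
    have F: "F \<in> L2 mu" unfolding F_def by (rule L)
    have g: "g \<in> R2 mu" unfolding g_def by (rule posopD(1)[OF posop_funpow[OF rstrang_rT_posop[OF V s]] f])
    note Eg = R2_bounded_mult(1)[OF g C] and EF = L2_bounded_mult(1)[OF F C]
    have "AE x in mu. T s (%y. cor (exp (- (s * V y / 2))) * F y) x = T s (%y. cor (exp (- (s * V y / 2)) * g y)) x"
    proof (rule bounded_op_cong[OF C0_semigroupD(1)[OF T s] EF])
      show "(%y. cor (exp (- (s * V y / 2)) * g y)) \<in> L2 mu" using Eg by (simp add: R2_L2_iff)
      show "AE x in mu. cor (exp (- (s * V x / 2))) * F x = cor (exp (- (s * V x / 2)) * g x)"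
        using Suc unfolding F_def[symmetric] g_def[symmetric] by eventually_elim simp
    qed
    then have "AE x in mu. strang T V s F x = cor (rstrang (%t. rop (T t)) V s g x)"
      using T_real(1)[OF s Eg] by eventually_elim (simp add: strang_def rstrang_def)
    then show ?case by (simp add: F_def g_def)
  qed simp
  then show "AE x in mu. (strang T V s ^^ n) (%y. cor (f y)) x = cor ((rstrang (%t. rop (T t)) V s ^^ n) f x) \<and> True" by simp
qed

lemma BP_real:
  assumes V: "bdd mu V" and t: "t >= 0"
  shows "!!f. f \<in> R2 mu ==> Rlim mu (%n. (rstrang (%t. rop (T t)) V (t / real n) ^^ n) f) (rop (BP V t) f)"
    "!!f. f \<in> R2 mu ==> AE x in mu. BP V t (%y. cor (f y)) x = cor (rop (BP V t) f x)"
    "posop mu (rop (BP V t))" "bounded_op mu (BP V t)"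
proof -
  show b: "bounded_op mu (BP V t)" by (rule C0_semigroupD(1)[OF BP(1)[OF V] t])
  have s: "t / real n >= 0" for n using t by simp
  have main: "Rlim mu (%n. (rstrang (%t. rop (T t)) V (t / real n) ^^ n) f) (rop (BP V t) f) \<and> (AE x in mu. BP V t (%y. cor (f y)) x = cor (rop (BP V t) f x))"
    if f: "f \<in> R2 mu" for f
  proof -
    define F where "F = (%y. cor (f y))"
    have F: "F \<in> L2 mu" using f by (simp add: F_def R2_L2_iff)
    note BF = bounded_opD(1)[OF b F]
    define g where "g n = (rstrang (%t. rop (T t)) V (t / real n) ^^ n) f" for n
    have g: "g n \<in> R2 mu" for n unfolding g_def by (rule posopD(1)[OF posop_funpow[OF rstrang_rT_posop[OF V s]] f])
    note SL = strang_real(2)[OF V s f, folded F_def]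
    have "nrm mu (%x. (strang T V (t / real n) ^^ n) F x - BP V t F x) = nrm mu (%x. cor (g n x) - BP V t F x)" for n
    proof (rule nrm_cong)
      show "AE x in mu. (strang T V (t / real n) ^^ n) F x - BP V t F x = cor (g n x) - BP V t F x"
        using strang_real(1)[OF V s f, of n n] unfolding F_def g_def by eventually_elim simp
    qed (intro L2_borel L2_diff BF SL g[unfolded R2_L2_iff])+
    then have "(%n. nrm mu (%x. cor (g n x) - BP V t F x)) \<longlonglongrightarrow> 0" using BP(2)[OF V t F] by simp
    from nrm_limit_real[OF g BF this] show ?thesis by (simp add: rop_def F_def g_def[abs_def])
  qed
  then show 1: "!!f. f \<in> R2 mu ==> Rlim mu (%n. (rstrang (%t. rop (T t)) V (t / real n) ^^ n) f) (rop (BP V t) f)"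
    and "!!f. f \<in> R2 mu ==> AE x in mu. BP V t (%y. cor (f y)) x = cor (rop (BP V t) f x)" by auto
  show "posop mu (rop (BP V t))"
  proof (rule rop_posop[OF b])
    fix f assume f: "f \<in> R2 mu" "AE x in mu. 0 <= f x"
    show "AE x in mu. 0 <= rop (BP V t) f x"
      by (rule Rlim_le[OF Rlim_const[OF R2_0] 1[OF f(1)] always_eventually])
        (use posopD(3)[OF posop_funpow[OF rstrang_rT_posop[OF V s]] f] in simp)
  qed
qed

sublocale perturbed_family mu "%t. rop (T t)" "%V t. rop (BP V t)"
proof
  fix s t :: real and f assume s: "s >= 0" and t: "t >= 0" and f: "f \<in> R2 mu"
  have F: "(%y. cor (f y)) \<in> L2 mu" using f by (simp add: R2_L2_iff)
  show "AE x in mu. rop (T (s + t)) f x = rop (T s) (rop (T t) f) x"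
    using C0_semigroupD(3)[OF T s t F] rop_comp_cong[OF C0_semigroupD(1)[OF T s] posopD(1)[OF rT_posop[OF t] f] C0_semigroupD(5)[OF T t F] T_real(1)[OF t f]]
    by eventually_elim (simp add: rop_def)
  fix V assume V: "bdd mu V"
  show "AE x in mu. rop (BP V (s + t)) f x = rop (BP V s) (rop (BP V t) f) x"
    using C0_semigroupD(3)[OF BP(1)[OF V] s t F] rop_comp_cong[OF C0_semigroupD(1)[OF BP(1)[OF V] s] posopD(1)[OF BP_real(3)[OF V t] f] C0_semigroupD(5)[OF BP(1)[OF V] t F] BP_real(2)[OF V t f]]
    by eventually_elim (simp add: rop_def)
next
  fix f assume f: "f \<in> R2 mu"
  have F: "(%y. cor (f y)) \<in> L2 mu" using f by (simp add: R2_L2_iff)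
  show "AE x in mu. rop (T 0) f x = f x" using C0_semigroupD(2)[OF T F] by eventually_elim (simp add: rop_def)
next
  fix t :: real and f assume t: "t >= 0" and f: "f \<in> R2 mu"
  have F: "(%y. cor (f y)) \<in> L2 mu" using f by (simp add: R2_L2_iff)
  show "rn mu (rop (T t) f) <= rn mu f" unfolding rop_def rn_nrm[of mu f]
    by (rule order_trans[OF Re_R2(2)[OF C0_semigroupD(5)[OF T t F]] contr[OF t F]])
  fix g assume g: "g \<in> R2 mu"
  have G: "(%y. cor (g y)) \<in> L2 mu" using g by (simp add: R2_L2_iff)
  note m = R2_borel[OF posopD(1)[OF rT_posop[OF t] f]] R2_borel[OF posopD(1)[OF rT_posop[OF t] g]]
  have "cor (ip mu (rop (T t) f) g) = (\<integral>x. cor (rop (T t) f x * g x) \<partial>mu)"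
    unfolding ip_def by (rule integral_complex_of_real[symmetric])
  also have "... = (\<integral>x. T t (%y. cor (f y)) x * cnj (cor (g x)) \<partial>mu)"
    by (rule integral_cong_AE)
      (use m R2_borel[OF g] L2_borel[OF C0_semigroupD(5)[OF T t F]] T_real(1)[OF t f] in auto)
  also have "... = (\<integral>x. cor (f x) * cnj (T t (%y. cor (g y)) x) \<partial>mu)"
    by (rule sa[unfolded self_adjoint_semigroup_def, rule_format, OF t F G])
  also have "... = (\<integral>x. cor (f x * rop (T t) g x) \<partial>mu)"
  proof (rule integral_cong_AE)
    show "(%x. cor (f x) * cnj (T t (%y. cor (g y)) x)) \<in> borel_measurable mu"
      using L2_mult_integrable(2)[OF F C0_semigroupD(5)[OF T t G]] by (rule borel_measurable_integrable)
    show "(%x. cor (f x * rop (T t) g x)) \<in> borel_measurable mu" using m R2_borel[OF f] by measurable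
    show "AE x in mu. cor (f x) * cnj (T t (%y. cor (g y)) x) = cor (f x * rop (T t) g x)"
      using T_real(1)[OF t g] by eventually_elim simp
  qed
  also have "... = cor (ip mu f (rop (T t) g))" unfolding ip_def by (rule integral_complex_of_real)
  finally show "ip mu (rop (T t) f) g = ip mu f (rop (T t) g)" by (simp only: of_real_eq_iff)
qed (auto intro: rT_posop BP_real)

lemma truncate_trunc: "truncate n V = trunc (real n) V"
  by (rule ext) (simp add: truncate_def trunc_def)

lemma perturbed_strong_limit:
  "\<exists>B. strong_limit mu (%n. BP (truncate n V) t) B ==> strong_limit mu (%n. BP (truncate n V) t) (perturbed mu T V t)"
  unfolding perturbed_def using someI_ex[of "%B. strong_limit mu (%n. BP (truncate n V) t) B"] by simp

lemma truncate_bdd: "V \<in> borel_measurable mu ==> bdd mu (truncate n V)"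
  unfolding bdd_def truncate_trunc trunc_def[abs_def] by (auto intro!: exI[of _ "real n"])

text \<open>The strong limits for the negative part of W give the dominating semigroup
  \<open>G\<close>. Domination and \<open>trunc_Rlim\<close> then produce the semigroups for theta
  W, 0 <= theta <= 1; in the application W = p V, and theta = 1 and theta = 1/p are the operators of
  the theorem.\<close>

lemma admissible_limit_family:
  assumes adm: "admissible mu T W"
  shows "limit_family mu (%t. rop (T t)) (%V t. rop (BP V t)) W
      (%t. rop (perturbed mu T (%x. - max (- W x) 0) t)) (%theta t. rop (perturbed mu T (%x. theta * W x) t))"
    and "!!theta t. 0 <= theta ==> theta <= 1 ==> t >= 0 ==> bounded_op mu (perturbed mu T (%x. theta * W x) t)"
    and "!!theta t f. 0 <= theta ==> theta <= 1 ==> t >= 0 ==> f \<in> R2 mu ==>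
      AE x in mu. perturbed mu T (%x. theta * W x) t (%y. cor (f y)) x = cor (rop (perturbed mu T (%x. theta * W x) t) f x)"
proof -
  have W: "W \<in> borel_measurable mu" using adm by (simp add: admissible_def)
  define N where "N x = - max (- W x) 0" for x
  have N: "N \<in> borel_measurable mu" unfolding N_def[abs_def] using W by measurable
  define G where "G t = rop (perturbed mu T N t)" for t
  have SLN: "strong_limit mu (%n. BP (truncate n N) t) (perturbed mu T N t)" if "t >= 0" for t
    by (rule perturbed_strong_limit) (use adm that in \<open>auto simp: admissible_def admissible_signed_def N_def[abs_def]\<close>)
  note tb = truncate_bdd[OF N]
  have GL: "posop mu (G t)" "!!f. f \<in> R2 mu ==> Rlim mu (%n. rop (BP (truncate n N) t) f) (G t f)" if t: "t >= 0" for t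
    unfolding G_def
    using strong_limit_real[OF SLN[OF t] BP_real(2)[OF tb t] BP_real(3)[OF tb t] BP_real(4)[OF tb t]] by auto
  have dom: "dominated_family mu (%t. rop (T t)) (%V t. rop (BP V t)) W G"
  proof
    show "posop mu (G t)" if "t >= 0" for t by (rule GL(1)[OF that])
    fix t L :: real and f assume t: "t >= 0" and L: "L >= 0" and f: "f \<in> R2 mu" "AE x in mu. 0 <= f x"
    have b: "bdd mu (%x. - min (max (- W x) 0) L)" using W L unfolding bdd_def by (auto intro!: exI[of _ L])
    show "AE x in mu. rop (BP (%x. - min (max (- W x) 0) L) t) f x <= G t f x"
    proof (rule Rlim_le[OF Rlim_const GL(2)[OF t f(1)]])
      show "rop (BP (%x. - min (max (- W x) 0) L) t) f \<in> R2 mu" by (rule posopD(1)[OF BP_real(3)[OF b t] f(1)])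
      have "\<forall>\<^sub>F n in sequentially. real n >= L" by (rule eventually_sequentiallyI[of "nat \<lceil>L\<rceil>"]) linarith
      then show "\<forall>\<^sub>F n in sequentially. AE x in mu. rop (BP (%x. - min (max (- W x) 0) L) t) f x <= rop (BP (truncate n N) t) f x"
      proof eventually_elim
        case (elim n)
        have "truncate n N x <= - min (max (- W x) 0) L" for x using elim L by (auto simp: truncate_def N_def)
        from opleD[OF R_mono[OF truncate_bdd[OF N] b this t] f] show ?case .
      qed
    qed
  qed (rule W)
  interpret D: dominated_family mu "%t. rop (T t)" "%V t. rop (BP V t)" W G by (rule dom)
  have b: "bdd mu (truncate n (%x. theta * W x))" for n theta by (rule truncate_bdd) (use W in measurable)
  have SL: "strong_limit mu (%n. BP (truncate n (%x. theta * W x)) t) (perturbed mu T (%x. theta * W x) t)"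
    if theta: "0 <= theta" "theta <= 1" and t: "t >= 0" for theta t
  proof (rule perturbed_strong_limit)
    obtain C where C: "C > 0" "!!theta L f. 0 <= theta ==> theta <= 1 ==> L >= 0 ==> f \<in> R2 mu ==> rn mu (rop (BP (trunc L (%x. theta * W x)) t) f) <= C * rn mu f"
      using D.trunc_bound[OF t] by blast
    show "\<exists>B. strong_limit mu (%n. BP (truncate n (%x. theta * W x)) t) B"
    proof (rule strong_limitI[where C = C])
      show "\<exists>h. Rlim mu (%n. rop (BP (truncate n (%x. theta * W x)) t) f) h" if "f \<in> R2 mu" for f
        using D.trunc_Rlim[OF theta t that] by (simp add: truncate_trunc)
    qed (use BP_real[OF b t] C theta in \<open>auto simp: truncate_trunc\<close>)
  qed
  have SR: "posop mu (rop (perturbed mu T (%x. theta * W x) t))"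
      "!!f. f \<in> R2 mu ==> Rlim mu (%n. rop (BP (truncate n (%x. theta * W x)) t) f) (rop (perturbed mu T (%x. theta * W x) t) f)"
      "!!f. f \<in> R2 mu ==> AE x in mu. perturbed mu T (%x. theta * W x) t (%y. cor (f y)) x = cor (rop (perturbed mu T (%x. theta * W x) t) f x)"
    if theta: "0 <= theta" "theta <= 1" and t: "t >= 0" for theta t
    using strong_limit_real[OF SL[OF theta t] BP_real(2)[OF b t] BP_real(3)[OF b t] BP_real(4)[OF b t]] by auto
  show "!!theta t. 0 <= theta ==> theta <= 1 ==> t >= 0 ==> bounded_op mu (perturbed mu T (%x. theta * W x) t)"
    using SL by (simp add: strong_limit_def)
  show "!!theta t f. 0 <= theta ==> theta <= 1 ==> t >= 0 ==> f \<in> R2 mu ==>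
      AE x in mu. perturbed mu T (%x. theta * W x) t (%y. cor (f y)) x = cor (rop (perturbed mu T (%x. theta * W x) t) f x)"
    by (rule SR(3))
  have "limit_family mu (%t. rop (T t)) (%V t. rop (BP V t)) W G (%theta t. rop (perturbed mu T (%x. theta * W x) t))"
  proof
    fix theta t :: real assume theta: "0 <= theta" "theta <= 1" and t: "t >= 0"
    show "posop mu (rop (perturbed mu T (%x. theta * W x) t))" by (rule SR(1)[OF theta t])
    fix f assume f: "f \<in> R2 mu"
    show "Rlim mu (%n. rop (BP (trunc (real n) (%x. theta * W x)) t) f) (rop (perturbed mu T (%x. theta * W x) t) f)"
      using SR(2)[OF theta t f] by (simp add: truncate_trunc)
  qed
  then show "limit_family mu (%t. rop (T t)) (%V t. rop (BP V t)) W
      (%t. rop (perturbed mu T (%x. - max (- W x) 0) t)) (%theta t. rop (perturbed mu T (%x. theta * W x) t))"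
    by (simp add: G_def[abs_def] N_def[abs_def])
qed

end

section \<open>Powers of the hyperbolic cosine\<close>

lemma one_plus_power_le:
  fixes v :: real
  assumes "0 <= v" "v <= 1"
  shows "(1 + v) ^ m <= 1 + real m * v + 4 ^ m * v^2"
proof (induction m)
  case (Suc m)
  have m4: "real m <= 4 ^ m"
    using of_nat_less_two_power[of m, where ?'a = real] power_mono[of "2::real" 4 m] by linarith
  have "(1 + v) ^ Suc m <= (1 + v) * (1 + real m * v + 4 ^ m * v^2)"
    using Suc assms by (simp add: mult_left_mono)
  also have "... = 1 + real (Suc m) * v + (real m + 4 ^ m) * v^2 + 4 ^ m * (v * v^2)"
    by (simp add: algebra_simps power2_eq_square)
  also have "... <= 1 + real (Suc m) * v + (real m + 4 ^ m) * v^2 + 4 ^ m * v^2"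
    using assms by (intro add_left_mono mult_left_mono mult_left_le_one_le) auto
  also have "... = 1 + real (Suc m) * v + (real m + 2 * 4 ^ m) * v^2" by (simp add: algebra_simps)
  also have "... <= 1 + real (Suc m) * v + 4 ^ Suc m * v^2"
  proof (intro add_left_mono mult_right_mono)
    have "(0::real) <= 4 ^ m" by simp
    then show "real m + 2 * 4 ^ m <= 4 ^ Suc m" unfolding power_Suc using m4 by linarith
  qed simp
  finally show ?case .
qed simp

text \<open>With \<open>v = cosh x - 1\<close>, doubling the argument replaces \<open>v\<close> by \<open>4 v + 2 v^2\<close>.\<close>

lemma cosh_double_minus_one: "cosh (2 * x) - 1 = 4 * (cosh x - 1) + 2 * (cosh x - 1)^2" for x :: real
proof -
  have "cosh (2 * x) = 2 * (cosh x)^2 - 1" by (simp add: cosh_double cosh_square_eq)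
  then show ?thesis by (simp add: power2_eq_square algebra_simps)
qed

text \<open>The recursion has two regimes: keeping the linear and quadratic terms serves for small
  v, keeping only 2 v^2 produces the power 2^k and serves for large v.\<close>

lemma cosh_minus_one_iterate:
  fixes x :: real and k :: nat
  defines "v == cosh x - 1"
  shows "4 ^ k * v + (16 ^ k - 4 ^ k) / 8 * v^2 <= cosh (2 ^ k * x) - 1"
    and "2 ^ (2 ^ k - 1) * v ^ (2 ^ k) <= cosh (2 ^ k * x) - 1"
proof -
  have v: "v >= 0" using cosh_real_ge_1[of x] by (simp add: v_def)
  show "4 ^ k * v + (16 ^ k - 4 ^ k) / 8 * v^2 <= cosh (2 ^ k * x) - 1"
  proof (induction k)
    case (Suc k)
    define z where "z = cosh (2 ^ k * x) - 1"
    have p: "(0::real) <= (16 ^ k - 4 ^ k) / 8" by (simp add: power_mono)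
    have le: "4 ^ k * v <= z" using Suc v p by (smt (verit) z_def mult_nonneg_nonneg zero_le_power2)
    have "(4 ^ k * v)^2 <= z^2" using v by (intro power_mono le) auto
    then have "16 ^ k * v^2 <= z^2" by (simp add: power_mult_distrib power2_eq_square[of "4 ^ k"] flip: power_mult_distrib[of 4 4 k])
    moreover have "4 * (4 ^ k * v + (16 ^ k - 4 ^ k) / 8 * v^2) <= 4 * z"
      by (rule mult_left_mono) (use Suc in \<open>simp_all add: z_def\<close>)
    moreover have "4 ^ Suc k * v + (16 ^ Suc k - 4 ^ Suc k) / 8 * v^2
        <= 4 * (4 ^ k * v + (16 ^ k - 4 ^ k) / 8 * v^2) + 2 * (16 ^ k * v^2)"
      by (simp add: field_simps)
    moreover have "cosh (2 ^ Suc k * x) - 1 = 4 * z + 2 * z^2"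
      using cosh_double_minus_one[of "2 ^ k * x"] by (simp add: z_def mult.assoc)
    ultimately show ?case by linarith
  qed (simp add: v_def)
  show "2 ^ (2 ^ k - 1) * v ^ (2 ^ k) <= cosh (2 ^ k * x) - 1"
  proof (induction k)
    case (Suc k)
    define z where "z = cosh (2 ^ k * x) - 1"
    have z: "z >= 0" using cosh_real_ge_1[of "2 ^ k * x"] by (simp add: z_def)
    have "(2 ^ (2 ^ k - 1) * v ^ (2 ^ k))^2 <= z^2" using v Suc by (intro power_mono) (auto simp: z_def)
    moreover have "2 * (2 ^ (2 ^ k - 1) * v ^ (2 ^ k))^2 = 2 ^ (2 ^ Suc k - 1) * v ^ (2 ^ Suc k)"
    proof -
      obtain r where r: "(2::nat) ^ k = Suc r" using gr0_conv_Suc[of "2 ^ k"] by auto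
      have "(2::nat) ^ Suc k = Suc (Suc (r + r))" using r by simp
      then show ?thesis unfolding r by (simp add: power2_eq_square power_add algebra_simps)
    qed
    moreover have "cosh (2 ^ Suc k * x) - 1 = 4 * z + 2 * z^2"
      using cosh_double_minus_one[of "2 ^ k * x"] by (simp add: z_def mult.assoc)
    ultimately show ?case using z by linarith
  qed (simp add: v_def)
qed

lemma three_m_le: "3 * m + 5 <= 2 ^ (m + 2)" if "m >= 1" for m :: nat
  using that by (induction m rule: dec_induct) auto

text \<open>Both sides are 1 + m x^2 / 2 + O(x^4) near 0, so the coefficient m / B^2 is exactly what
  a sharp rate requires. As B is the power 2^(m+2), cosh(B x) is reached by doubling: for v <= 1
  quadratic terms are compared, for v > 1 powers.\<close>

lemma cosh_power_le:
  fixes x :: real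
  assumes m: "m >= 1"
  defines "B == 2 ^ (m + 2) :: real"
  shows "cosh x ^ m <= 1 + real m / B^2 * (cosh (B * x) - 1)" "real m / B^2 <= 1"
proof -
  define v where "v = cosh x - 1"
  have v: "v >= 0" using cosh_real_ge_1[of x] by (simp add: v_def)
  define k where "k = m + 2"
  have B2: "B^2 = 4 ^ k" by (simp add: B_def k_def power2_eq_square flip: power_mult_distrib)
  have m4: "real m <= 4 ^ m"
    using of_nat_less_two_power[of m, where ?'a = real] power_mono[of "2::real" 4 m] by linarith
  have "(4::real) ^ m <= 4 ^ k" by (simp add: k_def)
  then have "real m <= 4 ^ k" using m4 by linarith
  then show "real m / B^2 <= 1" unfolding B2 by simp
  have c: "cosh x ^ m = (1 + v) ^ m" by (simp add: v_def)
  show "cosh x ^ m <= 1 + real m / B^2 * (cosh (B * x) - 1)"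
  proof (cases "v <= 1")
    case True
    have "(1 + v) ^ m <= 1 + real m * v + 4 ^ m * v^2" by (rule one_plus_power_le[OF v True])
    also have "... <= 1 + real m / 4 ^ k * (4 ^ k * v + (16 ^ k - 4 ^ k) / 8 * v^2)"
    proof -
      have e: "(16::real) ^ k = 4 ^ k * 4 ^ k" by (simp flip: power_mult_distrib)
      have "real m / 4 ^ k * (4 ^ k * v + (16 ^ k - 4 ^ k) / 8 * v^2) = real m * v + real m * ((4 ^ k - 1) / 8) * v^2"
        unfolding e by (simp add: field_simps)
      moreover have "(4::real) ^ m <= real m * ((4 ^ k - 1) / 8)"
      proof -
        have "(4::real) ^ m <= (4 ^ k - 1) / 8" 
        proof -
          have e: "(4::real) ^ k = 16 * 4 ^ m" by (simp add: k_def power_add)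
          have "X <= (16 * X - 1) / 8" if "1 <= X" for X :: real using that by simp
          from this[of "4 ^ m"] show ?thesis unfolding e by simp
        qed
        also have "... <= real m * ((4 ^ k - 1) / 8)"
          using mult_right_mono[of 1 "real m" "(4 ^ k - 1) / 8"] m by simp
        finally show ?thesis .
      qed
      then have "4 ^ m * v^2 <= real m * ((4 ^ k - 1) / 8) * v^2" by (intro mult_right_mono) auto
      ultimately show ?thesis by linarith
    qed
    also have "... <= 1 + real m / 4 ^ k * (cosh (2 ^ k * x) - 1)"
      using cosh_minus_one_iterate(1)[of k x] by (intro add_left_mono mult_left_mono) (auto simp: v_def)
    finally show ?thesis unfolding c B2 by (simp add: B_def k_def)
  next
    case False
    have "(1 + v) ^ m <= (2 * v) ^ m" using False v by (intro power_mono) auto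
    also have "... <= real m / 4 ^ k * (2 ^ (2 ^ k - 1) * v ^ (2 ^ k))"
    proof -
      \<comment> \<open>The surplus exponent j = 2^k - m has to absorb the factor 2 * 4^k, that is j
        >= 1 + 2 k; for k = m + 2 this is \<open>three_m_le\<close>.\<close>
      have k3: "m + 1 + 2 * k <= 2 ^ k" using three_m_le[OF m] by (simp add: k_def)
      define j where "j = 2 ^ k - m"
      have j: "2 ^ k = m + j" "j >= 1 + 2 * k" using k3 by (auto simp: j_def)
      have "(2::real) * 4 ^ k = 2 ^ (1 + 2 * k)" by (simp add: power_mult)
      also have "... <= 2 ^ j" using j by (intro power_increasing) auto
      also have "... <= (2 * v) ^ j" using False by (intro power_mono) auto
      finally have a: "2 * 4 ^ k <= (2 * v) ^ j" .
      have "(2 * v) ^ m * (2 * 4 ^ k) <= (2 * v) ^ m * (2 * v) ^ j" using v by (intro mult_left_mono a) auto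
      also have "... = (2 * v) ^ (2 ^ k)" by (simp add: j(1) power_add)
      also have "... = 2 * (2 ^ (2 ^ k - 1) * v ^ (2 ^ k))"
        by (simp add: power_mult_distrib flip: power_Suc)
      also have "... <= real m * (2 * (2 ^ (2 ^ k - 1) * v ^ (2 ^ k)))"
        using mult_right_mono[of 1 "real m" "2 * (2 ^ (2 ^ k - 1) * v ^ (2 ^ k))"] m v by simp
      finally show ?thesis by (simp add: field_simps)
    qed
    also have "... <= real m / 4 ^ k * (cosh (2 ^ k * x) - 1)"
      using cosh_minus_one_iterate(2)[of k x] by (intro mult_left_mono) (auto simp: v_def)
    finally show ?thesis unfolding c B2 by (simp add: B_def k_def)
  qed
qed

section \<open>Bilinear and quadratic forms of positive operators\<close>

lemma R2_sum: "finite I ==> (!!i. i \<in> I ==> f i \<in> R2 mu) ==> (%x. \<Sum>i\<in>I. f i x) \<in> R2 mu"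
  by (induction rule: finite_induct) (auto intro: R2_add R2_0)

lemma ip_sum_right:
  assumes "finite I" "!!i. i \<in> I ==> g i \<in> R2 mu" "f \<in> R2 mu"
  shows "ip mu f (%x. \<Sum>i\<in>I. g i x) = (\<Sum>i\<in>I. ip mu f (g i))"
  unfolding ip_def sum_distrib_left using assms by (intro Bochner_Integration.integral_sum ip_integrable) auto

lemma posop_sum:
  assumes P: "posop mu P" and "finite I" "!!i. i \<in> I ==> f i \<in> R2 mu"
  shows "AE x in mu. P (%y. \<Sum>i\<in>I. f i y) x = (\<Sum>i\<in>I. P (f i) x)"
  using assms(2,3)
proof (induction rule: finite_induct)
  case empty
  have "AE x in mu. P (%y. 0 * 0 + 0 * 0) x = 0 * P (%y. 0) x + 0 * P (%y. 0) x"
    by (rule posopD(2)[OF P R2_0 R2_0])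
  then show ?case by simp
next
  case (insert a I)
  have "AE x in mu. P (%y. f a y + (\<Sum>i\<in>I. f i y)) x = P (f a) x + P (%y. \<Sum>i\<in>I. f i y) x"
    by (rule posopD(5)[OF P]) (use insert in \<open>auto intro: R2_sum\<close>)
  moreover have "AE x in mu. P (%y. \<Sum>i\<in>I. f i y) x = (\<Sum>i\<in>I. P (f i) x)" using insert by simp
  ultimately show ?case by eventually_elim (use insert(1,2) in simp)
qed

lemma ip_posop_sum:
  assumes P: "posop mu P" and I: "finite I" and f: "!!i. i \<in> I ==> f i \<in> R2 mu" and g: "!!i. i \<in> I ==> g i \<in> R2 mu"
  shows "ip mu (P (%x. \<Sum>i\<in>I. f i x)) (%x. \<Sum>j\<in>I. g j x) = (\<Sum>i\<in>I. \<Sum>j\<in>I. ip mu (P (f i)) (g j))"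
proof -
  note G = R2_sum[OF I g] and Pf = posopD(1)[OF P f]
  have "ip mu (P (%x. \<Sum>i\<in>I. f i x)) (%x. \<Sum>j\<in>I. g j x) = ip mu (%x. \<Sum>i\<in>I. P (f i) x) (%x. \<Sum>j\<in>I. g j x)"
    by (rule ip_cong[OF posopD(1)[OF P R2_sum[OF I f]] R2_sum[OF I Pf] G posop_sum[OF P I f]])
  also have "... = (\<Sum>i\<in>I. ip mu (P (f i)) (%x. \<Sum>j\<in>I. g j x))"
    using ip_sum_right[OF I Pf G] by (simp add: ip_commute[of mu _ "%x. \<Sum>j\<in>I. g j x"])
  also have "... = (\<Sum>i\<in>I. \<Sum>j\<in>I. ip mu (P (f i)) (g j))"
    by (intro sum.cong refl ip_sum_right[OF I g] Pf)
  finally show ?thesis .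
qed

lemma posop_ip_mono:
  assumes P: "posop mu P" and f: "f \<in> R2 mu" "f' \<in> R2 mu" and g: "g \<in> R2 mu" "g' \<in> R2 mu"
    and le: "!!x. 0 <= f x" "!!x. f x <= f' x" "!!x. 0 <= g x" "!!x. g x <= g' x"
  shows "ip mu (P f) g <= ip mu (P f') g'"
proof -
  have "ip mu (P f) g <= ip mu (P f') g"
    by (rule ip_mono[OF posopD(1)[OF P f(1)] posopD(1)[OF P f(2)] g(1) posop_mono[OF P f]]) (use le in auto)
  also have "... = ip mu g (P f')" by (rule ip_commute)
  also have "... <= ip mu g' (P f')"
    by (rule ip_mono[OF g posopD(1)[OF P f(2)] _ posopD(3)[OF P f(2)]])
      (use le in \<open>auto intro: order_trans[OF le(1,2)]\<close>)
  finally show ?thesis by (simp only: ip_commute)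
qed

lemma posop_ip_scale:
  assumes P: "posop mu P" and f: "f \<in> R2 mu" and g: "g \<in> R2 mu"
  shows "ip mu (P (%x. a * f x)) (%x. b * g x) = a * b * ip mu (P f) g"
proof -
  have "AE x in mu. P (%x. a * f x + 0 * f x) x = a * P f x + 0 * P f x" by (rule posopD(2)[OF P f f])
  then have "ip mu (P (%x. a * f x)) (%x. b * g x) = ip mu (%x. a * P f x) (%x. b * g x)"
    by (intro ip_cong posopD(1)[OF P] R2_scale f g) simp
  also have "... = (\<integral>x. (a * b) * (P f x * g x) \<partial>mu)" by (simp add: ip_def ac_simps)
  finally show ?thesis by (simp add: ip_def)
qed

text \<open>Averaging with the indices exchanged removes the odd part. Since cosh has no first-order
  term, the excess of the weighted form over the unweighted one becomes quadratic in the weight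
  exponent.\<close>

lemma sum_symmetric_exp_cosh:
  fixes a :: "int => int => real" and k :: "int => real"
  assumes "!!i j. a i j = a j i"
  shows "(\<Sum>i\<in>I. \<Sum>j\<in>I. exp (k i - k j) * a i j) = (\<Sum>i\<in>I. \<Sum>j\<in>I. cosh (k i - k j) * a i j)"
proof -
  have "(\<Sum>i\<in>I. \<Sum>j\<in>I. exp (k i - k j) * a i j) = (\<Sum>i\<in>I. \<Sum>j\<in>I. exp (k j - k i) * a i j)"
    by (subst sum.swap) (simp add: assms)
  then have "2 * (\<Sum>i\<in>I. \<Sum>j\<in>I. exp (k i - k j) * a i j) = (\<Sum>i\<in>I. \<Sum>j\<in>I. (exp (k i - k j) + exp (k j - k i)) * a i j)"
    by (simp add: sum.distrib distrib_right)
  also have "... = (\<Sum>i\<in>I. \<Sum>j\<in>I. (2 * cosh (k i - k j)) * a i j)"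
    by (intro sum.cong refl arg_cong2[where f = times]) (simp add: cosh_def)
  also have "... = 2 * (\<Sum>i\<in>I. \<Sum>j\<in>I. cosh (k i - k j) * a i j)"
    by (simp add: sum_distrib_left mult.assoc)
  finally show ?thesis by simp
qed

text \<open>The power inequality for the numerical radius, needed for conjugated operators D, which
  are not symmetric. Positivity extends the bound from nonnegative h to |<D h, h>| for all h. Then v
  = (w^2 - D^2) x equals both (w - D) y1 and (w + D) y2 with y1 = (w + D) x and y2 = (w - D) x, so
  <v, y1> and <v, y2> are nonnegative; their sum is 2 w <v, x>.\<close>

lemma quad_form_square:
  assumes D: "posop mu D" and w: "w > 0"
    and q: "!!h. h \<in> R2 mu ==> (!!x. 0 <= h x) ==> ip mu (D h) h <= w * (rn mu h)^2"
    and x: "x \<in> R2 mu"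
  shows "ip mu (D (D x)) x <= w^2 * (rn mu x)^2"
proof -
  have abs: "\<bar>ip mu (D h) h\<bar> <= w * (rn mu h)^2" if h: "h \<in> R2 mu" for h
  proof -
    note a = posop_abs[OF D h]
    have Dh: "D h \<in> R2 mu" "D (%x. \<bar>h x\<bar>) \<in> R2 mu" using posopD(1)[OF D] h a by auto
    have "\<bar>ip mu (D h) h\<bar> <= (\<integral>x. \<bar>D h x * h x\<bar> \<partial>mu)"
      unfolding ip_def using integral_norm_bound[of mu "%x. D h x * h x"] by simp
    also have "... <= (\<integral>x. D (%x. \<bar>h x\<bar>) x * \<bar>h x\<bar> \<partial>mu)"
    proof (rule integral_mono_AE)
      show "integrable mu (%x. \<bar>D h x * h x\<bar>)" using ip_integrable[OF Dh(1) h] by (rule Bochner_Integration.integrable_abs)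
      show "integrable mu (%x. D (%x. \<bar>h x\<bar>) x * \<bar>h x\<bar>)" by (rule ip_integrable[OF Dh(2) a(1)])
      show "AE x in mu. \<bar>D h x * h x\<bar> <= D (%x. \<bar>h x\<bar>) x * \<bar>h x\<bar>"
        using a(2) by eventually_elim (simp add: abs_mult mult_right_mono)
    qed
    also have "... <= w * (rn mu (%x. \<bar>h x\<bar>))^2" using q[OF a(1)] by (simp add: ip_def)
    finally show ?thesis by (simp add: rn_def)
  qed
  note Dx = posopD(1)[OF D x] note DDx = posopD(1)[OF D Dx]
  define y1 where "y1 = (%z. w * x z + 1 * D x z)"
  define y2 where "y2 = (%z. w * x z + (-1) * D x z)"
  define v where "v = (%z. w^2 * x z + (-1) * D (D x) z)"
  have y: "y1 \<in> R2 mu" "y2 \<in> R2 mu" "v \<in> R2 mu" unfolding y1_def y2_def v_def by (intro R2_lincomb x Dx DDx)+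
  note Dy = posopD(1)[OF D y(1)] posopD(1)[OF D y(2)]
  have e1: "AE z in mu. w * y1 z + (-1) * D y1 z = v z"
    using posopD(2)[OF D x Dx, of w 1] unfolding y1_def[symmetric]
    by eventually_elim (simp add: y1_def v_def algebra_simps power2_eq_square)
  have e2: "AE z in mu. w * y2 z + 1 * D y2 z = v z"
    using posopD(2)[OF D x Dx, of w "-1"] unfolding y2_def[symmetric]
    by eventually_elim (simp add: y2_def v_def algebra_simps power2_eq_square)
  have "0 <= w * ip mu y1 y1 + (-1) * ip mu (D y1) y1" using abs[OF y(1)] by (simp add: ip_self)
  also have "... = ip mu (%z. w * y1 z + (-1) * D y1 z) y1" by (rule ip_lincomb[symmetric, OF y(1) Dy(1) y(1)])
  also have "... = ip mu v y1" by (rule ip_cong[OF R2_lincomb[OF y(1) Dy(1)] y(3) y(1) e1])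
  also have "... = w * ip mu x v + 1 * ip mu (D x) v" unfolding ip_commute[of mu v] y1_def by (rule ip_lincomb[OF x Dx y(3)])
  finally have p1: "0 <= w * ip mu x v + ip mu (D x) v" by simp
  have "0 <= w * ip mu y2 y2 + 1 * ip mu (D y2) y2" using abs[OF y(2)] by (simp add: ip_self)
  also have "... = ip mu (%z. w * y2 z + 1 * D y2 z) y2" by (rule ip_lincomb[symmetric, OF y(2) Dy(2) y(2)])
  also have "... = ip mu v y2" by (rule ip_cong[OF R2_lincomb[OF y(2) Dy(2)] y(3) y(2) e2])
  also have "... = w * ip mu x v + (-1) * ip mu (D x) v" unfolding ip_commute[of mu v] y2_def by (rule ip_lincomb[OF x Dx y(3)])
  finally have "0 <= 2 * w * ip mu x v" using p1 by simp
  then have "0 <= ip mu v x" using w by (simp add: zero_le_mult_iff ip_commute)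
  also have "... = w^2 * ip mu x x + (-1) * ip mu (D (D x)) x" unfolding v_def by (rule ip_lincomb[OF x DDx x])
  finally show ?thesis by (simp add: ip_self)
qed

section \<open>The weighted bound on \<open>R2\<close> with the sharp growth rate\<close>

locale weighted_setting = limit_family mu Q R W G S for mu :: "'a measure" and Q R W G S +
  fixes rho :: "'a => real"
  assumes rho: "rho \<in> borel_measurable mu" "!!x. rho x > 0"
begin

definition wt :: "real => ('a => real) => 'a => real" where "wt alpha f x = rho x powr alpha * f x"

text \<open>All powers of rho are bounded on such a support, so every weighted function stays in
  \<open>R2\<close>.\<close>

definition supp :: "real => ('a => real) => bool" where
  "supp K f \<longleftrightarrow> f \<in> R2 mu \<and> (\<forall>x. 0 <= f x) \<and> (\<forall>x. f x ~= 0 \<longrightarrow> 1 / K <= rho x \<and> rho x <= K)"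

text \<open>The weight clipped to [1/N, N]. It is bounded with bounded inverse, so conjugated
  operators act on all of \<open>R2\<close> and can be iterated, which the unclipped weight does not
  permit.\<close>

definition rc :: "real => 'a => real" where "rc N x = max (1 / N) (min N (rho x))"

lemma suppD: "supp K f ==> f \<in> R2 mu" "supp K f ==> 0 <= f x" "supp K f ==> f x ~= 0 ==> 1 / K <= rho x \<and> rho x <= K"
  by (auto simp: supp_def)

lemma powr_between:
  fixes K y a :: real
  assumes K: "K >= 1" and y: "1 / K <= y" "y <= K"
  shows "y powr a <= K powr \<bar>a\<bar>"
proof (cases "a >= 0")
  case True
  have "0 < 1 / K" using K by simp
  then have "0 <= y" using y by linarith
  then show ?thesis using True y by (simp add: powr_mono2)
next
  case False
  have "0 < 1 / K" using K by simp
  then have y0: "0 < y" using y by linarith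
  have "1 / y <= K" using y y0 K by (simp add: field_simps)
  then have "(1 / y) powr (- a) <= K powr (- a)" using False y0 by (intro powr_mono2) auto
  then show ?thesis using False y0 by (simp add: powr_divide powr_minus_divide)
qed

lemma wt_R2:
  assumes f: "supp K f" and K: "K >= 1" shows "wt alpha f \<in> R2 mu"
proof -
  define m where "m x = (if 1 / K <= rho x \<and> rho x <= K then rho x powr alpha else 0)" for x
  have "m \<in> borel_measurable mu" unfolding m_def[abs_def] using rho(1) by measurable
  moreover have "\<bar>m x\<bar> <= K powr \<bar>alpha\<bar>" for x using powr_between[OF K] by (auto simp: m_def)
  ultimately have "(%x. m x * f x) \<in> R2 mu" by (rule R2_bounded_mult(1)[OF suppD(1)[OF f]])
  moreover have "(%x. m x * f x) = wt alpha f" using suppD(3)[OF f] by (auto simp: m_def wt_def fun_eq_iff)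
  ultimately show ?thesis by simp
qed

lemma rc_bounds: "N >= 1 ==> 1 / N <= rc N x" "N >= 1 ==> rc N x <= N" "N >= 1 ==> rc N x > 0"
proof -
  assume N: "N >= 1"
  have "1 / N <= 1" "1 / N > 0" using N by auto
  then have "1 / N <= N" using N by linarith
  then show "1 / N <= rc N x" "rc N x <= N" "rc N x > 0" using N by (auto simp: rc_def less_max_iff_disj)
qed

lemma rc_mult_R2: "N >= 1 ==> f \<in> R2 mu ==> (%x. rc N x powr alpha * f x) \<in> R2 mu"
  and rc_posop: "N >= 1 ==> posop mu (%f x. rc N x powr alpha * f x)"
proof -
  assume N: "N >= 1"
  have m: "(%x. rc N x powr alpha) \<in> borel_measurable mu" unfolding rc_def using rho(1) by measurable
  have b: "\<bar>rc N x powr alpha\<bar> <= N powr \<bar>alpha\<bar>" for x using powr_between[OF N rc_bounds(1,2)[OF N]] by simp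
  show "posop mu (%f x. rc N x powr alpha * f x)" by (rule posop_mult[OF m b]) simp
  show "f \<in> R2 mu ==> (%x. rc N x powr alpha * f x) \<in> R2 mu" by (rule R2_bounded_mult(1)[OF _ m b])
qed

text \<open>The level sets of \<open>\<lfloor>ln rho / d\<rfloor>\<close> play the role of points, so that no integral kernel is needed.\<close>

lemma weighted_quadratic_form_approx:
  assumes T2: "!!K u beta. K >= 1 ==> supp K u ==> ip mu (Q s (wt beta u)) (wt (- beta) u) <= exp (beta^2 * s) * (rn mu u)^2"
    and S1: "!!f. f \<in> R2 mu ==> rn mu (S 1 s f) <= rn mu f"
    and s: "s > 0" and alpha: "alpha > 0" and m: "m >= 2" and N: "N >= 1" and K: "K >= 1" and u: "supp K u" and d: "d > 0"
  defines "theta == 1 - 1 / real m" and "B == 2 ^ (m + 2) :: real"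
  shows "ip mu (S theta s (%x. rc N x powr alpha * u x)) (%x. rc N x powr (- alpha) * u x)
    <= exp (alpha * d) * (1 + (exp (B * alpha * d) * exp ((B * alpha)^2 * s) - 1) / B^2) * (rn mu u)^2"
proof -
  have theta: "0 < theta" "theta < 1" "0 <= theta" "theta <= 1" using m by (auto simp: theta_def)
  have s0: "s >= 0" using s by simp
  have uR: "u \<in> R2 mu" and u0: "!!x. 0 <= u x" using suppD[OF u] by auto
  \<comment> \<open>Slicing along ln rho: on a slice rho is constant up to the factor exp d, and
    finitely many slices meet the support of u.\<close>
  define idx where "idx x = \<lfloor>ln (rho x) / d\<rfloor>" for x
  define n where "n = \<lceil>ln K / d\<rceil> + 1"
  define I where "I = {- n..n}"
  have I: "finite I" by (simp add: I_def)
  define ui where "ui i x = (if idx x = i then u x else 0)" for i x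
  have um: "ui i \<in> R2 mu" for i
  proof (rule R2_mono(1)[OF _ uR])
    show "ui i \<in> borel_measurable mu" unfolding ui_def[abs_def] idx_def using rho(1) R2_borel[OF uR] by measurable
  qed (auto simp: ui_def)
  have ui0: "0 <= ui i x" for i x using u0 by (simp add: ui_def)
  have us: "supp K (ui i)" for i using um suppD[OF u] by (auto simp: supp_def ui_def)
  have idxI: "idx x \<in> I" if "u x ~= 0" for x
  proof -
    have "1 / K <= rho x" "rho x <= K" using suppD(3)[OF u that] by auto
    then have "ln (1 / K) <= ln (rho x)" "ln (rho x) <= ln K" using K rho(2)[of x] by auto
    then have "- (ln K / d) <= ln (rho x) / d" "ln (rho x) / d <= ln K / d" using d K by (auto simp: ln_div field_simps)
    then show ?thesis unfolding I_def idx_def n_def by (auto; linarith)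
  qed
  have usum: "u = (%x. \<Sum>i\<in>I. ui i x)"
  proof
    fix x show "u x = (\<Sum>i\<in>I. ui i x)" using idxI[of x] I by (cases "u x = 0") (auto simp: ui_def sum.delta)
  qed
  have bin: "exp (d * real_of_int i) <= rho x" "rho x <= exp (d * (real_of_int i + 1))" if "idx x = i" for i x
  proof -
    have "real_of_int i <= ln (rho x) / d" "ln (rho x) / d <= real_of_int i + 1" using that unfolding idx_def by linarith+
    then have "d * real_of_int i <= ln (rho x)" "ln (rho x) <= d * (real_of_int i + 1)" using d by (auto simp: field_simps)
    then have "exp (d * real_of_int i) <= exp (ln (rho x))" "exp (ln (rho x)) <= exp (d * (real_of_int i + 1))" by simp_all
    then show "exp (d * real_of_int i) <= rho x" "rho x <= exp (d * (real_of_int i + 1))" using rho(2)[of x] by simp_all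
  qed
  \<comment> \<open>Clipping on the logarithmic scale. \<open>cl\<close> is monotone and
    1-Lipschitz, so clipping does not enlarge the differences k i - k j.\<close>
  define cl where "cl y = max (- ln N) (min (ln N) y)" for y
  have cl: "cl (y + d) <= cl y + d" "\<bar>cl y - cl z\<bar> <= \<bar>y - z\<bar>" for y z using d by (auto simp: cl_def)
  have clmono: "y <= z ==> cl y <= cl z" for y z by (auto simp: cl_def)
  have rcl: "rc N x = exp (cl (ln (rho x)))" for x
  proof -
    have "exp (cl (ln (rho x))) = max (exp (- ln N)) (min (exp (ln N)) (exp (ln (rho x))))"
      unfolding cl_def by (simp add: max_def min_def)
    then show ?thesis using N rho(2)[of x] by (simp add: rc_def exp_minus divide_inverse)
  qed
  define k where "k i = alpha * cl (d * real_of_int i)" for i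
  have up: "rc N x powr alpha * ui i x <= exp (alpha * d + k i) * ui i x" for i x
  proof (cases "idx x = i")
    case True
    have "ln (rho x) <= d * real_of_int i + d" using bin(2)[OF True] rho(2)[of x] ln_le_cancel_iff[of "rho x" "exp (d * (real_of_int i + 1))"] by (simp add: algebra_simps)
    then have "cl (ln (rho x)) <= cl (d * real_of_int i) + d" using clmono cl(1) order_trans by blast
    then have "alpha * cl (ln (rho x)) <= alpha * d + k i" using alpha mult_left_mono[of _ _ alpha] by (fastforce simp: k_def algebra_simps)
    then show ?thesis using ui0[of i x] by (intro mult_right_mono) (auto simp: rcl powr_def)
  qed (simp add: ui_def)
  have lo: "rc N x powr (- alpha) * ui j x <= exp (- k j) * ui j x" for j x
  proof (cases "idx x = j")
    case True
    have "d * real_of_int j <= ln (rho x)" using bin(1)[OF True] rho(2)[of x] ln_le_cancel_iff[of "exp (d * real_of_int j)" "rho x"] by simp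
    then have "cl (d * real_of_int j) <= cl (ln (rho x))" by (rule clmono)
    then have "k j <= alpha * cl (ln (rho x))" using alpha by (simp add: k_def)
    then show ?thesis using ui0[of j x] by (intro mult_right_mono) (auto simp: rcl powr_def)
  qed (simp add: ui_def)
  define a where "a i j = ip mu (S theta s (ui i)) (ui j)" for i j
  define t where "t i j = ip mu (Q s (ui i)) (ui j)" for i j
  define y where "y i j = ip mu (S 1 s (ui i)) (ui j)" for i j
  note PS = S[OF theta(3,4) s0] and PQ = Q[OF s0] and P1 = S[OF zero_le_one order_refl s0]
  have sym: "a i j = a j i" "t i j = t j i" for i j
    unfolding a_def t_def using S_sym[OF theta(3,4) s0 um um] Q_sym[OF s0 um um] by (simp_all add: ip_commute)
  have a0: "0 <= a i j" and t0: "0 <= t i j" for i j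
    unfolding a_def t_def by (rule ip_nonneg, rule posopD(3)[OF PS um], use ui0 in auto)
      (rule ip_nonneg, rule posopD(3)[OF PQ um], use ui0 in auto)
  define c where "c i j = cosh (alpha * d * (real_of_int i - real_of_int j))" for i j
  have c1: "c i j >= 1" for i j unfolding c_def by (rule cosh_real_ge_1)
  have "ip mu (S theta s (%x. rc N x powr alpha * u x)) (%x. rc N x powr (- alpha) * u x)
      = ip mu (S theta s (%x. \<Sum>i\<in>I. rc N x powr alpha * ui i x)) (%x. \<Sum>j\<in>I. rc N x powr (- alpha) * ui j x)"
  proof -
    have "(%x. rc N x powr gamma * u x) = (%x. \<Sum>i\<in>I. rc N x powr gamma * ui i x)" for gamma
      by (rule ext) (simp add: fun_cong[OF usum] sum_distrib_left)
    then show ?thesis by simp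
  qed
  also have "... = (\<Sum>i\<in>I. \<Sum>j\<in>I. ip mu (S theta s (%x. rc N x powr alpha * ui i x)) (%x. rc N x powr (- alpha) * ui j x))"
    by (rule ip_posop_sum[OF PS I]) (intro rc_mult_R2 N um)+
  also have "... <= (\<Sum>i\<in>I. \<Sum>j\<in>I. exp (alpha * d) * (exp (k i - k j) * a i j))"
  proof (intro sum_mono)
    fix i j
    have "ip mu (S theta s (%x. rc N x powr alpha * ui i x)) (%x. rc N x powr (- alpha) * ui j x)
        <= ip mu (S theta s (%x. exp (alpha * d + k i) * ui i x)) (%x. exp (- k j) * ui j x)"
      by (rule posop_ip_mono[OF PS]) (use up lo ui0 in \<open>auto intro!: rc_mult_R2 N um R2_scale\<close>)
    also have "... = exp (alpha * d + k i) * exp (- k j) * a i j" unfolding a_def by (rule posop_ip_scale[OF PS um um])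
    finally show "ip mu (S theta s (%x. rc N x powr alpha * ui i x)) (%x. rc N x powr (- alpha) * ui j x) <= exp (alpha * d) * (exp (k i - k j) * a i j)"
      by (simp add: exp_add exp_diff exp_minus divide_inverse mult.assoc)
  qed
  also have "... = exp (alpha * d) * (\<Sum>i\<in>I. \<Sum>j\<in>I. exp (k i - k j) * a i j)" by (simp add: sum_distrib_left)
  also have "(\<Sum>i\<in>I. \<Sum>j\<in>I. exp (k i - k j) * a i j) = (\<Sum>i\<in>I. \<Sum>j\<in>I. cosh (k i - k j) * a i j)"
    by (rule sum_symmetric_exp_cosh[OF sym(1)])
  also have "(\<Sum>i\<in>I. \<Sum>j\<in>I. cosh (k i - k j) * a i j) <= (\<Sum>i\<in>I. \<Sum>j\<in>I. (1 - theta) * (c i j ^ m * t i j) + theta * y i j)"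
  proof (intro sum_mono)
    fix i j
    have "\<bar>k i - k j\<bar> <= alpha * d * \<bar>real_of_int i - real_of_int j\<bar>"
    proof -
      have "\<bar>k i - k j\<bar> = alpha * \<bar>cl (d * real_of_int i) - cl (d * real_of_int j)\<bar>"
        using alpha by (simp add: k_def abs_mult flip: right_diff_distrib)
      also have "... <= alpha * \<bar>d * real_of_int i - d * real_of_int j\<bar>" using alpha by (intro mult_left_mono cl) auto
      also have "\<bar>d * real_of_int i - d * real_of_int j\<bar> = d * \<bar>real_of_int i - real_of_int j\<bar>" using d by (simp add: abs_mult flip: right_diff_distrib)
      finally show ?thesis by (simp add: mult.assoc)
    qed
    then have "cosh \<bar>k i - k j\<bar> <= cosh (alpha * d * \<bar>real_of_int i - real_of_int j\<bar>)"
      using alpha d by (subst cosh_real_nonneg_le_iff) auto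
    also have "... = c i j" using alpha d cosh_real_abs[of "alpha * d * (real_of_int i - real_of_int j)"] by (simp add: c_def abs_mult)
    finally have "cosh (k i - k j) * a i j <= c i j * a i j" using a0 by (intro mult_right_mono) auto
    also have "c i j * a i j <= (1 - theta) * (c i j ^ m * t i j) + theta * y i j"
    proof -
      \<comment> \<open>Since 1 - theta = 1/m, this z gives c z^(theta - 1) = 1 and c z^theta = c^m:
        the whole weight falls on the free term t i j and none on y i j, for which only
        contractivity is known.\<close>
      define z where "z = c i j ^ m"
      have z: "z > 0" using c1[of i j] by (simp add: z_def)
      have "AE x in mu. S (theta * 1) s (ui i) x <= Q s (ui i) x powr (1 - theta) * S 1 s (ui i) x powr theta"
        by (rule S_log_convex[OF zero_le_one order_refl theta(1,2) s um um um])
          (use ui0 in \<open>auto simp flip: powr_add\<close>)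
      then have "AE x in mu. S theta s (ui i) x <= (1 - theta) * z powr theta * Q s (ui i) x + theta * z powr (theta - 1) * S 1 s (ui i) x"
        using AE_le_weighted_am_gm[OF theta(1,2) posopD(3)[OF PQ um] posopD(3)[OF P1 um], of i i "S theta s (ui i)"] ui0 z by simp
      then have "a i j <= ip mu (%x. (1 - theta) * z powr theta * Q s (ui i) x + theta * z powr (theta - 1) * S 1 s (ui i) x) (ui j)"
        unfolding a_def using ui0 by (intro ip_mono R2_lincomb posopD(1)[OF PS] posopD(1)[OF PQ] posopD(1)[OF P1] um) auto
      also have "... = (1 - theta) * z powr theta * t i j + theta * z powr (theta - 1) * y i j"
        unfolding t_def y_def by (rule ip_lincomb[OF posopD(1)[OF PQ um] posopD(1)[OF P1 um] um])
      finally have "c i j * a i j <= c i j * ((1 - theta) * z powr theta * t i j + theta * z powr (theta - 1) * y i j)"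
        using c1[of i j] by (intro mult_left_mono) auto
      also have "... = (1 - theta) * ((c i j * z powr theta) * t i j) + theta * ((c i j * z powr (theta - 1)) * y i j)"
        by (simp add: algebra_simps)
      also have "z powr (1 / real m) = c i j"
        using c1[of i j] m by (simp add: z_def powr_realpow[symmetric] powr_powr)
      then have "c i j * z powr (theta - 1) = 1" "c i j * z powr theta = z"
        using z by (auto simp: theta_def powr_minus powr_diff field_simps)
      ultimately show ?thesis by (simp add: z_def)
    qed
    finally show "cosh (k i - k j) * a i j <= (1 - theta) * (c i j ^ m * t i j) + theta * y i j" .
  qed
  also have "(\<Sum>i\<in>I. \<Sum>j\<in>I. (1 - theta) * (c i j ^ m * t i j) + theta * y i j)
      = (1 - theta) * (\<Sum>i\<in>I. \<Sum>j\<in>I. c i j ^ m * t i j) + theta * (\<Sum>i\<in>I. \<Sum>j\<in>I. y i j)"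
    by (simp add: sum.distrib sum_distrib_left)
  also have "... <= (1 - theta) * ((1 + real m / B^2 * (exp (B * alpha * d) * exp ((B * alpha)^2 * s) - 1)) * (rn mu u)^2) + theta * (rn mu u)^2"
  proof (intro add_mono mult_left_mono)
    have "(\<Sum>i\<in>I. \<Sum>j\<in>I. y i j) = ip mu (S 1 s u) u"
      unfolding y_def by (subst ip_posop_sum[OF P1 I um um, symmetric]) (simp add: usum[symmetric])
    also have "... <= rn mu (S 1 s u) * rn mu u" using ip_bound[OF posopD(1)[OF P1 uR] uR] by simp
    also have "... <= rn mu u * rn mu u" by (intro mult_right_mono S1 uR) auto
    finally show "(\<Sum>i\<in>I. \<Sum>j\<in>I. y i j) <= (rn mu u)^2" by (simp add: power2_eq_square)
    \<comment> \<open>e <= 1 makes (1 - e) t + e cosh t a convex combination: contractivity of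
      \<open>Q\<close> bounds the first part, the weighted hypothesis with exponent B alpha the
      second.\<close>
    define e where "e = real m / B^2"
    have e: "0 <= e" "e <= 1" using cosh_power_le(2)[of m] m by (auto simp: e_def B_def)
    define b where "b = B * alpha"
    have b: "b > 0" using alpha by (simp add: b_def B_def)
    have tt: "(\<Sum>i\<in>I. \<Sum>j\<in>I. t i j) = ip mu (Q s u) u"
      unfolding t_def by (subst ip_posop_sum[OF PQ I um um, symmetric]) (simp add: usum[symmetric])
    have "ip mu (Q s u) u <= rn mu (Q s u) * rn mu u" using ip_bound[OF posopD(1)[OF PQ uR] uR] by simp
    also have "... <= rn mu u * rn mu u" by (intro mult_right_mono Q_contraction uR s0) auto
    finally have t1: "(\<Sum>i\<in>I. \<Sum>j\<in>I. t i j) <= (rn mu u)^2" unfolding tt by (simp add: power2_eq_square)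
    have up': "exp (b * d * real_of_int i) * ui i x <= wt b (ui i) x" for i x
    proof (cases "idx x = i")
      case True
      have "exp (d * real_of_int i) powr b <= rho x powr b" using bin(1)[OF True] b by (intro powr_mono2) auto
      then show ?thesis unfolding wt_def using ui0[of i x] by (intro mult_right_mono) (auto simp: powr_def ac_simps)
    qed (simp add: ui_def wt_def)
    have lo': "exp (- (b * d * (real_of_int j + 1))) * ui j x <= wt (- b) (ui j) x" for j x
    proof (cases "idx x = j")
      case True
      have "exp (d * (real_of_int j + 1)) powr (- b) <= rho x powr (- b)" using bin(2)[OF True] rho(2)[of x] b by (intro powr_mono2') auto
      then show ?thesis unfolding wt_def using ui0[of j x] by (intro mult_right_mono) (auto simp: powr_def ac_simps)
    qed (simp add: ui_def wt_def)
    define kb where "kb i = b * d * real_of_int i" for i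
    have "(\<Sum>i\<in>I. \<Sum>j\<in>I. cosh (kb i - kb j) * t i j) = (\<Sum>i\<in>I. \<Sum>j\<in>I. exp (kb i - kb j) * t i j)"
      by (rule sum_symmetric_exp_cosh[OF sym(2), symmetric])
    \<comment> \<open>On slice i the weight rho^b is at least exp(b d i), on slice j its inverse is
      at least exp(- b d (j + 1)); the factor exp(b d) pays for the difference of the edges.\<close>
    also have "... <= (\<Sum>i\<in>I. \<Sum>j\<in>I. exp (b * d) * ip mu (Q s (wt b (ui i))) (wt (- b) (ui j)))"
    proof (intro sum_mono)
      fix i j
      have "exp (kb i) * exp (- (b * d * (real_of_int j + 1))) * t i j
          = ip mu (Q s (%x. exp (kb i) * ui i x)) (%x. exp (- (b * d * (real_of_int j + 1))) * ui j x)"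
        unfolding t_def by (rule posop_ip_scale[OF PQ um um, symmetric])
      also have "... <= ip mu (Q s (wt b (ui i))) (wt (- b) (ui j))"
        by (rule posop_ip_mono[OF PQ]) (use up' lo' ui0 in \<open>auto simp: kb_def intro!: wt_R2[OF us K] um R2_scale\<close>)
      finally have "exp (b * d) * (exp (kb i) * exp (- (b * d * (real_of_int j + 1))) * t i j) <= exp (b * d) * ip mu (Q s (wt b (ui i))) (wt (- b) (ui j))"
        by (rule mult_left_mono) simp
      moreover have "exp (b * d) * (exp (kb i) * exp (- (b * d * (real_of_int j + 1))) * t i j) = exp (kb i - kb j) * t i j"
        by (simp add: kb_def mult.assoc[symmetric] flip: exp_add) (simp add: algebra_simps)
      ultimately show "exp (kb i - kb j) * t i j <= exp (b * d) * ip mu (Q s (wt b (ui i))) (wt (- b) (ui j))" by simp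
    qed
    also have "... = exp (b * d) * ip mu (Q s (wt b u)) (wt (- b) u)"
    proof -
      have w: "wt gamma u = (%x. \<Sum>i\<in>I. wt gamma (ui i) x)" for gamma by (subst usum) (simp add: wt_def[abs_def] sum_distrib_left)
      show ?thesis unfolding w by (subst ip_posop_sum[OF PQ I wt_R2[OF us K] wt_R2[OF us K]]) (simp add: sum_distrib_left)
    qed
    also have "... <= exp (b * d) * (exp (b^2 * s) * (rn mu u)^2)" by (intro mult_left_mono T2[OF K u]) auto
    finally have ct: "(\<Sum>i\<in>I. \<Sum>j\<in>I. cosh (kb i - kb j) * t i j) <= exp (b * d) * exp (b^2 * s) * (rn mu u)^2" by simp
    have "(\<Sum>i\<in>I. \<Sum>j\<in>I. c i j ^ m * t i j) <= (\<Sum>i\<in>I. \<Sum>j\<in>I. (1 - e) * t i j + e * (cosh (kb i - kb j) * t i j))"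
    proof (intro sum_mono)
      fix i j
      have "c i j ^ m <= 1 + e * (cosh (kb i - kb j) - 1)"
        using cosh_power_le(1)[of m "alpha * d * (real_of_int i - real_of_int j)"] m
        by (simp add: c_def e_def kb_def b_def B_def algebra_simps)
      then have "c i j ^ m * t i j <= (1 + e * (cosh (kb i - kb j) - 1)) * t i j" using t0 by (intro mult_right_mono)
      then show "c i j ^ m * t i j <= (1 - e) * t i j + e * (cosh (kb i - kb j) * t i j)" by (simp add: algebra_simps)
    qed
    also have "... = (1 - e) * (\<Sum>i\<in>I. \<Sum>j\<in>I. t i j) + e * (\<Sum>i\<in>I. \<Sum>j\<in>I. cosh (kb i - kb j) * t i j)"
      by (simp add: sum.distrib sum_distrib_left)
    also have "... <= (1 - e) * (rn mu u)^2 + e * (exp (b * d) * exp (b^2 * s) * (rn mu u)^2)"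
      using e by (intro add_mono mult_left_mono t1 ct) auto
    also have "... = (1 + e * (exp (b * d) * exp (b^2 * s) - 1)) * (rn mu u)^2" by (simp add: algebra_simps)
    finally show "(\<Sum>i\<in>I. \<Sum>j\<in>I. c i j ^ m * t i j) <= (1 + real m / B^2 * (exp (B * alpha * d) * exp ((B * alpha)^2 * s) - 1)) * (rn mu u)^2"
      by (simp add: e_def b_def)
  qed (use theta in auto)
  \<comment> \<open>The product (1 - theta) m is 1, so m disappears and the excess keeps the
    coefficient 1 / B^2.\<close>
  also have "... = (1 + (exp (B * alpha * d) * exp ((B * alpha)^2 * s) - 1) / B^2) * (rn mu u)^2"
    using m by (simp add: theta_def field_simps)
  finally show ?thesis by (simp add: mult.assoc)
qed

end

lemma Rlim_cutoff:
  assumes f: "f \<in> R2 mu" and P: "!!n. Measurable.pred mu (P n)" and ev: "!!x. f x ~= 0 ==> \<forall>\<^sub>F n in sequentially. P n x"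
  shows "Rlim mu (%n x. if P n x then f x else 0) f"
  unfolding Rlim_def
proof (intro conjI allI)
  note [measurable] = P R2_borel[OF f]
  have fm: "f \<in> borel_measurable mu" by (rule R2_borel[OF f])
  have m: "(%x. if P n x then f x else 0) \<in> borel_measurable mu" for n by measurable
  show "(%x. if P n x then f x else 0) \<in> R2 mu" for n by (rule R2_mono(1)[OF m f]) auto
  have "(%n. \<integral>x. ((if P n x then f x else 0) - f x)^2 \<partial>mu) \<longlonglongrightarrow> (\<integral>x. 0 \<partial>mu)"
  proof (rule integral_dominated_convergence[where w = "%x. (f x)^2"])
    show "integrable mu (%x. (f x)^2)" using f by (simp add: R2_def)
    show "(%x. ((if P n x then f x else 0) - f x)^2) \<in> borel_measurable mu" for n by measurable
    show "AE x in mu. (%n. ((if P n x then f x else 0) - f x)^2) \<longlonglongrightarrow> 0"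
    proof (rule AE_I2)
      fix x
      have "\<forall>\<^sub>F n in sequentially. ((if P n x then f x else 0) - f x)^2 = 0"
      proof (cases "f x = 0")
        case False
        show ?thesis using ev[OF False] by eventually_elim simp
      qed simp
      then show "(%n. ((if P n x then f x else 0) - f x)^2) \<longlonglongrightarrow> 0" by (rule tendsto_eventually)
    qed
  qed auto
  then have "(%n. sqrt (\<integral>x. ((if P n x then f x else 0) - f x)^2 \<partial>mu)) \<longlonglongrightarrow> sqrt 0" by (intro tendsto_real_sqrt) simp
  then show "(%n. rn mu (%x. (if P n x then f x else 0) - f x)) \<longlonglongrightarrow> 0" by (simp add: rn_def)
qed (rule f)

lemma Rlim_ip2:
  assumes a: "Rlim mu a a'" and b: "Rlim mu b b'"
  shows "(%n. ip mu (a n) (b n)) \<longlonglongrightarrow> ip mu a' b'"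
proof -
  note A = RlimD[OF a] and B = RlimD[OF b]
  have "(%n. rn mu (a n) * rn mu (%x. b n x - b' x)) \<longlonglongrightarrow> rn mu a' * 0" by (intro tendsto_mult Rlim_rn[OF a] B(3))
  then have z: "(%n. rn mu (a n) * rn mu (%x. b n x - b' x)) \<longlonglongrightarrow> 0" by simp
  have le: "norm (ip mu (a n) (%x. b n x - b' x)) <= rn mu (a n) * rn mu (%x. b n x - b' x)" for n
    using ip_bound[OF A(1) R2_diff[OF B(1) B(2)]] by simp
  have l: "(%n. ip mu (a n) (%x. b n x - b' x)) \<longlonglongrightarrow> 0"
    by (rule Lim_null_comparison[OF always_eventually z]) (intro allI le)
  have e: "ip mu (a n) (%x. b n x - b' x) + ip mu (a n) b' = ip mu (a n) (b n)" for n
    using ip_diff[OF B(1) B(2) A(1), of n n] ip_commute[of mu "a n"] by simp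
  show ?thesis using tendsto_add[OF l Rlim_ip[OF a B(2)]] unfolding e by simp
qed

lemma one_plus_power_le_exp: "0 <= 1 + x ==> (1 + x) ^ n <= exp (real n * x)" for x :: real
  using power_mono[OF exp_ge_add_one_self[of x], of n] by (simp add: exp_of_nat_mult)

lemma tendsto_half_power_0: "(%k. c / 2 ^ k) \<longlonglongrightarrow> (0::real)"
proof -
  have "(%k. c * (1/2) ^ k) \<longlonglongrightarrow> c * 0" by (intro tendsto_intros LIMSEQ_realpow_zero) auto
  then show ?thesis by (simp add: power_divide)
qed

context weighted_setting
begin

text \<open>The slice width d tends to 0, which removes the discretisation error; then the support
  restriction on u is lifted by cutoffs \<open>un\<close>, the weight remaining clipped at the fixed
  N.\<close>

lemma weighted_quadratic_form:
  assumes T2: "!!K u beta. K >= 1 ==> supp K u ==> ip mu (Q s (wt beta u)) (wt (- beta) u) <= exp (beta^2 * s) * (rn mu u)^2"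
    and S1: "!!f. f \<in> R2 mu ==> rn mu (S 1 s f) <= rn mu f"
    and s: "s > 0" and alpha: "alpha > 0" and m: "m >= 2" and N: "N >= 1" and u: "u \<in> R2 mu" "!!x. 0 <= u x"
  defines "theta == 1 - 1 / real m" and "B == 2 ^ (m + 2) :: real"
  shows "ip mu (S theta s (%x. rc N x powr alpha * u x)) (%x. rc N x powr (- alpha) * u x)
    <= (1 + (exp ((B * alpha)^2 * s) - 1) / B^2) * (rn mu u)^2"
proof -
  have supp: "ip mu (S theta s (%x. rc N x powr alpha * v x)) (%x. rc N x powr (- alpha) * v x)
    <= (1 + (exp ((B * alpha)^2 * s) - 1) / B^2) * (rn mu v)^2" if K: "K >= 1" and v: "supp K v" for K v
  proof -
    have "((%d. exp (alpha * d) * (1 + (exp (B * alpha * d) * exp ((B * alpha)^2 * s) - 1) / B^2) * (rn mu v)^2)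
        \<longlongrightarrow> exp (alpha * 0) * (1 + (exp (B * alpha * 0) * exp ((B * alpha)^2 * s) - 1) / B^2) * (rn mu v)^2) (at_right 0)"
      by (intro tendsto_intros) (simp add: B_def)
    then have "ip mu (S theta s (%x. rc N x powr alpha * v x)) (%x. rc N x powr (- alpha) * v x)
      <= exp (alpha * 0) * (1 + (exp (B * alpha * 0) * exp ((B * alpha)^2 * s) - 1) / B^2) * (rn mu v)^2"
    proof (rule tendsto_lowerbound)
      show "\<forall>\<^sub>F d in at_right 0. ip mu (S theta s (%x. rc N x powr alpha * v x)) (%x. rc N x powr (- alpha) * v x)
          <= exp (alpha * d) * (1 + (exp (B * alpha * d) * exp ((B * alpha)^2 * s) - 1) / B^2) * (rn mu v)^2"
      proof (rule eventually_mono[OF eventually_at_right_less[of 0]])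
        fix d :: real assume d: "d > 0"
        show "ip mu (S theta s (%x. rc N x powr alpha * v x)) (%x. rc N x powr (- alpha) * v x)
          <= exp (alpha * d) * (1 + (exp (B * alpha * d) * exp ((B * alpha)^2 * s) - 1) / B^2) * (rn mu v)^2"
          unfolding theta_def B_def by (rule weighted_quadratic_form_approx[OF T2 S1 s alpha m N K v d])
      qed
    qed simp
    then show ?thesis by simp
  qed
  have theta: "0 <= theta" "theta <= 1" using m by (auto simp: theta_def)
  have s0: "s >= 0" using s by simp
  define P where "P n x \<longleftrightarrow> 1 / (real n + 1) <= rho x \<and> rho x <= real n + 1" for n x
  have Pm: "Measurable.pred mu (P n)" for n unfolding P_def[abs_def] using rho(1) by measurable
  have Pe: "\<forall>\<^sub>F n in sequentially. P n x" for x
  proof -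
    obtain N1 :: nat where N1: "real N1 >= max (rho x) (1 / rho x)" using real_arch_simple by blast
    show ?thesis
    proof (rule eventually_sequentiallyI[of N1])
      fix n assume "n >= N1"
      then have n: "real n + 1 >= rho x" "real n + 1 >= 1 / rho x" using N1 by (auto intro: order_trans)
      then show "P n x" using rho(2)[of x] by (simp add: P_def field_simps)
    qed
  qed
  define un where "un n x = (if P n x then u x else 0)" for n x
  have lim: "Rlim mu un u" unfolding un_def[abs_def] by (rule Rlim_cutoff[OF u(1) Pm Pe])
  have us: "supp (real n + 1) (un n)" for n using RlimD(1)[OF lim] u(2) by (auto simp: supp_def un_def P_def)
  have l1: "Rlim mu (%n. S theta s (%x. rc N x powr alpha * un n x)) (S theta s (%x. rc N x powr alpha * u x))"
    by (rule posop_Rlim[OF S[OF theta s0] posop_Rlim[OF rc_posop[OF N] lim]])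
  have l2: "Rlim mu (%n x. rc N x powr (- alpha) * un n x) (%x. rc N x powr (- alpha) * u x)"
    by (rule posop_Rlim[OF rc_posop[OF N] lim])
  have B1: "B^2 >= 0" by simp
  show ?thesis
  proof (rule LIMSEQ_le[OF Rlim_ip2[OF l1 l2]])
    show "(%n. (1 + (exp ((B * alpha)^2 * s) - 1) / B^2) * (rn mu (un n))^2) \<longlonglongrightarrow> (1 + (exp ((B * alpha)^2 * s) - 1) / B^2) * (rn mu u)^2"
      by (intro tendsto_intros Rlim_rn[OF lim])
    show "\<exists>N'. \<forall>n\<ge>N'. ip mu (S theta s (%x. rc N x powr alpha * un n x)) (%x. rc N x powr (- alpha) * un n x) <= (1 + (exp ((B * alpha)^2 * s) - 1) / B^2) * (rn mu (un n))^2"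
      using supp[OF _ us] by auto
  qed
qed

lemma wt_eq_rc:
  assumes f: "supp K f" and K: "K >= 1"
  shows "wt alpha f = (%x. rc K x powr alpha * f x)"
proof
  fix x
  show "wt alpha f x = rc K x powr alpha * f x"
  proof (cases "f x = 0")
    case False
    then have "1 / K <= rho x" "rho x <= K" using suppD(3)[OF f, of x] by auto
    then have "rc K x = rho x" by (simp add: rc_def)
    then show ?thesis by (simp add: wt_def)
  qed (simp add: wt_def)
qed

text \<open>The form bound w s = 1 + (exp((B alpha)^2 s) - 1) / B^2 equals 1 + alpha^2 s + O(s^2),
  as B cancels in first order. Squaring k times by \<open>quad_form_square\<close>, starting from s
  = t / 2^k, and letting k tend to infinity gives exp(alpha^2 t). The factor 4 is the price for
  bilinear instead of quadratic forms and is independent of m.\<close>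

theorem weighted_L2_bound:
  assumes T2: "!!s K u beta. s > 0 ==> K >= 1 ==> supp K u ==> ip mu (Q s (wt beta u)) (wt (- beta) u) <= exp (beta^2 * s) * (rn mu u)^2"
    and S1: "!!s f. s > 0 ==> f \<in> R2 mu ==> rn mu (S 1 s f) <= rn mu f"
    and t: "t > 0" and alpha: "alpha > 0" and m: "m >= 2" and K: "K >= 1" and f: "supp K f" and g: "supp K g"
  defines "theta == 1 - 1 / real m"
  shows "ip mu (S theta t (wt alpha f)) (wt (- alpha) g) <= 4 * exp (alpha^2 * t) * rn mu f * rn mu g"
proof -
  define B where "B = (2 ^ (m + 2) :: real)"
  have B: "B > 0" by (simp add: B_def)
  have theta: "0 <= theta" "theta <= 1" using m by (auto simp: theta_def)
  define D where "D s h = (%x. rc K x powr (- alpha) * S theta s (%x. rc K x powr alpha * h x) x)" for s h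
  have D: "posop mu (D s)" if "s >= 0" for s
    unfolding D_def by (rule posop_comp[OF rc_posop[OF K] posop_comp[OF S[OF theta that] rc_posop[OF K]]])
  have Dip: "ip mu (D s h) g = ip mu (S theta s (%x. rc K x powr alpha * h x)) (%x. rc K x powr (- alpha) * g x)" for s h g
    by (simp add: D_def ip_def ac_simps)
  have inv: "rc K x powr alpha * (rc K x powr (- alpha) * z) = z" for x z
    using rc_bounds(3)[OF K, of x] by (simp add: mult.assoc[symmetric] flip: powr_add)
  have D2: "AE x in mu. D (s + s) h x = D s (D s h) x" if s: "s >= 0" and h: "h \<in> R2 mu" for s h
    using S_add[OF theta s s rc_mult_R2[OF K h, of alpha]] by eventually_elim (simp add: D_def inv)
  define w where "w s = 1 + (exp ((B * alpha)^2 * s) - 1) / B^2" for s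
  have w: "w s > 0" if "s > 0" for s
  proof -
    have "exp ((B * alpha)^2 * s) >= 1" using that by simp
    then show ?thesis using B by (simp add: w_def add_pos_nonneg)
  qed
  have base: "ip mu (D s h) h <= w s * (rn mu h)^2" if s: "s > 0" and h: "h \<in> R2 mu" "!!x. 0 <= h x" for s h
    unfolding Dip w_def B_def theta_def by (rule weighted_quadratic_form[OF T2[OF s] S1[OF s] s alpha m K h])
  have iter: "ip mu (D (2 ^ k * s) h) h <= w s ^ (2 ^ k) * (rn mu h)^2" if s: "s > 0" and h: "h \<in> R2 mu" "!!x. 0 <= h x" for s h k
    using h
  proof (induction k arbitrary: h)
    case 0
    then show ?case using base[OF s] by simp
  next
    case (Suc k)
    have ks: "2 ^ k * s >= 0" using s by simp
    have e: "2 ^ Suc k * s = 2 ^ k * s + 2 ^ k * s" by simp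
    have "ip mu (D (2 ^ Suc k * s) h) h = ip mu (D (2 ^ k * s) (D (2 ^ k * s) h)) h"
      unfolding e by (rule ip_cong[OF posopD(1)[OF D[OF add_nonneg_nonneg[OF ks ks]] Suc(2)] posopD(1)[OF D[OF ks] posopD(1)[OF D[OF ks] Suc(2)]] Suc(2) D2[OF ks Suc(2)]])
    also have "... <= (w s ^ (2 ^ k))^2 * (rn mu h)^2"
      by (rule quad_form_square[OF D[OF ks] _ Suc.IH Suc(2)]) (use w[OF s] in auto)
    finally show ?case by (simp add: power_mult[symmetric] mult.commute)
  qed
  have quad: "ip mu (D t h) h <= exp (alpha^2 * t) * (rn mu h)^2" if h: "h \<in> R2 mu" "!!x. 0 <= h x" for h
  proof -
    define y where "y k = (B * alpha)^2 * t / 2 ^ k" for k :: nat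
    have le: "ip mu (D t h) h <= exp (alpha^2 * t * exp (y k)) * (rn mu h)^2" for k
    proof -
      define s where "s = t / 2 ^ k"
      have s: "s > 0" using t by (simp add: s_def)
      have ys: "(B * alpha)^2 * s = y k" by (simp add: y_def s_def)
      have y0: "y k >= 0" using t by (simp add: y_def)
      have "2 ^ k * s = t" by (simp add: s_def)
      then have "ip mu (D t h) h <= w s ^ (2 ^ k) * (rn mu h)^2" using iter[OF s h, of k] by simp
      also have "w s ^ (2 ^ k) <= exp (real (2 ^ k) * ((exp (y k) - 1) / B^2))"
        unfolding w_def ys by (rule one_plus_power_le_exp) (use y0 B in \<open>simp add: add_nonneg_nonneg\<close>)
      also have "... <= exp (alpha^2 * t * exp (y k))"
      proof -
        have "exp (y k) - 1 <= y k * exp (y k)" using abs_exp_minus_one_le[of "y k"] y0 by simp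
        then have "2 ^ k * ((exp (y k) - 1) / B^2) <= 2 ^ k * (y k * exp (y k) / B^2)"
          by (intro mult_left_mono divide_right_mono) auto
        also have "... = alpha^2 * t * exp (y k)" using B by (simp add: y_def power_mult_distrib)
        finally show ?thesis by simp
      qed
      finally show ?thesis by (simp add: mult_right_mono)
    qed
    have "(%k. exp (alpha^2 * t * exp (y k)) * (rn mu h)^2) \<longlonglongrightarrow> exp (alpha^2 * t * exp 0) * (rn mu h)^2"
      unfolding y_def by (intro tendsto_intros tendsto_half_power_0)
    then have "ip mu (D t h) h <= exp (alpha^2 * t * exp 0) * (rn mu h)^2"
      by (rule LIMSEQ_le_const) (intro exI[of _ 0] allI impI le)
    then show ?thesis by simp
  qed
  define E where "E = exp (alpha^2 * t)"
  have t0: "t >= 0" using t by simp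
  note fR = suppD(1)[OF f] and gR = suppD(1)[OF g]
  have f0: "0 <= f x" and g0: "0 <= g x" for x using suppD(2) f g by auto
  \<comment> \<open>Positivity replaces polarisation: a f and g / a both lie below h = a f + g / a,
    so the bilinear form is at most the quadratic form at h.\<close>
  have pol: "ip mu (D t f) g <= E * (a * rn mu f + rn mu g / a)^2" if a: "a > 0" for a
  proof -
    define h where "h = (%x. a * f x + (1 / a) * g x)"
    have h: "h \<in> R2 mu" unfolding h_def by (rule R2_lincomb[OF fR gR])
    have h0: "0 <= h x" for x using f0[of x] g0[of x] a by (simp add: h_def)
    have le: "a * f x <= h x" "1 / a * g x <= h x" for x using f0[of x] g0[of x] a by (auto simp: h_def)
    have "ip mu (D t f) g = ip mu (D t (%x. a * f x)) (%x. 1 / a * g x)"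
      using posop_ip_scale[OF D[OF t0] fR gR, of a "1 / a"] a by simp
    also have "... <= ip mu (D t h) h"
      by (rule posop_ip_mono[OF D[OF t0] R2_scale[OF fR] h R2_scale[OF gR] h]) (use le f0 g0 a in auto)
    also have "... <= E * (rn mu h)^2" unfolding E_def by (rule quad[OF h h0])
    also have "... <= E * (a * rn mu f + rn mu g / a)^2"
    proof (intro mult_left_mono power_mono)
      show "rn mu h <= a * rn mu f + rn mu g / a"
        using rn_triangle[OF R2_scale[OF fR, of a] R2_scale[OF gR, of "1 / a"]] a
        unfolding h_def rn_scale by (simp only: abs_of_pos[OF a] abs_divide abs_one times_divide_eq_left mult_1)
    qed (auto simp: E_def)
    finally show ?thesis .
  qed
  have "ip mu (D t f) g <= 4 * E * rn mu f * rn mu g"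
  proof (cases "rn mu f = 0 \<or> rn mu g = 0")
    case True
    obtain C where C: "C > 0" "!!f. f \<in> R2 mu ==> rn mu (D t f) <= C * rn mu f" using posop_bound[OF D[OF t0]] by blast
    have "ip mu (D t f) g <= rn mu (D t f) * rn mu g" using ip_bound[OF posopD(1)[OF D[OF t0] fR] gR] by simp
    also have "... <= (C * rn mu f) * rn mu g" by (intro mult_right_mono C fR) simp
    also have "... = 0" using True by auto
    finally show ?thesis using True by auto
  next
    case False
    then have pos: "rn mu f > 0" "rn mu g > 0" by (auto simp: order_less_le)
    \<comment> \<open>This a equalises a |f| and |g| / a; the square of their sum is then four times
      their product.\<close>
    define a where "a = sqrt (rn mu g / rn mu f)"
    have a: "a > 0" using pos by (simp add: a_def)
    have a2: "a * a = rn mu g / rn mu f" using pos by (simp add: a_def)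
    then have "a * rn mu f = rn mu g / a" using a pos by (simp add: field_simps)
    then have "(a * rn mu f + rn mu g / a)^2 = 4 * ((a * rn mu f) * (rn mu g / a))" by (simp add: power2_eq_square)
    also have "... = 4 * (rn mu f * rn mu g)" using a by simp
    finally show ?thesis using pol[OF a] by (simp add: ac_simps)
  qed
  then show ?thesis unfolding Dip E_def wt_eq_rc[OF f K] wt_eq_rc[OF g K] .
qed

section \<open>Interpolation between the free and the perturbed semigroup\<close>

definition nice :: "real => ('a => real) => bool" where
  "nice K f \<longleftrightarrow> K >= 1 \<and> supp K f \<and> integrable mu f \<and> (\<forall>x. f x <= K)"

lemma niceD: "nice K f ==> K >= 1" "nice K f ==> supp K f" "nice K f ==> integrable mu f" "nice K f ==> f x <= K" "nice K f ==> 0 <= f x"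
  by (auto simp: nice_def suppD)

lemma niceI:
  assumes K: "K >= 1" and i: "integrable mu f" and b: "!!x. 0 <= f x" "!!x. f x <= K" and s: "!!x. f x ~= 0 ==> 1 / K <= rho x \<and> rho x <= K"
  shows "nice K f"
proof -
  have m: "f \<in> borel_measurable mu" using i by (rule borel_measurable_integrable)
  have "integrable mu (%x. (f x)^2)"
  proof (rule Bochner_Integration.integrable_bound[of mu "%x. K * f x"])
    show "(%x. (f x)^2) \<in> borel_measurable mu" using m by measurable
    show "AE x in mu. norm ((f x)^2) <= norm (K * f x)"
      using b K by (auto simp: power2_eq_square abs_mult intro!: mult_right_mono)
  qed (use i in simp)
  then show ?thesis using assms m by (auto simp: nice_def supp_def R2_def)
qed

lemma nice_mono:
  assumes "nice K f" "K <= L" shows "nice L f"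
proof -
  note f = niceD[OF assms(1)]
  have "1 / L <= 1 / K" using f(1) assms(2) by (intro divide_left_mono) auto
  then show ?thesis using assms f suppD(3)[OF f(2)]
    by (intro niceI) (auto intro: order_trans[OF f(4)] order_trans)
qed

lemma nice_powr:
  assumes f: "nice K f" and a: "a >= 1"
  shows "integrable mu (%x. f x powr a)"
proof (rule Bochner_Integration.integrable_bound[of mu "%x. K powr (a - 1) * f x"])
  have m: "f \<in> borel_measurable mu" using niceD(3)[OF f] by (rule borel_measurable_integrable)
  show "(%x. f x powr a) \<in> borel_measurable mu" using m by measurable
  have "f x powr a <= K powr (a - 1) * f x" for x
  proof (cases "f x = 0")
    case False
    then have p: "f x > 0" using niceD(5)[OF f, of x] by simp
    have "f x powr a = f x powr (a - 1) * f x" using p by (simp add: powr_diff)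
    also have "... <= K powr (a - 1) * f x" using p a niceD(4)[OF f, of x] by (intro mult_right_mono powr_mono2) auto
    finally show ?thesis .
  qed (use a in simp)
  then show "AE x in mu. norm (f x powr a) <= norm (K powr (a - 1) * f x)" using niceD(5)[OF f] by simp
qed (use niceD(3)[OF f] in simp)

definition nq :: "real => ('a => real) => real" where
  "nq q f = (\<integral>x. f x powr q \<partial>mu) powr (1 / q)"

lemma nq_nonneg[simp]: "nq q f >= 0" by (simp add: nq_def)

text \<open>The operators with potential \<open>0\<close>, \<open>l theta W\<close>, \<open>theta W\<close> are interpolated by writing
  \<open>f = (f\<^sup>q)\<^bsup>1-l\<^esup> (f\<^bsup>q/2\<^esup>)\<^bsup>l\<^esup>\<close>.\<close>

lemma interpolated_bound_normalised:
  assumes C1: "!!K f g. nice K f ==> nice K g ==> ip mu (Q t (wt alpha f)) (wt (- alpha) g) <= C1 * (\<integral>x. f x \<partial>mu) * (\<integral>x. g x \<partial>mu)"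
    and C2: "!!K f g. K >= 1 ==> supp K f ==> supp K g ==> ip mu (S theta t (wt alpha f)) (wt (- alpha) g) <= C2 * rn mu f * rn mu g"
    and t: "t > 0" and theta: "0 <= theta" "theta <= 1" and l: "0 < l" "l < 1" and C: "C1 >= 0" "C2 >= 0"
    and f: "nice K f" "(\<integral>x. f x powr (2 / (2 - l)) \<partial>mu) = 1" and g: "nice K g" "(\<integral>x. g x powr (2 / (2 - l)) \<partial>mu) = 1"
  shows "ip mu (S (l * theta) t (wt alpha f)) (wt (- alpha) g) <= C1 powr (1 - l) * C2 powr l"
proof -
  \<comment> \<open>1/q = (1 - l) + l/2 interpolates between the exponent 1 of the free bound and
    the exponent 2 of the perturbed one.\<close>
  define q where "q = 2 / (2 - l)"
  have q: "1 < q" "q < 2" "q * (1 - l / 2) = 1" using l by (auto simp: q_def field_simps)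
  have K: "K >= 1" by (rule niceD(1)[OF f(1)])
  define K' where "K' = K powr q"
  have K': "K <= K'" "K' >= 1" using powr_mono[of 1 q K] q K by (auto simp: K'_def)
  have kk: "1 / K' <= 1 / K" using K K' by (intro divide_left_mono) auto
  have t0: "t >= 0" using t by simp
  define f1 where "f1 h x = h x powr q" for h :: "'a => real" and x
  define f2 where "f2 h x = h x powr (q / 2)" for h :: "'a => real" and x
  have n1: "nice K' (f1 h)" if h: "nice K h" for h
  proof (rule niceI[OF K'(2)])
    show "integrable mu (f1 h)" unfolding f1_def by (rule nice_powr[OF h]) (use q in simp)
    show "f1 h x <= K'" for x unfolding f1_def K'_def using niceD(4,5)[OF h] q by (intro powr_mono2) auto
    show "1 / K' <= rho x \<and> rho x <= K'" if "f1 h x ~= 0" for x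
      using suppD(3)[OF niceD(2)[OF h], of x] that K'(1) kk by (auto simp: f1_def)
  qed (simp add: f1_def)
  have sq: "(f2 h x)^2 = f1 h x" for h x by (simp add: f1_def f2_def power2_eq_square flip: powr_add)
  have n2: "supp K' (f2 h)" if h: "nice K h" for h
    unfolding supp_def
  proof (intro conjI allI impI)
    have "h \<in> borel_measurable mu" using niceD(3)[OF h] by (rule borel_measurable_integrable)
    then have "f2 h \<in> borel_measurable mu" unfolding f2_def[abs_def] by measurable
    moreover have "integrable mu (%x. (f2 h x)^2)" unfolding sq by (rule niceD(3)[OF n1[OF h]])
    ultimately show "f2 h \<in> R2 mu" by (simp add: R2_def)
    show "1 / K' <= rho x" if "f2 h x ~= 0" for x
      using suppD(3)[OF niceD(2)[OF h], of x] that kk by (auto simp: f2_def)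
    show "rho x <= K'" if "f2 h x ~= 0" for x
      using suppD(3)[OF niceD(2)[OF h], of x] that K'(1) by (auto simp: f2_def)
  qed (simp add: f2_def)
  have r2: "rn mu (f2 h) = 1" if "(\<integral>x. h x powr q \<partial>mu) = 1" for h unfolding rn_def sq using that by (simp add: f1_def)
  \<comment> \<open>The weight is split with the same exponents as h, so all three operators carry
    the same alpha.\<close>
  have fac: "wt gamma h x = (wt gamma (f1 h) x) powr (1 - l) * (wt gamma (f2 h) x) powr l" if h: "nice K h" for h gamma x
  proof -
    have "h x = h x powr (q * (1 - l / 2))" using niceD(5)[OF h, of x] q(3) by simp
    also have "q * (1 - l / 2) = q * (1 - l) + q / 2 * l" by (simp add: algebra_simps)
    also have "h x powr (q * (1 - l) + q / 2 * l) = (f1 h x) powr (1 - l) * (f2 h x) powr l"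
      by (simp add: f1_def f2_def powr_powr powr_add)
    finally have e: "h x = (f1 h x) powr (1 - l) * (f2 h x) powr l" .
    have "rho x powr gamma = (rho x powr gamma) powr (1 - l) * (rho x powr gamma) powr l" using rho(2)[of x] by (simp flip: powr_add)
    then have "wt gamma h x = ((rho x powr gamma) powr (1 - l) * (f1 h x) powr (1 - l)) * ((rho x powr gamma) powr l * (f2 h x) powr l)"
      unfolding wt_def by (subst e) (simp only: ac_simps)
    then show ?thesis unfolding wt_def by (simp add: powr_mult f1_def f2_def)
  qed
  have lt: "0 <= l * theta" "l * theta <= 1" using l theta mult_mono[of l 1 theta 1] by auto
  note F = wt_R2[OF niceD(2)[OF f(1)] K] wt_R2[OF niceD(2)[OF n1[OF f(1)]] K'(2)] wt_R2[OF n2[OF f(1)] K'(2)]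
  note G = wt_R2[OF niceD(2)[OF g(1)] K] wt_R2[OF niceD(2)[OF n1[OF g(1)]] K'(2)] wt_R2[OF n2[OF g(1)] K'(2)]
  define X where "X = Q t (wt alpha (f1 f))" define Y where "Y = S theta t (wt alpha (f2 f))"
  have XY: "X \<in> R2 mu" "Y \<in> R2 mu" unfolding X_def Y_def by (rule posopD(1)[OF Q[OF t0] F(2)], rule posopD(1)[OF S[OF theta t0] F(3)])
  have X0: "AE x in mu. 0 <= X x" unfolding X_def by (rule posopD(3)[OF Q[OF t0] F(2)]) (simp add: wt_def f1_def)
  have Y0: "AE x in mu. 0 <= Y x" unfolding Y_def by (rule posopD(3)[OF S[OF theta t0] F(3)]) (simp add: wt_def f2_def)
  have le: "AE x in mu. S (l * theta) t (wt alpha f) x <= X x powr (1 - l) * Y x powr l"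
    unfolding X_def Y_def
    by (rule S_log_convex[OF theta l t F]) (use fac[OF f(1), of alpha] in \<open>auto simp: wt_def f1_def f2_def\<close>)
  \<comment> \<open>Hoelder's inequality for the pairing with g, again by optimising over linear
    inequalities after integration.\<close>
  have "ip mu (S (l * theta) t (wt alpha f)) (wt (- alpha) g) <= (ip mu X (wt (- alpha) (f1 g))) powr (1 - l) * (ip mu Y (wt (- alpha) (f2 g))) powr l"
  proof (rule weighted_am_gm_optimal[OF l])
    show i1: "0 <= ip mu X (wt (- alpha) (f1 g))" by (rule ip_nonneg[OF X0]) (simp add: wt_def f1_def)
    show i2: "0 <= ip mu Y (wt (- alpha) (f2 g))" by (rule ip_nonneg[OF Y0]) (simp add: wt_def f2_def)
    fix z :: real assume z: "z > 0"
    have "ip mu (S (l * theta) t (wt alpha f)) (wt (- alpha) g)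
        <= (\<integral>x. (1 - l) * z powr l * (X x * wt (- alpha) (f1 g) x) + l * z powr (l - 1) * (Y x * wt (- alpha) (f2 g) x) \<partial>mu)"
      unfolding ip_def
    proof (rule integral_mono_AE[OF ip_integrable[OF posopD(1)[OF S[OF lt t0] F(1)] G(1)]])
      show "integrable mu (%x. (1 - l) * z powr l * (X x * wt (- alpha) (f1 g) x) + l * z powr (l - 1) * (Y x * wt (- alpha) (f2 g) x))"
        using ip_integrable[OF XY(1) G(2)] ip_integrable[OF XY(2) G(3)] by simp
      show "AE x in mu. S (l * theta) t (wt alpha f) x * wt (- alpha) g x
          <= (1 - l) * z powr l * (X x * wt (- alpha) (f1 g) x) + l * z powr (l - 1) * (Y x * wt (- alpha) (f2 g) x)"
        using le X0 Y0
      proof eventually_elim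
        case (elim x)
        define G1 where "G1 = wt (- alpha) (f1 g) x" define G2 where "G2 = wt (- alpha) (f2 g) x"
        have G0: "G1 >= 0" "G2 >= 0" by (auto simp: G1_def G2_def wt_def f1_def f2_def)
        have "S (l * theta) t (wt alpha f) x * wt (- alpha) g x <= (X x powr (1 - l) * Y x powr l) * (G1 powr (1 - l) * G2 powr l)"
          unfolding fac[OF g(1), of "- alpha"] G1_def[symmetric] G2_def[symmetric] by (intro mult_right_mono elim) auto
        also have "... = (X x * G1) powr (1 - l) * (Y x * G2) powr l" using elim G0 by (simp add: powr_mult ac_simps)
        also have "... <= (1 - l) * z powr l * (X x * G1) + l * z powr (l - 1) * (Y x * G2)"
          using elim G0 l z by (intro le_weighted_am_gm) auto
        finally show ?case unfolding G1_def G2_def .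
      qed
    qed
    also have "... = (1 - l) * z powr l * ip mu X (wt (- alpha) (f1 g)) + l * z powr (l - 1) * ip mu Y (wt (- alpha) (f2 g))"
      using ip_integrable[OF XY(1) G(2)] ip_integrable[OF XY(2) G(3)] by (simp add: ip_def)
    finally show "ip mu (S (l * theta) t (wt alpha f)) (wt (- alpha) g) <= (1 - l) * z powr l * ip mu X (wt (- alpha) (f1 g)) + l * z powr (l - 1) * ip mu Y (wt (- alpha) (f2 g))" .
  qed
  also have "... <= C1 powr (1 - l) * C2 powr l"
  proof (intro mult_mono powr_mono2)
    have "ip mu X (wt (- alpha) (f1 g)) <= C1 * (\<integral>x. f1 f x \<partial>mu) * (\<integral>x. f1 g x \<partial>mu)"
      unfolding X_def by (rule C1[OF n1[OF f(1)] n1[OF g(1)]])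
    then show "ip mu X (wt (- alpha) (f1 g)) <= C1" using f(2) g(2) by (simp add: f1_def q_def)
    have "ip mu Y (wt (- alpha) (f2 g)) <= C2 * rn mu (f2 f) * rn mu (f2 g)"
      unfolding Y_def by (rule C2[OF K'(2) n2[OF f(1)] n2[OF g(1)]])
    then show "ip mu Y (wt (- alpha) (f2 g)) <= C2" using r2 f(2) g(2) by (simp add: q_def)
    show "0 <= ip mu X (wt (- alpha) (f1 g))" by (rule ip_nonneg[OF X0]) (simp add: wt_def f1_def)
    show "0 <= ip mu Y (wt (- alpha) (f2 g))" by (rule ip_nonneg[OF Y0]) (simp add: wt_def f2_def)
  qed (use l in auto)
  finally show ?thesis .
qed

end

text \<open>Taking suprema over Z gives D <= A D^s. As D is finite, division by D^s is allowed, and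
  the result no longer depends on the a priori bound.\<close>

lemma self_improving_bound:
  fixes Z :: "real set" and A s z :: real
  assumes z: "z \<in> Z" and bdd: "bdd_above Z" and nn: "!!z. z \<in> Z ==> 0 <= z" and A: "A >= 0" and s: "0 < s" "s < 1"
    and step: "!!z D. z \<in> Z ==> (!!z'. z' \<in> Z ==> z' <= D) ==> z <= A * D powr s"
  shows "z <= A powr (1 / (1 - s))"
proof -
  define D where "D = Sup Z"
  have up: "z' <= D" if "z' \<in> Z" for z' unfolding D_def by (rule cSup_upper[OF that bdd])
  have D0: "D >= 0" using up[OF z] nn[OF z] by linarith
  have ne: "Z ~= {}" using z by auto
  have "Sup Z <= A * D powr s" by (rule cSup_least[OF ne]) (rule step[OF _ up])
  then have D: "D <= A * D powr s" by (simp only: D_def)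
  have "D <= A powr (1 / (1 - s))"
  proof (cases "D = 0")
    case False
    then have p: "D > 0" using D0 by simp
    have "D powr (1 - s) * D powr s = D" using p by (simp flip: powr_add)
    then have "D powr (1 - s) * D powr s <= A * D powr s" using D by simp
    then have "D powr (1 - s) <= A" using p by simp
    then have "(D powr (1 - s)) powr (1 / (1 - s)) <= A powr (1 / (1 - s))" using s by (intro powr_mono2) auto
    then show ?thesis using p s by (simp add: powr_powr)
  qed simp
  then show ?thesis using up[OF z] by linarith
qed

section \<open>Lebesgue norms, truncated test functions and duality\<close>

context weighted_setting
begin

lemma wt_cancel: "wt alpha (wt (- alpha) F) x = F x" "wt (- alpha) (wt alpha F) x = F x"
  using rho(2)[of x] by (simp_all add: wt_def mult.assoc[symmetric] flip: powr_add)

lemma wt_scale: "wt alpha (%x. a * f x) = (%x. a * wt alpha f x)" by (simp add: wt_def fun_eq_iff)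

lemma nice_R2: "nice K f ==> wt alpha f \<in> R2 mu" by (rule wt_R2[OF niceD(2) niceD(1)])

lemma nice_measurable: "nice K f ==> f \<in> borel_measurable mu" using niceD(3)[of K f] by (rule borel_measurable_integrable)

lemma nice_power:
  assumes h: "nice K h" and q: "q >= 1"
  shows "nice (K powr q) (%x. h x powr q)"
proof -
  have K: "K >= 1" by (rule niceD(1)[OF h])
  have K': "K <= K powr q" "K powr q >= 1" using powr_mono[of 1 q K] q K by auto
  have kk: "1 / K powr q <= 1 / K" using K K' by (intro divide_left_mono) auto
  show ?thesis
  proof (rule niceI[OF K'(2)])
    show "integrable mu (%x. h x powr q)" by (rule nice_powr[OF h q])
    show "h x powr q <= K powr q" for x using niceD(4,5)[OF h] q by (intro powr_mono2) auto
    show "1 / K powr q <= rho x \<and> rho x <= K powr q" if n: "h x powr q ~= 0" for x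
    proof -
      have "h x ~= 0" using n by auto
      then have "1 / K <= rho x \<and> rho x <= K" by (rule suppD(3)[OF niceD(2)[OF h]])
      then show ?thesis using K'(1) kk by linarith
    qed
  qed simp
qed

lemma nice_scale:
  assumes f: "nice K f" and a: "a > 0"
  shows "nice (max K (a * K)) (%x. a * f x)"
proof (rule niceI)
  note n = nice_mono[OF f max.cobounded1[of K "a * K"]]
  show "1 <= max K (a * K)" by (rule niceD(1)[OF n])
  show "integrable mu (%x. a * f x)" using niceD(3)[OF f] by simp
  show "0 <= a * f x" for x using a niceD(5)[OF f] by simp
  have "a * f x <= a * K" for x using a niceD(4)[OF f] by simp
  then show "a * f x <= max K (a * K)" for x by (rule order_trans[OF _ max.cobounded2])
  show "1 / max K (a * K) <= rho x \<and> rho x <= max K (a * K)" if "a * f x ~= 0" for x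
    by (rule suppD(3)[OF niceD(2)[OF n]]) (use that in auto)
qed

text \<open>With \<open>q = 1 + \<sigma>\<close> the conjugate exponent is \<open>1 + 1/\<sigma>\<close>.\<close>

lemma nq_interpolation:
  assumes f: "nice K f" and \<sigma>: "0 < \<sigma>" "\<sigma> < 1"
  shows "nq (1 + \<sigma>) f <= (\<integral>x. f x \<partial>mu) powr (1 - \<sigma>) * nq (1 + 1 / \<sigma>) f powr \<sigma>"
proof -
  define X where "X = (\<integral>x. f x \<partial>mu)"
  define Y where "Y = (\<integral>x. f x powr (1 + 1 / \<sigma>) \<partial>mu)"
  have i1: "integrable mu (%x. f x powr (1 + 1 / \<sigma>))" and i2: "integrable mu (%x. f x powr (1 + \<sigma>))"
    using \<sigma> by (auto intro!: nice_powr[OF f])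
  have s2: "0 < \<sigma>^2" "\<sigma>^2 < 1" using \<sigma> by (auto simp: power_less_one_iff abs_square_less_1)
  have X0: "X >= 0" unfolding X_def using niceD(5)[OF f] by (intro integral_nonneg_AE) auto
  have Y0: "Y >= 0" unfolding Y_def by (intro integral_nonneg_AE) auto
  \<comment> \<open>The exponent 1 + \<sigma> lies between 1 and 1 + 1/\<sigma> with parameter
    \<sigma>^2; taking the root of order 1 + \<sigma> later turns 1 - \<sigma>^2 into 1 -
    \<sigma>.\<close>
  have e: "1 - \<sigma>^2 + (1 + 1 / \<sigma>) * \<sigma>^2 = 1 + \<sigma>" using \<sigma> by (simp add: field_simps power2_eq_square)
  have "(\<integral>x. f x powr (1 + \<sigma>) \<partial>mu) <= X powr (1 - \<sigma>^2) * Y powr \<sigma>^2"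
  proof (rule weighted_am_gm_optimal[OF s2 X0 Y0])
    fix z :: real assume z: "z > 0"
    have "(\<integral>x. f x powr (1 + \<sigma>) \<partial>mu) <= (\<integral>x. (1 - \<sigma>^2) * z powr \<sigma>^2 * f x + \<sigma>^2 * z powr (\<sigma>^2 - 1) * f x powr (1 + 1 / \<sigma>) \<partial>mu)"
    proof (rule integral_mono[OF i2])
      show "integrable mu (%x. (1 - \<sigma>^2) * z powr \<sigma>^2 * f x + \<sigma>^2 * z powr (\<sigma>^2 - 1) * f x powr (1 + 1 / \<sigma>))"
        using i1 niceD(3)[OF f] by simp
      fix x
      have "f x powr (1 + \<sigma>) = f x powr (1 - \<sigma>^2) * (f x powr (1 + 1 / \<sigma>)) powr \<sigma>^2"
        unfolding powr_powr powr_add[symmetric] e ..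
      also have "... <= (1 - \<sigma>^2) * z powr \<sigma>^2 * f x + \<sigma>^2 * z powr (\<sigma>^2 - 1) * f x powr (1 + 1 / \<sigma>)"
        by (rule le_weighted_am_gm[OF s2 niceD(5)[OF f] _ z]) simp
      finally show "f x powr (1 + \<sigma>) <= (1 - \<sigma>^2) * z powr \<sigma>^2 * f x + \<sigma>^2 * z powr (\<sigma>^2 - 1) * f x powr (1 + 1 / \<sigma>)" .
    qed
    also have "... = (1 - \<sigma>^2) * z powr \<sigma>^2 * X + \<sigma>^2 * z powr (\<sigma>^2 - 1) * Y"
      using i1 niceD(3)[OF f] by (simp add: X_def Y_def)
    finally show "(\<integral>x. f x powr (1 + \<sigma>) \<partial>mu) <= (1 - \<sigma>^2) * z powr \<sigma>^2 * X + \<sigma>^2 * z powr (\<sigma>^2 - 1) * Y" .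
  qed
  then have "nq (1 + \<sigma>) f <= (X powr (1 - \<sigma>^2) * Y powr \<sigma>^2) powr (1 / (1 + \<sigma>))"
    unfolding nq_def using \<sigma> by (intro powr_mono2 integral_nonneg_AE) auto
  also have "... = X powr ((1 - \<sigma>^2) * (1 / (1 + \<sigma>))) * Y powr (\<sigma>^2 * (1 / (1 + \<sigma>)))"
    by (simp add: powr_mult powr_powr)
  also have "(1 - \<sigma>^2) * (1 / (1 + \<sigma>)) = 1 - \<sigma>" using \<sigma> by (simp add: field_simps power2_eq_square)
  also have "\<sigma>^2 * (1 / (1 + \<sigma>)) = 1 / (1 + 1 / \<sigma>) * \<sigma>" using \<sigma> by (simp add: field_simps power2_eq_square)
  finally show ?thesis unfolding nq_def X_def Y_def powr_powr .
qed

text \<open>Homogeneity in f and g. If one of the norms vanishes, normalisation is impossible, but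
  then the weighted function is 0 almost everywhere.\<close>

lemma interpolated_bound:
  assumes C1: "!!K f g. nice K f ==> nice K g ==> ip mu (Q t (wt alpha f)) (wt (- alpha) g) <= C1 * (\<integral>x. f x \<partial>mu) * (\<integral>x. g x \<partial>mu)"
    and C2: "!!K f g. K >= 1 ==> supp K f ==> supp K g ==> ip mu (S theta t (wt alpha f)) (wt (- alpha) g) <= C2 * rn mu f * rn mu g"
    and t: "t > 0" and theta: "0 <= theta" "theta <= 1" and l: "0 < l" "l < 1" and C: "C1 >= 0" "C2 >= 0"
    and f: "nice K f" and g: "nice K g"
  shows "ip mu (S (l * theta) t (wt alpha f)) (wt (- alpha) g) <= C1 powr (1 - l) * C2 powr l * nq (2 / (2 - l)) f * nq (2 / (2 - l)) g"
proof -
  define q where "q = 2 / (2 - l)"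
  have q: "q >= 1" using l by (simp add: q_def field_simps)
  have lt: "0 <= l * theta" "l * theta <= 1" using l theta mult_mono[of l 1 theta 1] by auto
  have t0: "t >= 0" using t by simp
  define Cq where "Cq = C1 powr (1 - l) * C2 powr l"
  define b where "b f g = ip mu (S (l * theta) t (wt alpha f)) (wt (- alpha) g)" for f g
  have sc: "b (%x. a * f x) (%x. c * g x) = a * c * b f g" if f: "nice K f" and g: "nice K g" for a c f g K
    unfolding b_def wt_scale by (rule posop_ip_scale[OF S[OF lt t0] nice_R2[OF f] nice_R2[OF g]])
  have pos: "b f g <= Cq * a * c" if f: "nice K f" and g: "nice K g" and I: "(\<integral>x. f x powr q \<partial>mu) = a powr q" "(\<integral>x. g x powr q \<partial>mu) = c powr q" and ac: "a > 0" "c > 0" for f g a c K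
  proof -
    define L where "L = max (max K (1 / a * K)) (max K (1 / c * K))"
    have nf: "nice L (%x. 1 / a * f x)" unfolding L_def by (rule nice_mono[OF nice_scale[OF f] max.cobounded1]) (use ac in simp)
    have ng: "nice L (%x. 1 / c * g x)" unfolding L_def by (rule nice_mono[OF nice_scale[OF g] max.cobounded2]) (use ac in simp)
    have i: "(\<integral>x. (1 / a * f x) powr q \<partial>mu) = 1" if "(\<integral>x. f x powr q \<partial>mu) = a powr q" "a > 0" "nice K f" for a f
    proof -
      have "(1 / a * f x) powr q = (1 / a) powr q * f x powr q" for x by (rule powr_mult)
      then have "(\<integral>x. (1 / a * f x) powr q \<partial>mu) = (1 / a) powr q * a powr q" by (simp only: integral_mult_right_zero that(1))
      also have "... = (1 / a * a) powr q" by (rule powr_mult[symmetric])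
      finally show ?thesis using that(2) by simp
    qed
    have "b (%x. 1 / a * f x) (%x. 1 / c * g x) <= Cq"
      unfolding b_def Cq_def
      by (rule interpolated_bound_normalised[OF C1 C2 t theta l C nf i[OF I(1) ac(1) f, unfolded q_def] ng i[OF I(2) ac(2) g, unfolded q_def]])
    then have "a * c * (1 / a * (1 / c) * b f g) <= a * c * Cq" unfolding sc[OF f g] using ac by (intro mult_left_mono) auto
    then show ?thesis using ac by (simp add: ac_simps)
  qed
  have zero: "rn mu (wt gamma h) = 0" if "nice K h" "(\<integral>x. h x powr q \<partial>mu) = 0" for h gamma
  proof -
    have "AE x in mu. h x powr q = 0"
      using integral_nonneg_eq_0_iff_AE[OF nice_powr[OF that(1) q]] that(2) by simp
    then have "AE x in mu. wt gamma h x = 0" by eventually_elim (simp add: wt_def)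
    then show ?thesis using rn_0_iff[OF nice_R2[OF that(1)]] by simp
  qed
  define F where "F = (\<integral>x. f x powr q \<partial>mu)" define G where "G = (\<integral>x. g x powr q \<partial>mu)"
  have FG: "F >= 0" "G >= 0" by (auto simp: F_def G_def intro: integral_nonneg_AE)
  have "b f g <= Cq * nq q f * nq q g"
  proof (cases "F = 0 \<or> G = 0")
    case True
    obtain C where C: "C > 0" "!!f. f \<in> R2 mu ==> rn mu (S (l * theta) t f) <= C * rn mu f" using posop_bound[OF S[OF lt t0]] by blast
    have "b f g <= rn mu (S (l * theta) t (wt alpha f)) * rn mu (wt (- alpha) g)"
      unfolding b_def using ip_bound[OF posopD(1)[OF S[OF lt t0] nice_R2[OF f]] nice_R2[OF g]] by (rule order_trans[OF abs_ge_self])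
    also have "... <= (C * rn mu (wt alpha f)) * rn mu (wt (- alpha) g)" by (intro mult_right_mono C nice_R2[OF f]) simp
    also have "... = 0" using True zero[OF f] zero[OF g] by (auto simp: F_def G_def)
    also have "0 <= Cq * nq q f * nq q g" by (simp add: Cq_def)
    finally show ?thesis .
  next
    case False
    then have "F > 0" "G > 0" using FG by auto
    then show ?thesis using q by (intro pos[OF f g]) (auto simp: nq_def powr_powr F_def G_def)
  qed
  then show ?thesis by (simp only: b_def Cq_def q_def)
qed

text \<open>A truncation of rho^(-alpha) F to a \<open>nice\<close> function. Finiteness of Lebesgue
  norms other than the second is not known for F itself, so all estimates are made for the cuts,
  uniformly in n. The lower threshold forces a support of finite measure.\<close>

definition cut :: "real => ('a => real) => nat => 'a => real" where
  "cut alpha F n x = (if 1 / (real n + 1) <= rho x \<and> rho x <= real n + 1 \<and> 1 / (real n + 1) <= wt (- alpha) F x \<and> wt (- alpha) F x <= real n + 1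
    then wt (- alpha) F x else 0)"

lemma wt_measurable[measurable (raw)]: "F \<in> borel_measurable mu ==> wt alpha F \<in> borel_measurable mu"
  unfolding wt_def[abs_def] using rho(1) by measurable

lemma cut_nice:
  assumes F: "F \<in> R2 mu"
  shows "nice (real n + 1) (cut alpha F n)"
proof -
  define N where "N = real n + 1"
  have N: "N >= 1" by (simp add: N_def)
  note [measurable] = R2_borel[OF F] rho(1)
  have m: "cut alpha F n \<in> borel_measurable mu" unfolding cut_def[abs_def] by measurable
  have b: "0 <= cut alpha F n x" "cut alpha F n x <= N" "cut alpha F n x ~= 0 ==> 1 / N <= rho x \<and> rho x <= N"
    "cut alpha F n x <= N * (N powr \<bar>alpha\<bar>)^2 * (F x)^2" for x
  proof -
    define y where "y = wt (- alpha) F x"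
    show "cut alpha F n x <= N * (N powr \<bar>alpha\<bar>)^2 * (F x)^2" "0 <= cut alpha F n x" "cut alpha F n x <= N" "cut alpha F n x ~= 0 ==> 1 / N <= rho x \<and> rho x <= N"
    proof -
      have N1: "1 / N > 0" using N by simp
      show "0 <= cut alpha F n x" "cut alpha F n x <= N" "cut alpha F n x ~= 0 ==> 1 / N <= rho x \<and> rho x <= N"
        using N N1 unfolding cut_def N_def[symmetric] by (auto split: if_splits intro: order_trans[OF less_imp_le[OF N1]])
      show "cut alpha F n x <= N * (N powr \<bar>alpha\<bar>)^2 * (F x)^2"
      proof (cases "cut alpha F n x = 0")
        case False
        then have P: "1 / N <= rho x" "rho x <= N" "1 / N <= y" and e: "cut alpha F n x = y"
          unfolding cut_def N_def[symmetric] y_def[symmetric] by (auto split: if_splits)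
        have y: "y > 0" using P(3) N1 by linarith
        \<comment> \<open>The lower threshold 1/N <= y gives y <= N y^2, which is integrable because
          F is in \<open>R2\<close>.\<close>
        have "1 <= N * y" using P(3) N by (simp add: field_simps)
        then have "y <= (N * y) * y" using y by simp
        also have "... = N * y^2" by (simp add: power2_eq_square)
        also have "y^2 = (rho x powr (- alpha))^2 * (F x)^2" by (simp add: y_def wt_def power_mult_distrib)
        also have "N * ... <= N * ((N powr \<bar>alpha\<bar>)^2 * (F x)^2)"
          using powr_between[OF N P(1,2), of "- alpha"] N by (intro mult_left_mono mult_right_mono power_mono) auto
        finally show ?thesis by (simp add: e mult.assoc)
      next
        case True
        then show ?thesis using N by simp
      qed
    qed
  qed
  show ?thesis
    unfolding N_def[symmetric]
  proof (rule niceI[OF N _ b(1,2) b(3)])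
    show "integrable mu (cut alpha F n)"
    proof (rule Bochner_Integration.integrable_bound[of mu "%x. N * (N powr \<bar>alpha\<bar>)^2 * (F x)^2"])
      show "integrable mu (%x. N * (N powr \<bar>alpha\<bar>)^2 * (F x)^2)" using F by (simp add: R2_def)
      show "AE x in mu. norm (cut alpha F n x) <= norm (N * (N powr \<bar>alpha\<bar>)^2 * (F x)^2)"
      proof (rule AE_I2)
        fix x show "norm (cut alpha F n x) <= norm (N * (N powr \<bar>alpha\<bar>)^2 * (F x)^2)"
          using b(1)[of x] b(4)[of x] by (simp only: real_norm_def abs_of_nonneg)
      qed
    qed (rule m)
  qed
qed

lemma cut_Rlim:
  assumes F: "F \<in> R2 mu" "AE x in mu. 0 <= F x"
  shows "Rlim mu (%n. wt alpha (cut alpha F n)) F"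
proof -
  define P where "P n x \<longleftrightarrow> 1 / (real n + 1) <= rho x \<and> rho x <= real n + 1 \<and> 1 / (real n + 1) <= wt (- alpha) F x \<and> wt (- alpha) F x <= real n + 1" for n x
  note [measurable] = R2_borel[OF F(1)] rho(1)
  have Pm: "Measurable.pred mu (P n)" for n unfolding P_def[abs_def] by measurable
  define H where "H x = max 0 (F x)" for x
  have HR: "H \<in> R2 mu" unfolding H_def[abs_def] by (rule R2_mono(1)[OF _ F(1)]) (auto simp: max_def)
  have "Rlim mu (%n x. if P n x then H x else 0) H"
  proof (rule Rlim_cutoff[OF HR Pm])
    fix x assume "H x ~= 0"
    then have Fx: "F x > 0" by (auto simp: H_def max_def split: if_splits)
    define y where "y = wt (- alpha) F x"
    have y: "y > 0" using Fx rho(2)[of x] by (simp add: y_def wt_def)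
    have r: "rho x > 0" by (rule rho(2))
    obtain N1 :: nat where N1: "real N1 >= max (max (rho x) (1 / rho x)) (max y (1 / y))" using real_arch_simple by blast
    show "\<forall>\<^sub>F n in sequentially. P n x"
    proof (rule eventually_sequentiallyI[of N1])
      fix n assume "n >= N1"
      then have "real n + 1 >= real N1" by simp
      then have n: "real n + 1 >= rho x" "real n + 1 >= 1 / rho x" "real n + 1 >= y" "real n + 1 >= 1 / y" using N1 by auto
      have n0: "real n + 1 > 0" by simp
      have "1 / (real n + 1) <= rho x" using n(2) r n0 by (simp add: field_simps)
      moreover have "1 / (real n + 1) <= y" using n(4) y n0 by (simp add: field_simps)
      ultimately show "P n x" using n(1,3) by (simp add: P_def y_def)
    qed
  qed
  moreover have "(%n x. if P n x then H x else 0) = (%n. wt alpha (cut alpha F n))"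
  proof (intro ext)
    fix n x
    show "(if P n x then H x else 0) = wt alpha (cut alpha F n) x"
    proof (cases "P n x")
      case True
      then have "0 < 1 / (real n + 1)" "1 / (real n + 1) <= wt (- alpha) F x" by (auto simp: P_def)
      then have "0 < wt (- alpha) F x" by linarith
      then have "0 < F x" using rho(2)[of x] by (simp add: wt_def zero_less_mult_iff)
      moreover have "cut alpha F n x = wt (- alpha) F x" using True by (simp add: cut_def P_def)
      ultimately show ?thesis using True wt_cancel(1)[of alpha F x] by (simp add: H_def wt_def)
    next
      case False
      then have "cut alpha F n x = 0" unfolding cut_def P_def by (rule if_not_P)
      then show ?thesis using False by (simp add: wt_def)
    qed
  qed
  ultimately have L: "Rlim mu (%n. wt alpha (cut alpha F n)) H" by simp
  have "rn mu (%x. wt alpha (cut alpha F n) x - H x) = rn mu (%x. wt alpha (cut alpha F n) x - F x)" for n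
  proof (rule rn_cong)
    show "(%x. wt alpha (cut alpha F n) x - H x) \<in> borel_measurable mu" by (rule R2_borel[OF R2_diff[OF RlimD(1)[OF L] HR]])
    show "(%x. wt alpha (cut alpha F n) x - F x) \<in> borel_measurable mu" by (rule R2_borel[OF R2_diff[OF RlimD(1)[OF L] F(1)]])
    show "AE x in mu. wt alpha (cut alpha F n) x - H x = wt alpha (cut alpha F n) x - F x" using F(2) by eventually_elim (simp add: H_def)
  qed
  then show ?thesis using L F(1) by (simp add: Rlim_def)
qed

text \<open>Where a cut is nonzero it is at least 1 / (n + 1), so N times the cut is an integrable
  majorant of the indicator.\<close>

lemma nice_cut_indicator:
  assumes F: "F \<in> R2 mu" and A: "Measurable.pred mu A" and le: "!!x. A x ==> cut alpha F n x ~= 0"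
  shows "nice (real n + 1) (%x. if A x then 1 else 0)"
proof (rule niceI)
  define N where "N = real n + 1"
  have N: "N >= 1" by (simp add: N_def)
  note cn = cut_nice[OF F, of n alpha, folded N_def]
  show "integrable mu (%x. if A x then 1 else 0 :: real)"
  proof (rule Bochner_Integration.integrable_bound[of mu "%x. N * cut alpha F n x"])
    show "integrable mu (%x. N * cut alpha F n x)" using niceD(3)[OF cn] by simp
    show "(%x. if A x then 1 else 0 :: real) \<in> borel_measurable mu" using A by measurable
    show "AE x in mu. norm (if A x then 1 else 0 :: real) <= norm (N * cut alpha F n x)"
    proof (rule AE_I2)
      fix x
      show "norm (if A x then 1 else 0 :: real) <= norm (N * cut alpha F n x)"
      proof (cases "A x")
        case True
        then have "1 / N <= cut alpha F n x" using le[OF True] unfolding cut_def N_def[symmetric] by (auto split: if_splits)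
        then have "1 <= N * cut alpha F n x" using N by (simp add: field_simps)
        then show ?thesis using True by simp
      qed simp
    qed
  qed
  show "1 / (real n + 1) <= rho x \<and> rho x <= real n + 1" if n: "(if A x then 1 else 0 :: real) ~= 0" for x
  proof -
    have "A x" using n by (auto split: if_splits)
    then show ?thesis using suppD(3)[OF niceD(2)[OF cn] le] by (simp only: N_def)
  qed
qed auto

text \<open>Testing F with the indicator of the support of the cut gives exactly the mass of the
  cut.\<close>

lemma cut_mass:
  assumes F: "F \<in> R2 mu" and le: "!!K h. nice K h ==> (!!x. h x <= 1) ==> ip mu F (wt (- alpha) h) <= c"
  shows "(\<integral>x. cut alpha F n x \<partial>mu) <= c"
proof -
  define h where "h x = (if cut alpha F n x ~= 0 then 1 else 0 :: real)" for x
  have [measurable]: "cut alpha F n \<in> borel_measurable mu" by (rule nice_measurable[OF cut_nice[OF F]])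
  have nh: "nice (real n + 1) h" unfolding h_def[abs_def]
    by (rule nice_cut_indicator[OF F, where alpha = alpha]) auto
  have "F x * wt (- alpha) h x = cut alpha F n x" for x
  proof (cases "cut alpha F n x = 0")
    case False
    then have "cut alpha F n x = wt (- alpha) F x" unfolding cut_def by (auto split: if_splits)
    then show ?thesis using False by (simp add: h_def wt_def)
  qed (simp add: h_def wt_def)
  then have "(\<integral>x. cut alpha F n x \<partial>mu) = ip mu F (wt (- alpha) h)" by (simp add: ip_def)
  also have "... <= c" by (rule le[OF nh]) (simp add: h_def)
  finally show ?thesis .
qed

text \<open>Duality between the exponents 1 + \<sigma> and 1 + 1/\<sigma>. The extremal test
  function of a cut c is c^(1/\<sigma>), which is again nice; it gives X <= b X^(1/(1 + \<sigma>))
  for the finite integral X of c^(1 + 1/\<sigma>).\<close>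

lemma dual_cut_bound:
  assumes F: "F \<in> R2 mu" and b: "b >= 0" and \<sigma>: "0 < \<sigma>" "\<sigma> < 1"
    and le: "!!K g. nice K g ==> ip mu F (wt (- alpha) g) <= b * nq (1 + \<sigma>) g"
  shows "nq (1 + 1 / \<sigma>) (cut alpha F n) <= b"
proof -
  define c where "c = cut alpha F n"
  have cn: "nice (real n + 1) c" unfolding c_def by (rule cut_nice[OF F])
  define h where "h x = c x powr (1 / \<sigma>)" for x
  have s1: "1 / \<sigma> >= 1" using \<sigma> by simp
  have nh: "nice ((real n + 1) powr (1 / \<sigma>)) h" unfolding h_def[abs_def] by (rule nice_power[OF cn s1])
  define X where "X = (\<integral>x. c x powr (1 + 1 / \<sigma>) \<partial>mu)"
  have X0: "X >= 0" unfolding X_def by (intro integral_nonneg_AE) auto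
  have "F x * wt (- alpha) h x = c x powr (1 + 1 / \<sigma>)" for x
  proof (cases "c x = 0")
    case False
    then have "c x = wt (- alpha) F x" unfolding c_def cut_def by (auto split: if_splits)
    moreover have "c x powr (1 + 1 / \<sigma>) = c x * h x" using niceD(5)[OF cn, of x] by (simp add: powr_add h_def)
    ultimately show ?thesis by (simp add: wt_def)
  qed (simp add: h_def wt_def)
  then have "X = ip mu F (wt (- alpha) h)" by (simp add: ip_def X_def)
  also have "... <= b * nq (1 + \<sigma>) h" by (rule le[OF nh])
  also have "nq (1 + \<sigma>) h = X powr (1 / (1 + \<sigma>))"
  proof -
    have "1 / \<sigma> * (1 + \<sigma>) = 1 + 1 / \<sigma>" using \<sigma> by (simp add: field_simps)
    then show ?thesis unfolding nq_def h_def powr_powr X_def by simp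
  qed
  finally have X: "X <= b * X powr (1 / (1 + \<sigma>))" .
  have e: "1 / (1 + 1 / \<sigma>) + 1 / (1 + \<sigma>) = 1" using \<sigma> by (simp add: field_simps)
  have "X powr (1 / (1 + 1 / \<sigma>)) <= b"
  proof (cases "X = 0")
    case False
    then have p: "X > 0" using X0 by simp
    have "X powr (1 / (1 + 1 / \<sigma>)) * X powr (1 / (1 + \<sigma>)) = X" using p by (simp only: powr_add[symmetric] e powr_one less_imp_le)
    then have "X powr (1 / (1 + 1 / \<sigma>)) * X powr (1 / (1 + \<sigma>)) <= b * X powr (1 / (1 + \<sigma>))" using X by simp
    then show ?thesis using p by simp
  qed (use b in simp)
  then show ?thesis by (simp add: nq_def X_def c_def)
qed

end

section \<open>Extrapolation of a form bound to L1 on both sides\<close>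

locale weighted_form = weighted_setting mu Q R W G S rho for mu :: "'a measure" and Q R W G S rho +
  fixes U :: "real => ('a => real) => 'a => real" and \<sigma> omega C :: real
  assumes U: "!!t. t >= 0 ==> posop mu (U t)"
    and U_sym: "!!t f g. t >= 0 ==> f \<in> R2 mu ==> g \<in> R2 mu ==> ip mu (U t f) g = ip mu f (U t g)"
    and U_add: "!!s t f. s >= 0 ==> t >= 0 ==> f \<in> R2 mu ==> AE x in mu. U (s + t) f x = U s (U t f) x"
    and \<sigma>: "0 < \<sigma>" "\<sigma> < 1" and omega: "omega > 0" and C: "C >= 0"
    and form_bound: "!!t alpha K f g. t > 0 ==> alpha ~= 0 ==> nice K f ==> nice K g ==>
      ip mu (U t (wt alpha f)) (wt (- alpha) g) <= C * t powr (- (omega * (1 - \<sigma>))) * exp (alpha^2 * t) * nq (1 + \<sigma>) f * nq (1 + \<sigma>) g"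
begin

text \<open>With the time exponent written as omega (1 - \<sigma>), one extrapolation gives omega
  \<sigma> for the map from mass to the norm with exponent 1 + \<sigma>, and extrapolation on both
  sides gives omega (1 + \<sigma>) in total.\<close>

definition B :: "real => real => real" where "B alpha t = C * t powr (- (omega * (1 - \<sigma>))) * exp (alpha^2 * t)"

lemma B_nonneg[simp]: "B alpha t >= 0" using C by (simp add: B_def)

lemma form_bound': 
  assumes "t > 0" "alpha ~= 0" "nice K f" "nice L g"
  shows "ip mu (U t (wt alpha f)) (wt (- alpha) g) <= B alpha t * nq (1 + \<sigma>) f * nq (1 + \<sigma>) g"
  unfolding B_def by (rule form_bound[OF assms(1,2) nice_mono[OF assms(3) max.cobounded1] nice_mono[OF assms(4) max.cobounded2]])

lemma form_bound_cut:
  assumes t: "t > 0" and alpha: "alpha ~= 0" and F: "F \<in> R2 mu" "AE x in mu. 0 <= F x" and b: "!!n. nq (1 + \<sigma>) (cut alpha F n) <= b"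
    and g: "nice K g"
  shows "ip mu (U t F) (wt (- alpha) g) <= B alpha t * b * nq (1 + \<sigma>) g"
proof (rule LIMSEQ_le_const2)
  have t0: "t >= 0" using t by simp
  show "(%n. ip mu (U t (wt alpha (cut alpha F n))) (wt (- alpha) g)) \<longlonglongrightarrow> ip mu (U t F) (wt (- alpha) g)"
    by (rule Rlim_ip[OF posop_Rlim[OF U[OF t0] cut_Rlim[OF F]] nice_R2[OF g]])
  have "ip mu (U t (wt alpha (cut alpha F n))) (wt (- alpha) g) <= B alpha t * b * nq (1 + \<sigma>) g" for n
  proof -
    have "ip mu (U t (wt alpha (cut alpha F n))) (wt (- alpha) g) <= B alpha t * nq (1 + \<sigma>) (cut alpha F n) * nq (1 + \<sigma>) g"
      by (rule form_bound'[OF t alpha cut_nice[OF F(1)] g])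
    also have "... <= B alpha t * b * nq (1 + \<sigma>) g" by (intro mult_right_mono mult_left_mono b) auto
    finally show ?thesis .
  qed
  then show "\<exists>N. \<forall>n\<ge>N. ip mu (U t (wt alpha (cut alpha F n))) (wt (- alpha) g) <= B alpha t * b * nq (1 + \<sigma>) g" by (intro exI allI impI)
qed

lemma form_bound_cut2:
  assumes t: "t > 0" and alpha: "alpha ~= 0" and F: "F \<in> R2 mu" "AE x in mu. 0 <= F x" and b: "!!n. nq (1 + \<sigma>) (cut alpha F n) <= b"
    and H: "H \<in> R2 mu" "AE x in mu. 0 <= H x" and b': "!!n. nq (1 + \<sigma>) (cut (- alpha) H n) <= b'"
  shows "ip mu (U t F) H <= B alpha t * b * b'"
proof (rule LIMSEQ_le_const2)
  have t0: "t >= 0" using t by simp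
  have b0: "b >= 0" using order_trans[OF nq_nonneg b[of 0]] .
  show "(%n. ip mu (U t F) (wt (- alpha) (cut (- alpha) H n))) \<longlonglongrightarrow> ip mu (U t F) H"
    by (rule Rlim_ip2[OF Rlim_const[OF posopD(1)[OF U[OF t0] F(1)]] cut_Rlim[OF H]])
  have "ip mu (U t F) (wt (- alpha) (cut (- alpha) H n)) <= B alpha t * b * b'" for n
  proof -
    have "ip mu (U t F) (wt (- alpha) (cut (- alpha) H n)) <= B alpha t * b * nq (1 + \<sigma>) (cut (- alpha) H n)"
      by (rule form_bound_cut[OF t alpha F b cut_nice[OF H(1)]])
    also have "... <= B alpha t * b * b'" by (intro mult_left_mono b') (use b0 in simp)
    finally show ?thesis .
  qed
  then show "\<exists>N. \<forall>n\<ge>N. ip mu (U t F) (wt (- alpha) (cut (- alpha) H n)) <= B alpha t * b * b'" by (intro exI allI impI)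
qed

text \<open>The bound on the mass is extrapolated: the norm with exponent \<open>1 + 1/\<sigma>\<close> at time \<open>tau\<close> is
  controlled by its own power \<open>\<sigma> < 1\<close> at time \<open>tau/2\<close>.\<close>

lemma extrapolation:
  assumes alpha: "alpha ~= 0" and f: "nice K f" and t: "t > 0" and M: "M >= 0"
    and mass: "!!tau n. 0 < tau ==> tau <= t ==> (\<integral>x. cut alpha (U tau (wt alpha f)) n x \<partial>mu) <= M * exp (alpha^2 * tau)"
  shows "nq (1 + \<sigma>) (cut alpha (U t (wt alpha f)) n) <= (C * 2 powr omega) powr (\<sigma> / (1 - \<sigma>)) * t powr (- (omega * \<sigma>)) * exp (alpha^2 * t) * M"
proof -
  define F where "F tau = U tau (wt alpha f)" for tau
  have FR: "F tau \<in> R2 mu" and F0: "AE x in mu. 0 <= F tau x" if "tau > 0" for tau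
    using posopD(1,3)[OF U[of tau] nice_R2[OF f, of alpha]] that niceD(5)[OF f] by (auto simp: F_def wt_def)
  have mass0: "0 <= (\<integral>x. cut alpha (F tau) n x \<partial>mu)" if "tau > 0" for tau n
    using niceD(5)[OF cut_nice[OF FR[OF that]]] by (intro integral_nonneg_AE AE_I2)
  define y where "y tau n = nq (1 + 1 / \<sigma>) (cut alpha (F tau) n)" for tau n
  have y0: "y tau n >= 0" for tau n by (simp add: y_def)
  have hoelder: "nq (1 + \<sigma>) (cut alpha (F tau) n) <= (M * exp (alpha^2 * tau)) powr (1 - \<sigma>) * D powr \<sigma>"
    if tau: "0 < tau" "tau <= t" and D: "y tau n <= D" for tau n D
  proof -
    have "nq (1 + \<sigma>) (cut alpha (F tau) n) <= (\<integral>x. cut alpha (F tau) n x \<partial>mu) powr (1 - \<sigma>) * y tau n powr \<sigma>"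
      unfolding y_def by (rule nq_interpolation[OF cut_nice[OF FR[OF tau(1)]] \<sigma>])
    also have "... <= (M * exp (alpha^2 * tau)) powr (1 - \<sigma>) * D powr \<sigma>"
      using \<sigma> mass[OF tau] mass0[OF tau(1)] D y0 by (intro mult_mono powr_mono2) (auto simp: F_def)
    finally show ?thesis .
  qed
  have split: "(M * exp (alpha^2 * tau)) powr (1 - \<sigma>) * (D * tau powr (- omega) * exp (alpha^2 * tau)) powr \<sigma>
      = M powr (1 - \<sigma>) * D powr \<sigma> * tau powr (- (omega * \<sigma>)) * exp (alpha^2 * tau)" if "D >= 0" for D tau
  proof -
    have "exp (alpha^2 * tau) powr (1 - \<sigma>) * exp (alpha^2 * tau) powr \<sigma> = exp (alpha^2 * tau)" by (simp flip: powr_add)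
    then have "M powr (1 - \<sigma>) * D powr \<sigma> * tau powr (- (omega * \<sigma>)) * (exp (alpha^2 * tau) powr (1 - \<sigma>) * exp (alpha^2 * tau) powr \<sigma>)
      = M powr (1 - \<sigma>) * D powr \<sigma> * tau powr (- (omega * \<sigma>)) * exp (alpha^2 * tau)" by (simp only:)
    moreover have "(tau powr (- omega)) powr \<sigma> = tau powr (- (omega * \<sigma>))" by (simp add: powr_powr)
    ultimately show ?thesis using M that by (simp add: powr_mult ac_simps del: powr_powr)
  qed
  define A where "A = C * 2 powr omega * M powr (1 - \<sigma>)"
  \<comment> \<open>Norms divided by the expected rate tau^(- omega) exp(alpha^2 tau), for all times
    up to t and all cut levels.\<close>
  define Z where "Z = {y tau n * tau powr omega * exp (- (alpha^2 * tau)) | tau n. 0 < tau \<and> tau <= t}"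
  have bound: "y tau n * tau powr omega * exp (- (alpha^2 * tau)) <= A powr (1 / (1 - \<sigma>))" if tau: "0 < tau" "tau <= t" for tau n
  proof (rule self_improving_bound[where Z = Z and s = \<sigma>])
    show "y tau n * tau powr omega * exp (- (alpha^2 * tau)) \<in> Z" unfolding Z_def using tau by blast
    show "A >= 0" using C by (simp add: A_def)
    show "0 <= z" if "z \<in> Z" for z using that y0 by (auto simp: Z_def)
    \<comment> \<open>The a priori bound: the form bound is used once on the nice function f. Its
      constant depends on f, which is harmless as only finiteness matters.\<close>
    show "bdd_above Z"
    proof (rule bdd_aboveI[where M = "C * t powr (omega * \<sigma>) * nq (1 + \<sigma>) f"])
      fix z assume "z \<in> Z"
      then obtain tau n where z: "z = y tau n * tau powr omega * exp (- (alpha^2 * tau))" and tau: "0 < tau" "tau <= t" unfolding Z_def by blast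
      have "y tau n <= B alpha tau * nq (1 + \<sigma>) f"
        unfolding y_def
      proof (rule dual_cut_bound[OF FR[OF tau(1)] _ \<sigma>])
        show "ip mu (F tau) (wt (- alpha) g) <= B alpha tau * nq (1 + \<sigma>) f * nq (1 + \<sigma>) g" if "nice K g" for K g
          unfolding F_def by (rule form_bound'[OF tau(1) alpha f that])
      qed simp
      then have "z <= B alpha tau * nq (1 + \<sigma>) f * tau powr omega * exp (- (alpha^2 * tau))" unfolding z by (intro mult_right_mono) auto
      also have "... = C * nq (1 + \<sigma>) f * (tau powr (- (omega * (1 - \<sigma>))) * tau powr omega) * (exp (alpha^2 * tau) * exp (- (alpha^2 * tau)))"
        by (simp only: B_def ac_simps)
      also have "tau powr (- (omega * (1 - \<sigma>))) * tau powr omega = tau powr (omega * \<sigma>)" by (simp add: algebra_simps flip: powr_add)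
      also have "exp (alpha^2 * tau) * exp (- (alpha^2 * tau)) = 1" by (simp flip: exp_add)
      also have "C * nq (1 + \<sigma>) f * tau powr (omega * \<sigma>) * 1 <= C * nq (1 + \<sigma>) f * t powr (omega * \<sigma>) * 1"
        using tau omega \<sigma> C by (intro mult_right_mono mult_left_mono powr_mono2) auto
      finally show "z <= C * t powr (omega * \<sigma>) * nq (1 + \<sigma>) f" by (simp add: ac_simps)
    qed
    fix z D assume "z \<in> Z" and D: "!!z'. z' \<in> Z ==> z' <= D"
    then obtain tau n where z: "z = y tau n * tau powr omega * exp (- (alpha^2 * tau))" and tau: "0 < tau" "tau <= t" unfolding Z_def by blast
    \<comment> \<open>After the first half of the time, interpolation of the mass with D bounds the
      norm with exponent 1 + \<sigma>; the form bound acts during the second half. Halving the time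
      accounts for 2^omega in A.\<close>
    define s where "s = tau / 2"
    have s: "0 < s" "s <= t" "tau = s + s" using tau by (auto simp: s_def)
    have "0 <= z" unfolding z using y0 by simp
    then have D0: "0 <= D" by (rule order_trans[OF _ D[OF \<open>z \<in> Z\<close>]])
    have yD: "y s k <= D * s powr (- omega) * exp (alpha^2 * s)" for k
    proof -
      have "y s k * s powr omega * exp (- (alpha^2 * s)) <= D" by (rule D) (use s in \<open>auto simp: Z_def\<close>)
      then show ?thesis using s(1) by (simp add: exp_minus powr_minus field_simps)
    qed
    define b where "b = M powr (1 - \<sigma>) * D powr \<sigma> * s powr (- (omega * \<sigma>)) * exp (alpha^2 * s)"
    have nb: "nq (1 + \<sigma>) (cut alpha (F s) k) <= b" for k
      using hoelder[OF s(1,2) yD] unfolding split[OF D0] b_def .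
    have "y tau n <= B alpha s * b"
      unfolding y_def
    proof (rule dual_cut_bound[OF FR[OF tau(1)] _ \<sigma>])
      show "0 <= B alpha s * b" by (simp add: b_def)
      fix K g assume g: "nice K g"
      have s0: "s >= 0" using s by simp
      have "ip mu (F tau) (wt (- alpha) g) = ip mu (U s (F s)) (wt (- alpha) g)"
        by (rule ip_cong[OF FR[OF tau(1)] posopD(1)[OF U[OF s0] FR[OF s(1)]] nice_R2[OF g]])
          (use U_add[OF s0 s0 nice_R2[OF f, of alpha]] in \<open>simp add: F_def s(3)\<close>)
      also have "... <= B alpha s * b * nq (1 + \<sigma>) g" by (rule form_bound_cut[OF s(1) alpha FR[OF s(1)] F0[OF s(1)] nb g])
      finally show "ip mu (F tau) (wt (- alpha) g) <= B alpha s * b * nq (1 + \<sigma>) g" .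
    qed
    then have "z <= B alpha s * b * tau powr omega * exp (- (alpha^2 * tau))" unfolding z by (intro mult_right_mono) auto
    also have "... = C * M powr (1 - \<sigma>) * D powr \<sigma> * ((s powr (- (omega * (1 - \<sigma>))) * s powr (- (omega * \<sigma>))) * tau powr omega) * ((exp (alpha^2 * s) * exp (alpha^2 * s)) * exp (- (alpha^2 * tau)))"
      by (simp only: B_def b_def ac_simps)
    also have "(exp (alpha^2 * s) * exp (alpha^2 * s)) * exp (- (alpha^2 * tau)) = 1" unfolding s(3) by (simp add: algebra_simps flip: exp_add)
    also have "s powr (- (omega * (1 - \<sigma>))) * s powr (- (omega * \<sigma>)) = s powr (- omega)" by (simp add: algebra_simps flip: powr_add)
    also have "s powr (- omega) * tau powr omega = 2 powr omega"
    proof -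
      have "tau = 2 * s" using s by simp
      then have "tau powr omega = 2 powr omega * s powr omega" using s(1) by (simp add: powr_mult)
      moreover have "s powr (- omega) * s powr omega = 1" using s(1) by (simp flip: powr_add)
      ultimately show ?thesis by simp
    qed
    finally show "z <= A * D powr \<sigma>" by (simp add: A_def ac_simps)
  qed (rule \<sigma>)+
  define X where "X = A powr (1 / (1 - \<sigma>))"
  have "y t n <= X * t powr (- omega) * exp (alpha^2 * t)"
    using bound[OF t order_refl, of n] t unfolding X_def[symmetric] by (simp add: exp_minus powr_minus field_simps)
  from hoelder[OF t order_refl this] split[of X t]
  have le: "nq (1 + \<sigma>) (cut alpha (F t) n) <= M powr (1 - \<sigma>) * X powr \<sigma> * t powr (- (omega * \<sigma>)) * exp (alpha^2 * t)"
    by (simp add: X_def)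
  have "X powr \<sigma> = A powr (\<sigma> / (1 - \<sigma>))" by (simp add: X_def powr_powr)
  also have "... = (C * 2 powr omega) powr (\<sigma> / (1 - \<sigma>)) * (M powr (1 - \<sigma>)) powr (\<sigma> / (1 - \<sigma>))"
    unfolding A_def by (rule powr_mult)
  also have "(M powr (1 - \<sigma>)) powr (\<sigma> / (1 - \<sigma>)) = M powr \<sigma>" using \<sigma> by (simp add: powr_powr)
  finally have "M powr (1 - \<sigma>) * X powr \<sigma> = (C * 2 powr omega) powr (\<sigma> / (1 - \<sigma>)) * (M powr (1 - \<sigma>) * M powr \<sigma>)" by (simp only: ac_simps)
  also have "M powr (1 - \<sigma>) * M powr \<sigma> = M" using M by (simp flip: powr_add)
  finally have eq: "M powr (1 - \<sigma>) * X powr \<sigma> = (C * 2 powr omega) powr (\<sigma> / (1 - \<sigma>)) * M" .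
  have "M powr (1 - \<sigma>) * X powr \<sigma> * t powr (- (omega * \<sigma>)) * exp (alpha^2 * t)
    = (C * 2 powr omega) powr (\<sigma> / (1 - \<sigma>)) * t powr (- (omega * \<sigma>)) * exp (alpha^2 * t) * M"
    unfolding eq by (simp only: ac_simps)
  with le show ?thesis by (simp only: F_def)
qed

text \<open>The outer pieces of t = t3 + t2 + t1 carry the two arguments from mass to the norm with
  exponent 1 + \<sigma>, and the middle piece, at least t/3, carries the pairing. The adjoint side
  works with the exponent - alpha, where symmetry turns the L_infinity bound into a mass
  bound.\<close>

theorem kernel_form_bound:
  assumes alpha: "alpha > 0" and t: "t > 0" and M: "M >= 0" and r: "r >= 1"
    and L1: "!!tau K f h. tau > 0 ==> nice K f ==> nice K h ==> (!!x. h x <= 1) ==>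
      ip mu (U tau (wt alpha f)) (wt (- alpha) h) <= M * exp (alpha^2 * tau) * (\<integral>x. f x \<partial>mu)"
    and L2: "!!tau K f h. tau > 0 ==> nice K f ==> nice K h ==> (!!x. f x <= 1) ==>
      ip mu (U tau (wt alpha f)) (wt (- alpha) h) <= M * exp (r * alpha^2 * tau) * (\<integral>x. h x \<partial>mu)"
    and f: "nice K f" and g: "nice K g"
  defines "E == (C * 2 powr omega) powr (\<sigma> / (1 - \<sigma>))"
  shows "ip mu (U t (wt alpha f)) (wt (- alpha) g) <= C * E^2 * M^2 * exp (1 / 3) * 3 powr (omega * (1 + \<sigma>)) * t powr (- (omega * (1 + \<sigma>)))
    * (1 + (r - 1) * alpha^2 * t) powr (omega * \<sigma>) * exp (alpha^2 * t) * (\<integral>x. f x \<partial>mu) * (\<integral>x. g x \<partial>mu)"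
proof -
  define X where "X = 1 + (r - 1) * alpha^2 * t"
  have X: "X >= 1" using r t by (simp add: X_def)
  define t1 where "t1 = t / 3"
  define t3 where "t3 = t1 / X"
  define t2 where "t2 = t - t1 - t3"
  have t1: "t1 > 0" using t by (simp add: t1_def)
  have t3: "t3 > 0" "t3 <= t1" using t1 X by (auto simp: t3_def field_simps)
  have t2: "t2 > 0" "t1 <= t2" using t1 t3 by (auto simp: t2_def t1_def)
  have nn: "t1 >= 0" "t2 >= 0" "t3 >= 0" "t2 + t1 >= 0" using t1 t2 t3 by auto
  have alpha0: "alpha ~= 0" "- alpha ~= 0" using alpha by auto
  have If: "(\<integral>x. f x \<partial>mu) >= 0" and Ig: "(\<integral>x. g x \<partial>mu) >= 0"
    using niceD(5)[OF f] niceD(5)[OF g] by (auto intro!: integral_nonneg_AE)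
  define F where "F = U t1 (wt alpha f)" define H where "H = U t3 (wt (- alpha) g)"
  have FR: "F \<in> R2 mu" and HR: "H \<in> R2 mu" unfolding F_def H_def by (rule posopD(1)[OF U nice_R2], fact nn, fact)+
  have F0: "AE x in mu. 0 <= F x" unfolding F_def by (rule posopD(3)[OF U[OF nn(1)] nice_R2[OF f]]) (use niceD(5)[OF f] in \<open>simp add: wt_def\<close>)
  have H0: "AE x in mu. 0 <= H x" unfolding H_def by (rule posopD(3)[OF U[OF nn(3)] nice_R2[OF g]]) (use niceD(5)[OF g] in \<open>simp add: wt_def\<close>)
  have F: "nq (1 + \<sigma>) (cut alpha F n) <= E * t1 powr (- (omega * \<sigma>)) * exp (alpha^2 * t1) * (M * (\<integral>x. f x \<partial>mu))" for n
    unfolding F_def E_def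
  proof (rule extrapolation[OF alpha0(1) f t1])
    show "M * (\<integral>x. f x \<partial>mu) >= 0" using M If by simp
    fix tau n assume tau: "0 < tau" "tau <= t1"
    show "(\<integral>x. cut alpha (U tau (wt alpha f)) n x \<partial>mu) <= M * (\<integral>x. f x \<partial>mu) * exp (alpha^2 * tau)"
    proof (rule cut_mass)
      show "U tau (wt alpha f) \<in> R2 mu" by (rule posopD(1)[OF U nice_R2[OF f]]) (use tau in simp)
      fix L h assume h: "nice L h" "!!x. h x <= 1"
      show "ip mu (U tau (wt alpha f)) (wt (- alpha) h) <= M * (\<integral>x. f x \<partial>mu) * exp (alpha^2 * tau)"
        using L1[OF tau(1) nice_mono[OF f max.cobounded1] nice_mono[OF h(1) max.cobounded2] h(2)] by (simp only: ac_simps)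
    qed
  qed
  have H: "nq (1 + \<sigma>) (cut (- alpha) H n) <= E * t3 powr (- (omega * \<sigma>)) * exp (alpha^2 * t3) * (M * exp (1 / 3) * (\<integral>x. g x \<partial>mu))" for n
    unfolding H_def E_def power2_minus[of alpha, symmetric]
  proof (rule extrapolation[OF alpha0(2) g t3(1)])
    show "M * exp (1 / 3) * (\<integral>x. g x \<partial>mu) >= 0" using M Ig by simp
    fix tau n assume tau: "0 < tau" "tau <= t3"
    have tau0: "tau >= 0" using tau by simp
    \<comment> \<open>t3 = t / (3 X) makes (r - 1) alpha^2 t3 at most 1/3, so the excess growth is
      the constant exp(1/3); the price is the power of X in t3^(- omega \<sigma>).\<close>
    have e: "exp (r * alpha^2 * tau) <= exp (1 / 3) * exp (alpha^2 * tau)"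
    proof -
      have "(r - 1) * alpha^2 * tau <= (r - 1) * alpha^2 * t3" using r tau by (intro mult_left_mono) auto
      also have "... = ((r - 1) * alpha^2 * t) / X / 3" by (simp add: t3_def t1_def)
      also have "... <= 1 / 3" using X by (intro divide_right_mono) (auto simp: X_def)
      finally have "r * alpha^2 * tau <= 1 / 3 + alpha^2 * tau" by (simp add: algebra_simps)
      then show ?thesis by (simp flip: exp_add)
    qed
    show "(\<integral>x. cut (- alpha) (U tau (wt (- alpha) g)) n x \<partial>mu) <= M * exp (1 / 3) * (\<integral>x. g x \<partial>mu) * exp ((- alpha)^2 * tau)"
    proof (rule cut_mass)
      show "U tau (wt (- alpha) g) \<in> R2 mu" by (rule posopD(1)[OF U[OF tau0] nice_R2[OF g]])
      fix L h assume h: "nice L h" "!!x. h x <= 1"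
      have "ip mu (U tau (wt (- alpha) g)) (wt (- (- alpha)) h) = ip mu (U tau (wt alpha h)) (wt (- alpha) g)"
        using U_sym[OF tau0 nice_R2[OF g, of "- alpha"] nice_R2[OF h(1), of alpha]] ip_commute[of mu "wt (- alpha) g"] by simp
      also have "... <= M * exp (r * alpha^2 * tau) * (\<integral>x. g x \<partial>mu)"
        by (rule L2[OF tau(1) nice_mono[OF h(1) max.cobounded2] nice_mono[OF g max.cobounded1] h(2)])
      also have "... <= M * (exp (1 / 3) * exp (alpha^2 * tau)) * (\<integral>x. g x \<partial>mu)"
        by (intro mult_right_mono mult_left_mono e M Ig)
      finally show "ip mu (U tau (wt (- alpha) g)) (wt (- (- alpha)) h) <= M * exp (1 / 3) * (\<integral>x. g x \<partial>mu) * exp ((- alpha)^2 * tau)"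
        by (simp only: ac_simps power2_minus)
    qed
  qed
  have "ip mu (U t (wt alpha f)) (wt (- alpha) g) = ip mu (U t3 (U t2 F)) (wt (- alpha) g)"
  proof (rule ip_cong)
    have U2: "U t2 F \<in> R2 mu" by (rule posopD(1)[OF U[OF nn(2)] FR])
    have t': "t >= 0" using t by simp
    show "U t (wt alpha f) \<in> R2 mu" by (rule posopD(1)[OF U[OF t'] nice_R2[OF f]])
    show "U t3 (U t2 F) \<in> R2 mu" by (rule posopD(1)[OF U[OF nn(3)] U2])
    have e: "t3 + (t2 + t1) = t" by (simp add: t2_def)
    have "AE x in mu. U t3 (U (t2 + t1) (wt alpha f)) x = U t3 (U t2 F) x"
      unfolding F_def
      by (rule posop_cong[OF U[OF nn(3)] posopD(1)[OF U[OF nn(4)] nice_R2[OF f]] U2[unfolded F_def] U_add[OF nn(2,1) nice_R2[OF f]]])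
    then show "AE x in mu. U t (wt alpha f) x = U t3 (U t2 F) x"
      using U_add[OF nn(3,4) nice_R2[OF f, of alpha]] unfolding e by eventually_elim simp
  qed (rule nice_R2[OF g])
  also have "... = ip mu (U t2 F) H" unfolding H_def by (rule U_sym[OF nn(3) posopD(1)[OF U[OF nn(2)] FR] nice_R2[OF g]])
  also have "... <= B alpha t2 * (E * t1 powr (- (omega * \<sigma>)) * exp (alpha^2 * t1) * (M * (\<integral>x. f x \<partial>mu)))
      * (E * t3 powr (- (omega * \<sigma>)) * exp (alpha^2 * t3) * (M * exp (1 / 3) * (\<integral>x. g x \<partial>mu)))"
    by (rule form_bound_cut2[OF t2(1) alpha0(1) FR F0 F HR H0 H])
  also have "... <= (C * t1 powr (- (omega * (1 - \<sigma>))) * exp (alpha^2 * t2)) * (E * t1 powr (- (omega * \<sigma>)) * exp (alpha^2 * t1) * (M * (\<integral>x. f x \<partial>mu)))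
      * (E * t3 powr (- (omega * \<sigma>)) * exp (alpha^2 * t3) * (M * exp (1 / 3) * (\<integral>x. g x \<partial>mu)))"
  proof (intro mult_right_mono)
    show "B alpha t2 <= C * t1 powr (- (omega * (1 - \<sigma>))) * exp (alpha^2 * t2)"
      unfolding B_def using C omega \<sigma> t1 t2 by (intro mult_right_mono mult_left_mono powr_mono2') auto
  qed (use M If Ig in \<open>auto simp: E_def\<close>)
  also have "... = C * (E * E) * (M * M) * exp (1 / 3) * ((t1 powr (- (omega * (1 - \<sigma>))) * t1 powr (- (omega * \<sigma>))) * t3 powr (- (omega * \<sigma>)))
      * ((exp (alpha^2 * t2) * exp (alpha^2 * t1)) * exp (alpha^2 * t3)) * (\<integral>x. f x \<partial>mu) * (\<integral>x. g x \<partial>mu)"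
    by (simp only: ac_simps)
  also have "(exp (alpha^2 * t2) * exp (alpha^2 * t1)) * exp (alpha^2 * t3) = exp (alpha^2 * t)"
    by (simp add: t2_def algebra_simps flip: exp_add)
  also have "(t1 powr (- (omega * (1 - \<sigma>))) * t1 powr (- (omega * \<sigma>))) * t3 powr (- (omega * \<sigma>)) = 3 powr (omega * (1 + \<sigma>)) * t powr (- (omega * (1 + \<sigma>))) * X powr (omega * \<sigma>)"
  proof -
    have "t3 powr (- (omega * \<sigma>)) = t1 powr (- (omega * \<sigma>)) * X powr (omega * \<sigma>)"
      unfolding t3_def using t1 X by (simp add: powr_divide powr_minus_divide)
    moreover have "t1 powr (- (omega * (1 - \<sigma>))) * t1 powr (- (omega * \<sigma>)) * t1 powr (- (omega * \<sigma>)) = t1 powr (- (omega * (1 + \<sigma>)))"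
      by (simp add: algebra_simps flip: powr_add)
    moreover have "t1 powr (- (omega * (1 + \<sigma>))) = 3 powr (omega * (1 + \<sigma>)) * t powr (- (omega * (1 + \<sigma>)))"
      unfolding t1_def using t by (simp add: powr_divide powr_minus_divide)
    ultimately show ?thesis by (simp only: mult.assoc[symmetric])
  qed
  finally show ?thesis by (simp only: X_def power2_eq_square ac_simps)
qed

end

section \<open>Combination of the estimates, the limit theta -> 1, and pointwise bounds\<close>

context weighted_setting
begin

lemma form_flip:
  assumes theta: "0 <= theta" "theta <= 1" and t: "t >= 0" and f: "nice K f" and g: "nice K g"
  shows "ip mu (S theta t (wt alpha f)) (wt (- alpha) g) = ip mu (S theta t (wt (- alpha) g)) (wt (- (- alpha)) f)"
  using S_sym[OF theta t nice_R2[OF f, of alpha] nice_R2[OF g, of "- alpha"]] by (simp add: ip_commute)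

text \<open>On supports with 1/K <= rho <= K, passing from exponent alpha to 0 costs at most K^alpha
  in each argument, which tends to 1. The mass hypotheses concern alpha > 0, so alpha = 0 is reached
  as a limit.\<close>

lemma form_bound_zero:
  assumes theta: "0 <= theta" "theta <= 1" and t: "t >= 0" and f: "nice K f" and g: "nice K g"
    and le: "!!alpha. alpha > 0 ==> ip mu (S theta t (wt alpha f)) (wt (- alpha) g) <= B alpha"
    and B: "(B \<longlongrightarrow> B0) (at_right 0)"
  shows "ip mu (S theta t (wt 0 f)) (wt (- 0) g) <= B0"
proof -
  have K: "K >= 1" by (rule niceD(1)[OF f])
  have "((%alpha. K powr alpha * K powr alpha * B alpha) \<longlongrightarrow> K powr 0 * K powr 0 * B0) (at_right 0)"
    using K by (intro tendsto_intros B) auto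
  then have "((%alpha. K powr alpha * K powr alpha * B alpha) \<longlongrightarrow> B0) (at_right 0)" using K by simp
  then show ?thesis
  proof (rule tendsto_lowerbound)
    show "\<forall>\<^sub>F alpha in at_right 0. ip mu (S theta t (wt 0 f)) (wt (- 0) g) <= K powr alpha * K powr alpha * B alpha"
    proof (rule eventually_mono[OF eventually_at_right_less[of 0]])
      fix alpha :: real assume alpha: "alpha > 0"
      have ge: "wt 0 h x <= K powr alpha * wt gamma h x" if h: "nice K h" and gamma: "\<bar>gamma\<bar> = alpha" for h x gamma
      proof (cases "h x = 0")
        case False
        then have "1 / K <= rho x" "rho x <= K" using suppD(3)[OF niceD(2)[OF h], of x] by auto
        then have "rho x powr (- gamma) <= K powr alpha" using powr_between[OF K, of "rho x" "- gamma"] gamma by simp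
        then have "rho x powr (- gamma) * (rho x powr gamma * h x) <= K powr alpha * (rho x powr gamma * h x)"
          using niceD(5)[OF h] by (intro mult_right_mono) auto
        moreover have "rho x powr (- gamma) * (rho x powr gamma * h x) = h x" using wt_cancel(2)[of gamma h x] by (simp add: wt_def)
        ultimately show ?thesis using rho(2)[of x] by (simp add: wt_def)
      qed (simp add: wt_def)
      have nn: "0 <= wt 0 h x" if "nice K h" for h x using niceD(5)[OF that] by (simp add: wt_def)
      have "ip mu (S theta t (wt 0 f)) (wt (- 0) g) <= ip mu (S theta t (%x. K powr alpha * wt alpha f x)) (%x. K powr alpha * wt (- alpha) g x)"
      proof (rule posop_ip_mono[OF S[OF theta t] nice_R2[OF f] R2_scale[OF nice_R2[OF f]] nice_R2[OF g] R2_scale[OF nice_R2[OF g]]])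
        show "0 <= wt 0 f x" "0 <= wt (- 0) g x" for x using nn f g by auto
        show "wt 0 f x <= K powr alpha * wt alpha f x" for x by (rule ge[OF f]) (use alpha in simp)
        show "wt (- 0) g x <= K powr alpha * wt (- alpha) g x" for x using ge[OF g, of "- alpha" x] alpha by simp
      qed
      also have "... = K powr alpha * K powr alpha * ip mu (S theta t (wt alpha f)) (wt (- alpha) g)"
        by (rule posop_ip_scale[OF S[OF theta t] nice_R2[OF f] nice_R2[OF g]])
      also have "... <= K powr alpha * K powr alpha * B alpha" by (intro mult_left_mono le[OF alpha]) auto
      finally show "ip mu (S theta t (wt 0 f)) (wt (- 0) g) <= K powr alpha * K powr alpha * B alpha" .
    qed
  qed simp
qed

text \<open>For theta = 1 - 1/m the parameter l is fixed by l theta = 1/p; it is below 1 for large m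
  because p > 1. The constant \<Phi> depends on m only through l and is continuous at l = 1/p, so
  the bound survives m -> infinity.\<close>

theorem limit_kernel_bound:
  fixes c nu p M r :: real
  assumes p: "p > 1" and nu: "nu > 0" and c: "c > 0" and M: "M >= 1" and r: "r >= 1"
    and Q1: "!!t alpha K f g. t > 0 ==> nice K f ==> nice K g ==>
      ip mu (Q t (wt alpha f)) (wt (- alpha) g) <= c * t powr (- nu) * exp (alpha^2 * t) * (\<integral>x. f x \<partial>mu) * (\<integral>x. g x \<partial>mu)"
    and T2: "!!s K u beta. s > 0 ==> K >= 1 ==> supp K u ==> ip mu (Q s (wt beta u)) (wt (- beta) u) <= exp (beta^2 * s) * (rn mu u)^2"
    and S1: "!!s f. s > 0 ==> f \<in> R2 mu ==> rn mu (S 1 s f) <= rn mu f"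
    and L1: "!!t alpha K f h. t > 0 ==> alpha > 0 ==> nice K f ==> nice K h ==> (!!x. h x <= 1) ==>
      ip mu (S (1 / p) t (wt alpha f)) (wt (- alpha) h) <= M * exp (alpha^2 * t) * (\<integral>x. f x \<partial>mu)"
    and L2: "!!t alpha K f h. t > 0 ==> alpha > 0 ==> nice K f ==> nice K h ==> (!!x. f x <= 1) ==>
      ip mu (S (1 / p) t (wt alpha f)) (wt (- alpha) h) <= M * exp (r * alpha^2 * t) * (\<integral>x. h x \<partial>mu)"
  obtains C' where "C' > 0" "!!t alpha K f g. t > 0 ==> nice K f ==> nice K g ==>
      ip mu (S (1 / p) t (wt alpha f)) (wt (- alpha) g)
        <= C' * t powr (- nu) * (1 + (r - 1) * alpha^2 * t) powr (nu / (2 * p)) * exp (alpha^2 * t) * (\<integral>x. f x \<partial>mu) * (\<integral>x. g x \<partial>mu)"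
proof -
  have p1: "0 <= 1 / p" "1 / p <= 1" "1 / p < 1" "0 < 1 / p" using p by auto
  define D where "D l = c powr (1 - l) * 4 powr l" for l :: real
  define \<Phi> where "\<Phi> l = D l * ((D l * 2 powr (nu * (2 - l) / 2)) powr (l / (2 - 2 * l)))^2 * M^2 * exp (1 / 3) * 3 powr nu" for l
  have Dpos: "D l > 0" for l using c by (simp add: D_def)
  have step: "ip mu (S (1 / p) t (wt alpha f)) (wt (- alpha) g)
      <= \<Phi> l * t powr (- nu) * (1 + (r - 1) * alpha^2 * t) powr (nu * l / 2) * exp (alpha^2 * t) * (\<integral>x. f x \<partial>mu) * (\<integral>x. g x \<partial>mu)"
    if m: "m >= 2" and l: "l = 1 / (p * (1 - 1 / real m))" "l < 1" and t: "t > 0" and alpha: "alpha > 0" and f: "nice K f" and g: "nice K g"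
    for m :: nat and l t alpha K f g
  proof -
    define theta where "theta = 1 - 1 / real m"
    have theta: "0 < theta" "0 <= theta" "theta <= 1" using m by (auto simp: theta_def)
    have l0: "0 < l" using theta p by (simp add: l(1) theta_def)
    have ltheta: "l * theta = 1 / p" using theta p unfolding l(1) theta_def[symmetric] by simp
    \<comment> \<open>\<sigma> makes 1 + \<sigma> = 2 / (2 - l) the interpolation exponent, and
      omega makes omega (1 - \<sigma>) = nu (1 - l) the interpolated time exponent. Then omega (1 +
      \<sigma>) = nu, and omega \<sigma> = nu l / 2 tends to nu / (2 p).\<close>
    define \<sigma> where "\<sigma> = l / (2 - l)"
    define omega where "omega = nu * (2 - l) / 2"
    have d: "2 - l > 0" "2 - l ~= 0" "1 - l > 0" using l(2) by auto
    have \<sigma>: "0 < \<sigma>" "\<sigma> < 1" using l0 l(2) d by (auto simp: \<sigma>_def)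
    have q: "2 / (2 - l) = 1 + \<sigma>" using d by (simp add: \<sigma>_def field_simps)
    have \<sigma>': "1 - \<sigma> = (2 - 2 * l) / (2 - l)" using d by (simp add: \<sigma>_def field_simps)
    have w1: "omega * (1 - \<sigma>) = nu * (1 - l)" unfolding \<sigma>' omega_def using d by (simp add: field_simps)
    have w2: "omega * (1 + \<sigma>) = nu" unfolding q[symmetric] omega_def using d by simp
    have "omega * (1 + \<sigma>) - omega * (1 - \<sigma>) = 2 * (omega * \<sigma>)" "nu - nu * (1 - l) = nu * l" by (simp_all add: algebra_simps)
    then have w3: "omega * \<sigma> = nu * l / 2" unfolding w1 w2 by linarith
    have w4: "\<sigma> / (1 - \<sigma>) = l / (2 - 2 * l)" unfolding \<sigma>' unfolding \<sigma>_def using d by simp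
    have pos: "ip mu (S (1 / p) t (wt alpha f)) (wt (- alpha) g)
        <= D l * t powr (- (omega * (1 - \<sigma>))) * exp (alpha^2 * t) * nq (1 + \<sigma>) f * nq (1 + \<sigma>) g"
      if t: "t > 0" and alpha: "alpha > 0" and f: "nice K f" and g: "nice K g" for t alpha K f g
    proof -
      have C0: "0 <= c * t powr (- nu) * exp (alpha^2 * t)" "0 <= 4 * exp (alpha^2 * t)" using c by auto
      have "ip mu (S (l * theta) t (wt alpha f)) (wt (- alpha) g) <= (c * t powr (- nu) * exp (alpha^2 * t)) powr (1 - l) * (4 * exp (alpha^2 * t)) powr l
          * nq (2 / (2 - l)) f * nq (2 / (2 - l)) g"
      proof (rule interpolated_bound[OF Q1[OF t] _ t theta(2,3) l0 l(2) C0 f g])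
        show "ip mu (S theta t (wt alpha f)) (wt (- alpha) g) <= 4 * exp (alpha^2 * t) * rn mu f * rn mu g"
          if "K >= 1" "supp K f" "supp K g" for K f g
          unfolding theta_def by (rule weighted_L2_bound[OF T2 S1 t alpha m that])
      qed
      also have "(c * t powr (- nu) * exp (alpha^2 * t)) powr (1 - l) * (4 * exp (alpha^2 * t)) powr l
        = D l * (t powr (- nu)) powr (1 - l) * (exp (alpha^2 * t) powr (1 - l) * exp (alpha^2 * t) powr l)"
        unfolding powr_mult D_def by (simp only: ac_simps)
      also have "exp (alpha^2 * t) powr (1 - l) * exp (alpha^2 * t) powr l = exp (alpha^2 * t)" by (simp flip: powr_add)
      also have "(t powr (- nu)) powr (1 - l) = t powr (- (omega * (1 - \<sigma>)))" unfolding w1 powr_powr by simp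
      finally show ?thesis unfolding ltheta q .
    qed
    have wf: "weighted_form mu Q R W G S rho (S (1 / p)) \<sigma> omega (D l)"
    proof unfold_locales
      show "posop mu (S (1 / p) t)" if "t >= 0" for t by (rule S[OF p1(1,2) that])
      show "ip mu (S (1 / p) t f) g = ip mu f (S (1 / p) t g)" if "t >= 0" "f \<in> R2 mu" "g \<in> R2 mu" for t f g
        by (rule S_sym[OF p1(1,2) that])
      show "AE x in mu. S (1 / p) (s + t) f x = S (1 / p) s (S (1 / p) t f) x" if "s >= 0" "t >= 0" "f \<in> R2 mu" for s t f
        by (rule S_add[OF p1(1,2) that])
      show "omega > 0" using nu d by (simp add: omega_def)
      show "D l >= 0" using Dpos[of l] by simp
      show "ip mu (S (1 / p) t (wt alpha f)) (wt (- alpha) g)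
        <= D l * t powr (- (omega * (1 - \<sigma>))) * exp (alpha^2 * t) * nq (1 + \<sigma>) f * nq (1 + \<sigma>) g"
        if t: "t > 0" and alpha: "alpha ~= 0" and f: "nice K f" and g: "nice K g" for t alpha K f g
      proof (cases "alpha > 0")
        case True
        show ?thesis by (rule pos[OF t True f g])
      next
        case False
        then have n: "- alpha > 0" using alpha by simp
        have t0: "t >= 0" using t by simp
        show ?thesis using pos[OF t n g f] unfolding form_flip[OF p1(1,2) t0 f g, of alpha] power2_minus by (simp only: ac_simps)
      qed
    qed (rule \<sigma>)+
    have M0: "M >= 0" using M by simp
    have "ip mu (S (1 / p) t (wt alpha f)) (wt (- alpha) g) <= D l * ((D l * 2 powr omega) powr (\<sigma> / (1 - \<sigma>)))^2 * M^2 * exp (1 / 3) * 3 powr (omega * (1 + \<sigma>))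
      * t powr (- (omega * (1 + \<sigma>))) * (1 + (r - 1) * alpha^2 * t) powr (omega * \<sigma>) * exp (alpha^2 * t) * (\<integral>x. f x \<partial>mu) * (\<integral>x. g x \<partial>mu)"
    proof (rule weighted_form.kernel_form_bound[OF wf alpha t M0 r _ _ f g])
      show "ip mu (S (1 / p) tau (wt alpha f)) (wt (- alpha) h) <= M * exp (alpha^2 * tau) * (\<integral>x. f x \<partial>mu)"
        if "tau > 0" "nice K f" "nice K h" "!!x. h x <= 1" for tau K f h by (rule L1[OF that(1) alpha that(2-4)])
      show "ip mu (S (1 / p) tau (wt alpha f)) (wt (- alpha) h) <= M * exp (r * alpha^2 * tau) * (\<integral>x. h x \<partial>mu)"
        if "tau > 0" "nice K f" "nice K h" "!!x. f x <= 1" for tau K f h by (rule L2[OF that(1) alpha that(2-4)])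
    qed
    then show ?thesis unfolding w2 w3 w4 unfolding \<Phi>_def omega_def .
  qed
  have \<Phi>: "\<Phi> (1 / p) > 0" using Dpos[of "1 / p"] M by (simp add: \<Phi>_def)
  define X where "X alpha t = 1 + (r - 1) * alpha^2 * t" for alpha t
  have pos: "ip mu (S (1 / p) t (wt alpha f)) (wt (- alpha) g)
      <= \<Phi> (1 / p) * t powr (- nu) * X alpha t powr (nu / (2 * p)) * exp (alpha^2 * t) * (\<integral>x. f x \<partial>mu) * (\<integral>x. g x \<partial>mu)"
    if t: "t > 0" and alpha: "alpha > 0" and f: "nice K f" and g: "nice K g" for t alpha K f g
  proof -
    define l where "l m = 1 / (p * (1 - 1 / real m))" for m
    have "(%m. 1 / (p * (1 - 1 / real m))) \<longlonglongrightarrow> 1 / (p * (1 - 0))" using p by (intro tendsto_intros lim_1_over_n) auto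
    then have L: "l \<longlonglongrightarrow> 1 / p" by (simp add: l_def[abs_def])
    have X1: "X alpha t >= 1" using r t by (simp add: X_def)
    \<comment> \<open>Keeps the denominator 2 - 2 l of the exponent in \<Phi> away from 0 at l =
      1/p.\<close>
    have p2: "2 / p ~= 2" using p by (simp add: field_simps)
    have "(%m. \<Phi> (l m) * t powr (- nu) * X alpha t powr (nu * l m / 2) * exp (alpha^2 * t) * (\<integral>x. f x \<partial>mu) * (\<integral>x. g x \<partial>mu))
      \<longlonglongrightarrow> \<Phi> (1 / p) * t powr (- nu) * X alpha t powr (nu * (1 / p) / 2) * exp (alpha^2 * t) * (\<integral>x. f x \<partial>mu) * (\<integral>x. g x \<partial>mu)"
      unfolding \<Phi>_def D_def using c p p2 X1 by (intro tendsto_intros L) auto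
    then have "ip mu (S (1 / p) t (wt alpha f)) (wt (- alpha) g)
      <= \<Phi> (1 / p) * t powr (- nu) * X alpha t powr (nu * (1 / p) / 2) * exp (alpha^2 * t) * (\<integral>x. f x \<partial>mu) * (\<integral>x. g x \<partial>mu)"
    proof (rule tendsto_lowerbound)
      have "\<forall>\<^sub>F m in sequentially. l m < 1" by (rule order_tendstoD(2)[OF L p1(3)])
      then show "\<forall>\<^sub>F m in sequentially. ip mu (S (1 / p) t (wt alpha f)) (wt (- alpha) g)
        <= \<Phi> (l m) * t powr (- nu) * X alpha t powr (nu * l m / 2) * exp (alpha^2 * t) * (\<integral>x. f x \<partial>mu) * (\<integral>x. g x \<partial>mu)"
        using eventually_ge_at_top[of 2]
      proof eventually_elim
        case (elim m)
        show ?case unfolding X_def by (rule step[OF elim(2) l_def elim(1) t alpha f g])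
      qed
    qed simp
    then show ?thesis by (simp add: mult.commute[of p])
  qed
  show thesis
  proof (rule that[OF \<Phi>])
    fix t alpha K :: real and f g assume t: "t > 0" and f: "nice K f" and g: "nice K g"
    have t0: "t >= 0" using t by simp
    consider "alpha > 0" | "alpha < 0" | "alpha = 0" by linarith
    then show "ip mu (S (1 / p) t (wt alpha f)) (wt (- alpha) g)
      <= \<Phi> (1 / p) * t powr (- nu) * (1 + (r - 1) * alpha^2 * t) powr (nu / (2 * p)) * exp (alpha^2 * t) * (\<integral>x. f x \<partial>mu) * (\<integral>x. g x \<partial>mu)"
    proof cases
      case 1
      show ?thesis using pos[OF t 1 f g] unfolding X_def .
    next
      case 2
      then have n: "- alpha > 0" by simp
      show ?thesis using pos[OF t n g f] unfolding form_flip[OF p1(1,2) t0 f g, of alpha] X_def power2_minus by (simp only: ac_simps)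
    next
      case 3
      define B where "B alpha = \<Phi> (1 / p) * t powr (- nu) * X alpha t powr (nu / (2 * p)) * exp (alpha^2 * t) * (\<integral>x. f x \<partial>mu) * (\<integral>x. g x \<partial>mu)" for alpha
      have "(B \<longlongrightarrow> B 0) (at_right 0)" unfolding B_def X_def by (intro tendsto_intros) auto
      from form_bound_zero[OF p1(1,2) t0 f g pos[OF t _ f g, folded B_def] this]
      show ?thesis unfolding 3 B_def X_def .
    qed
  qed
qed

text \<open>If a cut of the weighted image exceeded D on a set of positive measure, the indicator of
  that set, a nice function, would violate the form bound. The pointwise bound for all cuts passes
  to the limit.\<close>

lemma form_bound_imp_AE_bound:
  assumes P: "posop mu P" and D: "D >= 0"
    and form: "!!K f g. nice K f ==> nice K g ==> ip mu (P (wt alpha f)) (wt (- alpha) g) <= D * (\<integral>x. f x \<partial>mu) * (\<integral>x. g x \<partial>mu)"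
    and h: "h \<in> R2 mu" "!!x. 0 <= h x" and i: "integrable mu (wt (- alpha) h)" "(\<integral>x. wt (- alpha) h x \<partial>mu) <= 1"
  shows "AE x in mu. P h x <= D * rho x powr alpha"
proof -
  have h0: "AE x in mu. 0 <= h x" using h(2) by simp
  define F where "F = P h"
  have F: "F \<in> R2 mu" "AE x in mu. 0 <= F x" unfolding F_def by (rule posopD(1)[OF P h(1)], rule posopD(3)[OF P h(1) h0])
  have mass: "(\<integral>x. cut alpha h n x \<partial>mu) <= 1" for n
  proof -
    have "(\<integral>x. cut alpha h n x \<partial>mu) <= (\<integral>x. wt (- alpha) h x \<partial>mu)"
    proof (rule integral_mono[OF niceD(3)[OF cut_nice[OF h(1)]] i(1)])
      fix x show "cut alpha h n x <= wt (- alpha) h x" using h(2)[of x] by (simp add: cut_def wt_def)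
    qed
    then show ?thesis using i(2) by simp
  qed
  have 1: "ip mu F (wt (- alpha) g) <= D * (\<integral>x. g x \<partial>mu)" if g: "nice K g" for K g
  proof (rule LIMSEQ_le_const2)
    show "(%n. ip mu (P (wt alpha (cut alpha h n))) (wt (- alpha) g)) \<longlonglongrightarrow> ip mu F (wt (- alpha) g)"
      unfolding F_def by (rule Rlim_ip[OF posop_Rlim[OF P cut_Rlim[OF h(1) h0]] nice_R2[OF g]])
    have "ip mu (P (wt alpha (cut alpha h n))) (wt (- alpha) g) <= D * (\<integral>x. g x \<partial>mu)" for n
    proof -
      have "(\<integral>x. g x \<partial>mu) >= 0" using niceD(5)[OF g] by (intro integral_nonneg_AE) auto
      then have "D * (\<integral>x. cut alpha h n x \<partial>mu) * (\<integral>x. g x \<partial>mu) <= D * 1 * (\<integral>x. g x \<partial>mu)"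
        using D mass[of n] by (intro mult_right_mono mult_left_mono) auto
      moreover have "ip mu (P (wt alpha (cut alpha h n))) (wt (- alpha) g) <= D * (\<integral>x. cut alpha h n x \<partial>mu) * (\<integral>x. g x \<partial>mu)"
        by (rule form[OF nice_mono[OF cut_nice[OF h(1)] max.cobounded1] nice_mono[OF g max.cobounded2]])
      ultimately show ?thesis by simp
    qed
    then show "\<exists>N. \<forall>n\<ge>N. ip mu (P (wt alpha (cut alpha h n))) (wt (- alpha) g) <= D * (\<integral>x. g x \<partial>mu)" by (intro exI allI impI)
  qed
  have 2: "AE x in mu. cut alpha F n x <= D" for n
  proof -
    define u where "u = cut alpha F n"
    have nu: "nice (real n + 1) u" unfolding u_def by (rule cut_nice[OF F(1)])
    have [measurable]: "u \<in> borel_measurable mu" by (rule nice_measurable[OF nu])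
    \<comment> \<open>With this indicator u g - D g is nonnegative, while the form bound says that
      its integral is at most 0.\<close>
    define g where "g x = (if u x > D then 1 else 0 :: real)" for x
    have ng: "nice (real n + 1) g" unfolding g_def[abs_def]
      by (rule nice_cut_indicator[OF F(1), where alpha = alpha]) (use D in \<open>auto simp: u_def[symmetric]\<close>)
    have e: "F x * wt (- alpha) g x = u x * g x" for x
    proof (cases "u x > D")
      case True
      then have "u x ~= 0" using D by auto
      then have "u x = wt (- alpha) F x" unfolding u_def cut_def by (auto split: if_splits)
      then show ?thesis by (simp add: wt_def)
    qed (simp add: g_def wt_def)
    have iu: "integrable mu (%x. u x * g x)" unfolding e[symmetric] by (rule ip_integrable[OF F(1) nice_R2[OF ng]])
    have ig: "integrable mu (%x. D * g x)" using niceD(3)[OF ng] by simp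
    have nn: "0 <= u x * g x - D * g x" for x by (simp add: g_def)
    have "(\<integral>x. u x * g x - D * g x \<partial>mu) = ip mu F (wt (- alpha) g) - D * (\<integral>x. g x \<partial>mu)"
      using iu ig by (simp add: ip_def e)
    moreover have "0 <= (\<integral>x. u x * g x - D * g x \<partial>mu)" by (rule integral_nonneg_AE, rule AE_I2, rule nn)
    ultimately have "(\<integral>x. u x * g x - D * g x \<partial>mu) = 0" using 1[OF ng] by simp
    then have "AE x in mu. u x * g x - D * g x = 0"
      using integral_nonneg_eq_0_iff_AE[OF Bochner_Integration.integrable_diff[OF iu ig] AE_I2[OF nn]] by simp
    then show ?thesis
    proof eventually_elim
      case (elim x)
      then have "\<not> u x > D" by (auto simp: g_def)
      then show ?case by (simp add: u_def)
    qed
  qed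
  \<comment> \<open>The function D rho^alpha may fail to lie in \<open>R2\<close>; capped by the
    positive part of F it does, and it still bounds the cuts.\<close>
  define H where "H x = min (max 0 (F x)) (D * rho x powr alpha)" for x
  note [measurable] = R2_borel[OF F(1)] rho(1)
  have H: "H \<in> R2 mu"
  proof (rule R2_mono(1)[OF _ F(1)])
    show "H \<in> borel_measurable mu" unfolding H_def[abs_def] by measurable
    show "AE x in mu. \<bar>H x\<bar> <= \<bar>F x\<bar>" using D by (auto simp: H_def min_def max_def)
  qed
  have "AE x in mu. F x <= H x"
  proof (rule Rlim_le[OF cut_Rlim[OF F, of alpha] Rlim_const[OF H]])
    have le: "AE x in mu. wt alpha (cut alpha F n) x <= H x" for n
      using 2[of n]
    proof eventually_elim
      case (elim x)
      have "wt alpha (cut alpha F n) x <= rho x powr alpha * D" unfolding wt_def using elim by (rule mult_left_mono) simp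
      moreover have "wt alpha (cut alpha F n) x <= max 0 (F x)"
      proof (cases "cut alpha F n x = 0")
        case False
        then have e: "cut alpha F n x = wt (- alpha) F x" unfolding cut_def by (auto split: if_splits)
        have "wt alpha (cut alpha F n) x = wt alpha (wt (- alpha) F) x" by (simp only: wt_def[of alpha "cut alpha F n"] wt_def[of alpha "wt (- alpha) F"] e)
        then show ?thesis unfolding wt_cancel(1) by simp
      qed (simp add: wt_def)
      ultimately show ?case by (simp add: H_def mult.commute)
    qed
    show "\<forall>\<^sub>F n in sequentially. AE x in mu. wt alpha (cut alpha F n) x <= H x" by (rule always_eventually, rule allI, rule le)
  qed
  then show ?thesis unfolding F_def by eventually_elim (simp add: H_def F_def)
qed

end

section \<open>Translation between weighted operator norms and bilinear forms\<close>

lemma Lp_norm_infinity_le_iff: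
  assumes "f \<in> borel_measurable mu" "C >= 0"
  shows "Lp_norm mu \<infinity> f <= ennreal C \<longleftrightarrow> (AE x in mu. cmod (f x) <= C)"
proof
  assume le: "Lp_norm mu \<infinity> f <= ennreal C"
  have "AE x in mu. ennreal (cmod (f x)) <= esssup mu (%x. ennreal (cmod (f x)))" by (rule esssup_AE)
  then show "AE x in mu. cmod (f x) <= C"
  proof eventually_elim
    case (elim x)
    have "ennreal (cmod (f x)) <= ennreal C" using order_trans[OF elim] le by (simp add: Lp_norm_def)
    then show ?case using assms(2) by (simp add: ennreal_le_iff)
  qed
next
  assume a: "AE x in mu. cmod (f x) <= C"
  have m: "(%x. ennreal (cmod (f x))) \<in> borel_measurable mu" using assms(1) by measurable
  have "esssup mu (%x. ennreal (cmod (f x))) <= ennreal C"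
    by (rule esssup_I[OF m]) (use a in eventually_elim, simp add: ennreal_leI)
  then show "Lp_norm mu \<infinity> f <= ennreal C" by (simp add: Lp_norm_def)
qed

lemma Lp_norm_1: "Lp_norm mu 1 f = (\<integral>\<^sup>+x. ennreal (cmod (f x)) \<partial>mu)"
  by (simp add: Lp_norm_def ennreal_powr_def less_top)

lemma Lp_norm_cong_AE:
  assumes m: "f \<in> borel_measurable mu" "g \<in> borel_measurable mu" and e: "AE x in mu. f x = g x"
  shows "Lp_norm mu q f = Lp_norm mu q g"
proof (cases "q = \<infinity>")
  case True
  have m': "(%x. ennreal (cmod (f x))) \<in> borel_measurable mu" "(%x. ennreal (cmod (g x))) \<in> borel_measurable mu"
    using m by measurable
  have "(AE x in mu. ennreal (cmod (f x)) <= z) = (AE x in mu. ennreal (cmod (g x)) <= z)" for z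
    by (rule eventually_subst) (use e in eventually_elim, simp)
  then have "esssup mu (%x. ennreal (cmod (f x))) = esssup mu (%x. ennreal (cmod (g x)))"
    by (simp only: esssup_eq_AE[OF m'(1)] esssup_eq_AE[OF m'(2)])
  then show ?thesis using True by (simp add: Lp_norm_def)
next
  case False
  have "(\<integral>\<^sup>+x. ennreal (cmod (f x) powr enn2real q) \<partial>mu) = (\<integral>\<^sup>+x. ennreal (cmod (g x) powr enn2real q) \<partial>mu)"
    by (rule nn_integral_cong_AE) (use e in eventually_elim, simp)
  then show ?thesis using False by (simp add: Lp_norm_def)
qed

lemma weighted_norm_leD:
  assumes B: "bounded_op mu B" and w: "w \<in> borel_measurable mu" and le: "weighted_norm mu w q r B <= ennreal C"
    and F: "F \<in> Lp_space mu q" "Lp_norm mu q F <= 1" and G: "G \<in> L2 mu" "AE x in mu. G x = cor (w x) * F x"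
  shows "Lp_norm mu r (%x. cor (inverse (w x)) * B G x) <= ennreal C"
proof -
  define H where "H x = cor (w x) * F x" for x
  note [measurable] = w
  have [measurable]: "F \<in> borel_measurable mu" using F(1) by (simp add: Lp_space_def)
  have Hm: "H \<in> borel_measurable mu" unfolding H_def[abs_def] by measurable
  have H: "H \<in> L2 mu" by (rule nrm_mono(1)[OF Hm G(1)]) (use G(2) in eventually_elim, simp add: H_def)
  have "AE x in mu. G x = H x" using G(2) by (simp only: H_def)
  from bounded_op_cong[OF B G(1) H this] have e: "AE x in mu. B G x = B H x" .
  have "Lp_norm mu r (%x. cor (inverse (w x)) * B G x) = Lp_norm mu r (%x. cor (inverse (w x)) * B H x)"
  proof (rule Lp_norm_cong_AE)
    have [measurable]: "B G \<in> borel_measurable mu" "B H \<in> borel_measurable mu" using bounded_opD(1)[OF B] G(1) H by (auto intro: L2_borel)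
    show "(%x. cor (inverse (w x)) * B G x) \<in> borel_measurable mu" by measurable
    show "(%x. cor (inverse (w x)) * B H x) \<in> borel_measurable mu" by measurable
    show "AE x in mu. cor (inverse (w x)) * B G x = cor (inverse (w x)) * B H x" using e by eventually_elim simp
  qed
  also have "... <= weighted_norm mu w q r B"
    unfolding weighted_norm_def H_def[abs_def]
    by (rule SUP_upper) (use F H in \<open>simp add: H_def[abs_def]\<close>)
  finally show ?thesis using le by (rule order_trans)
qed

lemma L2_norm_leI:
  assumes B: "bounded_op mu B" and le: "weighted_norm mu w 2 2 B <= 1" and w: "!!x. x \<in> space mu ==> w x = 1" "w \<in> borel_measurable mu" and f: "f \<in> L2 mu"
  shows "nrm mu (B f) <= nrm mu f"
proof (rule field_le_epsilon)
  fix e :: real assume e: "e > 0"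
  \<comment> \<open>The summand e permits the division when f has norm 0; it is removed at the end
    by e -> 0.\<close>
  define a where "a = nrm mu f + e"
  have a: "a > 0" using e by (simp add: a_def add_nonneg_pos)
  define F where "F x = cor (1 / a) * f x" for x
  have F: "F \<in> L2 mu" unfolding F_def[abs_def] by (rule L2_scale[OF f])
  have "nrm mu F = 1 / a * nrm mu f" unfolding F_def[abs_def] nrm_scale norm_of_real using a by simp
  also have "... <= 1" using a e by (simp add: field_simps a_def)
  finally have F1: "Lp_norm mu 2 F <= 1" unfolding Lp_norm_2[OF F] by simp
  have BF: "B F \<in> L2 mu" by (rule bounded_opD(1)[OF B F])
  have wF: "AE x in mu. F x = cor (w x) * F x" using w by (intro AE_I2) simp
  have iB: "AE x in mu. cor (inverse (w x)) * B F x = B F x" using w by (intro AE_I2) simp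
  have wBm: "(%x. cor (inverse (w x)) * B F x) \<in> borel_measurable mu"
    using w(2) L2_borel[OF BF] by measurable
  have "Lp_norm mu 2 (%x. cor (inverse (w x)) * B F x) <= ennreal 1"
    by (rule weighted_norm_leD[OF B w(2) _ F F1 F wF]) (use le in simp)
  then have "ennreal (nrm mu (B F)) <= ennreal 1" unfolding Lp_norm_cong_AE[OF wBm L2_borel[OF BF] iB] Lp_norm_2[OF BF] .
  then have n1: "nrm mu (B F) <= 1" by (simp add: ennreal_le_iff)
  have "AE x in mu. B (%y. cor a * F y + 0 * F y) x = cor a * B F x + 0 * B F x" by (rule bounded_opD(2)[OF B F F])
  moreover have "(%y. cor a * F y + 0 * F y) = f" using a by (simp add: F_def fun_eq_iff)
  ultimately have "AE x in mu. B f x = cor a * B F x" by simp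
  then have "nrm mu (B f) = nrm mu (%x. cor a * B F x)"
    by (rule nrm_cong[OF L2_borel[OF bounded_opD(1)[OF B f]] L2_borel[OF L2_scale[OF BF]]])
  also have "... = a * nrm mu (B F)" unfolding nrm_scale using a by simp
  also have "... <= a * 1" using a n1 by (intro mult_left_mono) auto
  finally show "nrm mu (B f) <= nrm mu f + e" by (simp add: a_def)
qed

context weighted_setting
begin

text \<open>Division by a > N instead of N includes the case N = 0; then a decreases to N.\<close>

lemma form_homogeneous:
  assumes P: "posop mu P" and f: "f \<in> R2 mu" and g: "g \<in> R2 mu" and N: "N >= 0" 
    and le: "!!a. a > N ==> ip mu (P (%x. 1 / a * f x)) g <= D"
  shows "ip mu (P f) g <= D * N"
proof -
  have a: "ip mu (P f) g <= D * a" if a: "a > N" for a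
  proof -
    have a0: "a > 0" using a N by simp
    have "ip mu (P (%x. 1 / a * f x)) g = 1 / a * ip mu (P f) g" using posop_ip_scale[OF P f g, of "1 / a" 1] by simp
    then have "1 / a * ip mu (P f) g <= D" using le[OF a] by simp
    then show ?thesis using a0 by (simp add: field_simps)
  qed
  have "((%a. D * a) \<longlongrightarrow> D * N) (at_right N)" by (intro tendsto_intros)
  then show ?thesis
    by (rule tendsto_lowerbound) (use a in \<open>auto intro: eventually_mono[OF eventually_at_right_less[of N]]\<close>)
qed

text \<open>\<open>r0\<close> is the weight in the operator norm, tied to the positive function
  \<open>rho\<close> on \<open>space mu\<close> only; the two norms agree since integrals do not see
  other points.\<close>

context
  fixes B :: "'a op" and r0 :: "'a => real" and alpha :: real
  assumes B: "bounded_op mu B" and P: "posop mu (rop B)"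
    and Bre: "!!f. f \<in> R2 mu ==> AE x in mu. B (%y. cor (f y)) x = cor (rop B f x)"
    and r0: "r0 \<in> borel_measurable mu" "!!x. x \<in> space mu ==> r0 x = rho x"
begin

lemma wm: "(%x. r0 x powr alpha) \<in> borel_measurable mu" using r0(1) by measurable

lemma rop_measurable: "f \<in> R2 mu ==> rop B f \<in> borel_measurable mu" by (rule R2_borel[OF posopD(1)[OF P]])

lemma norm_pointwise:
  assumes f: "f \<in> R2 mu"
  shows "AE x in mu. cor (inverse (r0 x powr alpha)) * B (%y. cor (f y)) x = cor (wt (- alpha) (rop B f) x)"
proof -
  have "AE x in mu. inverse (r0 x powr alpha) = rho x powr (- alpha)" by (rule AE_I2) (simp add: r0(2) powr_minus)
  then show ?thesis using Bre[OF f] by eventually_elim (simp add: wt_def)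
qed

lemma real_norm_le:
  assumes le: "weighted_norm mu (%x. r0 x powr alpha) q s B <= ennreal C" and f: "wt alpha f \<in> R2 mu"
    and fq: "f \<in> borel_measurable mu" "Lp_norm mu q (%x. cor (f x)) <= 1"
  shows "Lp_norm mu s (%x. cor (wt (- alpha) (rop B (wt alpha f)) x)) <= ennreal C"
proof -
  define G where "G x = cor (wt alpha f x)" for x
  have G: "G \<in> L2 mu" using f by (simp add: R2_L2_iff G_def[abs_def])
  have F: "(%x. cor (f x)) \<in> Lp_space mu q"
    using fq by (auto simp: Lp_space_def intro: le_less_trans[OF _ ennreal_one_less_top])
  have GF: "AE x in mu. G x = cor (r0 x powr alpha) * cor (f x)" by (rule AE_I2) (simp add: G_def wt_def r0(2))
  have BG: "B G \<in> borel_measurable mu" by (rule L2_borel[OF bounded_opD(1)[OF B G]])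
  have "Lp_norm mu s (%x. cor (wt (- alpha) (rop B (wt alpha f)) x)) = Lp_norm mu s (%x. cor (inverse (r0 x powr alpha)) * B G x)"
  proof (rule Lp_norm_cong_AE[symmetric])
    show "(%x. cor (inverse (r0 x powr alpha)) * B G x) \<in> borel_measurable mu" using wm BG by measurable
    have "wt (- alpha) (rop B (wt alpha f)) \<in> borel_measurable mu" by (rule wt_measurable[OF rop_measurable[OF f]])
    then show "(%x. cor (wt (- alpha) (rop B (wt alpha f)) x)) \<in> borel_measurable mu" by measurable
    show "AE x in mu. cor (inverse (r0 x powr alpha)) * B G x = cor (wt (- alpha) (rop B (wt alpha f)) x)"
      unfolding G_def by (rule norm_pointwise[OF f])
  qed
  also have "... <= ennreal C" by (rule weighted_norm_leD[OF B wm le F fq(2) G GF])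
  finally show ?thesis .
qed

lemma form_le_of_AE:
  assumes f: "nice K f" and g: "nice K g" and le: "AE x in mu. wt (- alpha) (rop B (wt alpha f)) x <= D"
  shows "ip mu (rop B (wt alpha f)) (wt (- alpha) g) <= D * (\<integral>x. g x \<partial>mu)"
proof -
  have "ip mu (rop B (wt alpha f)) (wt (- alpha) g) <= (\<integral>x. D * g x \<partial>mu)"
    unfolding ip_def
  proof (rule integral_mono_AE[OF ip_integrable[OF posopD(1)[OF P nice_R2[OF f]] nice_R2[OF g]]])
    show "integrable mu (%x. D * g x)" using niceD(3)[OF g] by simp
    show "AE x in mu. rop B (wt alpha f) x * wt (- alpha) g x <= D * g x"
      using le
    proof eventually_elim
      case (elim x)
      have "rop B (wt alpha f) x * wt (- alpha) g x = wt (- alpha) (rop B (wt alpha f)) x * g x" by (simp add: wt_def)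
      also have "... <= D * g x" by (rule mult_right_mono[OF elim niceD(5)[OF g]])
      finally show ?case .
    qed
  qed
  then show ?thesis by simp
qed

lemma nn_integral_nice: "nice K f ==> Lp_norm mu 1 (%x. cor (f x)) = ennreal (\<integral>x. f x \<partial>mu)"
  unfolding Lp_norm_1 using niceD(5)[of K f] by (subst nn_integral_eq_integral[OF niceD(3)[of K f], symmetric]) auto

lemma scaled_nice:
  assumes f: "nice K f" and g: "nice K g" and a: "a > (\<integral>x. f x \<partial>mu)"
  obtains L where "nice L (%x. 1 / a * f x)" "nice L g" "(\<integral>x. 1 / a * f x \<partial>mu) <= 1"
proof -
  have "(\<integral>x. f x \<partial>mu) >= 0" using niceD(5)[OF f] by (intro integral_nonneg_AE) auto
  then have a0: "1 / a > 0" using a by simp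
  have "(\<integral>x. 1 / a * f x \<partial>mu) <= 1" using a a0 by (simp add: field_simps)
  then show thesis using that[OF nice_scale[OF f a0] nice_mono[OF g max.cobounded1]] by simp
qed

lemma form_1_infinity:
  assumes le: "weighted_norm mu (%x. r0 x powr alpha) 1 \<infinity> B <= ennreal C" and C: "C >= 0" and f: "nice K f" and g: "nice K g"
  shows "ip mu (rop B (wt alpha f)) (wt (- alpha) g) <= C * (\<integral>x. f x \<partial>mu) * (\<integral>x. g x \<partial>mu)"
proof -
  have If: "(\<integral>x. f x \<partial>mu) >= 0" using niceD(5)[OF f] by (intro integral_nonneg_AE) auto
  have "ip mu (rop B (wt alpha f)) (wt (- alpha) g) <= (C * (\<integral>x. g x \<partial>mu)) * (\<integral>x. f x \<partial>mu)"
  proof (rule form_homogeneous[OF P nice_R2[OF f] nice_R2[OF g] If])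
    fix a assume a: "a > (\<integral>x. f x \<partial>mu)"
    obtain L where L: "nice L (%x. 1 / a * f x)" "nice L g" "(\<integral>x. 1 / a * f x \<partial>mu) <= 1" by (rule scaled_nice[OF f g a])
    have L1: "Lp_norm mu 1 (%x. cor (1 / a * f x)) <= 1" unfolding nn_integral_nice[OF L(1)] ennreal_le_1 by (rule L(3))
    have m: "wt (- alpha) (rop B (wt alpha (%x. 1 / a * f x))) \<in> borel_measurable mu" by (rule wt_measurable[OF rop_measurable[OF nice_R2[OF L(1)]]])
    have "Lp_norm mu \<infinity> (%x. cor (wt (- alpha) (rop B (wt alpha (%x. 1 / a * f x))) x)) <= ennreal C"
      by (rule real_norm_le[OF le nice_R2[OF L(1)] nice_measurable[OF L(1)] L1])
    then have "AE x in mu. cmod (cor (wt (- alpha) (rop B (wt alpha (%x. 1 / a * f x))) x)) <= C"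
      using m by (subst (asm) Lp_norm_infinity_le_iff[OF _ C]) auto
    then have "AE x in mu. wt (- alpha) (rop B (wt alpha (%x. 1 / a * f x))) x <= C" by eventually_elim simp
    from form_le_of_AE[OF L(1,2) this] show "ip mu (rop B (%x. 1 / a * wt alpha f x)) (wt (- alpha) g) <= C * (\<integral>x. g x \<partial>mu)"
      unfolding wt_scale .
  qed
  then show ?thesis by (simp only: ac_simps)
qed

lemma form_infinity_infinity:
  assumes le: "weighted_norm mu (%x. r0 x powr alpha) \<infinity> \<infinity> B <= ennreal C" and C: "C >= 0" and f: "nice K f" "!!x. f x <= 1" and g: "nice K g"
  shows "ip mu (rop B (wt alpha f)) (wt (- alpha) g) <= C * (\<integral>x. g x \<partial>mu)"
proof (rule form_le_of_AE[OF f(1) g])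
  have m: "wt (- alpha) (rop B (wt alpha f)) \<in> borel_measurable mu" by (rule wt_measurable[OF rop_measurable[OF nice_R2[OF f(1)]]])
  have fm: "(%x. cor (f x)) \<in> borel_measurable mu" using nice_measurable[OF f(1)] by measurable
  have "Lp_norm mu \<infinity> (%x. cor (f x)) <= ennreal 1"
    unfolding Lp_norm_infinity_le_iff[OF fm zero_le_one] using f(2) niceD(5)[OF f(1)] by (intro AE_I2) simp
  then have f1: "Lp_norm mu \<infinity> (%x. cor (f x)) <= 1" by simp
  have "Lp_norm mu \<infinity> (%x. cor (wt (- alpha) (rop B (wt alpha f)) x)) <= ennreal C"
    by (rule real_norm_le[OF le nice_R2[OF f(1)] nice_measurable[OF f(1)] f1])
  then have "AE x in mu. cmod (cor (wt (- alpha) (rop B (wt alpha f)) x)) <= C"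
    using m by (subst (asm) Lp_norm_infinity_le_iff[OF _ C]) auto
  then show "AE x in mu. wt (- alpha) (rop B (wt alpha f)) x <= C" by eventually_elim simp
qed

lemma form_1_1:
  assumes le: "weighted_norm mu (%x. r0 x powr alpha) 1 1 B <= ennreal C" and C: "C >= 0" and f: "nice K f" and g: "nice K g" "!!x. g x <= 1"
  shows "ip mu (rop B (wt alpha f)) (wt (- alpha) g) <= C * (\<integral>x. f x \<partial>mu)"
proof -
  have If: "(\<integral>x. f x \<partial>mu) >= 0" using niceD(5)[OF f] by (intro integral_nonneg_AE) auto
  show ?thesis
  proof (rule form_homogeneous[OF P nice_R2[OF f] nice_R2[OF g(1)] If])
    fix a assume a: "a > (\<integral>x. f x \<partial>mu)"
    obtain L where L: "nice L (%x. 1 / a * f x)" "nice L g" "(\<integral>x. 1 / a * f x \<partial>mu) <= 1" by (rule scaled_nice[OF f g(1) a])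
    have L1: "Lp_norm mu 1 (%x. cor (1 / a * f x)) <= 1" unfolding nn_integral_nice[OF L(1)] ennreal_le_1 by (rule L(3))
    define u where "u = wt (- alpha) (rop B (wt alpha (%x. 1 / a * f x)))"
    have m[measurable]: "u \<in> borel_measurable mu" unfolding u_def by (rule wt_measurable[OF rop_measurable[OF nice_R2[OF L(1)]]])
    have "Lp_norm mu 1 (%x. cor (u x)) <= ennreal C"
      unfolding u_def by (rule real_norm_le[OF le nice_R2[OF L(1)] nice_measurable[OF L(1)] L1])
    then have n: "(\<integral>\<^sup>+x. ennreal (norm (u x)) \<partial>mu) <= ennreal C" by (simp add: Lp_norm_1)
    have "(\<integral>\<^sup>+x. ennreal (norm (u x)) \<partial>mu) < \<infinity>" unfolding infinity_ennreal_def by (rule le_less_trans[OF n ennreal_less_top])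
    then have iu: "integrable mu u" by (rule integrableI_bounded[OF m])
    have "ennreal (\<integral>x. norm (u x) \<partial>mu) <= ennreal C"
      using n nn_integral_eq_integral[OF integrable_norm[OF iu]] by simp
    then have nu: "(\<integral>x. norm (u x) \<partial>mu) <= C" using C by (simp add: ennreal_le_iff)
    have "ip mu (rop B (wt alpha (%x. 1 / a * f x))) (wt (- alpha) g) <= (\<integral>x. norm (u x) \<partial>mu)"
      unfolding ip_def
    proof (rule integral_mono[OF ip_integrable[OF posopD(1)[OF P nice_R2[OF L(1)]] nice_R2[OF L(2)]] integrable_norm[OF iu]])
      fix x
      have "rop B (wt alpha (%x. 1 / a * f x)) x * wt (- alpha) g x = u x * g x" by (simp add: wt_def u_def)
      also have "... <= norm (u x) * 1" using g(2)[of x] niceD(5)[OF g(1), of x] by (intro mult_mono) auto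
      finally show "rop B (wt alpha (%x. 1 / a * f x)) x * wt (- alpha) g x <= norm (u x)" by simp
    qed
    then show "ip mu (rop B (%x. 1 / a * wt alpha f x)) (wt (- alpha) g) <= C" using nu unfolding wt_scale by linarith
  qed
qed

lemma form_2_2:
  assumes le: "weighted_norm mu (%x. r0 x powr alpha) 2 2 B <= ennreal C" and C: "C >= 0" and K: "K >= 1" and u: "supp K u"
  shows "ip mu (rop B (wt alpha u)) (wt (- alpha) u) <= C * (rn mu u)^2"
proof -
  note uR = suppD(1)[OF u]
  have "ip mu (rop B (wt alpha u)) (wt (- alpha) u) <= (C * rn mu u) * rn mu u"
  proof (rule form_homogeneous[OF P wt_R2[OF u K] wt_R2[OF u K] rn_nonneg])
    fix a assume a: "a > rn mu u"
    have a0: "a > 0" using a rn_nonneg[of mu u] by linarith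
    define f where "f x = 1 / a * u x" for x
    have fR: "f \<in> R2 mu" unfolding f_def[abs_def] by (rule R2_scale[OF uR])
    have wf: "wt alpha f \<in> R2 mu" unfolding f_def[abs_def] wt_scale by (rule R2_scale[OF wt_R2[OF u K]])
    have f1: "rn mu f <= 1" using a a0 unfolding f_def[abs_def] rn_scale by (simp add: field_simps)
    have fL: "(%x. cor (f x)) \<in> L2 mu" using fR by (simp add: R2_L2_iff)
    define v where "v = wt (- alpha) (rop B (wt alpha f))"
    have vm: "v \<in> borel_measurable mu" unfolding v_def by (rule wt_measurable[OF rop_measurable[OF wf]])
    have n: "Lp_norm mu 2 (%x. cor (v x)) <= ennreal C"
      unfolding v_def by (rule real_norm_le[OF le wf R2_borel[OF fR]]) (use f1 in \<open>simp add: Lp_norm_2[OF fL] rn_nrm\<close>)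
    then have vL: "(%x. cor (v x)) \<in> L2 mu" using vm by (auto simp: Lp_space_def intro: le_less_trans[OF _ ennreal_less_top])
    have vn: "rn mu v <= C" using n C unfolding Lp_norm_2[OF vL] rn_nrm by (simp add: ennreal_le_iff)
    have vR: "v \<in> R2 mu" using vL by (simp add: R2_L2_iff)
    have "ip mu (rop B (wt alpha f)) (wt (- alpha) u) = ip mu v u" by (simp add: ip_def v_def wt_def ac_simps)
    also have "... <= rn mu v * rn mu u" by (rule order_trans[OF abs_ge_self ip_bound[OF vR uR]])
    also have "... <= C * rn mu u" by (rule mult_right_mono[OF vn]) simp
    finally show "ip mu (rop B (%x. 1 / a * wt alpha u x)) (wt (- alpha) u) <= C * rn mu u" unfolding f_def[abs_def] wt_scale .
  qed
  then show ?thesis by (simp add: power2_eq_square)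
qed

end

end

lemma integral_norm_le_1:
  fixes F :: "'a => complex"
  assumes F: "F \<in> Lp_space mu 1" "Lp_norm mu 1 F <= 1"
  shows "integrable mu (%x. cmod (F x))" "(\<integral>x. cmod (F x) \<partial>mu) <= 1"
proof -
  have m: "F \<in> borel_measurable mu" using F(1) by (simp add: Lp_space_def)
  have n: "(\<integral>\<^sup>+x. ennreal (cmod (F x)) \<partial>mu) <= 1" using F(2) by (simp only: Lp_norm_1)
  then have "(\<integral>\<^sup>+x. ennreal (norm (F x)) \<partial>mu) < \<infinity>" unfolding infinity_ennreal_def by (rule le_less_trans[OF _ ennreal_one_less_top])
  then have i: "integrable mu F" by (rule integrableI_bounded[OF m])
  show "integrable mu (%x. cmod (F x))" by (rule integrable_norm[OF i])
  show "(\<integral>x. cmod (F x) \<partial>mu) <= 1" using n nn_integral_eq_integral[OF integrable_norm[OF i]] by (simp add: ennreal_le_1)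
qed

context weighted_setting
begin

text \<open>The factor \<open>2\<close> comes from treating real and imaginary parts separately.\<close>

lemma weighted_norm_1_infinity_le:
  assumes B: "bounded_op mu B" and P: "posop mu (rop B)"
    and Bre: "!!f. f \<in> R2 mu ==> AE x in mu. B (%y. cor (f y)) x = cor (rop B f x)"
    and r0: "r0 \<in> borel_measurable mu" "!!x. x \<in> space mu ==> r0 x = rho x"
    and D: "D >= 0"
    and form: "!!K f g. nice K f ==> nice K g ==> ip mu (rop B (wt alpha f)) (wt (- alpha) g) <= D * (\<integral>x. f x \<partial>mu) * (\<integral>x. g x \<partial>mu)"
  shows "weighted_norm mu (%x. r0 x powr alpha) 1 \<infinity> B <= ennreal (2 * D)"
  unfolding weighted_norm_def
proof (rule SUP_least)
  fix F assume "F \<in> {f \<in> Lp_space mu 1. Lp_norm mu 1 f <= 1 \<and> (%x. cor (r0 x powr alpha) * f x) \<in> L2 mu}"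
  then have F: "F \<in> Lp_space mu 1" "Lp_norm mu 1 F <= 1" and GL: "(%x. cor (r0 x powr alpha) * F x) \<in> L2 mu" by auto
  note iF = integral_norm_le_1[OF F]
  define G where "G x = cor (r0 x powr alpha) * F x" for x
  have G: "G \<in> L2 mu" using GL by (simp only: G_def[abs_def])
  have part: "AE x in mu. \<bar>rop B h x\<bar> <= D * rho x powr alpha" if h: "h \<in> R2 mu" and le: "!!x. \<bar>h x\<bar> <= cmod (G x)" for h
  proof -
    define k where "k x = \<bar>h x\<bar>" for x
    have k: "k \<in> R2 mu" and ab: "AE x in mu. \<bar>rop B h x\<bar> <= rop B k x" using posop_abs[OF P h] by (simp_all only: k_def[abs_def])
    have kF: "wt (- alpha) k x <= cmod (F x)" if x: "x \<in> space mu" for x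
    proof -
      have "wt (- alpha) k x <= rho x powr (- alpha) * cmod (G x)" unfolding wt_def k_def by (rule mult_left_mono[OF le]) simp
      also have "... = wt (- alpha) (wt alpha (%x. cmod (F x))) x" by (simp add: wt_def G_def r0(2)[OF x] norm_mult)
      also have "... = cmod (F x)" by (rule wt_cancel(2))
      finally show ?thesis .
    qed
    have k0: "0 <= k x" for x by (simp add: k_def)
    have w0: "0 <= wt (- alpha) k x" for x by (simp add: wt_def k_def)
    have ik: "integrable mu (wt (- alpha) k)"
    proof (rule Bochner_Integration.integrable_bound[OF iF(1)])
      show "wt (- alpha) k \<in> borel_measurable mu" by (rule wt_measurable[OF R2_borel[OF k]])
      show "AE x in mu. norm (wt (- alpha) k x) <= norm (cmod (F x))" by (rule AE_I2) (use kF w0 in simp)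
    qed
    have "(\<integral>x. wt (- alpha) k x \<partial>mu) <= (\<integral>x. cmod (F x) \<partial>mu)" by (rule integral_mono[OF ik iF(1) kF])
    then have "(\<integral>x. wt (- alpha) k x \<partial>mu) <= 1" using iF(2) by (rule order_trans)
    from form_bound_imp_AE_bound[OF P D form k k0 ik this]
    have "AE x in mu. rop B k x <= D * rho x powr alpha" .
    then show ?thesis using ab by eventually_elim simp
  qed
  note re = Re_R2(1)[OF G] and im = Im_R2(1)[OF G]
  have "AE x in mu. cmod (cor (inverse (r0 x powr alpha)) * B G x) <= 2 * D"
    using AE_space bounded_op_real_imag[OF B G] Bre[OF re] Bre[OF im] part[OF re abs_Re_le_cmod] part[OF im abs_Im_le_cmod]
  proof eventually_elim
    case (elim x)
    define w where "w = rho x powr alpha"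
    have w: "w > 0" using rho(2)[of x] by (simp add: w_def)
    have "cmod (B G x) <= \<bar>rop B (%y. Re (G y)) x\<bar> + \<bar>rop B (%y. Im (G y)) x\<bar>"
      unfolding elim(2,3,4) by (rule order_trans[OF norm_triangle_ineq]) (simp add: norm_mult)
    also have "... <= 2 * D * w" using elim(5,6) by (simp add: w_def)
    finally have le: "inverse w * cmod (B G x) <= inverse w * (2 * D * w)" using w by (intro mult_left_mono) auto
    have e: "cmod (cor (inverse w) * B G x) = inverse w * cmod (B G x)" unfolding norm_mult norm_of_real using w by simp
    have "inverse w * (2 * D * w) = 2 * D" using w by simp
    then show ?case unfolding r0(2)[OF elim(1)] w_def[symmetric] e using le by linarith
  qed
  moreover have "(%x. cor (inverse (r0 x powr alpha)) * B G x) \<in> borel_measurable mu"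
    using r0(1) L2_borel[OF bounded_opD(1)[OF B G]] by measurable
  ultimately have "Lp_norm mu \<infinity> (%x. cor (inverse (r0 x powr alpha)) * B G x) <= ennreal (2 * D)"
    using Lp_norm_infinity_le_iff[of "%x. cor (inverse (r0 x powr alpha)) * B G x" mu "2 * D"] D by simp
  then show "Lp_norm mu \<infinity> (%x. cor (inverse (r0 x powr alpha)) * B (%y. cor (r0 y powr alpha) * F y) x) <= ennreal (2 * D)"
    by (simp only: G_def[abs_def])
qed

end

theorem theorem2p7:
  fixes \<mu> :: "'a measure" and \<rho> V :: "'a \<Rightarrow> real" and T :: "real \<Rightarrow> 'a op"
    and c \<nu> p M r :: real
  assumes "\<rho> \<in> borel_measurable \<mu>" and "\<And>x. x \<in> space \<mu> \<Longrightarrow> \<rho> x > 0"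
    and "C0_semigroup \<mu> T" and "positive_semigroup \<mu> T" and "self_adjoint_semigroup \<mu> T"
    and "c > 0" and "\<nu> > 0"
    and "\<And>t \<alpha>. t > 0 \<Longrightarrow>
      weighted_norm \<mu> (\<lambda>x. \<rho> x powr \<alpha>) 1 \<infinity> (T t) \<le> ennreal (c * t powr (-\<nu>) * exp (\<alpha>\<^sup>2 * t))"
    and "\<And>t \<alpha>. t > 0 \<Longrightarrow>
      weighted_norm \<mu> (\<lambda>x. \<rho> x powr \<alpha>) 2 2 (T t) \<le> ennreal (exp (\<alpha>\<^sup>2 * t))"
    and "V \<in> borel_measurable \<mu>"
    and "p > 1" and "M \<ge> 1" and "r \<ge> 1"
    and "admissible \<mu> T (\<lambda>x. p * V x)"
    and "\<And>t. t > 0 \<Longrightarrow> op_norm \<mu> 2 2 (perturbed \<mu> T (\<lambda>x. p * V x) t) \<le> 1"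
    and "\<And>t \<alpha>. t > 0 \<Longrightarrow> \<alpha> > 0 \<Longrightarrow>
      weighted_norm \<mu> (\<lambda>x. \<rho> x powr \<alpha>) 1 1 (perturbed \<mu> T V t) \<le> ennreal (M * exp (\<alpha>\<^sup>2 * t))"
    and "\<And>t \<alpha>. t > 0 \<Longrightarrow> \<alpha> > 0 \<Longrightarrow>
      weighted_norm \<mu> (\<lambda>x. \<rho> x powr \<alpha>) \<infinity> \<infinity> (perturbed \<mu> T V t)
        \<le> ennreal (M * exp (r * \<alpha>\<^sup>2 * t))"
  shows "\<exists>c'>0. \<forall>t>0. \<forall>\<alpha>.
    weighted_norm \<mu> (\<lambda>x. \<rho> x powr \<alpha>) 1 \<infinity> (perturbed \<mu> T V t)
      \<le> ennreal (c' * t powr (-\<nu>) * (1 + (r - 1) * \<alpha>\<^sup>2 * t) powr (\<nu> / (2 * p)) * exp (\<alpha>\<^sup>2 * t))"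
proof -
  define W where "W x = p * V x" for x
  have W: "admissible \<mu> T W" using assms(14) by (simp only: W_def[abs_def])
  \<comment> \<open>For t > 0 contractivity is the weighted bound at exponent 0; at t = 0 the
    operator is the identity.\<close>
  have c0: "nrm \<mu> (T t f) \<le> nrm \<mu> f" if t: "t \<ge> 0" and f: "f \<in> L2 \<mu>" for t f
  proof (cases "t = 0")
    case True
    have "AE x in \<mu>. T 0 f x = f x" using assms(3) f by (auto simp: C0_semigroup_def)
    then have "nrm \<mu> (T 0 f) = nrm \<mu> f"
      by (rule nrm_cong[OF L2_borel[OF bounded_opD(1)[OF C0_semigroupD(1)[OF assms(3) order_refl] f]] L2_borel[OF f]])
    then show ?thesis using True by simp
  next
    case False
    then have t0: "t > 0" using t by simp
    show ?thesis
    proof (rule L2_norm_leI[OF C0_semigroupD(1)[OF assms(3) t] _ _ _ f])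
      show "weighted_norm \<mu> (\<lambda>x. \<rho> x powr 0) 2 2 (T t) \<le> 1" using assms(9)[OF t0, of 0] by simp
      show "\<rho> x powr 0 = 1" if "x \<in> space \<mu>" for x using assms(2)[OF that] by simp
      show "(\<lambda>x. \<rho> x powr 0) \<in> borel_measurable \<mu>" using assms(1) by measurable
    qed
  qed
  interpret P: positive_contraction_semigroup \<mu> T
    by (rule positive_contraction_semigroup.intro[OF assms(3-5) c0])
  \<comment> \<open>Positivity of \<rho> is assumed on \<open>space \<mu>\<close>; the value 1
    elsewhere makes the weight positive everywhere.\<close>
  define \<rho>' where "\<rho>' x = (if x \<in> space \<mu> then \<rho> x else 1)" for x
  have \<rho>': "\<rho>' \<in> borel_measurable \<mu>" "\<And>x. \<rho>' x > 0" "\<And>x. x \<in> space \<mu> \<Longrightarrow> \<rho> x = \<rho>' x"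
  proof -
    show "\<rho>' \<in> borel_measurable \<mu>" using assms(1) by (subst measurable_cong[where g = \<rho>]) (simp_all add: \<rho>'_def)
  qed (use assms(2) in \<open>auto simp: \<rho>'_def\<close>)
  note A = P.admissible_limit_family[OF W]
  interpret L: weighted_setting \<mu> "\<lambda>t. rop (T t)" "\<lambda>V t. rop (bounded_perturbation \<mu> T V t)" W
      "\<lambda>t. rop (perturbed \<mu> T (\<lambda>x. - max (- W x) 0) t)" "\<lambda>\<theta> t. rop (perturbed \<mu> T (\<lambda>x. \<theta> * W x) t)" \<rho>'
    by (rule weighted_setting.intro[OF A(1) weighted_setting_axioms.intro[OF \<rho>'(1,2)]])
  have p: "0 \<le> 1 / p" "1 / p \<le> 1" using assms(11) by auto
  \<comment> \<open>With W = p V, the parameter theta = 1/p belongs to the semigroup to be estimated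
    and theta = 1 to the contractive one.\<close>
  have Vp: "(\<lambda>x. 1 / p * W x) = V" using assms(11) by (simp add: W_def fun_eq_iff)
  have V1: "(\<lambda>x. 1 * W x) = (\<lambda>x. p * V x)" by (simp add: W_def fun_eq_iff)
  note B = A(2)[OF p, unfolded Vp] and BP = L.S[OF p, unfolded Vp] and Br = A(3)[OF p, unfolded Vp]
  have nn: "M * exp s \<ge> 0" for s using assms(12) by simp
  obtain C where C: "C > 0" "\<And>t \<alpha> K f g. t > 0 \<Longrightarrow> L.nice K f \<Longrightarrow> L.nice K g \<Longrightarrow>
      ip \<mu> (rop (perturbed \<mu> T (\<lambda>x. 1 / p * W x) t) (L.wt \<alpha> f)) (L.wt (- \<alpha>) g)
        \<le> C * t powr (- \<nu>) * (1 + (r - 1) * \<alpha>\<^sup>2 * t) powr (\<nu> / (2 * p)) * exp (\<alpha>\<^sup>2 * t) * (\<integral>x. f x \<partial>\<mu>) * (\<integral>x. g x \<partial>\<mu>)"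
  proof (rule L.limit_kernel_bound[OF assms(11,7,6,12,13)])
    fix t \<alpha> K :: real and f g assume t: "t > 0" and f: "L.nice K f" and g: "L.nice K g"
    have t0: "t \<ge> 0" using t by simp
    have C0: "c * t powr (- \<nu>) * exp (\<alpha>\<^sup>2 * t) \<ge> 0" using assms(6) by simp
    show "ip \<mu> (rop (T t) (L.wt \<alpha> f)) (L.wt (- \<alpha>) g) \<le> c * t powr (- \<nu>) * exp (\<alpha>\<^sup>2 * t) * (\<integral>x. f x \<partial>\<mu>) * (\<integral>x. g x \<partial>\<mu>)"
      by (rule L.form_1_infinity[OF C0_semigroupD(1)[OF assms(3) t0] P.rT_posop[OF t0] P.T_real(1)[OF t0] assms(1) \<rho>'(3) assms(8)[OF t] C0 f g])
  next
    fix t K \<beta> :: real and u assume t: "t > 0" and K: "K \<ge> 1" and u: "L.supp K u"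
    have t0: "t \<ge> 0" using t by simp
    have C0: "exp (\<beta>\<^sup>2 * t) \<ge> 0" by simp
    show "ip \<mu> (rop (T t) (L.wt \<beta> u)) (L.wt (- \<beta>) u) \<le> exp (\<beta>\<^sup>2 * t) * (rn \<mu> u)\<^sup>2"
      by (rule L.form_2_2[OF C0_semigroupD(1)[OF assms(3) t0] P.rT_posop[OF t0] P.T_real(1)[OF t0] assms(1) \<rho>'(3) assms(9)[OF t] C0 K u])
  next
    fix t :: real and f assume t: "t > 0" and f: "f \<in> R2 \<mu>"
    have t0: "t \<ge> 0" using t by simp
    have fL: "(\<lambda>x. complex_of_real (f x)) \<in> L2 \<mu>" using f by (simp add: R2_L2_iff)
    note b = A(2)[OF zero_le_one order_refl t0]
    have "nrm \<mu> (perturbed \<mu> T (\<lambda>x. 1 * W x) t (\<lambda>x. complex_of_real (f x))) \<le> nrm \<mu> (\<lambda>x. complex_of_real (f x))"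
      by (rule L2_norm_leI[OF b, where w = "\<lambda>_. 1"]) (use assms(15)[OF t] fL in \<open>simp_all only: V1 borel_measurable_const\<close>)
    then show "rn \<mu> (rop (perturbed \<mu> T (\<lambda>x. 1 * W x) t) f) \<le> rn \<mu> f"
      unfolding rop_def rn_nrm[of \<mu> f] by (rule order_trans[OF Re_R2(2)[OF bounded_opD(1)[OF b fL]]])
  next
    fix t \<alpha> K :: real and f h assume t: "t > 0" and \<alpha>: "\<alpha> > 0" and f: "L.nice K f" and h: "L.nice K h" "\<And>x. h x \<le> 1"
    have t0: "t \<ge> 0" using t by simp
    show "ip \<mu> (rop (perturbed \<mu> T (\<lambda>x. 1 / p * W x) t) (L.wt \<alpha> f)) (L.wt (- \<alpha>) h) \<le> M * exp (\<alpha>\<^sup>2 * t) * (\<integral>x. f x \<partial>\<mu>)"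
      unfolding Vp by (rule L.form_1_1[OF B[OF t0] BP[OF t0] Br[OF t0] assms(1) \<rho>'(3) assms(16)[OF t \<alpha>] nn f h])
  next
    fix t \<alpha> K :: real and f h assume t: "t > 0" and \<alpha>: "\<alpha> > 0" and f: "L.nice K f" and h: "L.nice K h" and f1: "\<And>x. f x \<le> 1"
    have t0: "t \<ge> 0" using t by simp
    show "ip \<mu> (rop (perturbed \<mu> T (\<lambda>x. 1 / p * W x) t) (L.wt \<alpha> f)) (L.wt (- \<alpha>) h) \<le> M * exp (r * \<alpha>\<^sup>2 * t) * (\<integral>x. h x \<partial>\<mu>)"
      unfolding Vp by (rule L.form_infinity_infinity[OF B[OF t0] BP[OF t0] Br[OF t0] assms(1) \<rho>'(3) assms(17)[OF t \<alpha>] nn f f1 h])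
  qed (rule that)
  show ?thesis
  proof (intro exI[of _ "2 * C"] conjI allI impI)
    show "2 * C > 0" using C(1) by simp
    fix t \<alpha> :: real assume t: "t > 0"
    have t0: "t \<ge> 0" using t by simp
    define D where "D = C * t powr (- \<nu>) * (1 + (r - 1) * \<alpha>\<^sup>2 * t) powr (\<nu> / (2 * p)) * exp (\<alpha>\<^sup>2 * t)"
    have D: "D \<ge> 0" using C(1) by (simp add: D_def)
    have form: "ip \<mu> (rop (perturbed \<mu> T V t) (L.wt \<alpha> f)) (L.wt (- \<alpha>) g) \<le> D * (\<integral>x. f x \<partial>\<mu>) * (\<integral>x. g x \<partial>\<mu>)"
      if "L.nice K f" "L.nice K g" for K f g
      using C(2)[OF t that, of \<alpha>] unfolding Vp D_def .
    have "weighted_norm \<mu> (\<lambda>x. \<rho> x powr \<alpha>) 1 \<infinity> (perturbed \<mu> T V t) \<le> ennreal (2 * D)"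
      by (rule L.weighted_norm_1_infinity_le[OF B[OF t0] BP[OF t0] Br[OF t0] assms(1) \<rho>'(3) D form])
    then show "weighted_norm \<mu> (\<lambda>x. \<rho> x powr \<alpha>) 1 \<infinity> (perturbed \<mu> T V t)
      \<le> ennreal (2 * C * t powr (- \<nu>) * (1 + (r - 1) * \<alpha>\<^sup>2 * t) powr (\<nu> / (2 * p)) * exp (\<alpha>\<^sup>2 * t))"
      by (simp only: D_def mult.assoc)
  qed
qed

end
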